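(* Let $\alpha\in[0,\infty)$ and let $A$ be an injective sectorial operator with resolvent growth $(\alpha,0)$ on a Banach space $X$, such that the semigroup $(T(t))_{t\ge0}$ generated by $-A$ is asymptotically analytic. Let $\sigma\in[0,\infty)$ with $\sigma>\alpha-1$. Then for each $\rho\in\big[0,\frac{\sigma+1}\alpha-1\big)$ there is $C_\rho\in[0,\infty)$ with \[ \|T(t)\|_{\mathcal L(X^\sigma,X)}\le C_\rho t^{-\rho}\qquad(t\in[1,\infty)). \]
   Context: All Banach spaces are complex; $\mathbb C_\pm=\{\pm\Re\lambda>0\}$. A closed operator $A$ is sectorial if there is $\varphi\in[0,\pi)$ with $\sigma(A)\subseteq\overline{S_\varphi}$, $S_\varphi=\{z\ne0:|\arg z|<\varphi\}$ ($S_0=(0,\infty)$), and $\sup\{\|\lambda(\lambda-A)^{-1}\|:\lambda\in\mathbb C\setminus\overline{S_\theta}\}<\infty$ for each $\theta\in(\varphi,\pi)$; fractional powers via the sectorial functional calculus. For injective sectorial $A$ and $\sigma\ge0$, $X^\sigma:=\operatorname{Ran}(A^\sigma(1+A)^{-\sigma})$ with norm $\|x\|_X+\|(1+A)^{\sigma}A^{-\sigma}x\|_X$. $A$ has resolvent growth $(\alpha,\beta)$ if $-A$ generates a $C_0$-semigroup $(T(t))_{t\ge0}$ on $X$ (not assumed bounded), $\overline{\mathbb C_-}\setminus\{0\}\subseteq\rho(A)$, and $\{\lambda^\alpha(1+\lambda)^{-\alpha-\beta}(\lambda+A)^{-1}\mid\lambda\in\overline{\mathbb C_+}\setminus\{0\}\}$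 is uniformly bounded. The non-analytic growth bound of $(T(t))_{t\ge0}$ is $\zeta(T):=\inf\{\omega\in\mathbb R:\sup_{t>0}e^{-\omega t}\|T(t)-S(t)\|<\infty$ for some $S\in\mathcal H(\mathcal L(X))\}$, where $\mathcal H(\mathcal L(X))$ is the set of maps $S:(0,\infty)\to\mathcal L(X)$ having an exponentially bounded analytic extension to some sector containing $(0,\infty)$; the semigroup is asymptotically analytic if $\zeta(T)<0$. Convention: $\frac10=\infty$ and $\frac00=\infty$. *)

theory Defs
  imports "HOL-Analysis.Analysis"
begin

text \<open>A complex Banach space is modelled as a real Banach space 'a together with
a bounded real-linear complex structure J (multiplication by i) whose induced
complex scalar multiplication is norm-compatible.\<close>

definition cscale :: "('a::real_normed_vector \<Rightarrow>\<^sub>L 'a) \<Rightarrow> complex \<Rightarrow> 'a \<Rightarrow> 'a" where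
  "cscale J c x = Re c *\<^sub>R x + Im c *\<^sub>R (J x)"

definition cscaleL :: "('a::real_normed_vector \<Rightarrow>\<^sub>L 'a) \<Rightarrow> complex \<Rightarrow> ('a \<Rightarrow>\<^sub>L 'a) \<Rightarrow> ('a \<Rightarrow>\<^sub>L 'a)" where
  "cscaleL J c B = Re c *\<^sub>R B + Im c *\<^sub>R (J o\<^sub>L B)"

definition complex_structure :: "('a::real_normed_vector \<Rightarrow>\<^sub>L 'a) \<Rightarrow> bool" where
  "complex_structure J \<longleftrightarrow> (\<forall>x. J (J x) = - x) \<and> (\<forall>c x. norm (cscale J c x) = cmod c * norm x)"

definition closed_op :: "('a::real_normed_vector \<Rightarrow>\<^sub>L 'a) \<Rightarrow> 'a set \<Rightarrow> ('a \<Rightarrow> 'a) \<Rightarrow> bool" where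
  "closed_op J D A \<longleftrightarrow> subspace D
     \<and> (\<forall>x\<in>D. \<forall>y\<in>D. \<forall>a b. A (a *\<^sub>R x + b *\<^sub>R y) = a *\<^sub>R A x + b *\<^sub>R A y)
     \<and> (\<forall>x\<in>D. J x \<in> D \<and> A (J x) = J (A x))
     \<and> closed {(x, A x) | x. x \<in> D}"

definition is_resolvent :: "('a::real_normed_vector \<Rightarrow>\<^sub>L 'a) \<Rightarrow> 'a set \<Rightarrow> ('a \<Rightarrow> 'a) \<Rightarrow> complex \<Rightarrow> ('a \<Rightarrow>\<^sub>L 'a) \<Rightarrow> bool" where
  "is_resolvent J D A l R \<longleftrightarrow>
     (\<forall>y. R y \<in> D \<and> cscale J l (R y) - A (R y) = y) \<and> (\<forall>x\<in>D. R (cscale J l x - A x) = x)"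

definition in_resolvent_set :: "('a::real_normed_vector \<Rightarrow>\<^sub>L 'a) \<Rightarrow> 'a set \<Rightarrow> ('a \<Rightarrow> 'a) \<Rightarrow> complex \<Rightarrow> bool" where
  "in_resolvent_set J D A l \<longleftrightarrow> (\<exists>R. is_resolvent J D A l R)"

definition resolvent :: "('a::real_normed_vector \<Rightarrow>\<^sub>L 'a) \<Rightarrow> 'a set \<Rightarrow> ('a \<Rightarrow> 'a) \<Rightarrow> complex \<Rightarrow> ('a \<Rightarrow>\<^sub>L 'a)" where
  "resolvent J D A l = (THE R. is_resolvent J D A l R)"

definition sector :: "real \<Rightarrow> complex set" where
  "sector \<phi> = (if \<phi> = 0 then {complex_of_real r | r. r > 0} else {z. z \<noteq> 0 \<and> \<bar>Arg z\<bar> < \<phi>})"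

definition sectorial_angle :: "('a::real_normed_vector \<Rightarrow>\<^sub>L 'a) \<Rightarrow> 'a set \<Rightarrow> ('a \<Rightarrow> 'a) \<Rightarrow> real \<Rightarrow> bool" where
  "sectorial_angle J D A \<phi> \<longleftrightarrow> 0 \<le> \<phi> \<and> \<phi> < pi
     \<and> (\<forall>l. l \<notin> closure (sector \<phi>) \<longrightarrow> in_resolvent_set J D A l)
     \<and> (\<forall>\<theta>. \<phi> < \<theta> \<and> \<theta> < pi \<longrightarrow>
          (\<exists>M. \<forall>l. l \<notin> closure (sector \<theta>) \<longrightarrow> norm (cscaleL J l (resolvent J D A l)) \<le> M))"

definition sectorial :: "('a::real_normed_vector \<Rightarrow>\<^sub>L 'a) \<Rightarrow> 'a set \<Rightarrow> ('a \<Rightarrow> 'a) \<Rightarrow> bool" where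
  "sectorial J D A \<longleftrightarrow> closed_op J D A \<and> (\<exists>\<phi>. sectorial_angle J D A \<phi>)"

text \<open>A^sigma (1+A)^(-sigma) via the sectorial (extended Dunford--Riesz) functional
calculus: f(z) = z^sigma (1+z)^(-sigma) = f0(z) + 1 - 1/(1+z) with f0 in H_0^infinity,
so f(A) = f0(A) + A(1+A)^(-1), where f0(A) is the Cauchy integral over the
positively oriented boundary of S_theta (from infinity e^(i theta) to 0 to
infinity e^(-i theta)), theta strictly between a sectoriality angle and pi.
Note (1+A)^(-1) = - resolvent(-1), so A(1+A)^(-1) = I + resolvent(-1).\<close>
definition frac_reg :: "('a::banach \<Rightarrow>\<^sub>L 'a) \<Rightarrow> 'a set \<Rightarrow> ('a \<Rightarrow> 'a) \<Rightarrow> real \<Rightarrow> ('a \<Rightarrow>\<^sub>L 'a)" where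
  "frac_reg J D A \<sigma> =
    (if \<sigma> = 0 then id_blinfun else
     (let \<theta> = (SOME \<theta>. 0 < \<theta> \<and> \<theta> < pi \<and> (\<exists>\<phi><\<theta>. sectorial_angle J D A \<phi>));
          g = (\<lambda>z::complex. z powr (of_real \<sigma>) * (1 + z) powr (- of_real \<sigma>) - z / (1 + z));
          R = resolvent J D A;
          F = (\<lambda>r::real.
                 cscaleL J (g (of_real r * cis (- \<theta>)) * cis (- \<theta>)) (R (of_real r * cis (- \<theta>)))
               - cscaleL J (g (of_real r * cis \<theta>) * cis \<theta>) (R (of_real r * cis \<theta>)))
      in cscaleL J (1 / (2 * of_real pi * \<i>)) (integral {0<..} F) + (id_blinfun + R (-1))))"

definition c0_semigroup :: "('a::real_normed_vector \<Rightarrow>\<^sub>L 'a) \<Rightarrow> (real \<Rightarrow> ('a \<Rightarrow>\<^sub>L 'a)) \<Rightarrow> bool" where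
  "c0_semigroup J T \<longleftrightarrow> T 0 = id_blinfun
     \<and> (\<forall>s t. 0 \<le> s \<longrightarrow> 0 \<le> t \<longrightarrow> T (s + t) = T s o\<^sub>L T t)
     \<and> (\<forall>x. continuous_on {0..} (\<lambda>t. T t x))
     \<and> (\<forall>t\<ge>0. J o\<^sub>L T t = T t o\<^sub>L J)"

definition generates :: "('a::real_normed_vector \<Rightarrow>\<^sub>L 'a) \<Rightarrow> 'a set \<Rightarrow> ('a \<Rightarrow> 'a) \<Rightarrow> (real \<Rightarrow> ('a \<Rightarrow>\<^sub>L 'a)) \<Rightarrow> bool" where
  "generates J D G T \<longleftrightarrow> c0_semigroup J T
     \<and> D = {x. \<exists>y. ((\<lambda>h. (1 / h) *\<^sub>R (T h x - x)) \<longlongrightarrow> y) (at_right 0)}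
     \<and> (\<forall>x\<in>D. ((\<lambda>h. (1 / h) *\<^sub>R (T h x - x)) \<longlongrightarrow> G x) (at_right 0))"

definition resolvent_growth :: "('a::real_normed_vector \<Rightarrow>\<^sub>L 'a) \<Rightarrow> 'a set \<Rightarrow> ('a \<Rightarrow> 'a) \<Rightarrow> (real \<Rightarrow> ('a \<Rightarrow>\<^sub>L 'a)) \<Rightarrow> real \<Rightarrow> real \<Rightarrow> bool" where
  "resolvent_growth J D A T \<alpha> \<beta> \<longleftrightarrow> generates J D (\<lambda>x. - A x) T
     \<and> (\<forall>l. Re l \<le> 0 \<and> l \<noteq> 0 \<longrightarrow> in_resolvent_set J D A l)
     \<and> (\<exists>M. \<forall>l. Re l \<ge> 0 \<and> l \<noteq> 0 \<longrightarrow>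
          norm (cscaleL J (l powr (of_real \<alpha>) * (1 + l) powr (of_real (- \<alpha> - \<beta>)))
                  (- resolvent J D A (- l))) \<le> M)"

definition holo_op :: "('a::real_normed_vector \<Rightarrow>\<^sub>L 'a) \<Rightarrow> (complex \<Rightarrow> ('a \<Rightarrow>\<^sub>L 'a)) \<Rightarrow> complex set \<Rightarrow> bool" where
  "holo_op J F U \<longleftrightarrow> (\<forall>z\<in>U. \<exists>F'. ((\<lambda>h. cscaleL J (1 / h) (F (z + h) - F z)) \<longlongrightarrow> F') (at 0))"

definition analytic_class :: "('a::real_normed_vector \<Rightarrow>\<^sub>L 'a) \<Rightarrow> (real \<Rightarrow> ('a \<Rightarrow>\<^sub>L 'a)) \<Rightarrow> bool" where
  "analytic_class J S \<longleftrightarrow> (\<exists>\<theta> F. 0 < \<theta> \<and> \<theta> \<le> pi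
     \<and> (\<forall>t>0. F (complex_of_real t) = S t)
     \<and> (\<forall>z\<in>sector \<theta>. J o\<^sub>L F z = F z o\<^sub>L J)
     \<and> holo_op J F (sector \<theta>)
     \<and> (\<exists>M \<omega>. \<forall>z\<in>sector \<theta>. norm (F z) \<le> M * exp (\<omega> * cmod z)))"

text \<open>zeta(T) < 0, i.e. some omega < 0 belongs to the set whose infimum is zeta(T).\<close>
definition asymptotically_analytic :: "('a::real_normed_vector \<Rightarrow>\<^sub>L 'a) \<Rightarrow> (real \<Rightarrow> ('a \<Rightarrow>\<^sub>L 'a)) \<Rightarrow> bool" where
  "asymptotically_analytic J T \<longleftrightarrow> (\<exists>\<omega><0. \<exists>S. analytic_class J S
     \<and> (\<exists>K. \<forall>t>0. exp (- \<omega> * t) * norm (T t - S t) \<le> K))"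

end

(*
  Norming functionals reduce the estimate to scalar functions u(t) = Phi (T t (B x)), where
  B = A^sigma (1 + A)^(-sigma). Up to an exponentially decaying error, u extends analytically to a
  sector. Hence t^(n+1) u(t) is recovered from the (n+1)-st derivative of the Laplace transform of u,
  which is Phi applied to a power of the resolvent, by integrating over a contour that bends
  into the left half-plane away from the origin; the decay of u is governed by the part near 0.
  There one integrates directly for |z| >= t^(-1/alpha) and by parts for |z| <= t^(-1/alpha), which
  gives non-integer exponents without interpolation.
  The bounds on the resolvent powers are improved by B: the contour integral of
  z^(sigma - j) (1 + z)^(-sigma) is an operator whose image under A^j is B, and moving each
  A through the resolvents trades one resolvent for one power of z, up to an entire
  operator function, which contributes no singularity.
*)
theory Submission
  imports Defs "HOL-Complex_Analysis.Complex_Analysis"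
begin

section \<open>Hahn-Banach theorem by way of minimal sublinear functionals\<close>

section \<open>Norming functionals\<close>

text \<open>Write the rate as \<rho>' = n + 1 - \<gamma> with 0 < \<gamma> < 1 and \<rho>' > \<rho>.
  The two bounds that the contour argument asks for, |z|^(-1 - \<alpha> \<gamma>) for the (n+2)-nd
  and |z|^(\<alpha> (1 - \<gamma>) - 1) for the (n+1)-st resolvent power applied to B, are both the
  inequality \<alpha> (\<rho>' + 1) \<le> s + 1, where s is slightly below \<sigma>. The loss s <
  \<sigma> is the price of absolute convergence of the contour integrals and is paid by the strict
  bound on \<rho>. The (n+1)-st power serves as a primitive in the integration by parts, so it has
  to be small near 0; this is true only after an entire function has been subtracted. If \<alpha> <
  1, the resolvent stays bounded near 0 and the argument runs with \<alpha> = 1. All constants must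
  be uniform over functionals and over the unit ball, hence they are kept explicit. In the calculus
  the function z / (1 + z)^2 cannot be evaluated by closing the contour directly, because z (z -
  A)^(-1) is only bounded near 0. Therefore z^2 / (1 + z)^3 is evaluated, and injectivity of A
  removes the surplus factor.\<close>

definition sublinear :: "('a::real_vector \<Rightarrow> real) \<Rightarrow> bool" where
  "sublinear p \<longleftrightarrow> (\<forall>x y. p (x + y) \<le> p x + p y) \<and> (\<forall>c\<ge>0. \<forall>x. p (c *\<^sub>R x) = c * p x)"

lemma sublinear_zero: "sublinear p \<Longrightarrow> p 0 = 0"
  unfolding sublinear_def by (metis mult_zero_left order_refl scaleR_zero_left)

lemma sublinear_minus_le: "sublinear p \<Longrightarrow> - p (- x) \<le> p x"
  using sublinear_zero[of p] unfolding sublinear_def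
  by (metis add.right_inverse add_le_cancel_right diff_0 diff_le_eq uminus_add_conv_diff add.commute)

text \<open>Pushes \<open>p\<close> down until it is linear along \<open>a\<close>: the term c = 1
  makes the value at \<open>- a\<close> at most \<open>- p a\<close>, while sublinearity survives. A
  minimal sublinear functional must agree with all its shifts.\<close>

definition sublinear_shift :: "('a::real_vector \<Rightarrow> real) \<Rightarrow> 'a \<Rightarrow> 'a \<Rightarrow> real" where
  "sublinear_shift p a x = (INF c\<in>{0..}. p (x + c *\<^sub>R a) - c * p a)"

lemma
  assumes p: "sublinear p"
  shows sublinear_shift_le: "c \<ge> 0 \<Longrightarrow> sublinear_shift p a x \<le> p (x + c *\<^sub>R a) - c * p a"
    and sublinear_shift: "sublinear (sublinear_shift p a)"
proof -
  note add = p[unfolded sublinear_def, THEN conjunct1, rule_format]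
  note mult = p[unfolded sublinear_def, THEN conjunct2, rule_format]
  have lower: "- p (- x) \<le> p (x + c *\<^sub>R a) - c * p a" if "c \<ge> 0" for c x
    using add[of "x + c *\<^sub>R a" "- x"] mult[OF that, of a] by simp
  have bdd: "bdd_below ((\<lambda>c. p (x + c *\<^sub>R a) - c * p a) ` {0..})" for x
    using lower by (auto intro!: bdd_belowI2)
  show le: "sublinear_shift p a x \<le> p (x + c *\<^sub>R a) - c * p a" if "c \<ge> 0" for c x
    unfolding sublinear_shift_def using that by (intro cINF_lower bdd) auto
  have greatest: "z \<le> sublinear_shift p a x" if "\<And>c. c \<ge> 0 \<Longrightarrow> z \<le> p (x + c *\<^sub>R a) - c * p a" for x z
    unfolding sublinear_shift_def by (rule cINF_greatest) (use that in auto)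
  have subadd: "sublinear_shift p a (x + y) \<le> sublinear_shift p a x + sublinear_shift p a y" for x y
  proof -
    have *: "sublinear_shift p a (x + y) \<le> (p (x + c *\<^sub>R a) - c * p a) + (p (y + d *\<^sub>R a) - d * p a)"
      if "c \<ge> 0" "d \<ge> 0" for c d
      using le[of "c + d" "x + y"] add[of "x + c *\<^sub>R a" "y + d *\<^sub>R a"] that
      by (simp add: algebra_simps)
    have "sublinear_shift p a (x + y) - (p (x + c *\<^sub>R a) - c * p a) \<le> sublinear_shift p a y" if "c \<ge> 0" for c
      by (rule greatest) (use *[OF that] in \<open>simp add: algebra_simps\<close>)
    hence "sublinear_shift p a (x + y) - sublinear_shift p a y \<le> sublinear_shift p a x"
      by (intro greatest) (simp add: algebra_simps)
    thus ?thesis by simp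
  qed
  have scale_le: "sublinear_shift p a (d *\<^sub>R x) \<le> d * sublinear_shift p a x" if d: "d > 0" for d x
  proof -
    have "sublinear_shift p a (d *\<^sub>R x) / d \<le> p (x + c *\<^sub>R a) - c * p a" if "c \<ge> 0" for c
    proof -
      have "sublinear_shift p a (d *\<^sub>R x) \<le> p (d *\<^sub>R (x + c *\<^sub>R a)) - (d * c) * p a"
        using le[of "d * c" "d *\<^sub>R x"] that d by (simp add: algebra_simps)
      also have "\<dots> = d * (p (x + c *\<^sub>R a) - c * p a)"
        using mult[of d "x + c *\<^sub>R a"] d by (simp only: right_diff_distrib mult.assoc less_imp_le)
      finally show ?thesis using d by (simp add: field_simps)
    qed
    hence "sublinear_shift p a (d *\<^sub>R x) / d \<le> sublinear_shift p a x" by (rule greatest)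
    thus ?thesis using d by (simp add: field_simps)
  qed
  have scale: "sublinear_shift p a (d *\<^sub>R x) = d * sublinear_shift p a x" if d: "d > 0" for d x
  proof (rule antisym[OF scale_le[OF d]])
    have "sublinear_shift p a ((1 / d) *\<^sub>R (d *\<^sub>R x)) \<le> (1 / d) * sublinear_shift p a (d *\<^sub>R x)"
      by (rule scale_le) (use d in simp)
    thus "d * sublinear_shift p a x \<le> sublinear_shift p a (d *\<^sub>R x)"
      using d by (simp add: field_simps)
  qed
  have zero: "sublinear_shift p a 0 = 0"
  proof (rule antisym)
    show "sublinear_shift p a 0 \<le> 0" using le[of 0 0] sublinear_zero[OF p] by simp
    show "0 \<le> sublinear_shift p a 0" by (rule greatest) (simp add: mult)
  qed
  show "sublinear (sublinear_shift p a)"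
    unfolding sublinear_def using subadd scale zero
    by (metis less_eq_real_def mult_zero_left scaleR_zero_left)
qed

text \<open>By minimality each shift equals \<open>p\<close>, and the term c = 1 of the infimum then
  reads p x \<le> p (x + a) - p a, the reverse of subadditivity. Negative scalars follow from
  additivity.\<close>

lemma minimal_sublinear_linear:
  assumes p: "sublinear p" and min: "\<And>q. sublinear q \<Longrightarrow> (\<And>x. q x \<le> p x) \<Longrightarrow> q = p"
  shows "linear p"
proof -
  have shift: "sublinear_shift p a = p" for a
    using sublinear_shift_le[OF p, of 0 a] by (intro min sublinear_shift p) simp
  have add: "p (x + a) = p x + p a" for x a
  proof (rule antisym)
    show "p (x + a) \<le> p x + p a" using p unfolding sublinear_def by blast
    show "p x + p a \<le> p (x + a)"
      using sublinear_shift_le[OF p, of 1 a x] by (simp add: shift)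
  qed
  have neg: "p (- x) = - p x" for x
    using add[of x "- x"] sublinear_zero[OF p] by simp
  have "p (c *\<^sub>R x) = c * p x" for c x
  proof (cases "c \<ge> 0")
    case True thus ?thesis using p unfolding sublinear_def by blast
  next
    case False
    hence "p ((- c) *\<^sub>R x) = (- c) * p x"
      using p unfolding sublinear_def by (metis le_cases neg_0_le_iff_le)
    thus ?thesis using neg[of "c *\<^sub>R x"] by simp
  qed
  thus ?thesis using add by (intro linearI) auto
qed

lemma linear_below_sublinear:
  fixes p0 :: "'a::real_vector \<Rightarrow> real"
  assumes p0: "sublinear p0"
  obtains p where "linear p" "\<And>x. p x \<le> p0 x"
proof -
  define S where "S = {p. sublinear p \<and> (\<forall>x. p x \<le> p0 x)}"
  \<comment> \<open>The order is reversed, so the maximal element supplied by Zorn's lemma is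
    pointwise minimal.\<close>
  define r where "r = {(p, q). p \<in> S \<and> q \<in> S \<and> (\<forall>x. q x \<le> p x)}"
  have po: "partial_order_on S r"
    unfolding partial_order_on_def preorder_on_def r_def
    by (auto simp: refl_on_def trans_on_def antisym_def fun_eq_iff intro: order_trans order_antisym)
  have Field: "Field r = S"
    unfolding r_def Field_def by auto
  have "\<exists>m\<in>Field r. \<forall>a\<in>Field r. (m, a) \<in> r \<longrightarrow> a = m"
  proof (rule Zorns_po_lemma)
    show "Partial_order r" using po Field by simp
    fix C assume C: "C \<in> Chains r"
    show "\<exists>u\<in>Field r. \<forall>a\<in>C. (a, u) \<in> r"
    proof (cases "C = {}")
      case True
      thus ?thesis using p0 unfolding Field S_def by auto
    next
      case False
      have CS: "p \<in> S" if "p \<in> C" for p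
        using C that unfolding Chains_def r_def by blast
      have chain: "(\<forall>x. p x \<le> q x) \<or> (\<forall>x. q x \<le> p x)" if "p \<in> C" "q \<in> C" for p q
        using C that unfolding Chains_def r_def by blast
      define u where "u x = (INF p\<in>C. p x)" for x
      \<comment> \<open>Every member of the chain is below \<open>p0\<close>, hence above - p0 (-
        x). This common lower bound keeps the infimum over the chain finite.\<close>
      have lower: "- p0 (- x) \<le> p x" if "p \<in> C" for p x
        using CS[OF that] sublinear_minus_le[of p x] unfolding S_def
        by (smt (verit) mem_Collect_eq)
      have bdd: "bdd_below ((\<lambda>p. p x) ` C)" for x
        using lower by (auto intro!: bdd_belowI2)
      have u_le: "u x \<le> p x" if "p \<in> C" for p x
        unfolding u_def by (intro cINF_lower bdd that)
      have u_greatest: "z \<le> u x" if "\<And>p. p \<in> C \<Longrightarrow> z \<le> p x" for x z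
        unfolding u_def by (rule cINF_greatest[OF False]) (use that in auto)
      have "u (x + y) \<le> u x + u y" for x y
      proof -
        have *: "u (x + y) \<le> p x + q y" if "p \<in> C" "q \<in> C" for p q
        proof -
          have "\<exists>w\<in>C. (\<forall>z. w z \<le> p z) \<and> (\<forall>z. w z \<le> q z)"
            using chain[OF that] that by auto
          then obtain w where w: "w \<in> C" "\<And>z. w z \<le> p z" "\<And>z. w z \<le> q z" by blast
          have "u (x + y) \<le> w (x + y)" by (rule u_le[OF w(1)])
          also have "\<dots> \<le> w x + w y" using CS[OF w(1)] unfolding S_def sublinear_def by blast
          finally show ?thesis using w(2)[of x] w(3)[of y] by linarith
        qed
        have "u (x + y) - p x \<le> u y" if "p \<in> C" for p
          by (rule u_greatest) (use *[OF that] in \<open>simp add: algebra_simps\<close>)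
        hence "u (x + y) - u y \<le> u x"
          by (intro u_greatest) (simp add: algebra_simps)
        thus ?thesis by simp
      qed
      moreover have "u (c *\<^sub>R x) = c * u x" if c: "c \<ge> 0" for c x
      proof (cases "c = 0")
        case True
        have "p 0 = 0" if "p \<in> C" for p using CS[OF that] sublinear_zero unfolding S_def by blast
        hence "u 0 = (INF p\<in>C. 0)" unfolding u_def by (intro INF_cong) auto
        hence "u 0 = 0" using False by simp
        thus ?thesis using True by simp
      next
        case cpos: False
        have sc: "p (c *\<^sub>R x) = c * p x" if "p \<in> C" for p
          using CS[OF that] c unfolding S_def sublinear_def by blast
        show ?thesis
        proof (rule antisym)
          have "u (c *\<^sub>R x) / c \<le> u x"
            by (rule u_greatest) (use u_le sc cpos c in \<open>fastforce simp: field_simps\<close>)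
          thus "u (c *\<^sub>R x) \<le> c * u x" using c cpos by (simp add: field_simps)
          show "c * u x \<le> u (c *\<^sub>R x)"
            by (rule u_greatest) (simp only: sc mult_left_mono[OF u_le c])
        qed
      qed
      ultimately have "sublinear u" unfolding sublinear_def by blast
      moreover obtain p where "p \<in> C" using False by blast
      hence "u x \<le> p0 x" for x
        using u_le[of p x] CS[of p] unfolding S_def by (smt (verit) mem_Collect_eq)
      ultimately have "u \<in> S" unfolding S_def by blast
      moreover have "(p, u) \<in> r" if "p \<in> C" for p
        using CS[OF that] u_le[OF that] \<open>u \<in> S\<close> unfolding r_def by simp
      ultimately show ?thesis unfolding Field by blast
    qed
  qed
  then obtain m where m: "m \<in> S" and max: "\<And>q. q \<in> S \<Longrightarrow> (m, q) \<in> r \<Longrightarrow> q = m"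
    unfolding Field by blast
  have "linear m"
  proof (rule minimal_sublinear_linear)
    show "sublinear m" using m unfolding S_def by blast
    fix q assume q: "sublinear q" "\<And>x. q x \<le> m x"
    hence "q \<in> S" using m unfolding S_def by (auto intro: order_trans)
    thus "q = m" using q m by (intro max) (auto simp: r_def)
  qed
  thus ?thesis using that[of m] m unfolding S_def by blast
qed

text \<open>A linear functional below \<open>sublinear_shift norm y\<close> is below the norm, and
  at \<open>- y\<close> it is at most - norm y, which forces the value norm y at
  \<open>y\<close>.\<close>

theorem Hahn_Banach_norming:
  fixes y :: "'a::real_normed_vector"
  obtains f :: "'a \<Rightarrow> real" where "linear f" "\<And>x. \<bar>f x\<bar> \<le> norm x" "f y = norm y"
proof -
  have norm: "sublinear (norm :: 'a \<Rightarrow> real)"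
    unfolding sublinear_def by (simp add: norm_triangle_ineq)
  obtain f where f: "linear f" "\<And>x. f x \<le> sublinear_shift norm y x"
    using linear_below_sublinear[OF sublinear_shift[OF norm]] by blast
  have le: "f x \<le> norm x" for x
    using f(2)[of x] sublinear_shift_le[OF norm, of 0 y x] by simp
  have neg: "f (- x) = - f x" for x using linear_neg[OF f(1)] by blast
  have "\<bar>f x\<bar> \<le> norm x" for x using le[of x] le[of "- x"] neg[of x] by simp
  moreover have "f y = norm y"
  proof (rule antisym[OF le])
    show "norm y \<le> f y"
      using f(2)[of "- y"] sublinear_shift_le[OF norm, of 1 y "- y"] neg[of y] by simp
  qed
  ultimately show ?thesis using that f(1) by blast
qed

section \<open>Complex scalars acting through J, complex functionals, and resolvents of a closed
  operator\<close>

section \<open>Resolvents\<close>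

text \<open>A complex scalar as a bounded operator. It depends linearly on the scalar, so complex
  factors can be handled by the rules for composition, continuity and derivatives of
  operators.\<close>

definition cmult :: "('a::real_normed_vector \<Rightarrow>\<^sub>L 'a) \<Rightarrow> complex \<Rightarrow> ('a \<Rightarrow>\<^sub>L 'a)" where
  "cmult J c = Re c *\<^sub>R id_blinfun + Im c *\<^sub>R J"

lemma cmult_apply [simp]: "cmult J c x = cscale J c x"
  by (simp add: cmult_def cscale_def blinfun.add_left blinfun.scaleR_left)

lemma cscaleL_eq: "cscaleL J c B = cmult J c o\<^sub>L B"
  by (rule blinfun_eqI) (simp add: cscaleL_def cscale_def blinfun.add_left blinfun.scaleR_left)

lemma cscaleL_apply [simp]: "cscaleL J c B x = cscale J c (B x)"
  by (simp add: cscaleL_eq)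

lemma cscale_of_real [simp]: "cscale J (of_real r) x = r *\<^sub>R x"
  by (simp add: cscale_def)

lemma cscale_one [simp]: "cscale J 1 x = x"
  by (simp add: cscale_def)

lemma cscale_zero [simp]: "cscale J 0 x = 0" "cscale J c 0 = 0"
  by (simp_all add: cscale_def blinfun.zero_right)

lemma cscale_add_right: "cscale J c (x + y) = cscale J c x + cscale J c y"
  by (simp add: cscale_def algebra_simps blinfun.add_right)

lemma cscale_minus_left: "cscale J (- a) x = - cscale J a x"
  by (simp add: cscale_def)

lemma cscale_minus_right: "cscale J a (- x) = - cscale J a x"
  by (simp add: cscale_def blinfun.minus_right)

lemma cscale_diff_left: "cscale J (a - b) x = cscale J a x - cscale J b x"
  by (simp add: cscale_def algebra_simps)

lemma cscale_diff_right: "cscale J c (x - y) = cscale J c x - cscale J c y"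
  by (simp add: cscale_def algebra_simps blinfun.diff_right)

lemma bounded_linear_cmult: "bounded_linear (cmult J)"
  unfolding cmult_def
  by (intro bounded_linear_add bounded_linear_scaleR_left[THEN bounded_linear_compose]
        bounded_linear_Re bounded_linear_Im)

locale complex_banach =
  fixes J :: "'a::banach \<Rightarrow>\<^sub>L 'a"
  assumes complex_structure: "complex_structure J"
begin

lemma J_J [simp]: "J (J x) = - x"
  using complex_structure unfolding complex_structure_def by blast

lemma norm_cscale [simp]: "norm (cscale J c x) = cmod c * norm x"
  using complex_structure unfolding complex_structure_def by blast

lemma norm_J [simp]: "norm (J x) = norm x"
  using norm_cscale[of \<i> x] by (simp add: cscale_def)

lemma cscale_cscale [simp]: "cscale J a (cscale J b x) = cscale J (a * b) x"
  by (simp add: cscale_def blinfun.add_right blinfun.scaleR_right algebra_simps)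

lemma norm_cmult_le: "norm (cmult J c) \<le> cmod c"
  by (rule norm_blinfun_bound) auto

lemma norm_cscaleL [simp]: "norm (cscaleL J c B) = cmod c * norm B"
proof (rule antisym)
  show *: "norm (cscaleL J c B) \<le> cmod c * norm B" for c B
    unfolding cscaleL_eq by (rule order_trans[OF norm_blinfun_compose mult_right_mono[OF norm_cmult_le]]) simp
  show "cmod c * norm B \<le> norm (cscaleL J c B)"
  proof (cases "c = 0")
    case False
    have "B = cscaleL J (1 / c) (cscaleL J c B)"
      using False by (intro blinfun_eqI) simp
    hence "norm B \<le> cmod (1 / c) * norm (cscaleL J c B)" using * by metis
    thus ?thesis using False by (simp add: norm_divide field_simps)
  qed simp
qed

definition commuting :: "('a \<Rightarrow>\<^sub>L 'a) \<Rightarrow> bool" where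
  "commuting B \<longleftrightarrow> (\<forall>x. B (J x) = J (B x))"

lemma commuting_cscale: "commuting B \<Longrightarrow> B (cscale J c x) = cscale J c (B x)"
  by (simp add: commuting_def cscale_def blinfun.add_right blinfun.scaleR_right)

text \<open>The classical passage from real to complex functionals: \<Phi> x = f x - i f (i
  x).\<close>

definition complexify :: "('a \<Rightarrow> real) \<Rightarrow> 'a \<Rightarrow> complex" where
  "complexify f x = Complex (f x) (- f (J x))"

text \<open>The bound is 2 and not 1 because real and imaginary part are simply added; only
  uniformity of the constant matters.\<close>

definition dual_unit :: "('a \<Rightarrow> complex) \<Rightarrow> bool" where
  "dual_unit \<Phi> \<longleftrightarrow> bounded_linear \<Phi> \<and> (\<forall>c x. \<Phi> (cscale J c x) = c * \<Phi> x) \<and> (\<forall>x. cmod (\<Phi> x) \<le> 2 * norm x)"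

lemma dual_unit_complexify:
  assumes f: "linear f" and bound: "\<And>x. \<bar>f x\<bar> \<le> norm x"
  shows "dual_unit (complexify f)"
proof -
  interpret f: linear f by fact
  have "cmod (complexify f x) \<le> 2 * norm x" for x
    using cmod_le[of "complexify f x"] bound[of x] bound[of "J x"] by (simp add: complexify_def)
  moreover have "linear (complexify f)"
    by (rule linearI) (auto simp: complexify_def blinfun.add_right blinfun.scaleR_right f.add f.scale complex_eq_iff)
  moreover have "complexify f (cscale J c x) = c * complexify f x" for c x
    by (simp add: complexify_def cscale_def complex_eq_iff blinfun.add_right blinfun.scaleR_right
        f.add f.scale f.neg f.diff)
  ultimately show ?thesis
    unfolding dual_unit_def
    by (metis bounded_linear.intro bounded_linear_axioms.intro mult.commute)
qed

lemma norming_functional: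
  obtains \<Phi> where "dual_unit \<Phi>" "norm x \<le> cmod (\<Phi> x)"
proof -
  obtain f where f: "linear f" "\<And>x. \<bar>f x\<bar> \<le> norm x" "f x = norm x"
    using Hahn_Banach_norming[of x] by blast
  have "norm x \<le> cmod (complexify f x)"
    using abs_Re_le_cmod[of "complexify f x"] f(3) by (simp add: complexify_def)
  thus ?thesis using that dual_unit_complexify[OF f(1,2)] by blast
qed

text \<open>Functionals separate points, so an identity between operator-valued contour integrals
  may be checked on scalar integrals, where Cauchy's theorem is available.\<close>

lemma blinfun_eqI_dual:
  fixes B C :: "'a \<Rightarrow>\<^sub>L 'a"
  assumes "\<And>\<Phi> x. dual_unit \<Phi> \<Longrightarrow> \<Phi> (B x) = \<Phi> (C x)"
  shows "B = C"
proof (rule blinfun_eqI)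
  fix x
  obtain \<Phi> where \<Phi>: "dual_unit \<Phi>" "norm (B x - C x) \<le> cmod (\<Phi> (B x - C x))"
    using norming_functional by blast
  interpret bounded_linear \<Phi> using \<Phi> unfolding dual_unit_def by blast
  have "\<Phi> (B x - C x) = 0" using assms[OF \<Phi>(1)] by (simp add: diff)
  thus "B x = C x" using \<Phi>(2) by simp
qed

end

locale complex_closed_op = complex_banach J for J :: "'a::banach \<Rightarrow>\<^sub>L 'a" +
  fixes D :: "'a set" and A :: "'a \<Rightarrow> 'a"
  assumes closed_op: "closed_op J D A"
begin

lemma subspace_D: "subspace D"
  using closed_op unfolding closed_op_def by blast

lemma A_linear: "x \<in> D \<Longrightarrow> y \<in> D \<Longrightarrow> A (a *\<^sub>R x + b *\<^sub>R y) = a *\<^sub>R A x + b *\<^sub>R A y"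
  using closed_op unfolding closed_op_def by blast

lemma A_J: "x \<in> D \<Longrightarrow> J x \<in> D" "x \<in> D \<Longrightarrow> A (J x) = J (A x)"
  using closed_op unfolding closed_op_def by blast+

lemma A_diff: "x \<in> D \<Longrightarrow> y \<in> D \<Longrightarrow> A (x - y) = A x - A y"
  using A_linear[of x y 1 "-1"] by simp

definition rho :: "complex set" where "rho = {l. in_resolvent_set J D A l}"

abbreviation res :: "complex \<Rightarrow> ('a \<Rightarrow>\<^sub>L 'a)" where "res \<equiv> resolvent J D A"

lemma is_resolvent_unique: "is_resolvent J D A l R \<Longrightarrow> is_resolvent J D A l S \<Longrightarrow> R = S"
  unfolding is_resolvent_def by (metis blinfun_eqI)

lemma is_resolvent_res: "l \<in> rho \<Longrightarrow> is_resolvent J D A l (res l)"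
  unfolding rho_def in_resolvent_set_def resolvent_def
  by (auto intro: theI is_resolvent_unique)

lemma res_in_D [simp]: "l \<in> rho \<Longrightarrow> res l y \<in> D"
  using is_resolvent_res unfolding is_resolvent_def by blast

lemma A_res: "l \<in> rho \<Longrightarrow> A (res l y) = cscale J l (res l y) - y"
  using is_resolvent_res unfolding is_resolvent_def by (metis add_diff_cancel_left' diff_add_cancel)

lemma res_left: "l \<in> rho \<Longrightarrow> x \<in> D \<Longrightarrow> res l (cscale J l x - A x) = x"
  using is_resolvent_res unfolding is_resolvent_def by blast

lemma res_eqI: "l \<in> rho \<Longrightarrow> x \<in> D \<Longrightarrow> cscale J l x - A x = y \<Longrightarrow> res l y = x"
  using res_left by blast

lemma res_commuting: "l \<in> rho \<Longrightarrow> commuting (res l)"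
  unfolding commuting_def
proof
  fix x assume l: "l \<in> rho"
  have "cscale J l (J (res l x)) = J (cscale J l (res l x))"
    by (simp add: cscale_def blinfun.add_right blinfun.scaleR_right)
  thus "res l (J x) = J (res l x)"
    using l by (intro res_eqI) (simp_all add: A_J A_res blinfun.diff_right)
qed

lemma res_cscale: "l \<in> rho \<Longrightarrow> res l (cscale J c x) = cscale J c (res l x)"
  by (rule commuting_cscale[OF res_commuting])

lemma resolvent_identity:
  assumes l: "l \<in> rho" and w: "w \<in> rho"
  shows "res l x - res w x = cscale J (w - l) (res l (res w x))"
proof -
  have "res l (x + cscale J (l - w) (res w x)) = res w x"
    using l w by (intro res_eqI) (simp_all add: A_res cscale_diff_left)
  hence "res l x + cscale J (l - w) (res l (res w x)) = res w x"
    by (simp add: blinfun.add_right res_cscale l)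
  thus ?thesis by (simp add: cscale_diff_left algebra_simps)
qed

lemma resolvent_commute:
  assumes l: "l \<in> rho" and w: "w \<in> rho"
  shows "res l (res w x) = res w (res l x)"
proof (cases "l = w")
  case False
  have "cscale J (w - l) (res l (res w x)) = cscale J (w - l) (res w (res l x))"
    using resolvent_identity[OF l w, of x] resolvent_identity[OF w l, of x]
    by (metis cscale_minus_left minus_diff_eq)
  hence "cscale J (1 / (w - l)) (cscale J (w - l) (res l (res w x)))
       = cscale J (1 / (w - l)) (cscale J (w - l) (res w (res l x)))" by simp
  thus ?thesis using False by simp
qed simp

lemma resolvent_diff:
  "l \<in> rho \<Longrightarrow> w \<in> rho \<Longrightarrow> res l - res w = cmult J (w - l) o\<^sub>L (res l o\<^sub>L res w)"
  by (rule blinfun_eqI) (simp add: blinfun.diff_left resolvent_identity)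

text \<open>The resolvent identity bounds the difference by half of \<open>norm (res l)\<close>,
  which is absorbed on the left. Both points are already known to be in the resolvent set, so no
  Neumann series is summed.\<close>

lemma norm_res_near:
  assumes l: "l \<in> rho" and w: "w \<in> rho" and near: "cmod (l - w) * norm (res w) \<le> 1 / 2"
  shows "norm (res l) \<le> 2 * norm (res w)"
proof -
  have "norm (res l - res w) \<le> cmod (w - l) * (norm (res l) * norm (res w))"
    unfolding resolvent_diff[OF l w]
    by (intro order_trans[OF norm_blinfun_compose] mult_mono norm_cmult_le norm_blinfun_compose) auto
  also have "\<dots> = norm (res l) * (cmod (l - w) * norm (res w))"
    by (simp add: norm_minus_commute)
  also have "\<dots> \<le> norm (res l) * (1 / 2)" using near by (intro mult_left_mono) auto
  finally show ?thesis using norm_triangle_ineq2[of "res l" "res w"] by linarith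
qed

lemma res_tendsto:
  assumes S: "S \<subseteq> rho" and w: "w \<in> S"
  shows "(res \<longlongrightarrow> res w) (at w within S)"
proof -
  let ?d = "1 / (2 * norm (res w) + 1)"
  have "eventually (\<lambda>l. norm (res l - res w) \<le> cmod (l - w) * (2 * norm (res w) * norm (res w))) (at w within S)"
    unfolding eventually_at
  proof (intro exI[of _ ?d] conjI ballI impI)
    have pos: "2 * norm (res w) + 1 > 0" using norm_ge_zero[of "res w"] by linarith
    thus "0 < ?d" by simp
    fix l assume l: "l \<in> S" and d: "l \<noteq> w \<and> dist l w < ?d"
    have "cmod (l - w) * (2 * norm (res w) + 1) \<le> 1"
      using d pos by (simp add: dist_norm field_simps)
    hence "norm (res l) \<le> 2 * norm (res w)"
      using l S w norm_ge_zero[of "l - w"]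
      by (intro norm_res_near) (auto simp: algebra_simps simp del: norm_ge_zero)
    hence "cmod (w - l) * (norm (res l) * norm (res w)) \<le> cmod (l - w) * (2 * norm (res w) * norm (res w))"
      by (intro mult_mono) (auto simp: norm_minus_commute)
    moreover have "norm (res l - res w) \<le> cmod (w - l) * (norm (res l) * norm (res w))"
      unfolding resolvent_diff[OF subsetD[OF S l] subsetD[OF S w]]
      by (intro order_trans[OF norm_blinfun_compose] mult_mono norm_cmult_le norm_blinfun_compose) auto
    ultimately show "norm (res l - res w) \<le> cmod (l - w) * (2 * norm (res w) * norm (res w))" by linarith
  qed
  moreover have "((\<lambda>l. cmod (l - w) * (2 * norm (res w) * norm (res w))) \<longlongrightarrow> 0) (at w within S)"
    by (auto intro!: tendsto_eq_intros)
  ultimately have "((\<lambda>l. res l - res w) \<longlongrightarrow> 0) (at w within S)"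
    by (rule Lim_null_comparison)
  thus ?thesis by (simp add: LIM_zero_iff)
qed

lemma continuous_on_res: "S \<subseteq> rho \<Longrightarrow> continuous_on S res"
  unfolding continuous_on_def using res_tendsto by blast

text \<open>The space of operators is a real normed space here, so the complex derivative - (res
  w)^2 appears as a real Frechet derivative in which the increment acts through
  \<open>cmult J h\<close>. Applying a complex functional turns it into a complex
  derivative.\<close>

lemma res_has_derivative:
  assumes S: "S \<subseteq> rho" and w: "w \<in> S"
  shows "(res has_derivative (\<lambda>h. - (cmult J h o\<^sub>L (res w o\<^sub>L res w)))) (at w within S)"
  unfolding has_derivative_within
proof
  show "bounded_linear (\<lambda>h. - (cmult J h o\<^sub>L (res w o\<^sub>L res w)))"
    by (intro bounded_linear_minus bounded_linear_compose[OF bounded_bilinear.bounded_linear_left[OF bounded_bilinear_blinfun_compose] bounded_linear_cmult])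
  have "eventually (\<lambda>l. norm ((1 / norm (l - w)) *\<^sub>R (res l - (res w + - (cmult J (l - w) o\<^sub>L (res w o\<^sub>L res w)))))
     \<le> norm (res w - res l) * norm (res w)) (at w within S)"
    unfolding eventually_at
  proof (intro exI[of _ 1] conjI ballI impI)
    fix l assume l: "l \<in> S" and d: "l \<noteq> w \<and> dist l w < 1"
    define X where "X = res l - (res w + - (cmult J (l - w) o\<^sub>L (res w o\<^sub>L res w)))"
    have Xeq: "X = cmult J (l - w) o\<^sub>L ((res w - res l) o\<^sub>L res w)"
    proof (rule blinfun_eqI)
      fix x
      have "X x = (res l x - res w x) + cscale J (l - w) (res w (res w x))"
        unfolding X_def by (simp add: blinfun.add_left blinfun.diff_left blinfun.minus_left)
      also have "res l x - res w x = cscale J (w - l) (res l (res w x))"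
        using l w S by (intro resolvent_identity) auto
      finally show "X x = (cmult J (l - w) o\<^sub>L ((res w - res l) o\<^sub>L res w)) x"
        by (simp add: blinfun.diff_left cscale_diff_left cscale_diff_right)
    qed
    have "norm X \<le> cmod (l - w) * (norm (res w - res l) * norm (res w))"
      unfolding Xeq
      by (intro order_trans[OF norm_blinfun_compose] mult_mono norm_cmult_le norm_blinfun_compose) auto
    thus "norm ((1 / norm (l - w)) *\<^sub>R (res l - (res w + - (cmult J (l - w) o\<^sub>L (res w o\<^sub>L res w)))))
     \<le> norm (res w - res l) * norm (res w)"
      using d unfolding X_def[symmetric] by (simp add: field_simps)
  qed simp
  moreover have "((\<lambda>l. norm (res w - res l) * norm (res w)) \<longlongrightarrow> 0) (at w within S)"
    using res_tendsto[OF S w] by (auto intro!: tendsto_eq_intros)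
  ultimately show "((\<lambda>l. (1 / norm (l - w)) *\<^sub>R (res l - (res w + - (cmult J (l - w) o\<^sub>L (res w o\<^sub>L res w))))) \<longlongrightarrow> 0)
      (at w within S)"
    by (rule Lim_null_comparison)
qed

fun blinfun_pow :: "('a \<Rightarrow>\<^sub>L 'a) \<Rightarrow> nat \<Rightarrow> ('a \<Rightarrow>\<^sub>L 'a)" where
  "blinfun_pow B 0 = id_blinfun"
| "blinfun_pow B (Suc n) = B o\<^sub>L blinfun_pow B n"

lemma norm_blinfun_pow_le: "norm (blinfun_pow B n) \<le> norm B ^ n"
  by (induction n) (auto intro!: order_trans[OF norm_blinfun_compose] mult_left_mono norm_blinfun_id_le)

lemma res_pow_has_derivative:
  assumes S: "S \<subseteq> rho" and w: "w \<in> S"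
  shows "((\<lambda>l. blinfun_pow (res l) n) has_derivative
     (\<lambda>h. - (real n *\<^sub>R (cmult J h o\<^sub>L blinfun_pow (res w) (Suc n))))) (at w within S)"
proof (induction n)
  case 0
  show ?case by simp
next
  case (Suc n)
  have "w \<in> rho" using S w by blast
  hence "(\<lambda>h. (res w o\<^sub>L - (real n *\<^sub>R (cmult J h o\<^sub>L blinfun_pow (res w) (Suc n))))
          + (- (cmult J h o\<^sub>L (res w o\<^sub>L res w)) o\<^sub>L blinfun_pow (res w) n))
      = (\<lambda>h. - (real (Suc n) *\<^sub>R (cmult J h o\<^sub>L blinfun_pow (res w) (Suc (Suc n)))))"
    by (intro ext blinfun_eqI) (simp add: blinfun.add_left blinfun.diff_left blinfun.minus_left blinfun.scaleR_left
        blinfun.minus_right blinfun.scaleR_right res_cscale algebra_simps)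
  thus ?case
    using bounded_bilinear.FDERIV[OF bounded_bilinear_blinfun_compose res_has_derivative[OF S w] Suc.IH] by simp
qed

lemma dual_res_pow_has_field_derivative:
  assumes S: "S \<subseteq> rho" and w: "w \<in> S" and \<Phi>: "dual_unit \<Phi>"
  shows "((\<lambda>l. \<Phi> (blinfun_pow (res l) n x)) has_field_derivative
     - (of_nat n * \<Phi> (blinfun_pow (res w) (Suc n) x))) (at w within S)"
proof -
  have lin: "bounded_linear \<Phi>" and sc: "\<And>c x. \<Phi> (cscale J c x) = c * \<Phi> x"
    using \<Phi> unfolding dual_unit_def by auto
  have bl: "bounded_linear (\<lambda>B::'a \<Rightarrow>\<^sub>L 'a. \<Phi> (B x))"
    by (rule bounded_linear_compose[OF lin blinfun.bounded_linear_left])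
  interpret bounded_linear \<Phi> by (rule lin)
  have "(\<lambda>h. \<Phi> ((- (real n *\<^sub>R (cmult J h o\<^sub>L blinfun_pow (res w) (Suc n)))) x))
      = (*) (- (of_nat n * \<Phi> (blinfun_pow (res w) (Suc n) x)))"
    by (rule ext) (simp add: blinfun.minus_left blinfun.scaleR_left neg scaleR sc scaleR_conv_of_real
        del: blinfun_pow.simps)
  thus ?thesis
    using bounded_linear.has_derivative[OF bl res_pow_has_derivative[OF S w, of n]]
    unfolding has_field_derivative_def by (simp del: blinfun_pow.simps)
qed

end

section \<open>Laplace transforms: bounds, differentiability, rotation of the ray of
  integration\<close>

section \<open>Laplace transforms\<close>

lemma power_le_fact_exp:
  fixes x :: real
  assumes "x \<ge> 0"
  shows "x ^ k \<le> fact k * exp x"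
proof -
  have "(\<Sum>n\<in>{k}. x ^ n /\<^sub>R fact n) \<le> (\<Sum>n. x ^ n /\<^sub>R fact n)"
    by (rule sum_le_suminf[OF summable_exp_generic]) (use assms in auto)
  thus ?thesis unfolding exp_def by (simp add: field_simps)
qed

lemma
  fixes c :: real
  assumes c: "c > 0"
  shows exp_set_integrable: "set_integrable lborel {0<..} (\<lambda>x. exp (- c * x))"
    and exp_set_integral: "(LBINT x:{0<..}. exp (- c * x)) = 1 / c"
proof -
  have "((\<lambda>x. exp (- c * x)) has_integral 1 / c) {0..}"
    using has_integral_exp_minus_to_infinity[OF c, of 0] by simp
  moreover have "negligible {x \<in> {0<..} - {0..}. exp (- c * x) \<noteq> 0}"
    by (rule negligible_subset[of "{}"]) auto
  moreover have "negligible {x \<in> {0..} - {0<..}. exp (- c * x) \<noteq> 0}"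
    by (rule negligible_subset[of "{0}"]) auto
  ultimately have hi: "((\<lambda>x. exp (- c * x)) has_integral 1 / c) {0<..}"
    by (subst has_integral_spike_set_eq)
  have "(\<lambda>x. exp (- c * x)) absolutely_integrable_on {0<..}"
    by (rule nonnegative_absolutely_integrable_1) (use hi in auto)
  hence "integrable lebesgue (\<lambda>x. indicator {0<..} x *\<^sub>R exp (- c * x))"
    unfolding set_integrable_def .
  moreover have "(\<lambda>x. indicator {0<..} x *\<^sub>R exp (- c * x)) \<in> borel_measurable borel" by measurable
  ultimately show si: "set_integrable lborel {0<..} (\<lambda>x. exp (- c * x))"
    unfolding set_integrable_def by (simp add: integrable_completion)
  show "(LBINT x:{0<..}. exp (- c * x)) = 1 / c"
    using set_borel_integral_eq_integral(2)[OF si] hi by (simp add: integral_unique)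
qed

definition laplace :: "(real \<Rightarrow> complex) \<Rightarrow> complex \<Rightarrow> complex" where
  "laplace f \<zeta> = (LBINT x:{0<..}. exp (- (\<zeta> * of_real x)) * f x)"

lemma set_integrable_exp_bound:
  fixes f :: "real \<Rightarrow> complex"
  assumes f: "continuous_on {0<..} f" and bound: "\<And>x. x > 0 \<Longrightarrow> cmod (f x) \<le> M * exp (- c * x)" and c: "c > 0"
  shows "set_integrable lborel {0<..} f" "cmod (LBINT x:{0<..}. f x) \<le> M / c"
proof -
  have M: "set_integrable lborel {0<..} (\<lambda>x. M * exp (- c * x))"
    using exp_set_integrable[OF c] by (intro set_integrable_mult_right) auto
  show si: "set_integrable lborel {0<..} f"
  proof (rule set_integrable_bound[OF M])
    show "set_borel_measurable lborel {0<..} f"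
      using set_measurable_continuous_on[OF _ f] unfolding set_borel_measurable_def by simp
    show "AE x in lborel. x \<in> {0<..} \<longrightarrow> norm (f x) \<le> norm (M * exp (- c * x))"
      by (intro AE_I2 impI) (use bound abs_ge_self order_trans in \<open>fastforce\<close>)
  qed
  have "cmod (LBINT x:{0<..}. f x) \<le> (LBINT x:{0<..}. cmod (f x))"
    by (rule set_integral_norm_bound[OF si])
  also have "\<dots> \<le> (LBINT x:{0<..}. M * exp (- c * x))"
    by (rule set_integral_mono) (use si M bound in \<open>auto intro: set_integrable_norm\<close>)
  also have "\<dots> = M / c"
    using exp_set_integral[OF c] by simp
  finally show "cmod (LBINT x:{0<..}. f x) \<le> M / c" .
qed

lemma laplace_integrand_bound:
  assumes "x > 0" "cmod (f x) \<le> M * exp (\<omega> * x)"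
  shows "cmod (exp (- (\<zeta> * of_real x)) * f x) \<le> M * exp (- (Re \<zeta> - \<omega>) * x)"
proof -
  have "cmod (exp (- (\<zeta> * of_real x)) * f x) \<le> exp (- (Re \<zeta> * x)) * (M * exp (\<omega> * x))"
    unfolding norm_mult by (intro mult_mono) (use assms in auto)
  also have "\<dots> = M * exp (- (Re \<zeta> - \<omega>) * x)"
    by (simp add: algebra_simps flip: exp_add)
  finally show ?thesis .
qed

lemma
  assumes f: "continuous_on {0<..} f" and bound: "\<And>x. x > 0 \<Longrightarrow> cmod (f x) \<le> M * exp (\<omega> * x)"
    and \<zeta>: "Re \<zeta> > \<omega>"
  shows laplace_integrable: "set_integrable lborel {0<..} (\<lambda>x. exp (- (\<zeta> * of_real x)) * f x)"
    and laplace_bound: "cmod (laplace f \<zeta>) \<le> M / (Re \<zeta> - \<omega>)"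
proof -
  have c: "continuous_on {0<..} (\<lambda>x. exp (- (\<zeta> * of_real x)) * f x)" by (intro continuous_intros f)
  have b: "cmod (exp (- (\<zeta> * of_real x)) * f x) \<le> M * exp (- (Re \<zeta> - \<omega>) * x)" if "x > 0" for x
    by (intro laplace_integrand_bound that bound)
  note * = set_integrable_exp_bound[OF c b]
  show "set_integrable lborel {0<..} (\<lambda>x. exp (- (\<zeta> * of_real x)) * f x)"
    by (rule *(1)) (use \<zeta> in auto)
  show "cmod (laplace f \<zeta>) \<le> M / (Re \<zeta> - \<omega>)"
    unfolding laplace_def by (rule *(2)) (use \<zeta> in auto)
qed

text \<open>A power of x is absorbed into a slightly larger exponential rate; the constant is what a
  single term of the exponential series gives for (d x)^k.\<close>

lemma times_exp_bound:
  fixes f :: "real \<Rightarrow> complex"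
  assumes "\<And>x. x > 0 \<Longrightarrow> cmod (f x) \<le> M * exp (\<omega> * x)" "d > 0" "M \<ge> 0" "x > 0"
  shows "cmod (of_real x ^ k * f x) \<le> (fact k / d ^ k * M) * exp ((\<omega> + d) * x)"
proof -
  have "x ^ k = (d * x) ^ k / d ^ k" using assms(2) by (simp add: power_mult_distrib)
  also have "\<dots> \<le> fact k * exp (d * x) / d ^ k"
    using assms by (intro divide_right_mono power_le_fact_exp) auto
  finally have "x ^ k \<le> fact k * exp (d * x) / d ^ k" .
  hence "x ^ k * cmod (f x) \<le> (fact k * exp (d * x) / d ^ k) * (M * exp (\<omega> * x))"
    using assms by (intro mult_mono) auto
  also have "\<dots> = (fact k / d ^ k * M) * exp ((\<omega> + d) * x)"
    by (simp add: algebra_simps exp_add)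
  finally show ?thesis using assms by (simp add: norm_mult norm_power)
qed

lemma exp_minus_linear_bound:
  fixes w :: complex
  shows "cmod (exp w - 1 - w) \<le> cmod w ^ 2 * exp (cmod w)"
proof -
  have "cmod (exp w - (\<Sum>i\<le>1. w ^ i / fact i)) \<le> exp \<bar>Re w\<bar> * cmod w ^ Suc 1 / fact 1"
    by (rule Taylor_exp)
  also have "\<dots> \<le> exp (cmod w) * cmod w ^ 2"
    by (simp add: abs_Re_le_cmod mult_right_mono power2_eq_square)
  finally show ?thesis by (simp add: algebra_simps)
qed

text \<open>The second-order remainder of exp (- h x) is at most |h|^2 x^2 exp (|h| x), so after
  integration the error of the linear approximation is O(|h|^2).\<close>

lemma laplace_has_field_derivative:
  assumes f: "continuous_on {0<..} f" and bound: "\<And>x. x > 0 \<Longrightarrow> cmod (f x) \<le> M * exp (\<omega> * x)"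
    and \<zeta>: "Re \<zeta> > \<omega>"
  shows "(laplace f has_field_derivative - laplace (\<lambda>x. of_real x * f x) \<zeta>) (at \<zeta>)"
proof -
  \<comment> \<open>A quarter of the distance to the abscissa: one share absorbs x^2, one absorbs
    exp (|h| x), and half of the gap remains for convergence.\<close>
  define d where "d = (Re \<zeta> - \<omega>) / 4"
  have d: "d > 0" using \<zeta> by (simp add: d_def)
  have M: "M \<ge> 0" using order_trans[OF norm_ge_zero bound[of 1]] by (simp add: zero_le_mult_iff)
  define K where "K = 2 / d ^ 2 * M / (Re \<zeta> - (\<omega> + d) - d)"
  note xf = times_exp_bound[OF bound d M, where k = 1]
  have cx: "continuous_on {0<..} (\<lambda>x. of_real x * f x)" by (intro continuous_intros f)
  have est: "cmod (laplace f (\<zeta> + h) - laplace f \<zeta> + h * laplace (\<lambda>x. of_real x * f x) \<zeta>) \<le> cmod h ^ 2 * K"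
    if h: "cmod h < d" for h
  proof -
    have i1: "set_integrable lborel {0<..} (\<lambda>x. exp (- ((\<zeta> + h) * of_real x)) * f x)"
      by (rule laplace_integrable[OF f bound]) (use h abs_Re_le_cmod[of h] \<zeta> in \<open>auto simp: d_def\<close>)
    have i2: "set_integrable lborel {0<..} (\<lambda>x. exp (- (\<zeta> * of_real x)) * f x)"
      by (rule laplace_integrable[OF f bound \<zeta>])
    have i3: "set_integrable lborel {0<..} (\<lambda>x. exp (- (\<zeta> * of_real x)) * (of_real x * f x))"
      by (rule laplace_integrable[OF cx xf[unfolded power_one_right]]) (use \<zeta> in \<open>simp_all add: d_def field_simps\<close>)
    have i4: "set_integrable lborel {0<..} (\<lambda>x. h * (exp (- (\<zeta> * of_real x)) * (of_real x * f x)))"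
      using i3 by (intro set_integrable_mult_right) auto
    let ?g = "\<lambda>x. exp (- (\<zeta> * of_real x)) * f x * (exp (- (h * of_real x)) - 1 - - (h * of_real x))"
    have "laplace f (\<zeta> + h) - laplace f \<zeta> + h * laplace (\<lambda>x. of_real x * f x) \<zeta>
        = (LBINT x:{0<..}. exp (- ((\<zeta> + h) * of_real x)) * f x - exp (- (\<zeta> * of_real x)) * f x
            + h * (exp (- (\<zeta> * of_real x)) * (of_real x * f x)))"
      unfolding laplace_def
      by (simp add: set_integral_add set_integral_diff i1 i2 i4)
    also have "\<dots> = (LBINT x:{0<..}. ?g x)"
      by (intro set_lebesgue_integral_cong) (auto simp: algebra_simps exp_add exp_diff exp_minus field_simps)
    also have "cmod \<dots> \<le> (cmod h ^ 2 * (2 / d ^ 2 * M)) / (Re \<zeta> - (\<omega> + d) - d)"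
    proof (rule set_integrable_exp_bound)
      show "continuous_on {0<..} ?g" by (intro continuous_intros f)
      show "Re \<zeta> - (\<omega> + d) - d > 0" using \<zeta> by (simp add: d_def field_simps)
      fix x :: real assume x: "x > 0"
      have "cmod (exp (- (h * of_real x)) - 1 - - (h * of_real x))
          \<le> cmod (- (h * of_real x)) ^ 2 * exp (cmod (- (h * of_real x)))"
        by (rule exp_minus_linear_bound)
      also have "\<dots> \<le> (cmod h ^ 2 * x ^ 2) * exp (d * x)"
        using h x by (intro mult_mono) (auto simp: norm_mult power_mult_distrib)
      finally have "cmod (?g x) \<le> cmod (exp (- (\<zeta> * of_real x)) * f x) * ((cmod h ^ 2 * x ^ 2) * exp (d * x))"
        unfolding norm_mult[of "exp (- (\<zeta> * of_real x)) * f x"] by (rule mult_left_mono) simp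
      also have "\<dots> = cmod h ^ 2 * exp (d * x) * cmod (exp (- (\<zeta> * of_real x)) * (of_real x ^ 2 * f x))"
        using x by (simp add: norm_mult norm_power)
      also have "\<dots> \<le> cmod h ^ 2 * exp (d * x) * ((fact 2 / d ^ 2 * M) * exp (- (Re \<zeta> - (\<omega> + d)) * x))"
        by (intro mult_left_mono laplace_integrand_bound x times_exp_bound[OF bound d M]) auto
      also have "\<dots> = cmod h ^ 2 * (2 / d ^ 2 * M) * exp (- (Re \<zeta> - (\<omega> + d) - d) * x)"
        by (simp add: algebra_simps flip: exp_add)
      finally show "cmod (?g x) \<le> cmod h ^ 2 * (2 / d ^ 2 * M) * exp (- (Re \<zeta> - (\<omega> + d) - d) * x)" .
    qed
    finally show ?thesis by (simp add: K_def)
  qed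
  have "((\<lambda>h. (laplace f (\<zeta> + h) - laplace f \<zeta>) / h - - laplace (\<lambda>x. of_real x * f x) \<zeta>) \<longlongrightarrow> 0) (at 0)"
  proof (rule Lim_null_comparison)
    show "((\<lambda>h. cmod h * K) \<longlongrightarrow> 0) (at 0)" by (auto intro!: tendsto_eq_intros)
    show "eventually (\<lambda>h. cmod ((laplace f (\<zeta> + h) - laplace f \<zeta>) / h - - laplace (\<lambda>x. of_real x * f x) \<zeta>)
        \<le> cmod h * K) (at 0)"
      unfolding eventually_at
    proof (intro exI[of _ d] conjI d ballI impI)
      fix h :: complex assume h: "h \<noteq> 0 \<and> dist h 0 < d"
      have "(laplace f (\<zeta> + h) - laplace f \<zeta>) / h - - laplace (\<lambda>x. of_real x * f x) \<zeta>
          = (laplace f (\<zeta> + h) - laplace f \<zeta> + h * laplace (\<lambda>x. of_real x * f x) \<zeta>) / h"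
        using h by (simp add: field_simps)
      also have "cmod \<dots> \<le> (cmod h ^ 2 * K) / cmod h"
        unfolding norm_divide by (intro divide_right_mono est) (use h in auto)
      finally show "cmod ((laplace f (\<zeta> + h) - laplace f \<zeta>) / h - - laplace (\<lambda>x. of_real x * f x) \<zeta>)
          \<le> cmod h * K"
        using h by (simp add: power2_eq_square)
    qed
  qed
  thus ?thesis unfolding DERIV_def by (rule LIM_zero_cancel)
qed

text \<open>Links the Lebesgue integrals, used for domination and Fubini, with the integrals over
  {0..L} that contour integrals along segments produce.\<close>

lemma tendsto_integral_half_line:
  fixes g :: "real \<Rightarrow> complex"
  assumes g: "set_integrable lborel {0<..} g"
  shows "((\<lambda>L. integral {0..L} g) \<longlongrightarrow> (LBINT x:{0<..}. g x)) at_top"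
proof -
  have meas: "(\<lambda>x. indicator {0<..} x *\<^sub>R g x) \<in> borel_measurable lborel"
    using g unfolding set_integrable_def by (rule borel_measurable_integrable)
  have eq: "indicator {0<..L} x *\<^sub>R g x = indicator {..L} x *\<^sub>R (indicator {0<..} x *\<^sub>R g x)" for L x
    by (auto simp: indicator_def)
  have "((\<lambda>L. LBINT x:{0<..L}. g x) \<longlongrightarrow> (LBINT x:{0<..}. g x)) at_top"
    unfolding set_lebesgue_integral_def
  proof (rule integral_dominated_convergence_at_top)
    show "integrable lborel (\<lambda>x. norm (indicator {0<..} x *\<^sub>R g x))"
      using g unfolding set_integrable_def by (rule integrable_norm)
    show "\<forall>\<^sub>F L in at_top. AE x in lborel. norm (indicator {0<..L} x *\<^sub>R g x) \<le> norm (indicator {0<..} x *\<^sub>R g x)"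
      by (intro always_eventually allI AE_I2) (auto simp: indicator_def)
    show "AE x in lborel. ((\<lambda>L. indicator {0<..L} x *\<^sub>R g x) \<longlongrightarrow> indicator {0<..} x *\<^sub>R g x) at_top"
    proof (intro AE_I2 tendsto_eventually)
      fix x :: real
      show "\<forall>\<^sub>F L in at_top. indicator {0<..L} x *\<^sub>R g x = indicator {0<..} x *\<^sub>R g x"
        using eventually_ge_at_top[of x] by eventually_elim (auto simp: indicator_def)
    qed
    show "(\<lambda>x. indicator {0<..} x *\<^sub>R g x) \<in> borel_measurable lborel" by (rule meas)
    show "(\<lambda>x. indicator {0<..L} x *\<^sub>R g x) \<in> borel_measurable lborel" for L
      unfolding eq using meas by measurable
  qed
  moreover have "(LBINT x:{0<..L}. g x) = integral {0..L} g" for L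
  proof -
    have "set_integrable lborel {0<..L} g"
      by (rule set_integrable_subset[OF g]) auto
    hence "(LBINT x:{0<..L}. g x) = integral {0<..L} g"
      by (rule set_borel_integral_eq_integral)
    also have "\<dots> = integral {0..L} g"
      by (rule integral_spike_set) (auto intro: negligible_subset[of "{0}"] negligible_subset[of "{}"])
    finally show ?thesis .
  qed
  ultimately show ?thesis by simp
qed

text \<open>The closed sector between the positive reals and the ray of angle c * \<theta>, where c
  is 1 or -1. As an intersection of two half-planes it is convex without any argument function, and
  the sign c lets the two halves of a symmetric contour share their lemmas.\<close>

definition wedge :: "real \<Rightarrow> real \<Rightarrow> complex set" where
  "wedge c \<theta> = {z. 0 \<le> c * Im z \<and> c * Im (z * cis (- (c * \<theta>))) \<le> 0}"

lemma convex_wedge: "convex (wedge c \<theta>)"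
proof (rule convexI)
  fix x y :: complex and u v :: real
  assume *: "x \<in> wedge c \<theta>" "y \<in> wedge c \<theta>" "0 \<le> u" "0 \<le> v"
  have "c * Im (u *\<^sub>R x + v *\<^sub>R y) = u * (c * Im x) + v * (c * Im y)"
    by (simp add: algebra_simps)
  moreover have "c * Im ((u *\<^sub>R x + v *\<^sub>R y) * cis (- (c * \<theta>)))
      = u * (c * Im (x * cis (- (c * \<theta>)))) + v * (c * Im (y * cis (- (c * \<theta>))))"
    by (simp add: algebra_simps)
  ultimately show "u *\<^sub>R x + v *\<^sub>R y \<in> wedge c \<theta>"
    using * unfolding wedge_def
    by (auto intro!: add_nonneg_nonneg add_nonpos_nonpos mult_nonneg_nonneg mult_nonneg_nonpos simp del: times_complex.sel)
qed

lemma wedge_rays: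
  assumes "c = 1 \<or> c = -1" "0 < \<theta>" "\<theta> < pi" "x \<ge> 0"
  shows "of_real x \<in> wedge c \<theta>" "of_real x * cis (c * \<theta>) \<in> wedge c \<theta>"
  using assms sin_gt_zero[of \<theta>] unfolding wedge_def by (auto simp: mult.assoc cis_mult)

lemma wedge_Re_aux:
  assumes "0 < \<theta>" "\<theta> < pi" "0 \<le> Im z" "Im (z * cis (- \<theta>)) \<le> 0"
  shows "cmod z * cos \<theta> \<le> Re z"
proof (cases "z = 0")
  case False
  define r where "r = cmod z"
  define \<phi> where "\<phi> = Arg z"
  have r: "r > 0" using False by (simp add: r_def)
  have z: "z = of_real r * cis \<phi>" using False by (simp add: r_def \<phi>_def cis_Arg complex_sgn_def scaleR_conv_of_real)
  have \<phi>: "- pi < \<phi>" "\<phi> \<le> pi" using Arg_bounded[of z] by (auto simp: \<phi>_def)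
  have "sin \<phi> \<ge> 0" using assms(3) r unfolding z by (simp add: zero_le_mult_iff)
  hence "\<phi> \<ge> 0" using sin_gt_zero[of "- \<phi>"] \<phi> by (force simp: not_le)
  have "sin (\<phi> - \<theta>) \<le> 0"
    using assms(4) r unfolding z by (simp add: mult.assoc cis_mult mult_le_0_iff)
  hence "\<phi> \<le> \<theta>" using sin_gt_zero[of "\<phi> - \<theta>"] \<phi> assms by (force simp: not_le)
  hence "cos \<theta> \<le> cos \<phi>" using \<open>\<phi> \<ge> 0\<close> assms by (intro cos_monotone_0_pi_le) auto
  thus ?thesis using r unfolding z by (simp add: norm_mult)
qed simp

lemma wedge_Re:
  assumes "c = 1 \<or> c = -1" "0 < \<theta>" "\<theta> < pi" "z \<in> wedge c \<theta>"
  shows "cmod z * cos \<theta> \<le> Re z"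
  using assms(1)
proof
  assume "c = 1"
  thus ?thesis using wedge_Re_aux[OF assms(2,3), of z] assms(4) unfolding wedge_def by auto
next
  assume "c = -1"
  thus ?thesis using wedge_Re_aux[OF assms(2,3), of "cnj z"] assms(4) unfolding wedge_def by auto
qed

lemma contour_integral_ray:
  assumes "L > 0"
  shows "contour_integral (linepath 0 (of_real L * v)) h = integral {0..L} (\<lambda>x. v * h (of_real x * v))"
proof -
  have "contour_integral (linepath 0 (of_real L * v)) h
      = contour_integral (linepath 0 (of_real L)) (\<lambda>z. v * h (z * v))"
    unfolding contour_integral_integral vector_derivative_linepath_at linepath_def
    by (intro integral_cong) (simp add: scaleR_conv_of_real mult_ac)
  also have "\<dots> = integral {0..L} (\<lambda>x. v * h (of_real x * v))"
    using assms by (subst contour_integral_linepath_Reals_eq) auto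
  finally show ?thesis .
qed

text \<open>Cauchy's theorem for the triangle 0, L v, L w: the integrals along the two rays up to L
  differ by the one over the third side. Its length is L |w - v|, so it vanishes in the limit if L *
  B L tends to 0.\<close>

lemma ray_rotation:
  fixes h :: "complex \<Rightarrow> complex"
  assumes S: "convex S" and rays: "\<And>x. x \<ge> 0 \<Longrightarrow> of_real x * v \<in> S \<and> of_real x * w \<in> S"
    and cont: "continuous_on S h" and holo: "h holomorphic_on interior S"
    and bound: "eventually (\<lambda>L. \<forall>z\<in>closed_segment (of_real L * v) (of_real L * w). cmod (h z) \<le> B L) at_top"
    and lim: "((\<lambda>L. L * B L) \<longlongrightarrow> 0) at_top"
  shows "((\<lambda>L. integral {0..L} (\<lambda>x. v * h (of_real x * v)) - integral {0..L} (\<lambda>x. w * h (of_real x * w))) \<longlongrightarrow> 0) at_top"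
proof (rule Lim_null_comparison)
  show "((\<lambda>L. cmod (w - v) * (L * B L)) \<longlongrightarrow> 0) at_top" using lim by (rule tendsto_mult_right_zero)
  show "\<forall>\<^sub>F L in at_top. cmod (integral {0..L} (\<lambda>x. v * h (of_real x * v)) - integral {0..L} (\<lambda>x. w * h (of_real x * w)))
      \<le> cmod (w - v) * (L * B L)"
    using bound eventually_gt_at_top[of 0]
  proof eventually_elim
    fix L :: real
    assume b: "\<forall>z\<in>closed_segment (of_real L * v) (of_real L * w). cmod (h z) \<le> B L" and L: "L > 0"
    let ?T = "convex hull {0, of_real L * v, of_real L * w}"
    have TS: "?T \<subseteq> S" using rays[of 0] rays[of L] L S by (intro hull_minimal) auto
    have c: "continuous_on ?T h" by (rule continuous_on_subset[OF cont TS])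
    have seg: "closed_segment 0 (of_real L * v) \<subseteq> ?T" "closed_segment (of_real L * v) (of_real L * w) \<subseteq> ?T"
       "closed_segment 0 (of_real L * w) \<subseteq> ?T"
      by (rule segments_subset_convex_hull)+
    have "(h has_contour_integral 0) (linepath 0 (of_real L * v) +++ linepath (of_real L * v) (of_real L * w) +++ linepath (of_real L * w) 0)"
      by (rule Cauchy_theorem_triangle_interior[OF c holomorphic_on_subset[OF holo interior_mono[OF TS]]])
    from has_chain_integral_chain_integral3[OF this]
    have diff: "contour_integral (linepath 0 (of_real L * v)) h - contour_integral (linepath 0 (of_real L * w)) h
        = - contour_integral (linepath (of_real L * v) (of_real L * w)) h"
      using contour_integral_reverse_linepath[OF continuous_on_subset[OF c seg(3)]]
      by algebra
    moreover have "cmod (contour_integral (linepath (of_real L * v) (of_real L * w)) h)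
       \<le> B L * cmod (of_real L * w - of_real L * v)"
    proof (rule contour_integral_bound_linepath)
      show "h contour_integrable_on linepath (of_real L * v) (of_real L * w)"
        by (intro contour_integrable_continuous_linepath continuous_on_subset[OF c seg(2)])
      show "0 \<le> B L" using b order_trans[OF norm_ge_zero] by (meson ends_in_segment(1))
    qed (use b in auto)
    moreover have "cmod (of_real L * w - of_real L * v) = L * cmod (w - v)"
      using L by (simp add: norm_mult flip: right_diff_distrib)
    ultimately show "cmod (integral {0..L} (\<lambda>x. v * h (of_real x * v)) - integral {0..L} (\<lambda>x. w * h (of_real x * w)))
      \<le> cmod (w - v) * (L * B L)"
      unfolding contour_integral_ray[OF L, of v h, symmetric] contour_integral_ray[OF L, of w h, symmetric] diff
      by (simp add: mult_ac)
  qed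
qed

text \<open>Ln (z - \<tau>) is a primitive on the right half of the kite and Ln (\<tau> - z) on the
  left half. The first exceeds the second by i \<pi> at \<open>p\<close> and by - i \<pi> at
  \<open>cnj p\<close>; the two jumps add up to 2 \<pi> i.\<close>

lemma kite_integral:
  fixes p :: complex and a b \<tau> :: real
  assumes "b < \<tau>" "\<tau> < a" "Im p > 0"
  defines "f \<equiv> \<lambda>z. 1 / (z - of_real \<tau>)"
  shows "contour_integral (linepath p (of_real b)) f + contour_integral (linepath (of_real b) (cnj p)) f
       + contour_integral (linepath (cnj p) (of_real a)) f + contour_integral (linepath (of_real a) p) f = 2 * of_real pi * \<i>"
proof -
  have seg: "Im z * s > 0 \<or> z = of_real x" if "z \<in> closed_segment q (of_real x)" "Im q * s > 0" for z q x s
  proof -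
    from that(1) obtain u where u: "0 \<le> u" "u \<le> 1" "z = (1 - u) *\<^sub>R q + u *\<^sub>R of_real x"
      by (auto simp: in_segment)
    show ?thesis
    proof (cases "u = 1")
      case False
      hence "u < 1" using u by simp
      hence "(1 - u) * (Im q * s) > 0" using mult_pos_pos[of "1 - u" "Im q * s"] that(2) by (metis diff_gt_0_iff_gt)
      moreover have "Im z * s = (1 - u) * (Im q * s)" using u by simp
      ultimately show ?thesis by metis
    qed (use u in auto)
  qed
  have right: "contour_integral (linepath q r) f = Ln (r - of_real \<tau>) - Ln (q - of_real \<tau>)"
    if "\<And>z. z \<in> closed_segment q r \<Longrightarrow> Im z \<noteq> 0 \<or> z = of_real a" for q r
  proof -
    have "(f has_contour_integral (Ln (pathfinish (linepath q r) - of_real \<tau>) - Ln (pathstart (linepath q r) - of_real \<tau>))) (linepath q r)"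
    proof (rule contour_integral_primitive[where S = "closed_segment q r"])
      fix z assume "z \<in> closed_segment q r"
      hence "z - of_real \<tau> \<notin> \<real>\<^sub>\<le>\<^sub>0"
        using that[of z] assms(2) by (auto simp: complex_nonpos_Reals_iff)
      thus "((\<lambda>z. Ln (z - of_real \<tau>)) has_field_derivative f z) (at z within closed_segment q r)"
        unfolding f_def by (auto intro!: derivative_eq_intros simp: inverse_eq_divide)
    qed auto
    thus ?thesis by (simp add: contour_integral_unique)
  qed
  have left: "contour_integral (linepath q r) f = Ln (of_real \<tau> - r) - Ln (of_real \<tau> - q)"
    if "\<And>z. z \<in> closed_segment q r \<Longrightarrow> Im z \<noteq> 0 \<or> z = of_real b" for q r
  proof -
    have "(f has_contour_integral (Ln (of_real \<tau> - pathfinish (linepath q r)) - Ln (of_real \<tau> - pathstart (linepath q r)))) (linepath q r)"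
    proof (rule contour_integral_primitive[where S = "closed_segment q r"])
      fix z assume "z \<in> closed_segment q r"
      hence "of_real \<tau> - z \<notin> \<real>\<^sub>\<le>\<^sub>0"
        using that[of z] assms(1) by (auto simp: complex_nonpos_Reals_iff)
      moreover from this have "of_real \<tau> - z \<noteq> 0" by auto
      ultimately show "((\<lambda>z. Ln (of_real \<tau> - z)) has_field_derivative f z) (at z within closed_segment q r)"
        unfolding f_def by (auto intro!: derivative_eq_intros simp: field_simps)
    qed auto
    thus ?thesis by (simp add: contour_integral_unique)
  qed
  have up: "Im z \<noteq> 0 \<or> z = of_real x" if "z \<in> closed_segment p (of_real x) \<or> z \<in> closed_segment (of_real x) p" for z x
    using seg[of z p x 1] that assms(3) by (auto simp: closed_segment_commute)
  have down: "Im z \<noteq> 0 \<or> z = of_real x" if "z \<in> closed_segment (cnj p) (of_real x) \<or> z \<in> closed_segment (of_real x) (cnj p)" for z x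
    using seg[of z "cnj p" x "-1"] that assms(3) by (auto simp: closed_segment_commute)
  have n0: "Ln (of_real \<tau> - p) = Ln (p - of_real \<tau>) - \<i> * pi"
    using Ln_minus[of "p - of_real \<tau>"] assms(3) by (auto simp: complex_eq_iff)
  have n1: "Ln (of_real \<tau> - cnj p) = Ln (cnj p - of_real \<tau>) + \<i> * pi"
    using Ln_minus[of "cnj p - of_real \<tau>"] assms(3) by (auto simp: complex_eq_iff)
  have n2: "contour_integral (linepath p (of_real b)) f = Ln (of_real \<tau> - of_real b) - Ln (of_real \<tau> - p)"
    by (rule left) (use up in blast)
  have n3: "contour_integral (linepath (of_real b) (cnj p)) f = Ln (of_real \<tau> - cnj p) - Ln (of_real \<tau> - of_real b)"
    by (rule left) (use down in blast)
  have n4: "contour_integral (linepath (cnj p) (of_real a)) f = Ln (of_real a - of_real \<tau>) - Ln (cnj p - of_real \<tau>)"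
    by (rule right) (use down in blast)
  have n5: "contour_integral (linepath (of_real a) p) f = Ln (p - of_real \<tau>) - Ln (of_real a - of_real \<tau>)"
    by (rule right) (use up in blast)
  show ?thesis unfolding n2 n3 n4 n5 n0 n1 by simp
qed

lemma laplace_one:
  assumes "Re \<kappa> > 0"
  shows "laplace (\<lambda>_. 1) \<kappa> = 1 / \<kappa>"
proof -
  have \<kappa>: "\<kappa> \<noteq> 0" using assms by auto
  have "set_integrable lborel {0<..} (\<lambda>x. exp (- (\<kappa> * of_real x)) * 1)"
    by (rule laplace_integrable[of "\<lambda>_. 1" 1 0]) (use assms in auto)
  from tendsto_integral_half_line[OF this]
  have lim1: "((\<lambda>L. integral {0..L} (\<lambda>x. exp (- (\<kappa> * of_real x)))) \<longlongrightarrow> laplace (\<lambda>_. 1) \<kappa>) at_top"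
    unfolding laplace_def by simp
  have ev: "\<forall>\<^sub>F L in at_top. (1 - exp (- (\<kappa> * of_real L))) / \<kappa> = integral {0..L} (\<lambda>x. exp (- (\<kappa> * of_real x)))"
    using eventually_ge_at_top[of 0]
  proof eventually_elim
    fix L :: real assume L: "L \<ge> 0"
    have "((\<lambda>x. exp (- (\<kappa> * of_real x))) has_integral
        (- exp (- (\<kappa> * of_real L)) / \<kappa> - (- exp (- (\<kappa> * of_real 0)) / \<kappa>))) {0..L}"
    proof (rule fundamental_theorem_of_calculus[OF L])
      fix x assume "x \<in> {0..L}"
      have "((\<lambda>z. - exp (- (\<kappa> * z)) / \<kappa>) has_field_derivative exp (- (\<kappa> * of_real x))) (at (of_real x))"
        using \<kappa> by (auto intro!: derivative_eq_intros)
      thus "((\<lambda>x. - exp (- (\<kappa> * of_real x)) / \<kappa>) has_vector_derivative exp (- (\<kappa> * of_real x))) (at x within {0..L})"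
        by (rule has_vector_derivative_real_field)
    qed
    thus "(1 - exp (- (\<kappa> * of_real L))) / \<kappa> = integral {0..L} (\<lambda>x. exp (- (\<kappa> * of_real x)))"
      by (simp add: integral_unique diff_divide_distrib)
  qed
  have lim2: "((\<lambda>L. (1 - exp (- (\<kappa> * of_real L))) / \<kappa>) \<longlongrightarrow> (1 - 0) / \<kappa>) at_top"
  proof -
    have "((\<lambda>L. exp (- (Re \<kappa> * L))) \<longlongrightarrow> 0) at_top" using assms by real_asymp
    hence "((\<lambda>L. exp (- (\<kappa> * of_real L))) \<longlongrightarrow> 0) at_top"
      by (intro tendsto_norm_zero_cancel[of "\<lambda>L. exp (- (\<kappa> * of_real L))"]) simp
    from tendsto_divide[OF tendsto_diff[OF tendsto_const this] tendsto_const \<kappa>] show ?thesis .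
  qed
  show ?thesis
    using tendsto_unique[OF trivial_limit_at_top_linorder lim1 Lim_transform_eventually[OF lim2 ev]] by simp
qed

lemma set_integral_Fubini_exp_bound:
  fixes g :: "real \<Rightarrow> real \<Rightarrow> complex"
  assumes cont: "continuous_on ({0<..} \<times> {0<..}) (\<lambda>(y, x). g y x)"
    and bound: "\<And>y x. y > 0 \<Longrightarrow> x > 0 \<Longrightarrow> cmod (g y x) \<le> K * exp (- \<beta> * y) * exp (- \<gamma> * x)"
    and pos: "\<beta> > 0" "\<gamma> > 0"
  shows "(LBINT y:{0<..}. LBINT x:{0<..}. g y x) = (LBINT x:{0<..}. LBINT y:{0<..}. g y x)"
proof -
  let ?e = "\<lambda>c x. indicator {0<..} x *\<^sub>R exp (- c * x) :: real"
  let ?g = "\<lambda>(y, x). indicator ({0<..} \<times> {0<..}) (y, x) *\<^sub>R g y x"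
  have e: "integrable lborel (?e c)" if "c > 0" for c
    using exp_set_integrable[OF that] unfolding set_integrable_def .
  have "integrable (lborel \<Otimes>\<^sub>M lborel) (\<lambda>(y, x). ?e \<beta> y * ?e \<gamma> x)"
  proof (rule lborel_pair.Fubini_integrable)
    show "(\<lambda>(y, x). ?e \<beta> y * ?e \<gamma> x) \<in> borel_measurable (lborel \<Otimes>\<^sub>M lborel)" by measurable
    show "integrable lborel (\<lambda>y. LINT x|lborel. norm (case (y, x) of (y, x) \<Rightarrow> ?e \<beta> y * ?e \<gamma> x))"
      using e[OF pos(1)] e[OF pos(2)] by (simp add: abs_mult)
    show "AE y in lborel. integrable lborel (\<lambda>x. case (y, x) of (y, x) \<Rightarrow> ?e \<beta> y * ?e \<gamma> x)"
      using e[OF pos(2)] by simp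
  qed
  hence "integrable (lborel \<Otimes>\<^sub>M lborel) (\<lambda>p. K * (case p of (y, x) \<Rightarrow> ?e \<beta> y * ?e \<gamma> x))"
    by (rule integrable_mult_right)
  hence int: "integrable (lborel \<Otimes>\<^sub>M lborel) ?g"
  proof (rule Bochner_Integration.integrable_bound)
    have "(\<lambda>p. indicator ({0<..} \<times> {0<..}) p *\<^sub>R (case p of (y, x) \<Rightarrow> g y x)) \<in> borel_measurable borel"
      by (rule borel_measurable_continuous_on_indicator[OF _ cont]) (intro borel_open open_Times open_greaterThan)
    thus "?g \<in> borel_measurable (lborel \<Otimes>\<^sub>M lborel)"
      by (simp add: lborel_prod case_prod_unfold)
    show "AE p in lborel \<Otimes>\<^sub>M lborel. norm (?g p) \<le> norm (K * (case p of (y, x) \<Rightarrow> ?e \<beta> y * ?e \<gamma> x))"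
    proof (intro AE_I2)
      fix p :: "real \<times> real"
      obtain y x where p: "p = (y, x)" by (cases p)
      show "norm (?g p) \<le> norm (K * (case p of (y, x) \<Rightarrow> ?e \<beta> y * ?e \<gamma> x))"
        using order_trans[OF bound abs_ge_self, of y x] unfolding p by (auto simp: indicator_def mult.assoc)
    qed
  qed
  have "(LINT x|lborel. LINT y|lborel. ?g (y, x)) = (LINT y|lborel. LINT x|lborel. ?g (y, x))"
    using lborel_pair.Fubini_integral[of "\<lambda>y x. ?g (y, x)"] int by (simp add: case_prod_unfold)
  moreover have "(LINT x|lborel. ?g (y, x)) = indicator {0<..} y *\<^sub>R (LBINT x:{0<..}. g y x)" for y
    unfolding set_lebesgue_integral_def by (cases "y > 0") (auto simp: indicator_times)
  moreover have "(LINT y|lborel. ?g (y, x)) = indicator {0<..} x *\<^sub>R (LBINT y:{0<..}. g y x)" for x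
    unfolding set_lebesgue_integral_def by (cases "x > 0") (auto simp: indicator_times)
  ultimately show ?thesis
    using set_lebesgue_integral_def[of lborel "{0<..}" "\<lambda>y. LBINT x:{0<..}. g y x"]
      set_lebesgue_integral_def[of lborel "{0<..}" "\<lambda>x. LBINT y:{0<..}. g y x"] by simp
qed

text \<open>The set is |Arg z| \<le> \<theta> with the vertex included, again without an argument
  function. Continuity up to the boundary is part of the setting because the Laplace integrals will
  run along the boundary rays.\<close>

locale sector_function =
  fixes f :: "complex \<Rightarrow> complex" and \<theta> M \<omega> :: real
  assumes \<theta>: "0 < \<theta>" "\<theta> < pi / 2"
    and cont_f: "continuous_on {z. cmod z * cos \<theta> \<le> Re z} f"
    and holo_f: "f holomorphic_on interior {z. cmod z * cos \<theta> \<le> Re z}"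
    and bound_f: "\<And>z. cmod z * cos \<theta> \<le> Re z \<Longrightarrow> cmod (f z) \<le> M * exp (\<omega> * cmod z)"
    and \<omega>: "\<omega> \<ge> 0"
begin

abbreviation \<Sigma> :: "complex set" where "\<Sigma> \<equiv> {z. cmod z * cos \<theta> \<le> Re z}"

lemma trig_pos: "cos \<theta> > 0" "sin \<theta> > 0" "\<theta> < pi"
  using \<theta> cos_gt_zero[of \<theta>] sin_gt_zero[of \<theta>] pi_gt_zero by (auto simp del: pi_gt_zero)

lemma M: "M \<ge> 0"
  using order_trans[OF norm_ge_zero bound_f[of 0]] by simp

lemma convex_\<Sigma>: "convex \<Sigma>"
proof (rule convexI)
  fix x y :: complex and u v :: real
  assume *: "x \<in> \<Sigma>" "y \<in> \<Sigma>" "0 \<le> u" "0 \<le> v"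
  have "cmod (u *\<^sub>R x + v *\<^sub>R y) \<le> u * cmod x + v * cmod y"
    using norm_triangle_ineq[of "u *\<^sub>R x" "v *\<^sub>R y"] * by simp
  hence "cmod (u *\<^sub>R x + v *\<^sub>R y) * cos \<theta> \<le> (u * cmod x + v * cmod y) * cos \<theta>"
    using trig_pos by (intro mult_right_mono) auto
  also have "\<dots> = u * (cmod x * cos \<theta>) + v * (cmod y * cos \<theta>)" by (simp add: algebra_simps)
  also have "\<dots> \<le> u * Re x + v * Re y" using * by (intro add_mono mult_left_mono) auto
  finally show "u *\<^sub>R x + v *\<^sub>R y \<in> \<Sigma>" by simp
qed

lemma ray_in_\<Sigma>: "\<bar>\<phi>\<bar> \<le> \<theta> \<Longrightarrow> x \<ge> 0 \<Longrightarrow> of_real x * cis \<phi> \<in> \<Sigma>"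
  using cos_monotone_0_pi_le[of "\<bar>\<phi>\<bar>" \<theta>] trig_pos by (auto simp: norm_mult intro: mult_left_mono)

lemma cont_ray: "\<bar>\<phi>\<bar> \<le> \<theta> \<Longrightarrow> continuous_on {0<..} (\<lambda>x. f (of_real x * cis \<phi>))"
  by (rule continuous_on_compose2[OF cont_f]) (use ray_in_\<Sigma>[of \<phi>] in \<open>auto intro!: continuous_intros\<close>)

lemma bound_ray: "\<bar>\<phi>\<bar> \<le> \<theta> \<Longrightarrow> x > 0 \<Longrightarrow> cmod (f (of_real x * cis \<phi>)) \<le> M * exp (\<omega> * x)"
  using bound_f[of "of_real x * cis \<phi>"] ray_in_\<Sigma>[of \<phi> x] by (auto simp: norm_mult)

text \<open>The Laplace integral of \<open>f\<close> along the ray of direction \<open>cis (- (c * \<theta>))\<close>; it continues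
  the Laplace transform of \<open>f\<close> to a half-plane rotated by the angle \<open>c * \<theta>\<close>.\<close>
definition G :: "real \<Rightarrow> complex \<Rightarrow> complex" where
  "G c w = cis (- (c * \<theta>)) * laplace (\<lambda>x. f (of_real x * cis (- (c * \<theta>)))) (w * cis (- (c * \<theta>)))"

lemma abs_c: "c = 1 \<or> c = -1 \<Longrightarrow> \<bar>- (c * \<theta>)\<bar> \<le> \<theta>"
  using \<theta> by auto

lemma G_bound:
  assumes "c = 1 \<or> c = -1" "Re (w * cis (- (c * \<theta>))) > \<omega>"
  shows "cmod (G c w) \<le> M / (Re (w * cis (- (c * \<theta>))) - \<omega>)"
  unfolding G_def norm_mult[of "cis _"] norm_cis mult_1
  by (rule laplace_bound[OF cont_ray bound_ray assms(2)]) (use abs_c[OF assms(1)] in auto)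

lemma G_holomorphic:
  assumes "c = 1 \<or> c = -1"
  shows "G c holomorphic_on {w. Re (w * cis (- (c * \<theta>))) > \<omega>}"
proof -
  have "laplace (\<lambda>x. f (of_real x * cis (- (c * \<theta>)))) holomorphic_on {\<zeta>. Re \<zeta> > \<omega>}"
    unfolding holomorphic_on_def field_differentiable_def
  proof
    fix \<zeta> assume "\<zeta> \<in> {\<zeta>. Re \<zeta> > \<omega>}"
    hence "Re \<zeta> > \<omega>" by simp
    from laplace_has_field_derivative[OF cont_ray[OF abs_c[OF assms]] bound_ray[OF abs_c[OF assms]] this]
    show "\<exists>F. (laplace (\<lambda>x. f (of_real x * cis (- (c * \<theta>)))) has_field_derivative F) (at \<zeta> within {\<zeta>. Re \<zeta> > \<omega>})"
      by (blast intro: has_field_derivative_at_within)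
  qed
  hence "(laplace (\<lambda>x. f (of_real x * cis (- (c * \<theta>)))) \<circ> (\<lambda>w. w * cis (- (c * \<theta>)))) holomorphic_on
      {w. Re (w * cis (- (c * \<theta>))) > \<omega>}"
    by (intro holomorphic_on_compose_gen[where t = "{\<zeta>. Re \<zeta> > \<omega>}"] holomorphic_intros) auto
  thus ?thesis unfolding G_def[abs_def] o_def by (intro holomorphic_intros)
qed

text \<open>A disc and a half-plane are convex and contain both end points, hence the chord;
  together the two bounds place it in the sector.\<close>

lemma third_side:
  assumes "L \<ge> 0" "z \<in> closed_segment (of_real L * cis \<phi>) (of_real L * cis \<psi>)"
    "\<bar>\<phi>\<bar> \<le> \<theta>" "\<bar>\<psi>\<bar> \<le> \<theta>"
  shows "cmod z \<le> L" "L * cos \<theta> \<le> Re z" "z \<in> \<Sigma>"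
proof -
  let ?S = "{z. cmod z \<le> L} \<inter> {z. L * cos \<theta> \<le> Re z}"
  have "convex ?S"
    using convex_cball[of 0 L] convex_halfspace_Re_ge[of "L * cos \<theta>"]
    by (intro convex_Int) (auto simp: cball_def)
  moreover have "of_real L * cis q \<in> ?S" if "\<bar>q\<bar> \<le> \<theta>" for q
    using ray_in_\<Sigma>[OF that assms(1)] assms(1) by (simp add: norm_mult)
  ultimately have "z \<in> ?S"
    using assms closed_segment_subset[of "of_real L * cis \<phi>" ?S "of_real L * cis \<psi>"] by blast
  thus *: "cmod z \<le> L" "L * cos \<theta> \<le> Re z" by auto
  have "cmod z * cos \<theta> \<le> L * cos \<theta>" using * trig_pos by (intro mult_right_mono) auto
  thus "z \<in> \<Sigma>" using * by simp
qed

text \<open>The ray may be rotated when l is real and large: on the far side |exp (- l z)| is at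
  most exp (- l L cos \<theta>), which beats the growth exp (\<omega> L) of
  \<open>f\<close>.\<close>

lemma laplace_eq_G:
  assumes c: "c = 1 \<or> c = -1" and l: "l * cos \<theta> > \<omega>"
  shows "laplace (\<lambda>x. f (of_real x)) (of_real l) = G c (of_real l)"
proof -
  let ?w = "cis (- (c * \<theta>))"
  let ?h = "\<lambda>z. exp (- (of_real l * z)) * f z"
  note c' = abs_c[OF c]
  have l0: "l > 0" using l \<omega> trig_pos by (smt (verit) mult_nonpos_nonneg)
  have l\<omega>: "l > \<omega>"
    using l l0 cos_le_one[of \<theta>] by (smt (verit) mult_left_le)
  have "((\<lambda>L. integral {0..L} (\<lambda>x. 1 * ?h (of_real x * 1)) - integral {0..L} (\<lambda>x. ?w * ?h (of_real x * ?w))) \<longlongrightarrow> 0) at_top"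
  proof (rule ray_rotation[OF convex_\<Sigma>, where B = "\<lambda>L. M * exp (\<omega> * L) * exp (- (l * (L * cos \<theta>)))"])
    show "of_real x * 1 \<in> \<Sigma> \<and> of_real x * ?w \<in> \<Sigma>" if "x \<ge> 0" for x
      using ray_in_\<Sigma>[OF c' that] ray_in_\<Sigma>[of 0 x] that \<theta> by auto
    show "continuous_on \<Sigma> ?h" by (intro continuous_intros cont_f)
    show "?h holomorphic_on interior \<Sigma>" by (intro holomorphic_intros holo_f)
    show "\<forall>\<^sub>F L in at_top. \<forall>z\<in>closed_segment (of_real L * 1) (of_real L * ?w).
        cmod (?h z) \<le> M * exp (\<omega> * L) * exp (- (l * (L * cos \<theta>)))"
      using eventually_ge_at_top[of 0]
    proof eventually_elim
      fix L :: real assume L: "L \<ge> 0"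
      show "\<forall>z\<in>closed_segment (of_real L * 1) (of_real L * ?w). cmod (?h z) \<le> M * exp (\<omega> * L) * exp (- (l * (L * cos \<theta>)))"
      proof
        fix z assume "z \<in> closed_segment (of_real L * 1) (of_real L * ?w)"
        hence z: "cmod z \<le> L" "L * cos \<theta> \<le> Re z" "z \<in> \<Sigma>"
          using third_side[OF L, of z 0 "- (c * \<theta>)"] c' \<theta> by auto
        have "cmod (?h z) = cmod (f z) * exp (- (l * Re z))" by (simp add: norm_mult)
        also have "\<dots> \<le> (M * exp (\<omega> * L)) * exp (- (l * (L * cos \<theta>)))"
        proof (intro mult_mono)
          have "cmod (f z) \<le> M * exp (\<omega> * cmod z)" using bound_f z by simp
          also have "\<dots> \<le> M * exp (\<omega> * L)" using z \<omega> M by (intro mult_left_mono) (auto intro: mult_left_mono)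
          finally show "cmod (f z) \<le> M * exp (\<omega> * L)" .
        qed (use z l0 M in auto)
        finally show "cmod (?h z) \<le> M * exp (\<omega> * L) * exp (- (l * (L * cos \<theta>)))" .
      qed
    qed
    have "((\<lambda>L. M * (L * exp (- ((l * cos \<theta> - \<omega>) * L)))) \<longlongrightarrow> M * 0) at_top"
      using l by (intro tendsto_intros) real_asymp
    thus "((\<lambda>L. L * (M * exp (\<omega> * L) * exp (- (l * (L * cos \<theta>))))) \<longlongrightarrow> 0) at_top"
      by (simp add: algebra_simps flip: exp_add)
  qed
  moreover have "((\<lambda>L. integral {0..L} (\<lambda>x. 1 * ?h (of_real x * 1))) \<longlongrightarrow> laplace (\<lambda>x. f (of_real x)) (of_real l)) at_top"
  proof -
    have "set_integrable lborel {0<..} (\<lambda>x. exp (- (of_real l * of_real x)) * f (of_real x))"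
      by (rule laplace_integrable[OF cont_ray[of 0, simplified] bound_ray[of 0, simplified]]) (use \<theta> l\<omega> in auto)
    from tendsto_integral_half_line[OF this] show ?thesis unfolding laplace_def by simp
  qed
  moreover have "((\<lambda>L. integral {0..L} (\<lambda>x. ?w * ?h (of_real x * ?w))) \<longlongrightarrow> G c (of_real l)) at_top"
  proof -
    have "set_integrable lborel {0<..} (\<lambda>x. exp (- ((of_real l * ?w) * of_real x)) * f (of_real x * ?w))"
      by (rule laplace_integrable[OF cont_ray[OF c'] bound_ray[OF c']]) (use l c in auto)
    from tendsto_mult_left[OF tendsto_integral_half_line[OF this], of ?w] show ?thesis
      unfolding laplace_def G_def by (simp add: mult_ac)
  qed
  ultimately have "((\<lambda>L::real. 0) \<longlongrightarrow> laplace (\<lambda>x. f (of_real x)) (of_real l) - G c (of_real l) - 0) at_top"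
    using tendsto_diff[OF tendsto_diff] by fastforce
  thus ?thesis by (simp add: tendsto_const_iff)
qed

end

section \<open>Laplace inversion on a contour bent into the left half-plane, for functions analytic
  in a sector\<close>

section \<open>Inversion for functions analytic in a sector\<close>

context sector_function
begin

text \<open>The half-line from \<open>a\<close> perpendicular to the direction cis (c * \<theta>).
  Along it Re (\<lambda> cis (- c \<theta>)) = a cos \<theta> is constant, so \<open>G c\<close> is
  bounded, while Re \<lambda> = a - y sin \<theta> tends to minus infinity, so exp (\<lambda> t)
  makes the inversion integral absolutely convergent.\<close>

definition lam :: "real \<Rightarrow> real \<Rightarrow> real \<Rightarrow> complex" where
  "lam a c y = of_real a + of_real (c * y) * \<i> * cis (c * \<theta>)"

lemma lam_cis: "lam a c y * cis (- (c * \<theta>)) = of_real a * cis (- (c * \<theta>)) + of_real (c * y) * \<i>"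
  unfolding lam_def by (simp add: algebra_simps flip: cis_mult) (simp add: cis_mult mult.assoc[symmetric])

lemma Re_lam: "c = 1 \<or> c = -1 \<Longrightarrow> Re (lam a c y) = a - y * sin \<theta>"
  and Im_lam: "c = 1 \<or> c = -1 \<Longrightarrow> Im (lam a c y) = c * y * cos \<theta>"
  and Re_lam_cis: "c = 1 \<or> c = -1 \<Longrightarrow> Re (lam a c y * cis (- (c * \<theta>))) = a * cos \<theta>"
  unfolding lam_cis by (auto simp: lam_def)

definition I :: "real \<Rightarrow> real \<Rightarrow> real \<Rightarrow> complex" where
  "I a t c = (LBINT y:{0<..}. exp (lam a c y * of_real t) * G c (lam a c y)) * (of_real c * \<i> * cis (c * \<theta>))"

lemma lam_integrand:
  assumes c: "c = 1 \<or> c = -1" and a: "a * cos \<theta> > \<omega>" and t: "t > 0"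
  shows "continuous_on {0<..} (\<lambda>y. exp (lam a c y * of_real t) * G c (lam a c y))"
    and "cmod (exp (lam a c y * of_real t) * G c (lam a c y)) \<le> M / (a * cos \<theta> - \<omega>) * exp (a * t) * exp (- (t * sin \<theta>) * y)"
proof -
  have "continuous_on {0<..} (\<lambda>y. G c (lam a c y))"
    by (rule continuous_on_compose2[OF holomorphic_on_imp_continuous_on[OF G_holomorphic[OF c]]])
       (use a Re_lam_cis[OF c] in \<open>auto simp: lam_def intro!: continuous_intros\<close>)
  thus "continuous_on {0<..} (\<lambda>y. exp (lam a c y * of_real t) * G c (lam a c y))"
    unfolding lam_def by (intro continuous_intros)
  have "cmod (G c (lam a c y)) \<le> M / (a * cos \<theta> - \<omega>)"
    using G_bound[OF c, of "lam a c y"] Re_lam_cis[OF c] a by simp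
  hence "cmod (exp (lam a c y * of_real t)) * cmod (G c (lam a c y)) \<le> exp ((a - y * sin \<theta>) * t) * (M / (a * cos \<theta> - \<omega>))"
    using Re_lam[OF c] by (intro mult_mono) auto
  also have "\<dots> = M / (a * cos \<theta> - \<omega>) * exp (a * t) * exp (- (t * sin \<theta>) * y)"
    by (simp add: algebra_simps flip: exp_add)
  finally show "cmod (exp (lam a c y * of_real t) * G c (lam a c y)) \<le> M / (a * cos \<theta> - \<omega>) * exp (a * t) * exp (- (t * sin \<theta>) * y)"
    by (simp add: norm_mult)
qed

text \<open>Insert the integral defining \<open>G\<close> and integrate over the contour variable y
  first. This elementary integral is 1 / \<kappa>, which is up to a constant the Cauchy kernel 1 /
  (z - t) at the point z = x w of the ray.\<close>

lemma I_eq_ray: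
  assumes c: "c = 1 \<or> c = -1" and a: "a * cos \<theta> > \<omega>" and t: "t > 0"
  defines "w \<equiv> cis (- (c * \<theta>))"
  defines "h \<equiv> \<lambda>z. f z * exp (of_real a * (of_real t - z)) / (z - of_real t)"
  shows "I a t c = (LBINT x:{0<..}. w * h (of_real x * w))"
    and "set_integrable lborel {0<..} (\<lambda>x. w * h (of_real x * w))"
proof -
  define g where "g y x = exp (lam a c y * (of_real t - of_real x * w)) * f (of_real x * w)" for y x
  note c' = abs_c[OF c]
  have w1: "cis (c * \<theta>) * w = 1" by (simp add: w_def cis_mult)
  have expand: "lam a c y * (of_real t - of_real x * w)
      = of_real a * (of_real t - of_real x * w) + of_real (c * y) * \<i> * (cis (c * \<theta>) * of_real t - of_real x)" for y x
  proof -
    have "cis (c * \<theta>) * (of_real t - of_real x * w) = cis (c * \<theta>) * of_real t - of_real x"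
      using w1 by (simp add: algebra_simps)
    thus ?thesis unfolding lam_def by (simp add: distrib_right mult.assoc)
  qed
  have Re_w: "Re w = cos \<theta>" using c by (auto simp: w_def)
  have Re_exp: "Re (lam a c y * (of_real t - of_real x * w)) = a * t - a * x * cos \<theta> - y * (t * sin \<theta>)" for y x
    unfolding expand using c Re_w by (auto simp: algebra_simps)
  have fub: "(LBINT y:{0<..}. LBINT x:{0<..}. g y x) = (LBINT x:{0<..}. LBINT y:{0<..}. g y x)"
  proof (rule set_integral_Fubini_exp_bound)
    show "continuous_on ({0<..} \<times> {0<..}) (\<lambda>(y, x). g y x)"
    proof -
      have "continuous_on ({0<..} \<times> {0<..}) (\<lambda>p::real\<times>real. f (of_real (snd p) * w))"
        by (rule continuous_on_compose2[OF cont_ray[OF c'], folded w_def]) (auto intro!: continuous_intros)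
      thus ?thesis unfolding g_def lam_def case_prod_unfold by (intro continuous_intros)
    qed
    show "cmod (g y x) \<le> (M * exp (a * t)) * exp (- (t * sin \<theta>) * y) * exp (- (a * cos \<theta> - \<omega>) * x)"
      if "y > 0" "x > 0" for y x
    proof -
      have "cmod (g y x) \<le> exp (a * t - a * x * cos \<theta> - y * (t * sin \<theta>)) * (M * exp (\<omega> * x))"
        unfolding g_def norm_mult norm_exp_eq_Re Re_exp
        using bound_ray[OF c' that(2), folded w_def] by (intro mult_left_mono) auto
      also have "\<dots> = (M * exp (a * t)) * exp (- (t * sin \<theta>) * y) * exp (- (a * cos \<theta> - \<omega>) * x)"
        by (simp add: algebra_simps flip: exp_add)
      finally show ?thesis .
    qed
    show "t * sin \<theta> > 0" "a * cos \<theta> - \<omega> > 0" using t a trig_pos by auto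
  qed
  have inner_x: "(LBINT x:{0<..}. g y x) = exp (lam a c y * of_real t) * G c (lam a c y) * cis (c * \<theta>)" for y
  proof -
    have "(LBINT x:{0<..}. g y x)
       = (LBINT x:{0<..}. exp (lam a c y * of_real t) * (exp (- ((lam a c y * w) * of_real x)) * f (of_real x * w)))"
      unfolding g_def by (intro set_lebesgue_integral_cong) (auto simp: algebra_simps exp_diff exp_minus field_simps)
    also have "\<dots> = exp (lam a c y * of_real t) * (cis (c * \<theta>) * w * laplace (\<lambda>x. f (of_real x * w)) (lam a c y * w))"
      unfolding laplace_def w1 by simp
    finally show ?thesis unfolding G_def w_def by (simp add: mult_ac)
  qed
  \<comment> \<open>Minus the coefficient of y in the exponent. Its real part is t sin \<theta>,
    positive and independent of x, because \<open>t\<close> stays off the ray.\<close>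
  define \<kappa> where "\<kappa> x = - (of_real c * \<i> * cis (c * \<theta>) * (of_real t - of_real x * w))" for x
  have \<kappa>: "\<kappa> x = - (of_real c * \<i> * (cis (c * \<theta>) * of_real t - of_real x))" for x
    unfolding \<kappa>_def using w1 by (simp add: algebra_simps)
  have Re\<kappa>: "Re (\<kappa> x) > 0" for x
    unfolding \<kappa> using c t trig_pos by auto
  have ck: "of_real c * \<i> / \<kappa> x = w / (of_real x * w - of_real t)" for x
  proof -
    have "\<kappa> x \<noteq> 0" using Re\<kappa>[of x] by auto
    hence "of_real t - of_real x * w \<noteq> 0" unfolding \<kappa>_def by auto
    moreover have "of_real c * \<i> * (of_real x * w - of_real t) = w * \<kappa> x"
    proof -
      have "w * \<kappa> x = - (of_real c * \<i> * (cis (c * \<theta>) * w) * (of_real t - of_real x * w))"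
        unfolding \<kappa>_def by (simp add: mult_ac)
      thus ?thesis unfolding w1 by (simp add: algebra_simps)
    qed
    ultimately show ?thesis using \<open>\<kappa> x \<noteq> 0\<close> by (simp add: field_simps)
  qed
  have inner_y: "of_real c * \<i> * (LBINT y:{0<..}. g y x) = w * h (of_real x * w)" for x
  proof -
    have "(LBINT y:{0<..}. g y x)
       = (LBINT y:{0<..}. (f (of_real x * w) * exp (of_real a * (of_real t - of_real x * w))) * (exp (- (\<kappa> x * of_real y)) * 1))"
    proof (intro set_lebesgue_integral_cong allI impI)
      fix y
      have "lam a c y * (of_real t - of_real x * w)
          = of_real a * (of_real t - of_real x * w) + - (\<kappa> x * of_real y)"
        unfolding expand \<kappa> by (simp add: algebra_simps)
      thus "g y x = (f (of_real x * w) * exp (of_real a * (of_real t - of_real x * w))) * (exp (- (\<kappa> x * of_real y)) * 1)"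
        unfolding g_def by (simp only: exp_add mult_ac mult_1_right mult_1)
    qed simp
    also have "\<dots> = f (of_real x * w) * exp (of_real a * (of_real t - of_real x * w)) * laplace (\<lambda>_. 1) (\<kappa> x)"
      unfolding laplace_def by simp
    finally have "of_real c * \<i> * (LBINT y:{0<..}. g y x)
        = f (of_real x * w) * exp (of_real a * (of_real t - of_real x * w)) * (of_real c * \<i> / \<kappa> x)"
      unfolding laplace_one[OF Re\<kappa>] by simp
    thus ?thesis unfolding ck h_def by simp
  qed
  have "I a t c = of_real c * \<i> * (LBINT y:{0<..}. LBINT x:{0<..}. g y x)"
    unfolding I_def inner_x by (simp add: mult_ac)
  also have "\<dots> = (LBINT x:{0<..}. of_real c * \<i> * (LBINT y:{0<..}. g y x))"
    unfolding fub by simp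
  finally show "I a t c = (LBINT x:{0<..}. w * h (of_real x * w))" unfolding inner_y .
  show "set_integrable lborel {0<..} (\<lambda>x. w * h (of_real x * w))"
  proof (rule set_integrable_exp_bound(1))
    have ne: "of_real x * w - of_real t \<noteq> 0" for x
    proof
      assume "of_real x * w - of_real t = 0"
      hence "of_real t - of_real x * w = 0" by simp
      hence "\<kappa> x = 0" unfolding \<kappa>_def by (simp only: mult_zero_right minus_zero)
      thus False using Re\<kappa>[of x] by simp
    qed
    thus "continuous_on {0<..} (\<lambda>x. w * h (of_real x * w))"
      unfolding h_def using cont_ray[OF c', folded w_def] by (intro continuous_intros) auto
    show "a * cos \<theta> - \<omega> > 0" using a by simp
    fix x :: real assume x: "x > 0"
    \<comment> \<open>The distance from \<open>t\<close> to the ray is at least t sin \<theta>: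
      after rotating the ray onto the real axis it is bounded below by an imaginary part.\<close>
    have "t * sin \<theta> = \<bar>Im (cis (c * \<theta>) * (of_real x * w - of_real t))\<bar>"
    proof -
      have "cis (c * \<theta>) * (of_real x * w - of_real t) = of_real x - cis (c * \<theta>) * of_real t"
        using w1 by (simp add: algebra_simps)
      thus ?thesis using c t trig_pos by auto
    qed
    also have "\<dots> \<le> cmod (cis (c * \<theta>) * (of_real x * w - of_real t))" by (rule abs_Im_le_cmod)
    finally have d: "t * sin \<theta> \<le> cmod (of_real x * w - of_real t)" by (simp add: norm_mult)
    have "cmod (w * h (of_real x * w)) = cmod (f (of_real x * w)) * exp (a * t - a * x * cos \<theta>) / cmod (of_real x * w - of_real t)"
      unfolding h_def norm_mult norm_divide norm_exp_eq_Re using Re_w by (simp add: w_def algebra_simps)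
    also have "\<dots> \<le> (M * exp (\<omega> * x)) * exp (a * t - a * x * cos \<theta>) / (t * sin \<theta>)"
      using bound_ray[OF c' x, folded w_def] d t trig_pos M by (intro frac_le mult_mono) auto
    also have "\<dots> = (M * exp (a * t) / (t * sin \<theta>)) * exp (- (a * cos \<theta> - \<omega>) * x)"
      by (simp add: algebra_simps exp_add exp_diff exp_minus field_simps)
    finally show "cmod (w * h (of_real x * w)) \<le> (M * exp (a * t) / (t * sin \<theta>)) * exp (- (a * cos \<theta> - \<omega>) * x)" .
  qed
qed

text \<open>The vertex \<open>q\<close> lies on the segment from \<open>cnj p\<close> to
  \<open>p\<close>, so the kite is the truncated sector with its far side cut in two. In this form
  \<open>kite_integral\<close> yields winding number 1 around \<open>t\<close>.\<close>

lemma Cauchy_kite: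
  assumes t: "t > 0" and L: "L * cos \<theta> > t" and k: "continuous_on \<Sigma> k" "k holomorphic_on interior \<Sigma>"
  defines "h \<equiv> \<lambda>z. k z / (z - of_real t)" and "p \<equiv> of_real L * cis \<theta>" and "q \<equiv> of_real (L * cos \<theta>)"
  shows "contour_integral (linepath 0 (cnj p)) h - contour_integral (linepath 0 p) h
     + contour_integral (linepath (cnj p) q) h + contour_integral (linepath q p) h = 2 * of_real pi * \<i> * k (of_real t)"
proof -
  have L0: "L > 0" using L t trig_pos by (smt (verit) mult_nonpos_nonneg)
  let ?\<gamma> = "linepath p 0 +++ linepath 0 (cnj p) +++ linepath (cnj p) q +++ linepath q p"
  have Imp: "Im p > 0" using L0 trig_pos by (simp add: p_def)
  have p\<Sigma>: "p \<in> \<Sigma>" "cnj p \<in> \<Sigma>" "q \<in> \<Sigma>" "0 \<in> \<Sigma>"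
    using L0 trig_pos unfolding p_def q_def by (auto simp: norm_mult mult_left_le)
  have seg: "closed_segment u v \<subseteq> \<Sigma>" if "u \<in> \<Sigma>" "v \<in> \<Sigma>" for u v
    using closed_segment_subset[OF that convex_\<Sigma>] .
  have nt: "of_real t \<notin> closed_segment u (of_real x)" "of_real t \<notin> closed_segment (of_real x) u"
    if "Im u \<noteq> 0" "x \<noteq> t" for u x
  proof -
    have "of_real t \<notin> closed_segment u (of_real x)"
    proof
      assume "of_real t \<in> closed_segment u (of_real x)"
      then obtain s where s: "of_real t = (1 - s) *\<^sub>R u + s *\<^sub>R of_real x" by (auto simp: in_segment)
      from arg_cong[OF s, of Im] have "s = 1" using that by simp
      thus False using s that by simp
    qed
    thus "of_real t \<notin> closed_segment u (of_real x)" "of_real t \<notin> closed_segment (of_real x) u"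
      by (auto simp: closed_segment_commute)
  qed
  have nts: "of_real t \<notin> closed_segment p 0" "of_real t \<notin> closed_segment 0 (cnj p)"
      "of_real t \<notin> closed_segment (cnj p) q" "of_real t \<notin> closed_segment q p"
    using nt[of p 0] nt[of "cnj p" 0] nt[of p "L * cos \<theta>"] nt[of "cnj p" "L * cos \<theta>"] Imp t L
    by (auto simp: q_def)
  have pi: "path_image ?\<gamma> \<subseteq> \<Sigma> - {of_real t}"
    using seg[OF p\<Sigma>(1,4)] seg[OF p\<Sigma>(4,2)] seg[OF p\<Sigma>(2,3)] seg[OF p\<Sigma>(3,1)] nts
    by (simp only: path_image_join path_image_linepath pathfinish_join pathstart_join
        pathfinish_linepath pathstart_linepath Un_subset_iff subset_Diff_insert) simp
  have vp: "valid_path ?\<gamma>" by (simp add: valid_path_join)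
  have tint: "of_real t \<in> interior \<Sigma>"
  proof (rule interiorI)
    show "open {z. cmod z * cos \<theta> < Re z}" by (intro open_Collect_less continuous_intros)
    have "t * cos \<theta> < t * 1"
      using t cos_monotone_0_pi[of 0 \<theta>] trig_pos \<theta> by (intro mult_strict_left_mono) auto
    thus "of_real t \<in> {z. cmod z * cos \<theta> < Re z}" using t by simp
  qed auto
  have "winding_number ?\<gamma> (of_real t) = 1 / (2 * pi * \<i>) * contour_integral ?\<gamma> (\<lambda>w. 1 / (w - of_real t))"
    by (rule winding_number_valid_path[OF vp]) (use pi in auto)
  moreover have "((\<lambda>w. 1 / (w - of_real t)) has_contour_integral contour_integral ?\<gamma> (\<lambda>w. 1 / (w - of_real t))) ?\<gamma>"
    by (intro has_contour_integral_integral contour_integrable_holomorphic_simple[where S = "- {of_real t}"] holomorphic_intros)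
       (use pi vp in auto)
  ultimately have wn: "winding_number ?\<gamma> (of_real t) = 1"
    using has_chain_integral_chain_integral4[of "\<lambda>w. 1 / (w - of_real t)" _ p 0 "cnj p" q p]
      kite_integral[of 0 t "L * cos \<theta>" p] t L Imp by (simp add: q_def)
  have "(h has_contour_integral (2 * pi * \<i> * winding_number ?\<gamma> (of_real t) * k (of_real t))) ?\<gamma>"
    unfolding h_def
  proof (rule Cauchy_integral_formula_weak[OF convex_\<Sigma>, of "{}"])
    show "k field_differentiable at x" if "x \<in> interior \<Sigma> - {}" for x
      using that k(2) by (auto intro: holomorphic_on_imp_differentiable_at)
  qed (use k tint vp pi in auto)
  from has_chain_integral_chain_integral4[OF this]
  have *: "contour_integral (linepath p 0) h + contour_integral (linepath 0 (cnj p)) h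
     + contour_integral (linepath (cnj p) q) h + contour_integral (linepath q p) h = 2 * of_real pi * \<i> * k (of_real t)"
    using wn by simp
  have "continuous_on (closed_segment p 0) h"
    unfolding h_def using nts(1) seg[OF p\<Sigma>(1,4)]
    by (intro continuous_intros continuous_on_subset[OF k(1)]) auto
  from contour_integral_reverse_linepath[OF this] show ?thesis using * by simp
qed

text \<open>By \<open>I_eq_ray\<close> both terms integrate the same Cauchy kernel, along the lower
  and the upper boundary ray. Their difference is the Cauchy integral of f(z) exp (a (t - z)) over
  the boundary of the sector; the far side disappears because a cos \<theta> > \<omega>.\<close>

theorem inversion:
  assumes a: "a * cos \<theta> > \<omega>" and t: "t > 0"
  shows "I a t 1 - I a t (-1) = 2 * of_real pi * \<i> * f (of_real t)"
proof -
  define k where "k z = f z * exp (of_real a * (of_real t - z))" for z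
  define h where "h z = k z / (z - of_real t)" for z
  have a0: "a > 0" using a \<omega> trig_pos by (smt (verit) mult_nonpos_nonneg)
  have k: "continuous_on \<Sigma> k" "k holomorphic_on interior \<Sigma>"
    unfolding k_def by (intro continuous_intros cont_f holomorphic_intros holo_f)+
  let ?ray = "\<lambda>L w. integral {0..L} (\<lambda>x. w * h (of_real x * w))"
  have lim: "((\<lambda>L. ?ray L (cis (- \<theta>))) \<longlongrightarrow> I a t 1) at_top" "((\<lambda>L. ?ray L (cis \<theta>)) \<longlongrightarrow> I a t (-1)) at_top"
    using tendsto_integral_half_line[OF I_eq_ray(2)[of 1 a t]] tendsto_integral_half_line[OF I_eq_ray(2)[of "-1" a t]]
      I_eq_ray(1)[of 1 a t] I_eq_ray(1)[of "-1" a t] a t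
    unfolding h_def k_def by simp_all
  have "((\<lambda>L. ?ray L (cis (- \<theta>)) - ?ray L (cis \<theta>)) \<longlongrightarrow> 2 * of_real pi * \<i> * f (of_real t)) at_top"
  proof (rule LIM_zero_cancel, rule Lim_null_comparison)
    let ?B = "\<lambda>L. M * exp (\<omega> * L) * exp (a * t - a * (L * cos \<theta>)) / (L * cos \<theta> - t)"
    have lim0: "((\<lambda>L. (M * exp (a * t) * 4) * (L * exp (- ((a * cos \<theta> - \<omega>) * L)) / (L * cos \<theta> - t))) \<longlongrightarrow> (M * exp (a * t) * 4) * 0) at_top"
      using a trig_pos by (intro tendsto_mult_left) real_asymp
    have "(M * exp (a * t) * 4) * (L * exp (- ((a * cos \<theta> - \<omega>) * L)) / (L * cos \<theta> - t)) = ?B L * (4 * L)" for L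
      by (simp add: algebra_simps exp_diff exp_add exp_minus field_simps)
    thus "((\<lambda>L. ?B L * (4 * L)) \<longlongrightarrow> 0) at_top"
      using lim0 by (simp only: mult_zero_right)
    show "\<forall>\<^sub>F L in at_top. cmod (?ray L (cis (- \<theta>)) - ?ray L (cis \<theta>) - 2 * of_real pi * \<i> * f (of_real t)) \<le> ?B L * (4 * L)"
      using eventually_gt_at_top[of "t / cos \<theta>"]
    proof eventually_elim
      fix L assume "t / cos \<theta> < L"
      hence L: "L * cos \<theta> > t" using trig_pos by (simp add: field_simps)
      hence L0: "L > 0" using t trig_pos by (smt (verit) mult_nonpos_nonneg)
      define p where "p = of_real L * cis \<theta>"
      define q :: complex where "q = of_real (L * cos \<theta>)"
      have cp: "cnj p = of_real L * cis (- \<theta>)" by (simp add: p_def cis_cnj)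
      have ray: "?ray L (cis (- \<theta>)) = contour_integral (linepath 0 (cnj p)) h" "?ray L (cis \<theta>) = contour_integral (linepath 0 p) h"
        unfolding cp unfolding p_def by (simp_all only: contour_integral_ray[OF L0])
      have qseg: "q \<in> closed_segment (cnj p) p"
        by (simp add: in_segment) (intro exI[of _ "1/2"], simp add: p_def q_def complex_eq_iff)
      have sub: "closed_segment (cnj p) q \<subseteq> closed_segment (cnj p) p" "closed_segment q p \<subseteq> closed_segment (cnj p) p"
        using qseg by (simp_all add: subset_closed_segment)
      have est: "cmod (h z) \<le> ?B L" and z\<Sigma>: "z \<in> \<Sigma>" and znt: "z \<noteq> of_real t" if "z \<in> closed_segment (cnj p) p" for z
      proof -
        have z: "cmod z \<le> L" "L * cos \<theta> \<le> Re z" "z \<in> \<Sigma>"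
          using third_side[of L z "- \<theta>" \<theta>] that L0 \<theta> unfolding cp unfolding p_def by auto
        show "z \<in> \<Sigma>" by (rule z(3))
        show "z \<noteq> of_real t" using z L by auto
        have "cmod (f z) \<le> M * exp (\<omega> * cmod z)" using bound_f z by simp
        also have "\<dots> \<le> M * exp (\<omega> * L)" using z \<omega> M by (intro mult_left_mono) (auto intro: mult_left_mono)
        finally have fz: "cmod (f z) \<le> M * exp (\<omega> * L)" .
        have "L * cos \<theta> - t \<le> Re (z - of_real t)" using z by simp
        also have "\<dots> \<le> cmod (z - of_real t)" by (rule complex_Re_le_cmod)
        finally have d: "L * cos \<theta> - t \<le> cmod (z - of_real t)" .
        have "a * (L * cos \<theta>) \<le> a * Re z" using z a0 by (intro mult_left_mono) auto
        hence "cmod (exp (of_real a * (of_real t - z))) \<le> exp (a * t - a * (L * cos \<theta>))"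
          by (simp add: algebra_simps)
        thus "cmod (h z) \<le> ?B L"
          unfolding h_def k_def norm_mult norm_divide using fz d L M by (intro frac_le mult_mono) auto
      qed
      have B0: "?B L \<ge> 0" using M L by simp
      have conth: "continuous_on (closed_segment (cnj p) p) h"
        unfolding h_def using z\<Sigma> znt by (intro continuous_intros continuous_on_subset[OF k(1)]) auto
      have np: "cmod p = L" using L0 by (simp add: p_def norm_mult)
      have nq: "cmod q \<le> L" using L0 trig_pos unfolding q_def norm_of_real by (simp add: abs_mult mult_left_le)
      have b1: "cmod (contour_integral (linepath (cnj p) q) h) \<le> ?B L * cmod (q - cnj p)"
        by (rule contour_integral_bound_linepath)
          (use B0 est sub conth in \<open>auto intro!: contour_integrable_continuous_linepath intro: continuous_on_subset\<close>)
      have b2: "cmod (contour_integral (linepath q p) h) \<le> ?B L * cmod (p - q)"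
        by (rule contour_integral_bound_linepath)
          (use B0 est sub conth in \<open>auto intro!: contour_integrable_continuous_linepath intro: continuous_on_subset\<close>)
      have "cmod (q - cnj p) + cmod (p - q) \<le> 4 * L"
        using norm_triangle_ineq4[of q "cnj p"] norm_triangle_ineq4[of p q] np nq by simp
      hence b3: "?B L * cmod (q - cnj p) + ?B L * cmod (p - q) \<le> ?B L * (4 * L)"
        using B0 by (simp only: distrib_left[symmetric] mult_left_mono)
      have "?ray L (cis (- \<theta>)) - ?ray L (cis \<theta>) - 2 * of_real pi * \<i> * f (of_real t)
          = - (contour_integral (linepath (cnj p) q) h + contour_integral (linepath q p) h)"
        using Cauchy_kite[OF t L k] unfolding ray p_def[symmetric] q_def[symmetric] h_def[symmetric]
        by (simp add: k_def algebra_simps)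
      thus "cmod (?ray L (cis (- \<theta>)) - ?ray L (cis \<theta>) - 2 * of_real pi * \<i> * f (of_real t)) \<le> ?B L * (4 * L)"
        using b1 b2 b3 norm_triangle_ineq[of "contour_integral (linepath (cnj p) q) h" "contour_integral (linepath q p) h"]
        by (simp only: norm_minus_cancel)
    qed
  qed
  with tendsto_diff[OF lim] show ?thesis
    using tendsto_unique[OF trivial_limit_at_top_linorder] by blast
qed

end

section \<open>Contours in the punctured right half-plane and the contribution of the singularity at
  0\<close>

abbreviation rhp :: "complex set" where "rhp \<equiv> {z. 0 \<le> Re z} - {0}"

text \<open>The punctured closed half-plane is not convex. For s = 1 and s = -1 one gets two convex
  pieces that avoid 0 and both contain the positive reals, and Cauchy's theorem for triangles is
  applied in each piece.\<close>

definition half_plane :: "real \<Rightarrow> complex set" where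
  "half_plane s = {z. 0 \<le> Re z \<and> 0 < Re z + s * Im z}"

lemma convex_half_plane: "convex (half_plane s)"
proof (rule convexI)
  fix x y :: complex and u v :: real
  assume *: "x \<in> half_plane s" "y \<in> half_plane s" "0 \<le> u" "0 \<le> v" "u + v = 1"
  have "0 < u * (Re x + s * Im x) + v * (Re y + s * Im y)"
  proof (cases "u = 0")
    case True thus ?thesis using * by (simp add: half_plane_def)
  next
    case False thus ?thesis
      by (intro add_pos_nonneg[OF mult_pos_pos mult_nonneg_nonneg]) (use * in \<open>auto simp: half_plane_def\<close>)
  qed
  thus "u *\<^sub>R x + v *\<^sub>R y \<in> half_plane s" using * by (simp add: half_plane_def algebra_simps)
qed

lemma half_plane_subset: "half_plane s \<subseteq> rhp"
  by (auto simp: half_plane_def)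

lemma interior_Re_nonneg: "interior {z. 0 \<le> Re z} \<subseteq> {z. 0 < Re z}"
proof
  fix z assume "z \<in> interior {z. 0 \<le> Re z}"
  then obtain e where e: "e > 0" "ball z e \<subseteq> {z. 0 \<le> Re z}" by (meson mem_interior)
  have "z - of_real (e / 2) \<in> ball z e" using e by (simp add: dist_norm)
  hence "0 \<le> Re (z - of_real (e / 2))" using e by blast
  thus "z \<in> {z. 0 < Re z}" using e by simp
qed

lemma rhp_triangle:
  assumes cont: "continuous_on rhp F" and holo: "F holomorphic_on {z. 0 < Re z}"
    and "u \<in> half_plane s" "v \<in> half_plane s" "w \<in> half_plane s"
  shows "contour_integral (linepath u v) F + contour_integral (linepath v w) F + contour_integral (linepath w u) F = 0"
proof -
  have sub: "convex hull {u, v, w} \<subseteq> half_plane s"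
    using assms(3-5) by (intro hull_minimal convex_half_plane) auto
  hence "interior (convex hull {u, v, w}) \<subseteq> interior {z. 0 \<le> Re z}"
    using half_plane_subset[of s] by (intro interior_mono) auto
  hence "F holomorphic_on interior (convex hull {u, v, w})"
    using interior_Re_nonneg by (intro holomorphic_on_subset[OF holo]) auto
  moreover have "continuous_on (convex hull {u, v, w}) F"
    using sub half_plane_subset[of s] by (intro continuous_on_subset[OF cont]) auto
  ultimately show ?thesis
    by (intro has_chain_integral_chain_integral3 Cauchy_theorem_triangle_interior)
qed

lemma rhp_segment:
  assumes "u \<in> half_plane s" "v \<in> half_plane s"
  shows "closed_segment u v \<subseteq> rhp"
  using closed_segment_subset[OF assms convex_half_plane] half_plane_subset by blast

text \<open>A detour through \<open>a\<close> > 0 in place of the segment from - i N to i N, which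
  would run into the singularity at 0.\<close>

definition hat :: "(complex \<Rightarrow> complex) \<Rightarrow> real \<Rightarrow> real \<Rightarrow> complex" where
  "hat F N a = contour_integral (linepath (- (\<i> * of_real N)) (of_real a)) F
             + contour_integral (linepath (of_real a) (\<i> * of_real N)) F"

lemma hat_points [simp]:
  "N > 0 \<Longrightarrow> - (\<i> * of_real N) \<in> half_plane (-1)" "N > 0 \<Longrightarrow> \<i> * of_real N \<in> half_plane 1"
  "a > 0 \<Longrightarrow> of_real a \<in> half_plane s"
  by (auto simp: half_plane_def)

text \<open>Moving the apex sweeps out two triangles, one in each convex piece, so neither meets
  0.\<close>

lemma hat_apex:
  assumes cont: "continuous_on rhp F" and holo: "F holomorphic_on {z. 0 < Re z}"
    and pos: "N > 0" "a > 0" "b > 0"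
  shows "hat F N a = hat F N b"
proof -
  have rev: "contour_integral (linepath u v) F = - contour_integral (linepath v u) F"
    if "u \<in> half_plane s" "v \<in> half_plane s" for u v s
    by (rule contour_integral_reverse_linepath[OF continuous_on_subset[OF cont rhp_segment[OF that]]])
  have "contour_integral (linepath (- (\<i> * of_real N)) (of_real a)) F + contour_integral (linepath (of_real a) (of_real b)) F
      + contour_integral (linepath (of_real b) (- (\<i> * of_real N))) F = 0"
    by (rule rhp_triangle[OF cont holo, where s = "-1"]) (use pos in auto)
  moreover have "contour_integral (linepath (of_real a) (\<i> * of_real N)) F + contour_integral (linepath (\<i> * of_real N) (of_real b)) F
      + contour_integral (linepath (of_real b) (of_real a)) F = 0"
    by (rule rhp_triangle[OF cont holo, where s = "1"]) (use pos in auto)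
  ultimately show ?thesis
    using rev[of "of_real b" "-1" "- (\<i> * of_real N)"] rev[of "\<i> * of_real N" 1 "of_real b"] rev[of "of_real b" 1 "of_real a"] pos
    unfolding hat_def by (simp add: algebra_simps add_eq_0_iff)
qed

lemma hat_split:
  assumes cont: "continuous_on rhp F" and holo: "F holomorphic_on {z. 0 < Re z}"
    and pos: "N > 0" "\<eta> > 0" "a > 0"
  shows "hat F N a = contour_integral (linepath (- (\<i> * of_real N)) (- (\<i> * of_real \<eta>))) F + hat F \<eta> a
     + contour_integral (linepath (\<i> * of_real \<eta>) (\<i> * of_real N)) F"
proof -
  have rev: "contour_integral (linepath u v) F = - contour_integral (linepath v u) F"
    if "u \<in> half_plane s" "v \<in> half_plane s" for u v s
    by (rule contour_integral_reverse_linepath[OF continuous_on_subset[OF cont rhp_segment[OF that]]])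
  have "contour_integral (linepath (- (\<i> * of_real N)) (- (\<i> * of_real \<eta>))) F + contour_integral (linepath (- (\<i> * of_real \<eta>)) (of_real a)) F
      + contour_integral (linepath (of_real a) (- (\<i> * of_real N))) F = 0"
    by (rule rhp_triangle[OF cont holo, where s = "-1"]) (use pos in auto)
  moreover have "contour_integral (linepath (of_real a) (\<i> * of_real \<eta>)) F + contour_integral (linepath (\<i> * of_real \<eta>) (\<i> * of_real N)) F
      + contour_integral (linepath (\<i> * of_real N) (of_real a)) F = 0"
    by (rule rhp_triangle[OF cont holo, where s = "1"]) (use pos in auto)
  ultimately show ?thesis
    using rev[of "of_real a" "-1" "- (\<i> * of_real N)"] rev[of "\<i> * of_real N" 1 "of_real a"] pos
    unfolding hat_def by (simp add: algebra_simps add_eq_0_iff)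
qed

lemma imaginary_segment_bound:
  assumes cont: "continuous_on rhp F" and \<eta>: "0 < \<eta>" "\<eta> \<le> N"
    and bound: "\<And>s. \<eta> \<le> \<bar>s\<bar> \<Longrightarrow> \<bar>s\<bar> \<le> N \<Longrightarrow> cmod (F (Complex 0 s)) \<le> \<phi> \<bar>s\<bar>"
    and \<phi>: "(\<phi> has_integral K) {\<eta>..N}"
  shows "cmod (contour_integral (linepath (\<i> * of_real \<eta>) (\<i> * of_real N)) F) \<le> K"
    and "cmod (contour_integral (linepath (- (\<i> * of_real N)) (- (\<i> * of_real \<eta>))) F) \<le> K"
proof -
  have K: "K \<ge> 0"
  proof (rule has_integral_nonneg[OF \<phi>])
    fix x assume "x \<in> {\<eta>..N}"
    thus "0 \<le> \<phi> x" using order_trans[OF norm_ge_zero bound[of x]] \<eta> by simp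
  qed
  have int: "(\<lambda>x. F (Complex 0 x)) integrable_on {u..v}" if "\<And>x. x \<in> {u..v} \<Longrightarrow> x \<noteq> 0" for u v
  proof (intro integrable_continuous_interval continuous_on_compose2[OF cont])
    show "continuous_on {u..v} (Complex 0)" unfolding Complex_eq by (intro continuous_intros)
    show "Complex 0 ` {u..v} \<subseteq> rhp" using that by (auto simp: complex_eq_iff)
  qed
  have "cmod (integral {\<eta>..N} (\<lambda>x. F (Complex 0 x))) \<le> integral {\<eta>..N} \<phi>"
  proof (rule integral_norm_bound_integral)
    show "(\<lambda>x. F (Complex 0 x)) integrable_on {\<eta>..N}" using \<eta> by (intro int) auto
    show "\<phi> integrable_on {\<eta>..N}" using \<phi> by blast
    show "cmod (F (Complex 0 x)) \<le> \<phi> x" if "x \<in> {\<eta>..N}" for x using bound[of x] that \<eta> by simp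
  qed
  hence 1: "cmod (integral {\<eta>..N} (\<lambda>x. F (Complex 0 x))) \<le> K" using \<phi> by (simp add: integral_unique)
  have "integral {-N..-\<eta>} (\<lambda>x. F (Complex 0 x)) = integral {\<eta>..N} (\<lambda>x. F (Complex 0 (- x)))"
    using Henstock_Kurzweil_Integration.integral_reflect_real[of N \<eta> "\<lambda>x. F (Complex 0 (- x))"] by simp
  also have "cmod \<dots> \<le> integral {\<eta>..N} \<phi>"
  proof (rule integral_norm_bound_integral)
    show "(\<lambda>x. F (Complex 0 (- x))) integrable_on {\<eta>..N}"
      using Henstock_Kurzweil_Integration.integrable_reflect_real[where f = "\<lambda>x. F (Complex 0 (- x))" and a = \<eta> and b = N]
        int[of "-N" "-\<eta>"] \<eta> by simp
    show "\<phi> integrable_on {\<eta>..N}" using \<phi> by blast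
    show "cmod (F (Complex 0 (- x))) \<le> \<phi> x" if "x \<in> {\<eta>..N}" for x using bound[of "- x"] that \<eta> by simp
  qed
  finally have 2: "cmod (integral {-N..-\<eta>} (\<lambda>x. F (Complex 0 x))) \<le> K" using \<phi> by (simp add: integral_unique)
  show "cmod (contour_integral (linepath (\<i> * of_real \<eta>) (\<i> * of_real N)) F) \<le> K"
  proof (cases "\<eta> = N")
    case False
    thus ?thesis using 1 \<eta> by (subst contour_integral_linepath_same_Re[of _ 0 _ \<eta> N]) (auto simp: norm_mult)
  qed (use K in simp)
  show "cmod (contour_integral (linepath (- (\<i> * of_real N)) (- (\<i> * of_real \<eta>))) F) \<le> K"
  proof (cases "\<eta> = N")
    case False
    thus ?thesis using 2 \<eta> by (subst contour_integral_linepath_same_Re[of _ 0 _ "-N" "-\<eta>"]) (auto simp: norm_mult)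
  qed (use K in simp)
qed

lemma has_integral_powr:
  fixes b :: real
  assumes "b \<noteq> -1" "0 < \<eta>" "\<eta> \<le> N"
  shows "((\<lambda>x. x powr b) has_integral (N powr (b + 1) / (b + 1) - \<eta> powr (b + 1) / (b + 1))) {\<eta>..N}"
proof (rule fundamental_theorem_of_calculus[OF assms(3)])
  fix x assume "x \<in> {\<eta>..N}"
  hence x: "x > 0" using assms by auto
  have "((\<lambda>x. x powr (b + 1) / (b + 1)) has_real_derivative x powr b) (at x)"
    using DERIV_cdivide[OF has_real_derivative_powr[OF x, of "b + 1"], of "b + 1"] assms(1) by simp
  thus "((\<lambda>x. x powr (b + 1) / (b + 1)) has_vector_derivative x powr b) (at x within {\<eta>..N})"
    by (simp add: has_real_derivative_iff_has_vector_derivative has_vector_derivative_at_within)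
qed

text \<open>For b > -1 the singularity |z|^b is integrable, so the hat can be pressed onto the
  imaginary axis, where |exp (z t)| = 1. The remaining small hat of size \<eta> contributes
  O(\<eta>^(b + 1)), with a constant that may depend on t since \<eta> tends to 0 first.\<close>

lemma hat_bound_shrink:
  assumes cont: "continuous_on rhp q" and holo: "q holomorphic_on {z. 0 < Re z}"
    and pos: "0 < \<delta>" "\<delta> \<le> 1" "a > 0" "t \<ge> 0" and b: "b > -1" and C: "C \<ge> 0"
    and bound: "\<And>z. z \<in> rhp \<Longrightarrow> cmod z \<le> 1 \<Longrightarrow> cmod (q z) \<le> C * cmod z powr b"
  shows "cmod (hat (\<lambda>z. exp (z * of_real t) * q z) \<delta> a) \<le> 2 * C * (\<delta> powr (b + 1) / (b + 1))"
proof -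
  let ?F = "\<lambda>z. exp (z * of_real t) * q z"
  have contF: "continuous_on rhp ?F" by (intro continuous_intros cont)
  have holoF: "?F holomorphic_on {z. 0 < Re z}" by (intro holomorphic_intros holo)
  have main: "cmod (hat ?F \<delta> a) \<le> 2 * C * (\<delta> powr (b + 1) / (b + 1)) + 8 * C * exp t * \<eta> powr (b + 1)"
    if \<eta>: "0 < \<eta>" "\<eta> < \<delta>" for \<eta>
  proof -
    let ?K = "C * (\<delta> powr (b + 1) / (b + 1) - \<eta> powr (b + 1) / (b + 1))"
    have hi: "((\<lambda>s. C * s powr b) has_integral ?K) {\<eta>..\<delta>}"
      by (intro has_integral_mult_right has_integral_powr) (use b \<eta> in auto)
    have bF: "cmod (?F (Complex 0 s)) \<le> C * \<bar>s\<bar> powr b" if "\<eta> \<le> \<bar>s\<bar>" "\<bar>s\<bar> \<le> \<delta>" for s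
    proof -
      have "cmod (Complex 0 s) = \<bar>s\<bar>" by (simp add: complex_norm)
      thus ?thesis using bound[of "Complex 0 s"] that \<eta> pos
        by (auto simp: norm_mult complex_eq_iff)
    qed
    note seg = imaginary_segment_bound[OF contF \<eta>(1) less_imp_le[OF \<eta>(2)] bF hi]
    have K: "?K \<le> C * (\<delta> powr (b + 1) / (b + 1))"
      using C b by (intro mult_left_mono) auto
    have tri: "cmod (contour_integral (linepath u v) ?F) \<le> (exp t * (C * (2 * \<eta> powr b))) * cmod (v - u)"
      if uv: "(u = - (\<i> * of_real \<eta>) \<and> v = of_real \<eta>) \<or> (u = of_real \<eta> \<and> v = \<i> * of_real \<eta>)" for u v
    proof -
      have "u \<in> half_plane (-1) \<and> v \<in> half_plane (-1) \<or> u \<in> half_plane 1 \<and> v \<in> half_plane 1"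
        using uv \<eta> by auto
      then obtain s where s: "u \<in> half_plane s" "v \<in> half_plane s" by blast
      \<comment> \<open>Both sides of the small hat stay between the radii \<eta> / 2 and \<eta>, so
        |z|^b is comparable with \<eta>^b for either sign of b.\<close>
      have zz: "\<eta> / 2 \<le> cmod z \<and> cmod z \<le> \<eta> \<and> Re z \<le> \<eta>" if zs: "z \<in> closed_segment u v" for z
      proof -
        obtain x where x: "0 \<le> x" "x \<le> 1" "z = (1 - x) *\<^sub>R u + x *\<^sub>R v"
          using zs unfolding in_segment by blast
        have nu: "cmod u = \<eta>" "cmod v = \<eta>" using uv \<eta> by (auto simp: norm_mult)
        have "cmod z \<le> (1 - x) * cmod u + x * cmod v"
          using norm_triangle_ineq[of "(1 - x) *\<^sub>R u" "x *\<^sub>R v"] x by simp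
        hence "cmod z \<le> \<eta>" by (simp add: nu algebra_simps)
        moreover have "\<eta> / 2 \<le> cmod z"
        proof -
          have "(Re z = x * \<eta> \<and> Im z = - ((1 - x) * \<eta>)) \<or> (Re z = (1 - x) * \<eta> \<and> Im z = x * \<eta>)"
          proof -
            have "Re z = (1 - x) * Re u + x * Re v" "Im z = (1 - x) * Im u + x * Im v" using x(3) by simp_all
            thus ?thesis using uv by (elim disjE conjE) simp_all
          qed
          moreover have "\<eta> / 2 \<le> x * \<eta> \<or> \<eta> / 2 \<le> (1 - x) * \<eta>"
          proof (cases "1 / 2 \<le> x")
            case True
            from mult_right_mono[OF this, of \<eta>] show ?thesis using \<eta> by simp
          next
            case False
            hence "1 / 2 \<le> 1 - x" by simp
            from mult_right_mono[OF this, of \<eta>] show ?thesis using \<eta> by simp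
          qed
          ultimately show ?thesis
            using abs_Re_le_cmod[of z] abs_Im_le_cmod[of z] by linarith
        qed
        moreover have "Re z \<le> cmod z" by (rule complex_Re_le_cmod)
        ultimately show ?thesis by linarith
      qed
      show ?thesis
      proof (rule contour_integral_bound_linepath)
        show "?F contour_integrable_on linepath u v"
          by (intro contour_integrable_continuous_linepath continuous_on_subset[OF contF rhp_segment[OF s]])
        show "0 \<le> exp t * (C * (2 * \<eta> powr b))" using C by simp
        fix z assume z: "z \<in> closed_segment u v"
        have zr: "z \<in> rhp" using rhp_segment[OF s] z by blast
        have "cmod z powr b \<le> 2 * \<eta> powr b"
        proof (cases "b \<ge> 0")
          case True
          hence "cmod z powr b \<le> \<eta> powr b" using zz[OF z] by (intro powr_mono2) auto
          thus ?thesis using powr_ge_zero[of \<eta> b] by linarith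
        next
          case False
          hence "cmod z powr b \<le> (\<eta> / 2) powr b" using zz[OF z] \<eta> by (intro powr_mono2') auto
          also have "\<dots> = 2 powr (- b) * \<eta> powr b" using \<eta> by (simp add: powr_divide powr_minus field_simps)
          also have "\<dots> \<le> 2 powr 1 * \<eta> powr b" using b False by (intro mult_right_mono powr_mono) auto
          finally show ?thesis by simp
        qed
        hence "cmod (q z) \<le> C * (2 * \<eta> powr b)"
          using bound[OF zr] zz[OF z] \<eta> pos C by (meson less_le_not_le mult_left_mono order.trans)
        moreover have "Re z * t \<le> 1 * t" using zz[OF z] \<eta> pos by (intro mult_right_mono) auto
        ultimately show "cmod (?F z) \<le> exp t * (C * (2 * \<eta> powr b))"
          unfolding norm_mult by (intro mult_mono) auto
      qed
    qed
    have len: "cmod (of_real \<eta> - - (\<i> * of_real \<eta>)) \<le> 2 * \<eta>" "cmod (\<i> * of_real \<eta> - of_real \<eta>) \<le> 2 * \<eta>"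
      using norm_triangle_ineq4[of "of_real \<eta>" "- (\<i> * of_real \<eta>)"] norm_triangle_ineq4[of "\<i> * of_real \<eta>" "of_real \<eta>"] \<eta>
      by (auto simp: norm_mult)
    have E: "exp t * (C * (2 * \<eta> powr b)) * (2 * \<eta>) = 4 * C * exp t * \<eta> powr (b + 1)"
      using \<eta> by (simp add: powr_add)
    have c0: "exp t * (C * (2 * \<eta> powr b)) \<ge> 0" using C by simp
    have t1: "cmod (contour_integral (linepath (- (\<i> * of_real \<eta>)) (of_real \<eta>)) ?F) \<le> 4 * C * exp t * \<eta> powr (b + 1)"
      using order_trans[OF tri mult_left_mono[OF len(1) c0]] unfolding E by blast
    have t2: "cmod (contour_integral (linepath (of_real \<eta>) (\<i> * of_real \<eta>)) ?F) \<le> 4 * C * exp t * \<eta> powr (b + 1)"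
      using order_trans[OF tri mult_left_mono[OF len(2) c0]] unfolding E by blast
    have heq: "hat ?F \<delta> a = contour_integral (linepath (- (\<i> * of_real \<delta>)) (- (\<i> * of_real \<eta>))) ?F + hat ?F \<eta> \<eta>
     + contour_integral (linepath (\<i> * of_real \<eta>) (\<i> * of_real \<delta>)) ?F"
      using hat_split[OF contF holoF pos(1) \<eta>(1) pos(3)] hat_apex[OF contF holoF \<eta>(1) pos(3) \<eta>(1)] by simp
    have "cmod (hat ?F \<eta> \<eta>) \<le> 8 * C * exp t * \<eta> powr (b + 1)"
      using norm_triangle_ineq[of "contour_integral (linepath (- (\<i> * of_real \<eta>)) (of_real \<eta>)) ?F"
          "contour_integral (linepath (of_real \<eta>) (\<i> * of_real \<eta>)) ?F"] t1 t2
      unfolding hat_def by linarith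
    thus ?thesis
      unfolding heq using seg K norm_triangle_ineq[of "contour_integral (linepath (- (\<i> * of_real \<delta>)) (- (\<i> * of_real \<eta>))) ?F + hat ?F \<eta> \<eta>"
          "contour_integral (linepath (\<i> * of_real \<eta>) (\<i> * of_real \<delta>)) ?F"]
        norm_triangle_ineq[of "contour_integral (linepath (- (\<i> * of_real \<delta>)) (- (\<i> * of_real \<eta>))) ?F" "hat ?F \<eta> \<eta>"]
      by linarith
  qed
  have "((\<lambda>\<eta>. \<eta> powr (b + 1)) \<longlongrightarrow> 0) (at_right 0)"
    using b by real_asymp
  from tendsto_add[OF tendsto_const tendsto_mult_left[OF this]]
  have lim: "((\<lambda>\<eta>. 2 * C * (\<delta> powr (b + 1) / (b + 1)) + 8 * C * exp t * \<eta> powr (b + 1))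
      \<longlongrightarrow> 2 * C * (\<delta> powr (b + 1) / (b + 1)) + 8 * C * exp t * 0) (at_right 0)" .
  have "\<forall>\<^sub>F \<eta> in at_right 0. cmod (hat ?F \<delta> a) \<le> 2 * C * (\<delta> powr (b + 1) / (b + 1)) + 8 * C * exp t * \<eta> powr (b + 1)"
    using eventually_at_right_real[OF pos(1)]
  proof eventually_elim
    case (elim \<eta>)
    thus ?case by (intro main) auto
  qed
  from tendsto_lowerbound[OF lim this] show ?thesis by simp
qed

text \<open>The threshold \<delta> = t^(-1 / \<alpha>) balances two estimates: outside, the bound on
  \<open>rm\<close> integrates to \<delta>^(- \<alpha> \<gamma>) = t^\<gamma>; inside, integration
  by parts costs a factor t against \<delta>^(\<alpha> (1 - \<gamma>)) = t^(\<gamma> - 1). Splitting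
  off \<open>p\<close> matters, as \<open>rn\<close> itself need not obey the bound for
  \<open>rn - p\<close> near 0.\<close>

lemma low_frequency:
  fixes rn rm p p1 :: "complex \<Rightarrow> complex"
  assumes \<alpha>: "\<alpha> \<ge> 1" and \<gamma>: "0 < \<gamma>" "\<gamma> < 1" and t: "t \<ge> 1" and N: "N \<ge> 1" and a: "a > 0" and C: "C \<ge> 0"
    and der: "\<And>z. z \<in> rhp \<Longrightarrow> (rn has_field_derivative - rm z) (at z within rhp)"
    and cont: "continuous_on rhp rm" and holo: "rm holomorphic_on {z. 0 < Re z}"
    and p: "\<And>z. (p has_field_derivative p1 z) (at z)" and p1: "p1 holomorphic_on UNIV"
    and p1_bound: "\<And>z. cmod z \<le> 1 \<Longrightarrow> cmod (p1 z) \<le> C"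
    and rm_bound: "\<And>z. z \<in> rhp \<Longrightarrow> cmod (rm z) \<le> C * (cmod z powr (- 1 - \<alpha> * \<gamma>) + 1)"
    and q_bound: "\<And>z. z \<in> rhp \<Longrightarrow> cmod z \<le> 1 \<Longrightarrow> cmod (rn z - p z) \<le> C * cmod z powr (\<alpha> * (1 - \<gamma>) - 1)"
  shows "cmod (hat (\<lambda>z. exp (z * of_real t) * rm z) N a)
    \<le> C * (2 / (\<alpha> * \<gamma>) + 2 * N + 4 + 2 / (\<alpha> * (1 - \<gamma>))) * t powr \<gamma>"
proof -
  define \<delta> where "\<delta> = t powr (- 1 / \<alpha>)"
  have \<delta>: "0 < \<delta>" "\<delta> \<le> 1" using t \<alpha> powr_mono[of "-1/\<alpha>" 0 t] by (auto simp: \<delta>_def)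
  have \<delta>_powr: "\<delta> powr x = t powr (- x / \<alpha>)" for x by (simp add: \<delta>_def powr_powr)
  have t\<gamma>: "1 \<le> t powr \<gamma>" using t \<gamma> powr_mono[of 0 \<gamma> t] by simp
  define q where "q z = rn z - p z" for z
  define q1 where "q1 z = - rm z - p1 z" for z
  let ?e = "\<lambda>z. exp (z * of_real t)"
  have q_der: "(q has_field_derivative q1 z) (at z within rhp)" if "z \<in> rhp" for z
    unfolding q_def q1_def using der[OF that] has_field_derivative_at_within[OF p] by (intro DERIV_diff)
  have cont_p1: "continuous_on S p1" for S
    using holomorphic_on_imp_continuous_on[OF p1] continuous_on_subset by blast
  have holo_p1: "p1 holomorphic_on S" for S using holomorphic_on_subset[OF p1] by blast
  have cont_q: "continuous_on rhp q" using q_der by (rule DERIV_continuous_on)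
  have cont_q1: "continuous_on rhp q1" unfolding q1_def by (intro continuous_intros cont cont_p1)
  have holo_q: "q holomorphic_on {z. 0 < Re z}"
    unfolding holomorphic_on_def field_differentiable_def
  proof
    fix z assume "z \<in> {z. 0 < Re z}"
    hence "(q has_field_derivative q1 z) (at z within {z. 0 < Re z})"
      by (intro DERIV_subset[OF q_der]) auto
    thus "\<exists>f'. (q has_field_derivative f') (at z within {z. 0 < Re z})" by blast
  qed
  have holo_q1: "q1 holomorphic_on {z. 0 < Re z}" unfolding q1_def by (intro holomorphic_intros holo holo_p1)
  have hat_add: "hat (\<lambda>z. F z + G z) \<delta> a = hat F \<delta> a + hat G \<delta> a"
    if "continuous_on rhp F" "continuous_on rhp G" for F G
  proof -
    have "F contour_integrable_on linepath u v \<and> G contour_integrable_on linepath u v"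
      if "u \<in> half_plane s" "v \<in> half_plane s" for u v s
      using rhp_segment[OF that] \<open>continuous_on rhp F\<close> \<open>continuous_on rhp G\<close>
      by (meson contour_integrable_continuous_linepath continuous_on_subset)
    from this[of "- (\<i> * of_real \<delta>)" "-1" "of_real a"] this[of "of_real a" 1 "\<i> * of_real \<delta>"]
    show ?thesis using a \<delta> unfolding hat_def by (simp add: contour_integral_add)
  qed
  have hat_prim: "hat F' \<delta> a = F (\<i> * of_real \<delta>) - F (- (\<i> * of_real \<delta>))"
    if d: "\<And>z. z \<in> rhp \<Longrightarrow> (F has_field_derivative F' z) (at z within rhp)" for F F'
  proof -
    have "contour_integral (linepath u v) F' = F v - F u" if "u \<in> half_plane s" "v \<in> half_plane s" for u v s
      using contour_integral_unique[OF contour_integral_primitive[of rhp F F' "linepath u v"]] d rhp_segment[OF that] by simp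
    from this[of "- (\<i> * of_real \<delta>)" "-1" "of_real a"] this[of "of_real a" 1 "\<i> * of_real \<delta>"]
    show ?thesis using a \<delta> unfolding hat_def by simp
  qed
  have h1: "hat (\<lambda>z. ?e z * q1 z + of_real t * (?e z * q z)) \<delta> a
      = ?e (\<i> * of_real \<delta>) * q (\<i> * of_real \<delta>) - ?e (- (\<i> * of_real \<delta>)) * q (- (\<i> * of_real \<delta>))"
    by (rule hat_prim) (auto intro!: derivative_eq_intros q_der)
  have h2: "hat (\<lambda>z. ?e z * q1 z + of_real t * (?e z * q z)) \<delta> a
      = hat (\<lambda>z. ?e z * q1 z) \<delta> a + hat (\<lambda>z. of_real t * (?e z * q z)) \<delta> a"
    by (intro hat_add continuous_intros cont_q cont_q1)
  have h3: "hat (\<lambda>z. of_real t * (?e z * q z)) \<delta> a = of_real t * hat (\<lambda>z. ?e z * q z) \<delta> a"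
  proof -
    have c: "continuous_on rhp (\<lambda>z. ?e z * q z)" by (intro continuous_intros cont_q)
    have "(\<lambda>z. ?e z * q z) contour_integrable_on linepath u v"
      if "u \<in> half_plane s" "v \<in> half_plane s" for u v s
      using rhp_segment[OF that] c by (meson contour_integrable_continuous_linepath continuous_on_subset)
    from this[of "- (\<i> * of_real \<delta>)" "-1" "of_real a"] this[of "of_real a" 1 "\<i> * of_real \<delta>"]
    show ?thesis using a \<delta> unfolding hat_def by (simp add: contour_integral_lmul distrib_left)
  qed
  have h4: "hat (\<lambda>z. ?e z * rm z) \<delta> a + hat (\<lambda>z. ?e z * q1 z) \<delta> a = hat (\<lambda>z. - (?e z * p1 z)) \<delta> a"
  proof -
    have "hat (\<lambda>z. ?e z * rm z) \<delta> a + hat (\<lambda>z. ?e z * q1 z) \<delta> a = hat (\<lambda>z. ?e z * rm z + ?e z * q1 z) \<delta> a"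
      by (intro hat_add[symmetric] continuous_intros cont cont_q1)
    thus ?thesis by (simp add: q1_def algebra_simps)
  qed
  have "hat (\<lambda>z. ?e z * q1 z) \<delta> a
      = (?e (\<i> * of_real \<delta>) * q (\<i> * of_real \<delta>) - ?e (- (\<i> * of_real \<delta>)) * q (- (\<i> * of_real \<delta>)))
      - of_real t * hat (\<lambda>z. ?e z * q z) \<delta> a"
    unfolding eq_diff_eq h1[symmetric] h2 h3 ..
  \<comment> \<open>Integration by parts on the small hat, with \<open>rm\<close> = -
    \<open>q1\<close> - \<open>p1\<close> and \<open>q1\<close> the derivative of
    \<open>q\<close>.\<close>
  hence low: "hat (\<lambda>z. ?e z * rm z) \<delta> a = hat (\<lambda>z. - (?e z * p1 z)) \<delta> a
      - (?e (\<i> * of_real \<delta>) * q (\<i> * of_real \<delta>) - ?e (- (\<i> * of_real \<delta>)) * q (- (\<i> * of_real \<delta>)))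
      + of_real t * hat (\<lambda>z. ?e z * q z) \<delta> a"
    using h4 by (simp only: eq_diff_eq[symmetric] diff_diff_eq2 add_diff_eq) (simp add: algebra_simps)
  \<comment> \<open>\<open>p1\<close> is entire, so here the hat may be replaced by the straight
    segment through 0.\<close>
  have b1: "cmod (hat (\<lambda>z. - (?e z * p1 z)) \<delta> a) \<le> 2 * C"
  proof -
    let ?F = "\<lambda>z. - (?e z * p1 z)"
    have h: "?F holomorphic_on convex hull {- (\<i> * of_real \<delta>), of_real a, \<i> * of_real \<delta>}"
      by (intro holomorphic_intros holo_p1)
    have "hat ?F \<delta> a + contour_integral (linepath (\<i> * of_real \<delta>) (- (\<i> * of_real \<delta>))) ?F = 0"
      unfolding hat_def using has_chain_integral_chain_integral3[OF Cauchy_theorem_triangle[OF h]] by simp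
    moreover have "cmod (contour_integral (linepath (\<i> * of_real \<delta>) (- (\<i> * of_real \<delta>))) ?F)
        \<le> C * cmod (- (\<i> * of_real \<delta>) - \<i> * of_real \<delta>)"
    proof (rule contour_integral_bound_linepath)
      show "?F contour_integrable_on linepath (\<i> * of_real \<delta>) (- (\<i> * of_real \<delta>))"
        by (intro contour_integrable_continuous_linepath continuous_intros cont_p1)
      fix z assume "z \<in> closed_segment (\<i> * of_real \<delta>) (- (\<i> * of_real \<delta>))"
      then obtain x where x: "0 \<le> x" "x \<le> 1" "z = (1 - x) *\<^sub>R (\<i> * of_real \<delta>) + x *\<^sub>R (- (\<i> * of_real \<delta>))"
        by (auto simp: in_segment)
      have z0: "Re z = 0" using x by simp
      have "cmod z \<le> (1 - x) * \<delta> + x * \<delta>"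
        using norm_triangle_ineq[of "(1 - x) *\<^sub>R (\<i> * of_real \<delta>)" "x *\<^sub>R (- (\<i> * of_real \<delta>))"] x \<delta> by (simp add: norm_mult)
      hence "cmod z \<le> 1" using \<delta> by (simp add: algebra_simps)
      thus "cmod (?F z) \<le> C" using p1_bound z0 by (simp add: norm_mult)
    qed (rule C)
    moreover have "cmod (- (\<i> * of_real \<delta>) - \<i> * of_real \<delta>) = 2 * \<delta>"
    proof -
      have "- (\<i> * of_real \<delta>) - \<i> * of_real \<delta> = - (\<i> * of_real (2 * \<delta>))" by (simp add: complex_eq_iff)
      thus ?thesis using \<delta> by (simp add: norm_mult)
    qed
    moreover have "C * (2 * \<delta>) \<le> C * 2" using C \<delta> by (intro mult_left_mono) auto
    ultimately show ?thesis by (simp add: add_eq_0_iff)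
  qed
  have b2: "cmod (?e z * q z) \<le> C * t powr \<gamma>" if "z = \<i> * of_real \<delta> \<or> z = - (\<i> * of_real \<delta>)" for z
  proof -
    have z: "z \<in> rhp" "cmod z = \<delta>" "Re z = 0" using that \<delta> by (auto simp: norm_mult)
    have "cmod (q z) \<le> C * \<delta> powr (\<alpha> * (1 - \<gamma>) - 1)"
      unfolding q_def using q_bound[OF z(1)] z \<delta> by simp
    \<comment> \<open>The exponent of t is \<gamma> - 1 + 1 / \<alpha>, at most \<gamma> because
      \<alpha> \<ge> 1.\<close>
    also have "\<dots> \<le> C * t powr \<gamma>"
      unfolding \<delta>_powr using \<alpha> t C by (intro mult_left_mono powr_mono) (auto simp: field_simps)
    finally show ?thesis using z by (simp add: norm_mult)
  qed
  have b3: "t * cmod (hat (\<lambda>z. ?e z * q z) \<delta> a) \<le> C * (2 / (\<alpha> * (1 - \<gamma>))) * t powr \<gamma>"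
  proof -
    have "cmod (hat (\<lambda>z. ?e z * q z) \<delta> a) \<le> 2 * C * (\<delta> powr ((\<alpha> * (1 - \<gamma>) - 1) + 1) / ((\<alpha> * (1 - \<gamma>) - 1) + 1))"
    proof (rule hat_bound_shrink[OF cont_q holo_q \<delta> a])
      show "\<alpha> * (1 - \<gamma>) - 1 > -1" using \<alpha> \<gamma> by simp
    qed (use t C q_bound in \<open>auto simp: q_def\<close>)
    hence "t * cmod (hat (\<lambda>z. ?e z * q z) \<delta> a) \<le> t * (2 * C * (\<delta> powr (\<alpha> * (1 - \<gamma>)) / (\<alpha> * (1 - \<gamma>))))"
      using t by (intro mult_left_mono) auto
    also have "\<dots> = C * (2 / (\<alpha> * (1 - \<gamma>))) * (t powr 1 * \<delta> powr (\<alpha> * (1 - \<gamma>)))"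
      using t by simp
    also have "t powr 1 * \<delta> powr (\<alpha> * (1 - \<gamma>)) = t powr \<gamma>"
      unfolding \<delta>_powr powr_add[symmetric] using \<alpha> by (simp add: field_simps)
    finally show ?thesis .
  qed
  have b0: "cmod (hat (\<lambda>z. ?e z * rm z) \<delta> a) \<le> C * (4 + 2 / (\<alpha> * (1 - \<gamma>))) * t powr \<gamma>"
  proof -
    have "cmod (hat (\<lambda>z. ?e z * rm z) \<delta> a) \<le> cmod (hat (\<lambda>z. - (?e z * p1 z)) \<delta> a)
      + (cmod (?e (\<i> * of_real \<delta>) * q (\<i> * of_real \<delta>)) + cmod (?e (- (\<i> * of_real \<delta>)) * q (- (\<i> * of_real \<delta>))))
      + cmod (of_real t * hat (\<lambda>z. ?e z * q z) \<delta> a)"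
      unfolding low by (intro order_trans[OF norm_triangle_ineq] add_mono order_trans[OF norm_triangle_ineq4] order_refl)
    also have "cmod (of_real t * hat (\<lambda>z. ?e z * q z) \<delta> a) = t * cmod (hat (\<lambda>z. ?e z * q z) \<delta> a)"
      using t by (simp add: norm_mult)
    also have "cmod (hat (\<lambda>z. - (?e z * p1 z)) \<delta> a)
      + (cmod (?e (\<i> * of_real \<delta>) * q (\<i> * of_real \<delta>)) + cmod (?e (- (\<i> * of_real \<delta>)) * q (- (\<i> * of_real \<delta>))))
      + t * cmod (hat (\<lambda>z. ?e z * q z) \<delta> a)
      \<le> 2 * C * t powr \<gamma> + (C * t powr \<gamma> + C * t powr \<gamma>) + C * (2 / (\<alpha> * (1 - \<gamma>))) * t powr \<gamma>"
    proof (intro add_mono b2 b3)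
      show "cmod (hat (\<lambda>z. - (?e z * p1 z)) \<delta> a) \<le> 2 * C * t powr \<gamma>"
        using b1 mult_left_mono[OF t\<gamma>, of "2 * C"] C by simp
    qed auto
    also have "\<dots> = C * (4 + 2 / (\<alpha> * (1 - \<gamma>))) * t powr \<gamma>" by (simp add: algebra_simps)
    finally show ?thesis .
  qed
  have hp: "\<alpha> * \<gamma> > 0" using \<alpha> \<gamma> by simp
  let ?F = "\<lambda>z. ?e z * rm z"
  have contF: "continuous_on rhp ?F" by (intro continuous_intros cont)
  have holoF: "?F holomorphic_on {z. 0 < Re z}" by (intro holomorphic_intros holo)
  let ?K = "C * ((N powr ((- 1 - \<alpha> * \<gamma>) + 1) / ((- 1 - \<alpha> * \<gamma>) + 1) - \<delta> powr ((- 1 - \<alpha> * \<gamma>) + 1) / ((- 1 - \<alpha> * \<gamma>) + 1)) + (N - \<delta>))"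
  have \<delta>N: "\<delta> \<le> N" using \<delta> N by linarith
  have hi: "((\<lambda>s. C * (s powr (- 1 - \<alpha> * \<gamma>) + 1)) has_integral ?K) {\<delta>..N}"
    using has_integral_const_real[of "1::real" \<delta> N] \<delta>N \<delta>(1) hp
    by (intro has_integral_mult_right has_integral_add has_integral_powr) auto
  have bF: "cmod (?F (Complex 0 s)) \<le> C * (\<bar>s\<bar> powr (- 1 - \<alpha> * \<gamma>) + 1)" if "\<delta> \<le> \<bar>s\<bar>" "\<bar>s\<bar> \<le> N" for s
  proof -
    have "cmod (Complex 0 s) = \<bar>s\<bar>" by (simp add: complex_norm)
    thus ?thesis using rm_bound[of "Complex 0 s"] that \<delta> by (auto simp: norm_mult complex_eq_iff)
  qed
  note seg = imaginary_segment_bound[OF contF \<delta>(1) \<delta>N bF hi]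
  have K: "?K \<le> C * (1 / (\<alpha> * \<gamma>) + N) * t powr \<gamma>"
  proof -
    have "\<delta> powr (- (\<alpha> * \<gamma>)) = t powr \<gamma>" unfolding \<delta>_powr using \<alpha> by simp
    hence "?K = C * (t powr \<gamma> / (\<alpha> * \<gamma>) - N powr (- (\<alpha> * \<gamma>)) / (\<alpha> * \<gamma>) + (N - \<delta>))" by simp
    also have "\<dots> \<le> C * (t powr \<gamma> / (\<alpha> * \<gamma>) + N * t powr \<gamma>)"
    proof (intro mult_left_mono C add_mono)
      show "t powr \<gamma> / (\<alpha> * \<gamma>) - N powr (- (\<alpha> * \<gamma>)) / (\<alpha> * \<gamma>) \<le> t powr \<gamma> / (\<alpha> * \<gamma>)" using hp by simp
      have "N * 1 \<le> N * t powr \<gamma>" using N t\<gamma> by (intro mult_left_mono) auto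
      thus "N - \<delta> \<le> N * t powr \<gamma>" using \<delta> by linarith
    qed
    finally show ?thesis by (simp add: algebra_simps)
  qed
  have "cmod (hat ?F N a) \<le> ?K + C * (4 + 2 / (\<alpha> * (1 - \<gamma>))) * t powr \<gamma> + ?K"
    unfolding hat_split[OF contF holoF _ \<delta>(1) a, of N, OF less_le_trans[OF \<delta>(1) \<delta>N]]
    by (intro order_trans[OF norm_triangle_ineq] add_mono seg b0)
  also have "\<dots> \<le> C * (1 / (\<alpha> * \<gamma>) + N) * t powr \<gamma> + C * (4 + 2 / (\<alpha> * (1 - \<gamma>))) * t powr \<gamma> + C * (1 / (\<alpha> * \<gamma>) + N) * t powr \<gamma>"
    using K by (intro add_mono order_refl)
  also have "\<dots> = C * (2 / (\<alpha> * \<gamma>) + 2 * N + 4 + 2 / (\<alpha> * (1 - \<gamma>))) * t powr \<gamma>"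
    by (simp add: algebra_simps)
  finally show ?thesis .
qed

lemma contour_integral_affine:
  assumes "L > 0"
  shows "contour_integral (linepath p (p + of_real L * v)) F = integral {0..L} (\<lambda>y. F (p + of_real y * v) * v)"
proof -
  have "contour_integral (linepath p (p + of_real L * v)) F = contour_integral (linepath 0 (of_real L * v)) (\<lambda>z. F (p + z))"
    unfolding contour_integral_integral vector_derivative_linepath_at linepath_def
    by (intro integral_cong) (simp add: scaleR_conv_of_real algebra_simps)
  thus ?thesis using contour_integral_ray[OF assms, of v "\<lambda>z. F (p + z)"] by (simp add: mult_ac)
qed

section \<open>Tauberian estimate: decay in time from the transform on the bent contour\<close>

context sector_function
begin

text \<open>The half-line crosses the imaginary axis at y = a / sin \<theta>, in c i a cos \<theta>
  / sin \<theta>. Beyond the crossing |exp (\<lambda> t)| decays and \<open>G c\<close> is bounded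
  by M, which gives a bound uniform in t \<ge> 1. Before it \<open>G c\<close> may be replaced by
  any \<open>F\<close> that agrees with it in the right half-plane.\<close>

lemma I_low_high:
  assumes c: "c = 1 \<or> c = -1" and a: "a * cos \<theta> \<ge> \<omega> + 1" and t: "t \<ge> 1"
    and F: "\<And>z. Re z > 0 \<Longrightarrow> Re (z * cis (- (c * \<theta>))) > \<omega> \<Longrightarrow> F z = G c z"
  shows "cmod (I a t c - contour_integral (linepath (of_real a) (of_real c * \<i> * of_real (a * cos \<theta> / sin \<theta>)))
           (\<lambda>z. exp (z * of_real t) * F z)) \<le> M / sin \<theta>"
proof -
  have a': "a * cos \<theta> > \<omega>" using a by simp
  have t0: "t > 0" using t by simp
  have a0: "a > 0" using a' \<omega> trig_pos by (smt (verit) mult_nonpos_nonneg)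
  define y0 where "y0 = a / sin \<theta>"
  have y0: "y0 > 0" using a0 trig_pos by (simp add: y0_def)
  define v where "v = of_real c * \<i> * cis (c * \<theta>)"
  have lam_v: "lam a c y = of_real a + of_real y * v" for y by (simp add: lam_def v_def mult_ac)
  have endp: "of_real a + of_real y0 * v = of_real c * \<i> * of_real (a * cos \<theta> / sin \<theta>)"
    using c trig_pos unfolding v_def y0_def by (auto simp: complex_eq_iff)
  let ?g = "\<lambda>y. exp (lam a c y * of_real t) * G c (lam a c y)"
  have si: "set_integrable lborel {0<..} ?g"
    by (rule set_integrable_exp_bound(1)[OF lam_integrand(1)[OF c a' t0] lam_integrand(2)[OF c a' t0]])
       (use t0 trig_pos in auto)
  have contg: "continuous_on S ?g" for S
  proof -
    have "continuous_on S (\<lambda>y. G c (lam a c y))"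
      by (rule continuous_on_compose2[OF holomorphic_on_imp_continuous_on[OF G_holomorphic[OF c]]])
         (use a' Re_lam_cis[OF c] in \<open>auto simp: lam_def intro!: continuous_intros\<close>)
    thus ?thesis unfolding lam_def by (intro continuous_intros)
  qed
  have "integral {0..y0} (\<lambda>y. ?g y * v) = integral {0..y0} (\<lambda>y. exp ((of_real a + of_real y * v) * of_real t) * F (of_real a + of_real y * v) * v)"
  \<comment> \<open>At y0 the half-line is on the imaginary axis, where \<open>F\<close> is not
    known to equal \<open>G c\<close>; a single point does not change the integral.\<close>
  proof (rule integral_spike[of "{y0}"])
    fix y assume y: "y \<in> {0..y0} - {y0}"
    hence "y * sin \<theta> < a" using trig_pos by (auto simp: y0_def field_simps)
    hence "F (lam a c y) = G c (lam a c y)" using Re_lam[OF c] Re_lam_cis[OF c] a' by (intro F) auto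
    thus "exp ((of_real a + of_real y * v) * of_real t) * F (of_real a + of_real y * v) * v = ?g y * v"
      unfolding lam_v by simp
  qed auto
  hence low: "integral {0..y0} ?g * v = contour_integral (linepath (of_real a) (of_real c * \<i> * of_real (a * cos \<theta> / sin \<theta>)))
           (\<lambda>z. exp (z * of_real t) * F z)"
    unfolding endp[symmetric] contour_integral_affine[OF y0] by simp
  have high: "cmod (integral {0..L} ?g - integral {0..y0} ?g) \<le> M / sin \<theta>" if L: "L \<ge> y0" for L
  proof -
    have "integral {0..L} ?g - integral {0..y0} ?g = integral {y0..L} ?g"
      using Henstock_Kurzweil_Integration.integral_combine[of 0 y0 L ?g] y0 L integrable_continuous_interval[OF contg]
      by (simp add: algebra_simps)
    also have "cmod \<dots> \<le> integral {y0..L} (\<lambda>y. M * exp ((a - y * sin \<theta>) * t))"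
    proof (rule integral_norm_bound_integral)
      show "?g integrable_on {y0..L}" by (rule integrable_continuous_interval[OF contg])
      show "(\<lambda>y. M * exp ((a - y * sin \<theta>) * t)) integrable_on {y0..L}"
        by (intro integrable_continuous_interval continuous_intros)
      fix y assume y: "y \<in> {y0..L}"
      have "cmod (G c (lam a c y)) \<le> M / (a * cos \<theta> - \<omega>)"
        using G_bound[OF c, of "lam a c y"] Re_lam_cis[OF c] a' by simp
      also have "\<dots> \<le> M / 1" using a M by (intro divide_left_mono) auto
      finally have "cmod (G c (lam a c y)) \<le> M" by simp
      thus "cmod (?g y) \<le> M * exp ((a - y * sin \<theta>) * t)"
        using Re_lam[OF c] by (simp add: norm_mult mult.commute mult_right_mono)
    qed
    also have "\<dots> = M * ((1 - exp ((a - L * sin \<theta>) * t)) / (t * sin \<theta>))"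
    proof -
      have "((\<lambda>y. exp ((a - y * sin \<theta>) * t)) has_integral
          (- exp ((a - L * sin \<theta>) * t) / (t * sin \<theta>) - - exp ((a - y0 * sin \<theta>) * t) / (t * sin \<theta>))) {y0..L}"
      proof (rule fundamental_theorem_of_calculus[OF L])
        fix y assume "y \<in> {y0..L}"
        have "((\<lambda>y. - exp ((a - y * sin \<theta>) * t) / (t * sin \<theta>)) has_real_derivative exp ((a - y * sin \<theta>) * t)) (at y)"
          using t0 trig_pos by (auto intro!: derivative_eq_intros simp: field_simps)
        thus "((\<lambda>y. - exp ((a - y * sin \<theta>) * t) / (t * sin \<theta>)) has_vector_derivative exp ((a - y * sin \<theta>) * t)) (at y within {y0..L})"
          by (simp add: has_real_derivative_iff_has_vector_derivative has_vector_derivative_at_within)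
      qed
      moreover have "a - y0 * sin \<theta> = 0" using trig_pos by (simp add: y0_def)
      ultimately show ?thesis by (simp add: integral_unique diff_divide_distrib)
    qed
    also have "\<dots> \<le> M * (1 / (t * sin \<theta>))"
      using M t0 trig_pos by (intro mult_left_mono divide_right_mono) auto
    also have "\<dots> \<le> M * (1 / sin \<theta>)"
      using M t t0 trig_pos by (intro mult_left_mono divide_left_mono) auto
    finally show ?thesis by simp
  qed
  have "((\<lambda>L. cmod (integral {0..L} ?g - integral {0..y0} ?g)) \<longlongrightarrow> cmod ((LBINT y:{0<..}. ?g y) - integral {0..y0} ?g)) at_top"
    by (intro tendsto_intros tendsto_integral_half_line si)
  moreover have "\<forall>\<^sub>F L in at_top. cmod (integral {0..L} ?g - integral {0..y0} ?g) \<le> M / sin \<theta>"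
    using eventually_ge_at_top[of y0] by eventually_elim (rule high)
  ultimately have "cmod ((LBINT y:{0<..}. ?g y) - integral {0..y0} ?g) \<le> M / sin \<theta>"
    by (rule tendsto_upperbound) simp
  moreover have "cmod v = 1" using c by (auto simp: v_def norm_mult)
  moreover have "I a t c - integral {0..y0} ?g * v = ((LBINT y:{0<..}. ?g y) - integral {0..y0} ?g) * v"
    unfolding I_def v_def by (simp add: algebra_simps)
  ultimately show ?thesis unfolding low[symmetric] by (simp add: norm_mult)
qed

end

text \<open>Explicit, so that one constant serves all functionals and all vectors of the unit ball.
  The summands stem from the two tails of the contour, the singularity at 0, the transform of the
  exponentially small remainder, and the remainder itself; \<open>N\<close> is the height at which
  the contour crosses the imaginary axis.\<close>

definition tauberian_const :: "real \<Rightarrow> real \<Rightarrow> real \<Rightarrow> real \<Rightarrow> real \<Rightarrow> real \<Rightarrow> real \<Rightarrow> real \<Rightarrow> nat \<Rightarrow> real" where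
  "tauberian_const \<theta> M \<omega> K \<epsilon> \<alpha> \<gamma> C n = (let m = Suc n; N = (\<omega> + 2 + sin \<theta>) / sin \<theta> in
     2 * (fact m * M) / sin \<theta> + C * (2 / (\<alpha> * \<gamma>) + 2 * N + 4 + 2 / (\<alpha> * (1 - \<gamma>)))
       + 2 * N * (fact m / (\<epsilon> / 2) ^ m * K / (\<epsilon> / 2)) + K * fact m / \<epsilon> ^ m)"

text \<open>Inversion is applied to z^m s(z) with m = n + 1, since multiplication by t^m corresponds
  to differentiating the transform m times. The transform of t^m s(t) is \<open>r m\<close> minus
  that of t^m (u - s); the latter is analytic across the imaginary axis, so only \<open>r m\<close>
  brings in a singularity at 0.\<close>

lemma tauberian:
  fixes s :: "complex \<Rightarrow> complex" and u :: "real \<Rightarrow> complex" and r :: "nat \<Rightarrow> complex \<Rightarrow> complex" and p p1 :: "complex \<Rightarrow> complex"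
  assumes \<theta>: "0 < \<theta>" "\<theta> < pi / 2" and w0: "\<omega> \<ge> 0" and M0: "M \<ge> 0" and \<epsilon>: "\<epsilon> > 0" and K: "K \<ge> 0"
    and \<alpha>: "\<alpha> \<ge> 1" and \<gamma>: "0 < \<gamma>" "\<gamma> < 1" and C: "C \<ge> 0"
    and s: "s holomorphic_on {z. cmod z * cos \<theta> \<le> Re z} - {0}"
    and s_bound: "\<And>z. z \<in> {z. cmod z * cos \<theta> \<le> Re z} - {0} \<Longrightarrow> cmod (s z) \<le> M * exp (\<omega> * cmod z)"
    and u: "continuous_on {0<..} u" and us: "\<And>t. t > 0 \<Longrightarrow> cmod (u t - s (of_real t)) \<le> K * exp (- \<epsilon> * t)"
    and r: "\<And>k z. z \<in> rhp \<Longrightarrow> (r k has_field_derivative - r (Suc k) z) (at z within rhp)"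
    and r0: "\<And>z. Re z > \<omega> \<Longrightarrow> r 0 z = laplace u z"
    and p: "\<And>z. (p has_field_derivative p1 z) (at z)" and p1: "p1 holomorphic_on UNIV"
    and p1_bound: "\<And>z. cmod z \<le> 1 \<Longrightarrow> cmod (p1 z) \<le> C"
    and rm_bound: "\<And>z. z \<in> rhp \<Longrightarrow> cmod (r (Suc n) z) \<le> C * (cmod z powr (- 1 - \<alpha> * \<gamma>) + 1)"
    and q_bound: "\<And>z. z \<in> rhp \<Longrightarrow> cmod z \<le> 1 \<Longrightarrow> cmod (r n z - p z) \<le> C * cmod z powr (\<alpha> * (1 - \<gamma>) - 1)"
    and t: "t \<ge> 1"
  shows "cmod (u t) \<le> tauberian_const \<theta> M \<omega> K \<epsilon> \<alpha> \<gamma> C n * t powr (\<gamma> - real (Suc n))"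
proof -
  define m where "m = Suc n"
  define f where "f z = z ^ m * s z" for z
  let ?\<Sigma> = "{z. cmod z * cos \<theta> \<le> Re z}"
  have f_le: "cmod (f z) \<le> cmod z ^ m * (M * exp (\<omega> * cmod z))" if "z \<in> ?\<Sigma>" for z
    using s_bound[of z] that by (cases "z = 0") (auto simp: f_def m_def norm_mult norm_power intro!: mult_left_mono)
  \<comment> \<open>The factor z^m makes \<open>f\<close> continuous at the vertex, where
    \<open>s\<close> is merely bounded.\<close>
  have cont_f: "continuous_on ?\<Sigma> f"
    unfolding continuous_on_def
  proof
    fix z assume z: "z \<in> ?\<Sigma>"
    show "(f \<longlongrightarrow> f z) (at z within ?\<Sigma>)"
    proof (cases "z = 0")
      case True
      have "((\<lambda>z. cmod z ^ m * (M * exp (\<omega> * cmod z))) \<longlongrightarrow> cmod 0 ^ m * (M * exp (\<omega> * cmod 0))) (at 0 within ?\<Sigma>)"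
        by (intro tendsto_intros)
      hence "((\<lambda>z. cmod z ^ m * (M * exp (\<omega> * cmod z))) \<longlongrightarrow> 0) (at 0 within ?\<Sigma>)" by (simp add: m_def)
      hence "(f \<longlongrightarrow> 0) (at 0 within ?\<Sigma>)"
        by (rule Lim_null_comparison[rotated]) (use f_le in \<open>auto simp: eventually_at_filter\<close>)
      thus ?thesis using True by (simp add: f_def m_def)
    next
      case False
      have "continuous_on (?\<Sigma> - {0}) f"
        unfolding f_def by (intro continuous_intros holomorphic_on_imp_continuous_on s)
      hence "(f \<longlongrightarrow> f z) (at z within ?\<Sigma> - {0})" using z False unfolding continuous_on_def by blast
      moreover have "at z within ?\<Sigma> - {0} = at z within ?\<Sigma>"
        by (rule at_within_nhd[of _ "- {0}"]) (use False in auto)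
      ultimately show ?thesis by simp
    qed
  qed
  have int\<Sigma>: "interior ?\<Sigma> \<subseteq> ?\<Sigma> - {0}"
  proof
    fix z assume z: "z \<in> interior ?\<Sigma>"
    have "z \<noteq> 0"
    proof
      assume "z = 0"
      then obtain e where e: "e > 0" "ball 0 e \<subseteq> ?\<Sigma>" using z by (meson mem_interior)
      have "- of_real (e / 2) \<in> ball (0::complex) e" using e by simp
      hence "cmod (- of_real (e / 2)) * cos \<theta> \<le> Re (- of_real (e / 2))" using e by blast
      moreover have "e / 2 * cos \<theta> > 0" using e \<theta> cos_gt_zero[of \<theta>] by simp
      ultimately show False using e by simp
    qed
    thus "z \<in> ?\<Sigma> - {0}" using z interior_subset by blast
  qed
  \<comment> \<open>The factor z^m is paid for by m! and by raising the growth rate from \<omega> to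
    \<omega> + 1.\<close>
  interpret sector_function f \<theta> "fact m * M" "\<omega> + 1"
  proof
    show "f holomorphic_on interior ?\<Sigma>"
      unfolding f_def by (intro holomorphic_intros holomorphic_on_subset[OF s int\<Sigma>])
    show "cmod (f z) \<le> fact m * M * exp ((\<omega> + 1) * cmod z)" if "cmod z * cos \<theta> \<le> Re z" for z
    proof -
      have "cmod (f z) \<le> cmod z ^ m * (M * exp (\<omega> * cmod z))" using f_le that by simp
      also have "\<dots> \<le> (fact m * exp (cmod z)) * (M * exp (\<omega> * cmod z))"
        using M0 by (intro mult_right_mono power_le_fact_exp) auto
      also have "\<dots> = fact m * M * exp ((\<omega> + 1) * cmod z)" by (simp add: algebra_simps exp_add)
      finally show ?thesis .
    qed
  qed (use \<theta> cont_f w0 in auto)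
  note \<omega> = w0 and M = M0
  \<comment> \<open>\<open>I_low_high\<close> requires a cos \<theta> \<ge> (\<omega> + 1) + 1; the
    extra sin \<theta> makes N \<ge> 1 immediate.\<close>
  define a where "a = (\<omega> + 2 + sin \<theta>) / cos \<theta>"
  define N where "N = a * cos \<theta> / sin \<theta>"
  have acos: "a * cos \<theta> = \<omega> + 2 + sin \<theta>" using trig_pos by (simp add: a_def)
  have N_eq: "N = (\<omega> + 2 + sin \<theta>) / sin \<theta>" by (simp add: N_def acos)
  have N: "N \<ge> 1" using trig_pos \<omega> by (simp add: N_eq)
  have a: "a > 0" using trig_pos \<omega> by (simp add: a_def add_nonneg_pos)
  have t0: "t > 0" using t by simp

  define v where "v x = u x - s (of_real x)" for x
  have cont_s: "continuous_on {0<..} (\<lambda>x::real. s (of_real x))"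
  proof (rule continuous_on_compose2[OF holomorphic_on_imp_continuous_on[OF s]])
    show "of_real ` {0::real<..} \<subseteq> ?\<Sigma> - {0}" using ray_in_\<Sigma>[of 0] \<theta> by (auto simp: less_imp_le)
  qed (intro continuous_intros)
  have cont_v: "continuous_on {0<..} v" unfolding v_def by (intro continuous_intros u cont_s)
  have s_real: "cmod (s (of_real x)) \<le> M * exp (\<omega> * x)" if "x > 0" for x
    using s_bound[of "of_real x"] ray_in_\<Sigma>[of 0 x] that \<theta> by auto
  have v_le: "cmod (v x) \<le> K * exp (- \<epsilon> * x)" if "x > 0" for x
    using us[OF that] by (simp add: v_def)
  have u_le: "cmod (u x) \<le> (M + K) * exp (\<omega> * x)" if "x > 0" for x
  proof -
    have "cmod (u x) \<le> cmod (s (of_real x)) + cmod (v x)"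
      using norm_triangle_ineq[of "s (of_real x)" "v x"] by (simp add: v_def)
    also have "\<dots> \<le> M * exp (\<omega> * x) + K * exp (\<omega> * x)"
    proof (intro add_mono s_real that order_trans[OF v_le mult_left_mono])
      have "- \<epsilon> * x \<le> 0" "0 \<le> \<omega> * x" using \<epsilon> \<omega> that by auto
      thus "exp (- \<epsilon> * x) \<le> exp (\<omega> * x)" by simp
    qed (use K in auto)
    finally show ?thesis by (simp add: algebra_simps)
  qed
  let ?U = "\<lambda>k x. of_real x ^ k * u x" and ?V = "\<lambda>x. of_real x ^ m * v x"
  define KV where "KV = fact m / (\<epsilon> / 2) ^ m * K"
  have KV: "KV \<ge> 0" using K \<epsilon> by (simp add: KV_def)
  have cont_U: "continuous_on {0<..} (?U k)" for k by (intro continuous_intros u)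
  have cont_V: "continuous_on {0<..} ?V" by (intro continuous_intros cont_v)
  have U_le: "cmod (?U k x) \<le> (fact k / 1 ^ k * (M + K)) * exp ((\<omega> + 1) * x)" if "x > 0" for k x
    using times_exp_bound[of u "M + K" \<omega> 1 x k, OF u_le _ _ that] M K by simp
  have V_le: "cmod (?V x) \<le> KV * exp (- (\<epsilon> / 2) * x)" if "x > 0" for x
    using times_exp_bound[of v K "- \<epsilon>" "\<epsilon> / 2" x m, OF v_le _ _ that] \<epsilon> K by (simp add: KV_def)
  have hV: "laplace ?V holomorphic_on {z. Re z > - (\<epsilon> / 2)}"
    unfolding holomorphic_on_def field_differentiable_def
  proof
    fix z assume "z \<in> {z. Re z > - (\<epsilon> / 2)}"
    hence "Re z > - (\<epsilon> / 2)" by simp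
    from laplace_has_field_derivative[OF cont_V V_le this]
    show "\<exists>f'. (laplace ?V has_field_derivative f') (at z within {z. Re z > - (\<epsilon> / 2)})"
      by (blast intro: has_field_derivative_at_within)
  qed
  have lV: "cmod (laplace ?V z) \<le> KV / (\<epsilon> / 2)" if "Re z \<ge> 0" for z
  proof -
    have "cmod (laplace ?V z) \<le> KV / (Re z - - (\<epsilon> / 2))"
      by (rule laplace_bound[OF cont_V V_le]) (use that \<epsilon> in auto)
    also have "\<dots> \<le> KV / (\<epsilon> / 2)" using KV \<epsilon> that by (intro divide_left_mono) auto
    finally show ?thesis .
  qed

  have r_at: "(r k has_field_derivative - r (Suc k) z) (at z)" if "Re z > 0" for k z
  proof -
    have "(r k has_field_derivative - r (Suc k) z) (at z within {z. Re z > 0})"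
      by (rule DERIV_subset[OF r]) (use that in auto)
    thus ?thesis using at_within_open[of z "{z. Re z > 0}"] that open_halfspace_Re_gt[of 0] by simp
  qed
  \<comment> \<open>Both \<open>r k\<close> and the transforms of t^k u pass to the negative of the
    next one under differentiation, so the identity spreads from k = 0. The rate \<omega> + 1 serves
    all k at once.\<close>
  have r_laplace: "r k z = laplace (?U k) z" if "Re z > \<omega> + 1" for k z
    using that
  proof (induction k arbitrary: z)
    case 0
    thus ?case using r0 by simp
  next
    case (Suc k)
    have "(laplace (?U k) has_field_derivative - r (Suc k) z) (at z)"
    proof (rule has_field_derivative_transform_within_open[OF r_at])
      show "open {z. Re z > \<omega> + 1}" by (rule open_halfspace_Re_gt)
    qed (use Suc \<omega> in auto)
    moreover have "(laplace (?U k) has_field_derivative - laplace (\<lambda>x. of_real x * ?U k x) z) (at z)"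
      by (rule laplace_has_field_derivative[OF cont_U U_le Suc.prems])
    ultimately have "- r (Suc k) z = - laplace (\<lambda>x. of_real x * ?U k x) z" by (rule DERIV_unique)
    thus ?case by (simp add: mult.assoc)
  qed
  have r_cont: "continuous_on rhp (r k)" for k by (rule DERIV_continuous_on) (rule r)
  have r_holo: "r k holomorphic_on {z. 0 < Re z}" for k
    unfolding holomorphic_on_def field_differentiable_def
    using has_field_derivative_at_within[OF r_at] by blast
  let ?H = "\<lambda>z. r m z - laplace ?V z"
  \<comment> \<open>Both sides are analytic on the intersection of two half-planes, which is convex,
    and agree at large real points: there the left side is the Laplace transform of
    \<open>f\<close>, whose ray can be rotated.\<close>
  have H_G: "?H z = G c z" if c: "c = 1 \<or> c = -1" and z: "Re z > 0" "Re (z * cis (- (c * \<theta>))) > \<omega> + 1" for c z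
  proof -
    let ?S = "{z. Re z > 0} \<inter> {z. Re (z * cis (- (c * \<theta>))) > \<omega> + 1}"
    define l0 where "l0 = (\<omega> + 1) / cos \<theta>"
    have l0: "l0 > 0" using \<omega> trig_pos by (simp add: l0_def)
    have real_eq: "?H (of_real l) - G c (of_real l) = 0" if l: "l > l0" for l
    proof -
      have l1: "l * cos \<theta> > \<omega> + 1" using l trig_pos by (simp add: l0_def field_simps)
      have l2: "l > \<omega> + 1" using l1 l l0 cos_le_one[of \<theta>] by (smt (verit) mult_left_le)
      have "G c (of_real l) = laplace (\<lambda>x. f (of_real x)) (of_real l)"
        by (rule laplace_eq_G[OF c l1, symmetric])
      also have "\<dots> = laplace (\<lambda>x. ?U m x - ?V x) (of_real l)"
        by (simp add: f_def v_def algebra_simps)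
      also have "\<dots> = laplace (?U m) (of_real l) - laplace ?V (of_real l)"
        unfolding laplace_def right_diff_distrib
      proof (rule set_integral_diff)
        show "set_integrable lborel {0<..} (\<lambda>x. exp (- (of_real l * of_real x)) * ?U m x)"
          by (rule laplace_integrable[OF cont_U U_le]) (use l2 in auto)
        show "set_integrable lborel {0<..} (\<lambda>x. exp (- (of_real l * of_real x)) * ?V x)"
          by (rule laplace_integrable[OF cont_V V_le]) (use l2 \<omega> \<epsilon> in auto)
      qed
      also have "laplace (?U m) (of_real l) = r m (of_real l)" using r_laplace[of "of_real l" m] l2 by simp
      finally show ?thesis by simp
    qed
    have "?H z - G c z = 0"
    proof (rule analytic_continuation[where S = ?S and U = "of_real ` {l0<..}" and \<xi> = "of_real (l0 + 1)" and f = "\<lambda>z. ?H z - G c z"])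
      show "(\<lambda>z. ?H z - G c z) holomorphic_on ?S"
      proof (intro holomorphic_intros)
        show "r m holomorphic_on ?S" by (rule holomorphic_on_subset[OF r_holo]) auto
        show "laplace ?V holomorphic_on ?S" by (rule holomorphic_on_subset[OF hV]) (use \<epsilon> in auto)
        show "G c holomorphic_on ?S" by (rule holomorphic_on_subset[OF G_holomorphic[OF c]]) auto
      qed
      show "open ?S" by (intro open_Int open_halfspace_Re_gt open_Collect_less continuous_intros)
      show "connected ?S"
      proof (rule convex_connected, rule convexI)
        fix x y :: complex and p q :: real
        assume *: "x \<in> ?S" "y \<in> ?S" "0 \<le> p" "0 \<le> q" "p + q = 1"
        have "Re (p *\<^sub>R x + q *\<^sub>R y) > 0"
        proof (cases "p = 0")
          case False
          thus ?thesis using * by (auto intro!: add_pos_nonneg)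
        qed (use * in auto)
        moreover have "Re ((p *\<^sub>R x + q *\<^sub>R y) * w) = p * Re (x * w) + q * Re (y * w)" for w
          by (simp add: algebra_simps)
        moreover have "\<omega> + 1 < p * Re (x * cis (- (c * \<theta>))) + q * Re (y * cis (- (c * \<theta>)))"
          using * convex_bound_lt[of "- Re (x * cis (- (c * \<theta>)))" "- (\<omega> + 1)" "- Re (y * cis (- (c * \<theta>)))" p q]
          by (simp del: times_complex.sel)
        ultimately show "p *\<^sub>R x + q *\<^sub>R y \<in> ?S" unfolding Int_iff mem_Collect_eq by metis
      qed
      have Sreal: "of_real l \<in> ?S" if "l > l0" for l
      proof -
        have "\<omega> + 1 < l * cos \<theta>" using that trig_pos by (simp add: l0_def field_simps)
        thus ?thesis using that l0 c by auto
      qed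
      show "of_real ` {l0<..} \<subseteq> ?S" using Sreal by blast
      show "of_real (l0 + 1) \<in> ?S" by (rule Sreal) simp
      show "(of_real (l0 + 1) :: complex) islimpt of_real ` {l0<..}"
        unfolding islimpt_approachable
      proof (intro allI impI)
        fix e :: real assume "e > 0"
        thus "\<exists>x'\<in>of_real ` {l0<..}. x' \<noteq> of_real (l0 + 1) \<and> dist x' (of_real (l0 + 1) :: complex) < e"
          by (intro bexI[of _ "of_real (l0 + 1 + e / 2)"]) (auto simp: dist_norm simp del: of_real_add simp flip: of_real_diff)
      qed
    qed (use real_eq z in auto)
    thus ?thesis by simp
  qed

  let ?e = "\<lambda>z. exp (z * of_real t)"
  let ?E = "\<lambda>F. \<lambda>z. ?e z * F z"
  have a1: "a * cos \<theta> \<ge> (\<omega> + 1) + 1" using acos trig_pos by simp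
  have a2: "a * cos \<theta> > \<omega> + 1" using a1 by simp
  have I1: "cmod (I a t c - contour_integral (linepath (of_real a) (of_real c * \<i> * of_real N)) (?E ?H)) \<le> fact m * M / sin \<theta>"
    if "c = 1 \<or> c = -1" for c
    using I_low_high[OF that a1 t H_G[OF that]] unfolding N_def by simp
  have contV: "continuous_on rhp (laplace ?V)"
    by (rule continuous_on_subset[OF holomorphic_on_imp_continuous_on[OF hV]]) (use \<epsilon> in auto)
  have contH: "continuous_on rhp (?E ?H)" by (intro continuous_intros r_cont contV)
  have seg: "closed_segment (- (\<i> * of_real N)) (of_real a) \<subseteq> rhp" "closed_segment (of_real a) (\<i> * of_real N) \<subseteq> rhp"
    using rhp_segment[of _ "-1"] rhp_segment[of _ 1] a N by auto
  have rev: "contour_integral (linepath (of_real a) (- (\<i> * of_real N))) (?E ?H)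
      = - contour_integral (linepath (- (\<i> * of_real N)) (of_real a)) (?E ?H)"
    by (rule contour_integral_reverse_linepath) (use seg(1) in \<open>auto simp: closed_segment_commute intro: continuous_on_subset[OF contH]\<close>)
  have hat_H: "cmod ((I a t 1 - I a t (-1)) - hat (?E ?H) N a) \<le> 2 * (fact m * M) / sin \<theta>"
  proof -
    have "(I a t 1 - I a t (-1)) - hat (?E ?H) N a
       = (I a t 1 - contour_integral (linepath (of_real a) (of_real 1 * \<i> * of_real N)) (?E ?H))
       - (I a t (-1) - contour_integral (linepath (of_real a) (of_real (-1) * \<i> * of_real N)) (?E ?H))"
      unfolding hat_def using rev by simp
    also have "cmod \<dots> \<le> fact m * M / sin \<theta> + fact m * M / sin \<theta>"
      by (rule order_trans[OF norm_triangle_ineq4 add_mono[OF I1 I1]]) auto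
    also have "\<dots> = 2 * (fact m * M) / sin \<theta>" by (simp add: field_simps)
    finally show ?thesis .
  qed
  have hat_diff: "hat (?E ?H) N a = hat (?E (r m)) N a - hat (?E (laplace ?V)) N a"
  proof -
    have "?E (r m) contour_integrable_on linepath x y \<and> ?E (laplace ?V) contour_integrable_on linepath x y"
      if "closed_segment x y \<subseteq> rhp" for x y
      using that by (auto intro!: contour_integrable_continuous_linepath continuous_intros
          continuous_on_subset[OF r_cont] continuous_on_subset[OF contV])
    from this[OF seg(1)] this[OF seg(2)] show ?thesis
      unfolding hat_def by (simp add: right_diff_distrib contour_integral_diff)
  qed
  \<comment> \<open>In contrast to \<open>r m\<close>, this transform is analytic across the
    imaginary axis, so the hat is replaced by the straight segment through 0.\<close>
  have hat_V: "cmod (hat (?E (laplace ?V)) N a) \<le> 2 * N * (KV / (\<epsilon> / 2))"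
  proof -
    have sub: "convex hull {- (\<i> * of_real N), of_real a, \<i> * of_real N} \<subseteq> {z. Re z > - (\<epsilon> / 2)}"
      using \<epsilon> a by (intro hull_minimal) (auto simp: convex_halfspace_Re_gt)
    have h: "?E (laplace ?V) holomorphic_on convex hull {- (\<i> * of_real N), of_real a, \<i> * of_real N}"
      by (intro holomorphic_intros holomorphic_on_subset[OF hV sub])
    have "hat (?E (laplace ?V)) N a + contour_integral (linepath (\<i> * of_real N) (- (\<i> * of_real N))) (?E (laplace ?V)) = 0"
      unfolding hat_def using has_chain_integral_chain_integral3[OF Cauchy_theorem_triangle[OF h]] by simp
    moreover have "cmod (contour_integral (linepath (\<i> * of_real N) (- (\<i> * of_real N))) (?E (laplace ?V)))
       \<le> (KV / (\<epsilon> / 2)) * cmod (- (\<i> * of_real N) - \<i> * of_real N)"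
    proof (rule contour_integral_bound_linepath)
      show "?E (laplace ?V) contour_integrable_on linepath (\<i> * of_real N) (- (\<i> * of_real N))"
        by (intro contour_integrable_continuous_linepath continuous_on_subset[OF holomorphic_on_imp_continuous_on[OF h]]
            segments_subset_convex_hull)
      show "0 \<le> KV / (\<epsilon> / 2)" using KV \<epsilon> by simp
      fix z assume "z \<in> closed_segment (\<i> * of_real N) (- (\<i> * of_real N))"
      hence "Re z = 0" by (auto simp: in_segment)
      thus "cmod (?e z * laplace ?V z) \<le> KV / (\<epsilon> / 2)" using lV[of z] by (simp add: norm_mult)
    qed
    moreover have "cmod (- (\<i> * of_real N) - \<i> * of_real N) = 2 * N"
    proof -
      have "- (\<i> * of_real N) - \<i> * of_real N = - (\<i> * of_real (2 * N))" by (simp add: complex_eq_iff)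
      thus ?thesis using N by (simp add: norm_mult)
    qed
    ultimately show ?thesis by (simp add: add_eq_0_iff mult_ac)
  qed
  let ?L = "C * (2 / (\<alpha> * \<gamma>) + 2 * N + 4 + 2 / (\<alpha> * (1 - \<gamma>)))"
  have hat_r: "cmod (hat (?E (r m)) N a) \<le> ?L * t powr \<gamma>"
    unfolding m_def
    by (rule low_frequency[OF \<alpha> \<gamma> t N a C r r_cont r_holo p p1 p1_bound rm_bound q_bound])
  define B where "B = 2 * (fact m * M) / sin \<theta> + ?L + 2 * N * (KV / (\<epsilon> / 2))"
  have t\<gamma>: "1 \<le> t powr \<gamma>" using t \<gamma> powr_mono[of 0 \<gamma> t] by simp
  have "2 * pi * cmod (f (of_real t)) = cmod (I a t 1 - I a t (-1))"
    unfolding inversion[OF a2 t0] by (simp add: norm_mult)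
  also have "\<dots> \<le> cmod ((I a t 1 - I a t (-1)) - hat (?E ?H) N a) + (cmod (hat (?E (r m)) N a) + cmod (hat (?E (laplace ?V)) N a))"
    using norm_triangle_ineq[of "(I a t 1 - I a t (-1)) - hat (?E ?H) N a" "hat (?E ?H) N a"]
      norm_triangle_ineq4[of "hat (?E (r m)) N a" "hat (?E (laplace ?V)) N a"] unfolding hat_diff by simp
  also have "\<dots> \<le> 2 * (fact m * M) / sin \<theta> + (?L * t powr \<gamma> + 2 * N * (KV / (\<epsilon> / 2)))"
    by (intro add_mono hat_H hat_r hat_V)
  also have "\<dots> \<le> 2 * (fact m * M) / sin \<theta> * t powr \<gamma> + (?L * t powr \<gamma> + 2 * N * (KV / (\<epsilon> / 2)) * t powr \<gamma>)"
  proof (intro add_mono order_refl)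
    have "0 \<le> 2 * (fact m * M) / sin \<theta>" using M trig_pos by simp
    from mult_left_mono[OF t\<gamma> this] show "2 * (fact m * M) / sin \<theta> \<le> 2 * (fact m * M) / sin \<theta> * t powr \<gamma>" by simp
    have "0 \<le> 2 * N * (KV / (\<epsilon> / 2))" using N KV \<epsilon> by simp
    from mult_left_mono[OF t\<gamma> this] show "2 * N * (KV / (\<epsilon> / 2)) \<le> 2 * N * (KV / (\<epsilon> / 2)) * t powr \<gamma>" by simp
  qed
  also have "\<dots> = B * t powr \<gamma>" by (simp add: B_def algebra_simps)
  finally have "2 * pi * cmod (f (of_real t)) \<le> B * t powr \<gamma>" .
  moreover have "1 * cmod (f (of_real t)) \<le> 2 * pi * cmod (f (of_real t))"
    using pi_ge_two by (intro mult_right_mono) auto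
  ultimately have ft: "cmod (f (of_real t)) \<le> B * t powr \<gamma>" by linarith
  have tm: "t ^ m = t powr real m" using t0 by (simp add: powr_realpow)
  have "t powr real m * cmod (s (of_real t)) \<le> B * t powr \<gamma>"
    using ft t0 by (simp add: f_def norm_mult norm_power tm)
  hence "t powr (- real m) * (t powr real m * cmod (s (of_real t))) \<le> t powr (- real m) * (B * t powr \<gamma>)"
    by (rule mult_left_mono) simp
  hence st: "cmod (s (of_real t)) \<le> B * t powr (\<gamma> - real m)"
    using t0 by (simp add: powr_diff powr_minus field_simps)
  have "(\<epsilon> * t) ^ m \<le> fact m * exp (\<epsilon> * t)" using \<epsilon> t0 by (intro power_le_fact_exp) simp
  hence "exp (- \<epsilon> * t) \<le> fact m / \<epsilon> ^ m * t powr (- real m)"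
    using \<epsilon> t0 by (simp add: power_mult_distrib exp_minus powr_minus tm field_simps)
  also have "\<dots> \<le> fact m / \<epsilon> ^ m * t powr (\<gamma> - real m)"
    using \<epsilon> \<gamma> t by (intro mult_left_mono powr_mono) auto
  finally have et: "K * exp (- \<epsilon> * t) \<le> K * (fact m / \<epsilon> ^ m * t powr (\<gamma> - real m))"
    using K by (rule mult_left_mono)
  have "cmod (u t) \<le> cmod (s (of_real t)) + cmod (v t)"
    using norm_triangle_ineq[of "s (of_real t)" "v t"] by (simp add: v_def)
  also have "\<dots> \<le> B * t powr (\<gamma> - real m) + K * (fact m / \<epsilon> ^ m * t powr (\<gamma> - real m))"
    using st et v_le[OF t0] by linarith
  also have "\<dots> = tauberian_const \<theta> M \<omega> K \<epsilon> \<alpha> \<gamma> C n * t powr (\<gamma> - real m)"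
    unfolding tauberian_const_def Let_def B_def N_eq KV_def m_def by (simp only: algebra_simps times_divide_eq_right times_divide_eq_left)
  finally show ?thesis unfolding m_def .
qed

section \<open>Operator-valued contour integrals over the boundary of a sector, and their
  multiplication by resolvents\<close>

section \<open>Contour integrals of the resolvent\<close>

text \<open>The integral in \<open>frac_reg\<close> is a gauge integral of operators, so
  integrability is verified through the Cauchy criterion. Riemann sums of f and h differ by at most
  the Riemann sum of g, which is below 2 e / 5 on fine divisions.\<close>

lemma integrable_approximable:
  fixes f :: "real \<Rightarrow> 'b::banach"
  assumes approx: "\<And>e. e > 0 \<Longrightarrow> \<exists>h g. h integrable_on {a..b} \<and> g integrable_on {a..b} \<and>
      (\<forall>x\<in>{a..b}. norm (f x - h x) \<le> g x) \<and> integral {a..b} g < e"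
  shows "f integrable_on {a..b}"
proof -
  have "f integrable_on cbox a b"
    unfolding integrable_Cauchy
  proof (intro allI impI)
    fix e :: real assume e: "e > 0"
    obtain h g where h: "h integrable_on {a..b}" and g: "g integrable_on {a..b}"
      and fh: "\<And>x. x \<in> {a..b} \<Longrightarrow> norm (f x - h x) \<le> g x" and G: "integral {a..b} g < e / 5"
      using approx[of "e / 5"] e by auto
    have "h integrable_on cbox a b" using h by simp
    then obtain \<gamma>h where \<gamma>h: "gauge \<gamma>h" "\<And>p1 p2. p1 tagged_division_of cbox a b \<Longrightarrow> \<gamma>h fine p1 \<Longrightarrow>
        p2 tagged_division_of cbox a b \<Longrightarrow> \<gamma>h fine p2 \<Longrightarrow>
        norm ((\<Sum>(x,K)\<in>p1. measure lborel K *\<^sub>R h x) - (\<Sum>(x,K)\<in>p2. measure lborel K *\<^sub>R h x)) < e / 5"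
      unfolding integrable_Cauchy using e by (metis divide_pos_pos zero_less_numeral)
    have "(g has_integral integral {a..b} g) (cbox a b)" using g by (simp add: integrable_integral)
    then obtain \<gamma>g where \<gamma>g: "gauge \<gamma>g" "\<And>p. p tagged_division_of cbox a b \<Longrightarrow> \<gamma>g fine p \<Longrightarrow>
        norm ((\<Sum>(x,K)\<in>p. measure lborel K *\<^sub>R g x) - integral {a..b} g) < e / 5"
      unfolding has_integral using e by (metis divide_pos_pos zero_less_numeral)
    have near: "norm ((\<Sum>(x,K)\<in>p. measure lborel K *\<^sub>R f x) - (\<Sum>(x,K)\<in>p. measure lborel K *\<^sub>R h x)) < 2 * (e / 5)"
      if p: "p tagged_division_of cbox a b" "\<gamma>g fine p" for p
    proof -
      have "norm ((\<Sum>(x,K)\<in>p. measure lborel K *\<^sub>R f x) - (\<Sum>(x,K)\<in>p. measure lborel K *\<^sub>R h x))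
          = norm (\<Sum>(x,K)\<in>p. measure lborel K *\<^sub>R (f x - h x))"
        by (simp add: sum_subtractf[symmetric] case_prod_unfold scaleR_diff_right)
      also have "\<dots> \<le> (\<Sum>(x,K)\<in>p. measure lborel K *\<^sub>R g x)"
      proof (rule sum_norm_le)
        fix y assume y: "y \<in> p"
        obtain x K where yK: "y = (x, K)" by (cases y)
        have "x \<in> {a..b}" using tagged_division_ofD(2,3)[OF p(1), of x K] y yK by auto
        thus "norm (case y of (x, K) \<Rightarrow> measure lborel K *\<^sub>R (f x - h x)) \<le> (case y of (x, K) \<Rightarrow> measure lborel K *\<^sub>R g x)"
          using fh by (simp add: yK mult_left_mono)
      qed
      also have "\<dots> < 2 * (e / 5)" using \<gamma>g(2)[OF p] G by (simp add: abs_if split: if_splits)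
      finally show ?thesis .
    qed
    show "\<exists>\<gamma>. gauge \<gamma> \<and> (\<forall>p1 p2. p1 tagged_division_of cbox a b \<and> \<gamma> fine p1 \<and> p2 tagged_division_of cbox a b \<and> \<gamma> fine p2 \<longrightarrow>
        norm ((\<Sum>(x,K)\<in>p1. measure lborel K *\<^sub>R f x) - (\<Sum>(x,K)\<in>p2. measure lborel K *\<^sub>R f x)) < e)"
    proof (intro exI[of _ "\<lambda>x. \<gamma>h x \<inter> \<gamma>g x"] conjI allI impI gauge_Int \<gamma>h(1) \<gamma>g(1))
      fix p1 p2
      let ?S = "\<lambda>f p. \<Sum>(x,K)\<in>p. measure lborel K *\<^sub>R f x"
      assume "p1 tagged_division_of cbox a b \<and> (\<lambda>x. \<gamma>h x \<inter> \<gamma>g x) fine p1 \<and> p2 tagged_division_of cbox a b \<and> (\<lambda>x. \<gamma>h x \<inter> \<gamma>g x) fine p2"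
      hence p: "p1 tagged_division_of cbox a b" "\<gamma>h fine p1" "\<gamma>g fine p1" "p2 tagged_division_of cbox a b" "\<gamma>h fine p2" "\<gamma>g fine p2"
        by (auto simp: fine_Int)
      have "norm (?S f p1 - ?S h p1) < 2 * (e / 5)" "norm (?S f p2 - ?S h p2) < 2 * (e / 5)"
           "norm (?S h p1 - ?S h p2) < e / 5"
        by (intro near \<gamma>h(2) p)+
      thus "norm (?S f p1 - ?S f p2) < e"
        using norm_triangle_ineq4[of "?S f p1 - ?S h p1 + (?S h p1 - ?S h p2)" "?S f p2 - ?S h p2"]
          norm_triangle_ineq[of "?S f p1 - ?S h p1" "?S h p1 - ?S h p2"] by simp
    qed
  qed
  thus ?thesis by simp
qed

text \<open>Away from 0 continuity is enough. Near 0, where \<open>f\<close> may be unbounded, it is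
  replaced by 0 at the cost of the integral of \<open>g\<close> over {0..\<delta>}, which is small
  by continuity of the indefinite integral. The bound \<open>g\<close> then carries integrability to
  the whole half-line.\<close>

lemma integrable_half_line_dominated:
  fixes f :: "real \<Rightarrow> 'b::banach"
  assumes cont: "continuous_on {0<..} f" and bound: "\<And>x. x > 0 \<Longrightarrow> norm (f x) \<le> g x"
    and g: "g integrable_on {0<..}"
  shows "f integrable_on {0<..}"
proof (rule integrable_on_all_intervals_integrable_bound[OF _ _ g])
  show "norm (f x) \<le> g x" if "x \<in> {0<..}" for x using bound that by simp
  let ?F = "\<lambda>x. if x \<in> {0<..} then f x else 0"
  let ?G = "\<lambda>x. if x \<in> {0<..} then g x else 0"
  have G: "?G integrable_on {c..d}" for c d
    using integrable_altD(1)[OF g, of c d] by simp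
  have pos: "?F integrable_on {0..L}" if L: "L > 0" for L
  proof (rule integrable_approximable)
    fix e :: real assume e: "e > 0"
    have "continuous_on {0..L} (\<lambda>x. integral {0..x} ?G)"
      by (rule indefinite_integral_continuous_1[OF G])
    hence "((\<lambda>x. integral {0..x} ?G) \<longlongrightarrow> integral {0..0} ?G) (at 0 within {0..L})"
      unfolding continuous_on_def by (rule bspec) (use L in auto)
    hence "\<forall>\<^sub>F x in at 0 within {0..L}. integral {0..x} ?G < e"
      using e by (intro order_tendstoD) auto
    then obtain d where d: "d > 0" "\<And>x. x \<in> {0..L} \<Longrightarrow> x \<noteq> 0 \<Longrightarrow> dist x 0 < d \<Longrightarrow> integral {0..x} ?G < e"
      unfolding eventually_at by blast
    define \<delta> where "\<delta> = min L (d / 2)"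
    have \<delta>: "0 < \<delta>" "\<delta> \<le> L" and Gd: "integral {0..\<delta>} ?G < e"
      using d L d(2)[of \<delta>] by (auto simp: \<delta>_def min_def)
    let ?h = "\<lambda>x. if x \<in> {\<delta>..L} then f x else 0"
    let ?g = "\<lambda>x. if x \<in> {0..\<delta>} then ?G x else 0"
    have "f integrable_on {\<delta>..L}"
      by (intro integrable_continuous_interval continuous_on_subset[OF cont]) (use \<delta> in auto)
    hence "?h integrable_on {0..L}"
      using \<delta> by (subst integrable_restrict_Int) (simp add: Int_absorb2 Int_commute min_absorb2 max_absorb2)
    moreover have "?g integrable_on {0..L}"
      using G[of 0 \<delta>] \<delta> by (subst integrable_restrict_Int) (simp add: min_absorb2 Int_absorb2)
    moreover have "integral {0..L} ?g = integral {0..\<delta>} ?G"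
      using \<delta> by (subst integral_restrict_Int) (simp add: Int_absorb2)
    moreover have "norm (?F x - ?h x) \<le> ?g x" if "x \<in> {0..L}" for x
      using that bound[of x] order_trans[OF norm_ge_zero bound[of x]] \<delta> by auto
    ultimately show "\<exists>h g. h integrable_on {0..L} \<and> g integrable_on {0..L} \<and>
      (\<forall>x\<in>{0..L}. norm (?F x - h x) \<le> g x) \<and> integral {0..L} g < e"
      using Gd by (intro exI[of _ ?h] exI[of _ ?g]) auto
  qed
  have neg: "?F integrable_on {c..0}" for c
    by (rule integrable_eq[of "\<lambda>_. 0"]) auto
  fix c d :: real
  define L where "L = max 1 (max \<bar>c\<bar> \<bar>d\<bar>)"
  have L: "L > 0" "{c..d} \<subseteq> {-L..L}" by (auto simp: L_def)
  have "?F integrable_on {-L..L}"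
    by (rule Henstock_Kurzweil_Integration.integrable_combine[OF _ _ neg pos[OF L(1)]]) (use L in auto)
  from integrable_subinterval_real[OF this L(2)] show "?F integrable_on cbox c d" by simp
qed

text \<open>Decay of order \<kappa> at 0 and at infinity, which makes a contour integral against a
  resolvent of size 1 / |z| absolutely convergent. Its value at 0 is 0, since 0 powr x = 0 for every
  x.\<close>

definition bump :: "real \<Rightarrow> real \<Rightarrow> real" where
  "bump \<kappa> r = min (r powr \<kappa>) (r powr (- \<kappa>))"

lemma bump_nonneg: "bump \<kappa> r \<ge> 0"
  by (simp add: bump_def)

lemma bump_integrable:
  assumes \<kappa>: "\<kappa> > 0"
  shows "(\<lambda>r. bump \<kappa> r / r) integrable_on {0<..}"
proof -
  have 1: "(\<lambda>r. r powr (\<kappa> - 1)) integrable_on {0..1}"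
    using has_integral_powr_from_0[of "\<kappa> - 1" 1] \<kappa> by (auto simp: integrable_on_def)
  have 2: "(\<lambda>r. r powr (- \<kappa> - 1)) integrable_on {1..}"
    using has_integral_powr_to_inf[of "- \<kappa> - 1" 1] \<kappa> by (auto simp: integrable_on_def)
  have b1: "(\<lambda>r. bump \<kappa> r / r) integrable_on {0<..1}"
  proof (rule integrable_eq)
    show "(\<lambda>r. r powr (\<kappa> - 1)) integrable_on {0<..1}"
      by (rule integrable_spike_set[OF 1]) (auto intro: negligible_subset[of "{0}"] negligible_subset[of "{}"])
    fix r :: real assume r: "r \<in> {0<..1}"
    have "r powr \<kappa> \<le> r powr (- \<kappa>)" using r \<kappa> by (intro powr_mono') auto
    thus "r powr (\<kappa> - 1) = bump \<kappa> r / r" using r by (simp add: bump_def powr_diff)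
  qed
  have b2: "(\<lambda>r. bump \<kappa> r / r) integrable_on {1..}"
  proof (rule integrable_eq[OF 2])
    fix r :: real assume r: "r \<in> {1..}"
    have "r powr (- \<kappa>) \<le> r powr \<kappa>" using r \<kappa> by (intro powr_mono) auto
    thus "r powr (- \<kappa> - 1) = bump \<kappa> r / r" using r by (simp add: bump_def powr_diff)
  qed
  have "(\<lambda>r. bump \<kappa> r / r) integrable_on {0<..1} \<union> {1..}"
    by (rule integrable_Un'[OF b1 b2 _ refl]) (auto intro: negligible_subset[of "{1}"])
  moreover have "{0<..1} \<union> {1..} = {0::real<..}" by auto
  ultimately show ?thesis by simp
qed

lemma continuous_bump: "continuous_on {0<..} (\<lambda>r. bump \<kappa> r / r)"
  unfolding bump_def by (intro continuous_intros) auto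

lemma set_integrable_bump_bound:
  fixes f :: "real \<Rightarrow> complex"
  assumes \<kappa>: "\<kappa> > 0" and cont: "continuous_on {0<..} f" and bound: "\<And>x. x > 0 \<Longrightarrow> cmod (f x) \<le> C * (bump \<kappa> x / x)"
  shows "set_integrable lborel {0<..} f"
proof -
  have "(\<lambda>r. bump \<kappa> r / r) absolutely_integrable_on {0<..}"
    by (rule nonnegative_absolutely_integrable_1[OF bump_integrable[OF \<kappa>]]) (auto simp: bump_nonneg)
  hence "integrable lebesgue (\<lambda>x. indicator {0<..} x *\<^sub>R (bump \<kappa> x / x))"
    unfolding set_integrable_def .
  moreover have "(\<lambda>x. indicator {0<..} x *\<^sub>R (bump \<kappa> x / x)) \<in> borel_measurable borel"
    by (rule borel_measurable_continuous_on_indicator[OF _ continuous_bump]) simp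
  ultimately have "set_integrable lborel {0<..} (\<lambda>r. bump \<kappa> r / r)"
    unfolding set_integrable_def by (simp add: integrable_completion)
  hence "set_integrable lborel {0<..} (\<lambda>r. C * (bump \<kappa> r / r))" by (intro set_integrable_mult_right) auto
  thus ?thesis
  proof (rule set_integrable_bound)
    show "set_borel_measurable lborel {0<..} f"
      using set_measurable_continuous_on[OF _ cont] unfolding set_borel_measurable_def by simp
    show "AE x in lborel. x \<in> {0<..} \<longrightarrow> norm (f x) \<le> norm (C * (bump \<kappa> x / x))"
    proof (intro AE_I2 impI)
      fix x :: real assume "x \<in> {0<..}"
      thus "norm (f x) \<le> norm (C * (bump \<kappa> x / x))"
        using order_trans[OF bound[of x] abs_ge_self] by simp
    qed
  qed
qed

text \<open>The difference of the squares is 2 \<mu> (Re z - c |z|) + (1 - c) / 2 (|z| - \<mu>)^2.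
  With c the cosine of the half-opening it states that a sector keeps a proportional distance from
  the negative reals.\<close>

lemma norm_add_wedge:
  assumes "cmod z * c \<le> Re z" "\<mu> \<ge> 0" "-1 \<le> c" "c \<le> 1"
  shows "sqrt ((1 + c) / 2) * (cmod z + \<mu>) \<le> cmod (z + of_real \<mu>)"
proof (rule power2_le_imp_le)
  have "\<mu> * (cmod z * c) \<le> \<mu> * Re z" using assms by (intro mult_left_mono)
  moreover have "(cmod (z + of_real \<mu>))\<^sup>2 = (cmod z)\<^sup>2 + 2 * (\<mu> * Re z) + \<mu>\<^sup>2"
    unfolding cmod_power2 by (simp add: power2_eq_square algebra_simps)
  moreover have "0 \<le> (1 - c) / 2 * (cmod z - \<mu>)\<^sup>2" using assms by simp
  moreover have "(1 - c) / 2 * (cmod z - \<mu>)\<^sup>2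
      = (cmod z)\<^sup>2 + 2 * (\<mu> * (cmod z * c)) + \<mu>\<^sup>2 - (1 + c) / 2 * (cmod z + \<mu>)\<^sup>2"
    by (simp add: power2_eq_square field_simps)
  moreover have "(sqrt ((1 + c) / 2) * (cmod z + \<mu>))\<^sup>2 = (1 + c) / 2 * (cmod z + \<mu>)\<^sup>2"
    using assms by (simp add: power_mult_distrib)
  ultimately show "(sqrt ((1 + c) / 2) * (cmod z + \<mu>))\<^sup>2 \<le> (cmod (z + of_real \<mu>))\<^sup>2" by linarith
qed simp

lemma interior_wedge_nonzero:
  assumes "c = 1 \<or> c = -1"
  shows "0 \<notin> interior (wedge c \<theta>)"
proof
  assume "0 \<in> interior (wedge c \<theta>)"
  then obtain e where e: "e > 0" "ball 0 e \<subseteq> wedge c \<theta>" by (meson mem_interior)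
  have "- (of_real (c * e / 2) * \<i>) \<in> ball (0::complex) e" using e assms by (auto simp: norm_mult)
  hence "- (of_real (c * e / 2) * \<i>) \<in> wedge c \<theta>" using e by blast
  thus False using e assms unfolding wedge_def by auto
qed

text \<open>The resolvent is controlled on the closed complement of the sector, boundary rays
  included, because the contour consists of these rays.\<close>

locale sectorial_op = complex_closed_op J D A for J :: "'a::banach \<Rightarrow>\<^sub>L 'a" and D A +
  fixes \<theta> M :: real
  assumes \<theta>: "0 < \<theta>" "\<theta> < pi"
    and ext_rho: "\<And>z. z \<noteq> 0 \<Longrightarrow> Re z \<le> cmod z * cos \<theta> \<Longrightarrow> z \<in> rho"
    and ext_bound: "\<And>z. z \<noteq> 0 \<Longrightarrow> Re z \<le> cmod z * cos \<theta> \<Longrightarrow> cmod z * norm (res z) \<le> M"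
begin

definition q :: real where "q = sqrt ((1 + cos \<theta>) / 2)"

lemma cos_bounds: "-1 < cos \<theta>" "cos \<theta> \<le> 1"
  using cos_monotone_0_pi[of \<theta> pi] \<theta> by auto

lemma q: "0 < q" "q \<le> 1"
  using cos_bounds by (auto simp: q_def)

definition wide :: "complex set" where "wide = {z. cmod z * cos \<theta> \<le> Re z}"

lemma wedge_wide: "c = 1 \<or> c = -1 \<Longrightarrow> wedge c \<theta> \<subseteq> wide"
  using wedge_Re[of c \<theta>] \<theta> by (auto simp: wide_def)

lemma norm_add_wide: "z \<in> wide \<Longrightarrow> \<mu> \<ge> 0 \<Longrightarrow> q * (cmod z + \<mu>) \<le> cmod (z + of_real \<mu>)"
  unfolding q_def wide_def using norm_add_wedge[of z "cos \<theta>" \<mu>] cos_bounds by auto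

lemma wide_slit: "z \<in> wide \<Longrightarrow> z \<noteq> 0 \<Longrightarrow> z \<notin> \<real>\<^sub>\<le>\<^sub>0"
proof
  assume z: "z \<in> wide" "z \<noteq> 0" "z \<in> \<real>\<^sub>\<le>\<^sub>0"
  then obtain x where x: "z = of_real x" "x \<le> 0" by (auto elim: nonpos_Reals_cases)
  hence "x < 0" using z by auto
  hence "(- x) * (-1) < (- x) * cos \<theta>" using cos_bounds by (intro mult_strict_left_mono) auto
  thus False using z x \<open>x < 0\<close> by (auto simp: wide_def)
qed

lemma ray_wide: "c = 1 \<or> c = -1 \<Longrightarrow> r \<ge> 0 \<Longrightarrow> of_real r * cis (c * \<theta>) \<in> wide"
  by (auto simp: wide_def norm_mult)

lemma M: "M \<ge> 0"
proof -
  have "0 \<le> cmod (-1) * norm (res (-1))" by simp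
  also have "\<dots> \<le> M" by (rule ext_bound) (use cos_bounds in auto)
  finally show ?thesis .
qed

lemma ray_rho: "c = 1 \<or> c = -1 \<Longrightarrow> r > 0 \<Longrightarrow> of_real r * cis (c * \<theta>) \<in> rho"
  by (rule ext_rho) (auto simp: norm_mult)

lemma ray_bound: "c = 1 \<or> c = -1 \<Longrightarrow> r > 0 \<Longrightarrow> norm (res (of_real r * cis (c * \<theta>))) \<le> M / r"
  using ext_bound[of "of_real r * cis (c * \<theta>)"] by (auto simp: norm_mult field_simps)

text \<open>The usual class of symbols decaying at both ends, with order and constant displayed
  because norms of the resulting operators are read off from them. As 0 belongs to
  \<open>wide\<close> and \<open>bump\<close> vanishes there, the condition contains k 0 =
  0.\<close>

definition decays :: "real \<Rightarrow> real \<Rightarrow> (complex \<Rightarrow> complex) \<Rightarrow> bool" where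
  "decays \<kappa> C k \<longleftrightarrow> \<kappa> > 0 \<and> k holomorphic_on - \<real>\<^sub>\<le>\<^sub>0 \<and> (\<forall>z\<in>wide. cmod (k z) \<le> C * bump \<kappa> (cmod z))"

lemma decays_zero: "decays \<kappa> C k \<Longrightarrow> k 0 = 0"
proof -
  assume k: "decays \<kappa> C k"
  have "0 \<in> wide" by (simp add: wide_def)
  hence "cmod (k 0) \<le> C * bump \<kappa> (cmod 0)" using k unfolding decays_def by blast
  thus ?thesis by (simp add: bump_def)
qed

lemma decays_C: "decays \<kappa> C k \<Longrightarrow> C \<ge> 0"
proof -
  assume "decays \<kappa> C k"
  moreover have "1 \<in> wide" by (simp add: wide_def)
  ultimately have "cmod (k 1) \<le> C * bump \<kappa> (cmod 1)" unfolding decays_def by blast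
  from order_trans[OF norm_ge_zero this] show ?thesis by (simp add: bump_def)
qed

lemma decays_div:
  assumes k: "decays \<kappa> C k" and \<mu>: "\<mu> > 0"
  shows "decays \<kappa> (C / (q * \<mu>)) (\<lambda>z. k z / (z + of_real \<mu>))"
  unfolding decays_def
proof (intro conjI ballI)
  have ne: "z + of_real \<mu> \<noteq> 0" if "z \<in> - \<real>\<^sub>\<le>\<^sub>0" for z
  proof
    assume "z + of_real \<mu> = 0"
    hence "z = of_real (- \<mu>)" by (simp add: add_eq_0_iff2)
    thus False using that \<mu> by (auto simp: complex_nonpos_Reals_iff)
  qed
  show "(\<lambda>z. k z / (z + of_real \<mu>)) holomorphic_on - \<real>\<^sub>\<le>\<^sub>0"
    by (intro holomorphic_intros) (use k ne in \<open>auto simp: decays_def\<close>)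
  fix z assume z: "z \<in> wide"
  have "q * \<mu> \<le> q * (cmod z + \<mu>)" using q by (intro mult_left_mono) auto
  also have "\<dots> \<le> cmod (z + of_real \<mu>)" using norm_add_wide[OF z, of \<mu>] \<mu> by simp
  finally have d: "q * \<mu> \<le> cmod (z + of_real \<mu>)" .
  have "cmod (k z) \<le> C * bump \<kappa> (cmod z)" using k z unfolding decays_def by blast
  hence "cmod (k z) / cmod (z + of_real \<mu>) \<le> C * bump \<kappa> (cmod z) / (q * \<mu>)"
    using d q \<mu> decays_C[OF k] bump_nonneg by (intro frac_le) auto
  thus "cmod (k z / (z + of_real \<mu>)) \<le> C / (q * \<mu>) * bump \<kappa> (cmod z)" by (simp add: norm_divide)
qed (use k in \<open>auto simp: decays_def\<close>)

lemma continuous_on_decays: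
  assumes k: "decays \<kappa> C k"
  shows "continuous_on wide k"
  unfolding continuous_on_def
proof
  fix z assume z: "z \<in> wide"
  have \<kappa>: "\<kappa> > 0" using k by (simp add: decays_def)
  show "(k \<longlongrightarrow> k z) (at z within wide)"
  proof (cases "z = 0")
    case True
    have "((\<lambda>z. cmod z) \<longlongrightarrow> cmod 0) (at 0 within wide)" by (intro tendsto_intros)
    hence "((\<lambda>z. C * (cmod z powr \<kappa>)) \<longlongrightarrow> C * (0 powr \<kappa>)) (at 0 within wide)"
      using \<kappa> by (intro tendsto_intros tendsto_powr2) auto
    hence "((\<lambda>z. C * (cmod z powr \<kappa>)) \<longlongrightarrow> 0) (at 0 within wide)" by simp
    moreover have "\<forall>\<^sub>F z in at 0 within wide. cmod (k z) \<le> C * (cmod z powr \<kappa>)"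
      unfolding eventually_at_filter
    proof (intro always_eventually allI impI)
      fix z assume "z \<noteq> 0" "z \<in> wide"
      hence "cmod (k z) \<le> C * bump \<kappa> (cmod z)" using k unfolding decays_def by blast
      also have "\<dots> \<le> C * (cmod z powr \<kappa>)" using decays_C[OF k] by (intro mult_left_mono) (auto simp: bump_def)
      finally show "cmod (k z) \<le> C * (cmod z powr \<kappa>)" .
    qed
    ultimately have "(k \<longlongrightarrow> 0) (at 0 within wide)" by (rule Lim_null_comparison[rotated])
    thus ?thesis using True decays_zero[OF k] by simp
  next
    case False
    have "k field_differentiable at z"
      using k wide_slit[OF z False] unfolding decays_def
      by (intro holomorphic_on_imp_differentiable_at[of k "- \<real>\<^sub>\<le>\<^sub>0"]) auto
    hence "isCont k z" by (rule field_differentiable_imp_continuous_at)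
    thus ?thesis by (metis continuous_within isCont_def tendsto_within_subset top_greatest)
  qed
qed

lemma continuous_on_decays_ray:
  assumes "decays \<kappa> C k" "c = 1 \<or> c = -1"
  shows "continuous_on {0<..} (\<lambda>r. k (of_real r * cis (c * \<theta>)))"
  by (rule continuous_on_compose2[OF continuous_on_decays[OF assms(1)]])
     (use ray_wide[OF assms(2)] in \<open>auto intro!: continuous_intros\<close>)

lemma decays_ray_bound:
  assumes "decays \<kappa> C k" "c = 1 \<or> c = -1" "r > 0"
  shows "cmod (k (of_real r * cis (c * \<theta>))) \<le> C * bump \<kappa> r"
  using assms(1,3) ray_wide[OF assms(2), of r] unfolding decays_def by (auto simp: norm_mult)

text \<open>The contour integral of k(z) (z - A)^(-1) parametrised by the radius. Shape and signs
  copy the integrand of \<open>frac_reg\<close>, so that the regularised fractional power with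
  \<sigma> nonzero is by mere unfolding \<open>calc\<close> of a scalar symbol plus a bounded
  operator.\<close>

definition branch :: "(complex \<Rightarrow> complex) \<Rightarrow> real \<Rightarrow> real \<Rightarrow> ('a \<Rightarrow>\<^sub>L 'a)" where
  "branch k c r = cscaleL J (k (of_real r * cis (c * \<theta>)) * cis (c * \<theta>)) (res (of_real r * cis (c * \<theta>)))"

definition integrand :: "(complex \<Rightarrow> complex) \<Rightarrow> real \<Rightarrow> ('a \<Rightarrow>\<^sub>L 'a)" where
  "integrand k r = branch k (-1) r - branch k 1 r"

definition calc :: "(complex \<Rightarrow> complex) \<Rightarrow> ('a \<Rightarrow>\<^sub>L 'a)" where
  "calc k = cscaleL J (1 / (2 * of_real pi * \<i>)) (integral {0<..} (integrand k))"

definition bump_integral :: "real \<Rightarrow> real" where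
  "bump_integral \<kappa> = integral {0<..} (\<lambda>r. bump \<kappa> r / r)"

lemma branch_bound:
  assumes "decays \<kappa> C k" "c = 1 \<or> c = -1" "r > 0"
  shows "norm (branch k c r) \<le> C * M * (bump \<kappa> r / r)"
proof -
  have "norm (branch k c r) \<le> (C * bump \<kappa> r) * (M / r)"
    unfolding branch_def norm_cscaleL norm_mult norm_cis mult_1_right
    using decays_ray_bound[OF assms] ray_bound[OF assms(2,3)] decays_C[OF assms(1)] bump_nonneg
    by (intro mult_mono) auto
  thus ?thesis by (simp add: mult_ac)
qed

lemma continuous_branch:
  assumes "decays \<kappa> C k" "c = 1 \<or> c = -1"
  shows "continuous_on {0<..} (branch k c)"
proof -
  have "continuous_on {0<..} (\<lambda>r. res (of_real r * cis (c * \<theta>)))"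
    by (rule continuous_on_compose2[OF continuous_on_res[of rho]])
       (use ray_rho[OF assms(2)] in \<open>auto intro!: continuous_intros\<close>)
  thus ?thesis
    unfolding branch_def cscaleL_eq
    by (intro bounded_bilinear.continuous_on[OF bounded_bilinear_blinfun_compose]
        bounded_linear.continuous_on[OF bounded_linear_cmult] continuous_intros continuous_on_decays_ray[OF assms])
qed

lemma integrand_integrable:
  assumes k: "decays \<kappa> C k"
  shows "integrand k integrable_on {0<..}" "norm (calc k) \<le> C * M * bump_integral \<kappa> / pi"
proof -
  have \<kappa>: "\<kappa> > 0" using k by (simp add: decays_def)
  have cont: "continuous_on {0<..} (integrand k)"
    unfolding integrand_def by (intro continuous_intros continuous_branch[OF k]) auto
  have bound: "norm (integrand k r) \<le> 2 * C * M * (bump \<kappa> r / r)" if "r > 0" for r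
    using norm_triangle_ineq4[of "branch k (-1) r" "branch k 1 r"]
      branch_bound[OF k _ that, of 1] branch_bound[OF k _ that, of "-1"]
    unfolding integrand_def by simp
  have g: "(\<lambda>r. 2 * C * M * (bump \<kappa> r / r)) integrable_on {0<..}"
    using bump_integrable[OF \<kappa>] by (rule integrable_on_mult_right)
  show int: "integrand k integrable_on {0<..}"
    by (rule integrable_half_line_dominated[OF cont bound g])
  have "norm (integral {0<..} (integrand k)) \<le> integral {0<..} (\<lambda>r. 2 * C * M * (bump \<kappa> r / r))"
    by (rule Henstock_Kurzweil_Integration.integral_norm_bound_integral[OF int g]) (use bound in auto)
  also have "\<dots> = 2 * C * M * bump_integral \<kappa>"
    unfolding bump_integral_def by (rule Henstock_Kurzweil_Integration.integral_mult_right)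
  finally show "norm (calc k) \<le> C * M * bump_integral \<kappa> / pi"
    unfolding calc_def norm_cscaleL by (simp add: norm_divide norm_mult field_simps)
qed

lemma calc_diff:
  assumes "decays \<kappa> C k" "decays \<kappa>' C' k'"
  shows "calc (\<lambda>z. k z - k' z) = calc k - calc k'"
proof -
  have "integrand (\<lambda>z. k z - k' z) = (\<lambda>r. integrand k r - integrand k' r)"
    by (rule ext, rule blinfun_eqI)
       (simp add: integrand_def branch_def blinfun.diff_left left_diff_distrib cscale_diff_left)
  hence "integral {0<..} (integrand (\<lambda>z. k z - k' z)) = integral {0<..} (integrand k) - integral {0<..} (integrand k')"
    using Henstock_Kurzweil_Integration.integral_diff[OF integrand_integrable(1)[OF assms(1)] integrand_integrable(1)[OF assms(2)]] by simp
  thus ?thesis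
    unfolding calc_def by (intro blinfun_eqI) (simp add: blinfun.diff_left cscale_diff_right)
qed

lemma calc_cong:
  assumes "\<And>z. z \<in> wide \<Longrightarrow> z \<noteq> 0 \<Longrightarrow> k z = k' z"
  shows "calc k = calc k'"
proof -
  have "integrand k r = integrand k' r" if "r \<in> {0<..}" for r
    using assms[OF ray_wide[of 1 r]] assms[OF ray_wide[of "-1" r]] that
    by (auto simp: integrand_def branch_def)
  hence "integral {0<..} (integrand k) = integral {0<..} (integrand k')"
    by (rule Henstock_Kurzweil_Integration.integral_cong)
  thus ?thesis by (simp add: calc_def)
qed

text \<open>Each boundary ray is rotated onto the positive reals inside its own wedge; the pole -
  \<mu> lies outside \<open>wide\<close>. So the two rays give the same value, and the scalar
  contour integral of k(z) / (z + \<mu>) is 0.\<close>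

lemma scalar_ray:
  assumes k: "decays \<kappa> C k" and c: "c = 1 \<or> c = -1" and \<mu>: "\<mu> > 0"
  defines "h \<equiv> \<lambda>z. k z / (z + of_real \<mu>)"
  shows "set_integrable lborel {0<..} (\<lambda>r. cis (c * \<theta>) * h (of_real r * cis (c * \<theta>)))"
    and "(LBINT r:{0<..}. cis (c * \<theta>) * h (of_real r * cis (c * \<theta>))) = (LBINT r:{0<..}. h (of_real r))"
proof -
  have \<kappa>: "\<kappa> > 0" using k by (simp add: decays_def)
  note C = decays_C[OF k]
  have hd: "decays \<kappa> (C / (q * \<mu>)) h" unfolding h_def by (rule decays_div[OF k \<mu>])
  have h_bound: "cmod (h z) \<le> C / q * (bump \<kappa> (cmod z) / cmod z)" if z: "z \<in> wide" "z \<noteq> 0" for z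
  proof -
    have "q * cmod z \<le> q * (cmod z + \<mu>)" using q \<mu> by (intro mult_left_mono) auto
    also have "\<dots> \<le> cmod (z + of_real \<mu>)" using norm_add_wide[OF z(1), of \<mu>] \<mu> by simp
    finally have d: "q * cmod z \<le> cmod (z + of_real \<mu>)" .
    have "cmod (k z) \<le> C * bump \<kappa> (cmod z)" using k z unfolding decays_def by blast
    hence "cmod (k z) / cmod (z + of_real \<mu>) \<le> C * bump \<kappa> (cmod z) / (q * cmod z)"
      using d q z C bump_nonneg by (intro frac_le) auto
    thus ?thesis by (simp add: h_def norm_divide)
  qed
  show s1: "set_integrable lborel {0<..} (\<lambda>r. cis (c * \<theta>) * h (of_real r * cis (c * \<theta>)))"
  proof (rule set_integrable_bump_bound[OF \<kappa>])
    show "continuous_on {0<..} (\<lambda>r. cis (c * \<theta>) * h (of_real r * cis (c * \<theta>)))"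
      by (intro continuous_intros continuous_on_decays_ray[OF hd c])
    show "cmod (cis (c * \<theta>) * h (of_real r * cis (c * \<theta>))) \<le> C / q * (bump \<kappa> r / r)" if "r > 0" for r
      using h_bound[OF ray_wide[OF c, of r]] that by (auto simp: norm_mult)
  qed
  have real_wide: "of_real r \<in> wide" if "r \<ge> 0" for r
    using that cos_bounds mult_left_mono[of "cos \<theta>" 1 r] by (auto simp: wide_def)
  have s2: "set_integrable lborel {0<..} (\<lambda>r. h (of_real r))"
  proof (rule set_integrable_bump_bound[OF \<kappa>])
    show "continuous_on {0<..} (\<lambda>r. h (of_real r))"
      by (rule continuous_on_compose2[OF continuous_on_decays[OF hd]]) (auto intro!: continuous_intros real_wide)
    show "cmod (h (of_real r)) \<le> C / q * (bump \<kappa> r / r)" if "r > 0" for r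
      using h_bound[OF real_wide[of r]] that by auto
  qed
  have "((\<lambda>L. integral {0..L} (\<lambda>x. 1 * h (of_real x * 1)) - integral {0..L} (\<lambda>x. cis (c * \<theta>) * h (of_real x * cis (c * \<theta>)))) \<longlongrightarrow> 0) at_top"
  proof (rule ray_rotation[OF convex_wedge[of c \<theta>], where B = "\<lambda>L. C / q * ((L * q) powr (- \<kappa>) / (L * q))"])
    show "of_real x * 1 \<in> wedge c \<theta> \<and> of_real x * cis (c * \<theta>) \<in> wedge c \<theta>" if "x \<ge> 0" for x
      using wedge_rays[OF c \<theta> that] by simp
    show "continuous_on (wedge c \<theta>) h"
      by (rule continuous_on_subset[OF continuous_on_decays[OF hd] wedge_wide[OF c]])
    have "interior (wedge c \<theta>) \<subseteq> - \<real>\<^sub>\<le>\<^sub>0"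
    proof
      fix z assume z: "z \<in> interior (wedge c \<theta>)"
      hence "z \<noteq> 0" using interior_wedge_nonzero[OF c] by metis
      thus "z \<in> - \<real>\<^sub>\<le>\<^sub>0" using z interior_subset wedge_wide[OF c] wide_slit by blast
    qed
    thus "h holomorphic_on interior (wedge c \<theta>)"
      using hd unfolding decays_def by (meson holomorphic_on_subset)
    show "\<forall>\<^sub>F L in at_top. \<forall>z\<in>closed_segment (of_real L * 1) (of_real L * cis (c * \<theta>)).
        cmod (h z) \<le> C / q * ((L * q) powr (- \<kappa>) / (L * q))"
      using eventually_gt_at_top[of 0]
    proof eventually_elim
      fix L :: real assume L: "L > 0"
      show "\<forall>z\<in>closed_segment (of_real L * 1) (of_real L * cis (c * \<theta>)). cmod (h z) \<le> C / q * ((L * q) powr (- \<kappa>) / (L * q))"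
      proof
        fix z assume zs: "z \<in> closed_segment (of_real L * 1) (of_real L * cis (c * \<theta>))"
        then obtain x where x: "0 \<le> x" "x \<le> 1" "z = (1 - x) *\<^sub>R (of_real L * 1) + x *\<^sub>R (of_real L * cis (c * \<theta>))"
          unfolding in_segment by blast
        have "z \<in> wedge c \<theta>"
          using closed_segment_subset[OF _ _ convex_wedge[of c \<theta>]] wedge_rays[OF c \<theta>, of L] L zs by auto
        hence zw: "z \<in> wide" using wedge_wide[OF c] by blast
        have e: "of_real (x * L) * cis (c * \<theta>) \<in> wide" using ray_wide[OF c, of "x * L"] x L by auto
        \<comment> \<open>A point of the far side is a point of the ray plus a nonnegative real, the
          radii adding up to L, so \<open>norm_add_wide\<close> keeps it at distance q L from
          0.\<close>
        have "q * L = q * (cmod (of_real (x * L) * cis (c * \<theta>)) + (1 - x) * L)"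
          using x L by (simp add: norm_mult algebra_simps)
        also have "\<dots> \<le> cmod (of_real (x * L) * cis (c * \<theta>) + of_real ((1 - x) * L))"
          by (rule norm_add_wide[OF e]) (use x L in auto)
        also have "of_real (x * L) * cis (c * \<theta>) + of_real ((1 - x) * L) = z"
          unfolding x(3) by (simp add: scaleR_conv_of_real algebra_simps)
        finally have zL: "L * q \<le> cmod z" by (simp add: mult.commute)
        have Lq: "L * q > 0" using L q by simp
        have "cmod (h z) \<le> C / q * (bump \<kappa> (cmod z) / cmod z)"
        proof (rule h_bound[OF zw])
          show "z \<noteq> 0" using zL Lq by (metis norm_zero not_le)
        qed
        also have "\<dots> \<le> C / q * ((L * q) powr (- \<kappa>) / (L * q))"
        proof (intro mult_left_mono frac_le)
          have "bump \<kappa> (cmod z) \<le> cmod z powr (- \<kappa>)" by (simp add: bump_def)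
          also have "\<dots> \<le> (L * q) powr (- \<kappa>)" using zL Lq \<kappa> by (intro powr_mono2') auto
          finally show "bump \<kappa> (cmod z) \<le> (L * q) powr (- \<kappa>)" .
        qed (use zL Lq C q in auto)
        finally show "cmod (h z) \<le> C / q * ((L * q) powr (- \<kappa>) / (L * q))" .
      qed
    qed
    have "((\<lambda>L. C / q * ((L * q) powr (- \<kappa>) / q)) \<longlongrightarrow> 0) at_top"
    proof -
      have "((\<lambda>L. (L * q) powr (- \<kappa>)) \<longlongrightarrow> 0) at_top"
      proof (rule tendsto_neg_powr)
        show "filterlim (\<lambda>L. L * q) at_top at_top" using q(1) by real_asymp
      qed (use \<kappa> in simp)
      from tendsto_mult_left[OF tendsto_divide[OF this tendsto_const[of q]], of "C / q"] q show ?thesis by simp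
    qed
    moreover have "\<forall>\<^sub>F L in at_top. C / q * ((L * q) powr (- \<kappa>) / q) = L * (C / q * ((L * q) powr (- \<kappa>) / (L * q)))"
      using eventually_gt_at_top[of 0] by eventually_elim (use q in \<open>simp add: field_simps\<close>)
    ultimately show "((\<lambda>L. L * (C / q * ((L * q) powr (- \<kappa>) / (L * q)))) \<longlongrightarrow> 0) at_top"
      by (rule Lim_transform_eventually)
  qed
  moreover have "((\<lambda>L. integral {0..L} (\<lambda>x. 1 * h (of_real x * 1)) - integral {0..L} (\<lambda>x. cis (c * \<theta>) * h (of_real x * cis (c * \<theta>))))
     \<longlongrightarrow> (LBINT r:{0<..}. h (of_real r)) - (LBINT r:{0<..}. cis (c * \<theta>) * h (of_real r * cis (c * \<theta>)))) at_top"
    using tendsto_diff[OF tendsto_integral_half_line[OF s2] tendsto_integral_half_line[OF s1]] by simp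
  ultimately have "(LBINT r:{0<..}. h (of_real r)) - (LBINT r:{0<..}. cis (c * \<theta>) * h (of_real r * cis (c * \<theta>))) = 0"
    using tendsto_unique[OF trivial_limit_at_top_linorder] by blast
  thus "(LBINT r:{0<..}. cis (c * \<theta>) * h (of_real r * cis (c * \<theta>))) = (LBINT r:{0<..}. h (of_real r))" by simp
qed

text \<open>This is (\<mu> + A)^(-1); the sign appears because \<open>res z\<close> is (z -
  A)^(-1).\<close>

definition Rp :: "real \<Rightarrow> ('a \<Rightarrow>\<^sub>L 'a)" where "Rp \<mu> = - res (of_real (- \<mu>))"

lemma neg_rho: "\<mu> > 0 \<Longrightarrow> of_real (- \<mu>) \<in> rho"
  using cos_bounds mult_left_mono[of "-1" "cos \<theta>" \<mu>] by (intro ext_rho) auto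

lemma norm_Rp: "\<mu> > 0 \<Longrightarrow> norm (Rp \<mu>) \<le> M / \<mu>"
  using ext_bound[of "of_real (- \<mu>)"] cos_bounds mult_left_mono[of "-1" "cos \<theta>" \<mu>]
  by (auto simp: Rp_def field_simps)

lemma Rp_cscale: "\<mu> > 0 \<Longrightarrow> Rp \<mu> (cscale J c x) = cscale J c (Rp \<mu> x)"
  using res_cscale[OF neg_rho] by (simp add: Rp_def blinfun.minus_left cscale_minus_right)

lemma Rp_res:
  assumes \<mu>: "\<mu> > 0" and z: "z \<in> rho" "z + of_real \<mu> \<noteq> 0"
  shows "Rp \<mu> (res z x) = cscale J (1 / (z + of_real \<mu>)) (res z x + Rp \<mu> x)"
proof -
  have "res (of_real (- \<mu>)) x - res z x = cscale J (z + of_real \<mu>) (res (of_real (- \<mu>)) (res z x))"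
    using resolvent_identity[OF neg_rho[OF \<mu>] z(1), of x] by simp
  hence "res z x + Rp \<mu> x = cscale J (z + of_real \<mu>) (Rp \<mu> (res z x))"
    by (simp add: Rp_def blinfun.minus_left cscale_minus_right algebra_simps)
  thus ?thesis using z(2) by simp
qed

text \<open>Multiplicativity of the calculus for the single factor 1 / (z + \<mu>). The resolvent
  identity produces the desired integral plus a scalar contour integral times
  \<open>Rp \<mu>\<close>, and the scalar one vanishes by \<open>scalar_ray\<close>.\<close>

lemma Rp_calc:
  assumes k: "decays \<kappa> C k" and \<mu>: "\<mu> > 0"
  shows "Rp \<mu> o\<^sub>L calc k = calc (\<lambda>z. k z / (z + of_real \<mu>))"
proof -
  define h where "h z = k z / (z + of_real \<mu>)" for z
  define s where "s c r = cis (c * \<theta>) * h (of_real r * cis (c * \<theta>))" for c r :: real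
  have hd: "decays \<kappa> (C / (q * \<mu>)) h" unfolding h_def by (rule decays_div[OF k \<mu>])
  have br: "Rp \<mu> o\<^sub>L branch k c r = branch h c r + cscaleL J (s c r) (Rp \<mu>)" if c: "c = 1 \<or> c = -1" and r: "r > 0" for c r
  proof (rule blinfun_eqI)
    fix x
    let ?z = "of_real r * cis (c * \<theta>)"
    have "0 < q * (cmod ?z + \<mu>)" using q \<mu> r by (simp add: norm_mult add_pos_pos)
    also have "\<dots> \<le> cmod (?z + of_real \<mu>)" using norm_add_wide[OF ray_wide[OF c, of r], of \<mu>] r \<mu> by simp
    finally have "?z + of_real \<mu> \<noteq> 0" by auto
    from Rp_res[OF \<mu> ray_rho[OF c r] this, of x]
    show "(Rp \<mu> o\<^sub>L branch k c r) x = (branch h c r + cscaleL J (s c r) (Rp \<mu>)) x"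
      by (simp add: branch_def blinfun.add_left Rp_cscale[OF \<mu>] h_def s_def cscale_add_right mult_ac)
  qed
  have eq: "Rp \<mu> o\<^sub>L integrand k r = integrand h r + cscaleL J (s (-1) r - s 1 r) (Rp \<mu>)" if "r \<in> {0<..}" for r
  proof -
    have "Rp \<mu> o\<^sub>L integrand k r = (Rp \<mu> o\<^sub>L branch k (-1) r) - (Rp \<mu> o\<^sub>L branch k 1 r)"
      unfolding integrand_def by (intro blinfun_eqI) (simp add: blinfun.diff_left blinfun.diff_right)
    also have "\<dots> = (branch h (-1) r + cscaleL J (s (-1) r) (Rp \<mu>)) - (branch h 1 r + cscaleL J (s 1 r) (Rp \<mu>))"
      using br[of "-1" r] br[of 1 r] that by simp
    also have "\<dots> = integrand h r + cscaleL J (s (-1) r - s 1 r) (Rp \<mu>)"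
      unfolding integrand_def by (intro blinfun_eqI) (simp add: blinfun.diff_left blinfun.add_left cscale_diff_left)
    finally show ?thesis .
  qed
  have s_int: "s c integrable_on {0<..}" "integral {0<..} (s c) = (LBINT r:{0<..}. h (of_real r))" if "c = 1 \<or> c = -1" for c
    using set_borel_integral_eq_integral[OF scalar_ray(1)[OF k that \<mu>]] scalar_ray(2)[OF k that \<mu>]
    unfolding s_def h_def by simp_all
  have s0: "(\<lambda>r. s (-1) r - s 1 r) integrable_on {0<..}" "integral {0<..} (\<lambda>r. s (-1) r - s 1 r) = 0"
    using s_int[of 1] s_int[of "-1"]
    by (simp_all add: Henstock_Kurzweil_Integration.integrable_diff Henstock_Kurzweil_Integration.integral_diff)
  have bl: "bounded_linear (\<lambda>c. cscaleL J c (Rp \<mu>))"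
    unfolding cscaleL_eq
    by (rule bounded_linear_compose[OF bounded_bilinear.bounded_linear_left[OF bounded_bilinear_blinfun_compose] bounded_linear_cmult])
  have "Rp \<mu> o\<^sub>L integral {0<..} (integrand k) = integral {0<..} (\<lambda>r. Rp \<mu> o\<^sub>L integrand k r)"
    using integral_linear[OF integrand_integrable(1)[OF k] bounded_bilinear.bounded_linear_right[OF bounded_bilinear_blinfun_compose, of "Rp \<mu>"]]
    by (simp add: o_def)
  also have "\<dots> = integral {0<..} (\<lambda>r. integrand h r + cscaleL J (s (-1) r - s 1 r) (Rp \<mu>))"
    by (rule Henstock_Kurzweil_Integration.integral_cong) (rule eq)
  also have "\<dots> = integral {0<..} (integrand h) + integral {0<..} (\<lambda>r. cscaleL J (s (-1) r - s 1 r) (Rp \<mu>))"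
    using integrable_linear[OF s0(1) bl]
    by (intro Henstock_Kurzweil_Integration.integral_add integrand_integrable(1)[OF hd]) (simp add: o_def)
  also have "integral {0<..} (\<lambda>r. cscaleL J (s (-1) r - s 1 r) (Rp \<mu>)) = cscaleL J 0 (Rp \<mu>)"
    using integral_linear[OF s0(1) bl] s0(2) by (simp add: o_def)
  also have "cscaleL J 0 (Rp \<mu>) = 0" by (intro blinfun_eqI) simp
  finally have "Rp \<mu> o\<^sub>L integral {0<..} (integrand k) = integral {0<..} (integrand h)" by simp
  hence "Rp \<mu> (integral {0<..} (integrand k) x) = integral {0<..} (integrand h) x" for x
    by (metis blinfun_apply_blinfun_compose)
  thus ?thesis unfolding calc_def h_def[symmetric]
    by (intro blinfun_eqI) (simp add: Rp_cscale[OF \<mu>])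
qed

end

section \<open>Evaluation of a rational symbol by residues, and the operators A^(\<sigma> - j) (1 +
  A)^(-\<sigma>)\<close>

section \<open>Regularised fractional powers\<close>

lemma bump_boundI:
  assumes "r > 0" "\<kappa> \<ge> 0" "C \<ge> 0" "r \<le> 1 \<Longrightarrow> x \<le> C * r powr \<kappa>" "r \<ge> 1 \<Longrightarrow> x \<le> C * r powr (- \<kappa>)"
  shows "x \<le> C * bump \<kappa> r"
proof (cases "r \<le> 1")
  case True
  hence "r powr \<kappa> \<le> r powr (- \<kappa>)" using assms by (intro powr_mono') auto
  thus ?thesis using assms(4)[OF True] by (simp add: bump_def min_absorb1)
next
  case False
  hence "r powr (- \<kappa>) \<le> r powr \<kappa>" using assms by (intro powr_mono) auto
  thus ?thesis using assms(5) False by (simp add: bump_def min_absorb2)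
qed

lemma one_add_slit: "(z::complex) \<in> - \<real>\<^sub>\<le>\<^sub>0 \<Longrightarrow> 1 + z \<in> - \<real>\<^sub>\<le>\<^sub>0"
  unfolding Compl_iff complex_nonpos_Reals_iff by auto

lemma one_add_slit_nonzero: "(z::complex) \<in> - \<real>\<^sub>\<le>\<^sub>0 \<Longrightarrow> 1 + z \<noteq> 0"
  using one_add_slit by force

context sectorial_op
begin

abbreviation R1 :: "'a \<Rightarrow>\<^sub>L 'a" where "R1 \<equiv> Rp 1"

abbreviation P1 :: "'a \<Rightarrow>\<^sub>L 'a" where "P1 \<equiv> id_blinfun - Rp 1"

lemma one_add_wide: "z \<in> wide \<Longrightarrow> q * (1 + cmod z) \<le> cmod (1 + z)"
  using norm_add_wide[of z 1] by (simp add: add.commute)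

lemma decaysI:
  assumes "\<kappa> > 0" "C \<ge> 0" "k holomorphic_on - \<real>\<^sub>\<le>\<^sub>0" "k 0 = 0"
    and "\<And>z. z \<in> wide \<Longrightarrow> z \<noteq> 0 \<Longrightarrow> cmod z \<le> 1 \<Longrightarrow> cmod (k z) \<le> C * cmod z powr \<kappa>"
    and "\<And>z. z \<in> wide \<Longrightarrow> cmod z \<ge> 1 \<Longrightarrow> cmod (k z) \<le> C * cmod z powr (- \<kappa>)"
  shows "decays \<kappa> C k"
  unfolding decays_def
proof (intro conjI ballI)
  fix z assume z: "z \<in> wide"
  show "cmod (k z) \<le> C * bump \<kappa> (cmod z)"
  proof (cases "z = 0")
    case True
    thus ?thesis using assms by (simp add: bump_def)
  next
    case False
    thus ?thesis using assms z by (intro bump_boundI) auto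
  qed
qed (use assms in auto)

lemma decays_rational:
  assumes "1 \<le> i" "i < j"
  shows "decays 1 (1 / q ^ j) (\<lambda>z. z ^ i / (1 + z) ^ j)"
proof (rule decaysI)
  have le: "cmod (z ^ i / (1 + z) ^ j) \<le> cmod z ^ i / (q ^ j * (1 + cmod z) ^ j)" if "z \<in> wide" for z
  proof -
    have "(q * (1 + cmod z)) ^ j \<le> cmod (1 + z) ^ j"
      using one_add_wide[OF that] q by (intro power_mono) auto
    moreover have "0 < (q * (1 + cmod z)) ^ j" using q by (intro zero_less_power mult_pos_pos add_pos_nonneg) auto
    ultimately have "cmod z ^ i / cmod (1 + z) ^ j \<le> cmod z ^ i / (q * (1 + cmod z)) ^ j"
      by (intro frac_le) auto
    thus ?thesis by (simp only: norm_divide norm_power power_mult_distrib)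
  qed
  show "(\<lambda>z. z ^ i / (1 + z) ^ j) holomorphic_on - \<real>\<^sub>\<le>\<^sub>0"
    using one_add_slit_nonzero by (intro holomorphic_intros) auto
  show "cmod (z ^ i / (1 + z) ^ j) \<le> 1 / q ^ j * cmod z powr 1" if "z \<in> wide" "z \<noteq> 0" "cmod z \<le> 1" for z
  proof -
    have "cmod z ^ i \<le> cmod z ^ 1" using that assms by (intro power_decreasing) auto
    moreover have "q ^ j * 1 \<le> q ^ j * (1 + cmod z) ^ j" using q by (intro mult_left_mono) auto
    ultimately have "cmod z ^ i / (q ^ j * (1 + cmod z) ^ j) \<le> cmod z / (q ^ j)"
      using q by (intro frac_le) auto
    thus ?thesis using le[OF that(1)] that by simp
  qed
  show "cmod (z ^ i / (1 + z) ^ j) \<le> 1 / q ^ j * cmod z powr (- 1)" if "z \<in> wide" "cmod z \<ge> 1" for z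
  proof -
    have "cmod z ^ i * cmod z \<le> cmod z ^ j" using that assms power_increasing[of "Suc i" j "cmod z"] by (simp add: mult.commute)
    also have "\<dots> \<le> (1 + cmod z) ^ j" by (intro power_mono) auto
    finally have "cmod z ^ i * cmod z \<le> (1 + cmod z) ^ j" .
    moreover have "cmod z > 0" "(1 + cmod z) ^ j > 0" using that by (auto intro: add_pos_nonneg)
    ultimately have "cmod z ^ i / (1 + cmod z) ^ j \<le> 1 / cmod z"
      by (simp only: pos_divide_le_eq pos_le_divide_eq times_divide_eq_left mult_1)
    hence "cmod z ^ i / (1 + cmod z) ^ j / q ^ j \<le> 1 / cmod z / q ^ j" using q by (intro divide_right_mono) auto
    thus ?thesis using le[OF that(1)] that by (simp add: powr_minus_divide field_simps)
  qed
qed (use assms q in auto)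

text \<open>Half of the closed complement of the sector, between the ray of angle c * \<theta> and
  the negative reals. The map z to - cnj z is the reflection in the imaginary axis, which carries it
  to a wedge of angle \<pi> - \<theta>, so the wedge lemmas apply.\<close>

definition ext :: "real \<Rightarrow> complex set" where
  "ext c = {z. - cnj z \<in> wedge c (pi - \<theta>)}"

lemma convex_ext: "convex (ext c)"
proof (rule convexI)
  fix x y :: complex and u v :: real
  assume *: "x \<in> ext c" "y \<in> ext c" "0 \<le> u" "0 \<le> v" "u + v = 1"
  have "- cnj (u *\<^sub>R x + v *\<^sub>R y) = u *\<^sub>R (- cnj x) + v *\<^sub>R (- cnj y)" by (simp add: complex_eq_iff)
  thus "u *\<^sub>R x + v *\<^sub>R y \<in> ext c"
    using convexD[OF convex_wedge[of c "pi - \<theta>"], of "- cnj x" "- cnj y" u v] * unfolding ext_def by simp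
qed

lemma ext_Re: "c = 1 \<or> c = -1 \<Longrightarrow> z \<in> ext c \<Longrightarrow> Re z \<le> cmod z * cos \<theta>"
  using wedge_Re[of c "pi - \<theta>" "- cnj z"] \<theta> by (simp add: ext_def cos_diff)

lemma ext_rays:
  assumes c: "c = 1 \<or> c = -1" and x: "x \<ge> 0"
  shows "of_real x * cis (c * \<theta>) \<in> ext c" "of_real (- x) \<in> ext c"
proof -
  have e: "- cnj (of_real x * cis (c * \<theta>)) = of_real x * cis (c * (pi - \<theta>))"
    using c by (auto simp: complex_eq_iff cos_diff sin_diff)
  show "of_real x * cis (c * \<theta>) \<in> ext c"
    unfolding ext_def mem_Collect_eq e by (rule wedge_rays) (use c x \<theta> in auto)
  show "of_real (- x) \<in> ext c"
    using wedge_rays(1)[of c "pi - \<theta>" x] c x \<theta> by (simp add: ext_def)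
qed

lemma ext_in_rho: "c = 1 \<or> c = -1 \<Longrightarrow> z \<in> ext c \<Longrightarrow> z \<noteq> 0 \<Longrightarrow> z \<in> rho"
  using ext_Re ext_rho by blast

lemma interior_ext_nonzero:
  assumes c: "c = 1 \<or> c = -1"
  shows "0 \<notin> interior (ext c)"
proof
  assume "0 \<in> interior (ext c)"
  then obtain e where e: "e > 0" "ball 0 e \<subseteq> ext c" by (meson mem_interior)
  have "of_real (e / 2) \<in> ball (0::complex) e" using e by simp
  hence "Re (of_real (e / 2)) \<le> cmod (of_real (e / 2)) * cos \<theta>" using e ext_Re[OF c] by blast
  hence "e / 2 * 1 \<le> e / 2 * cos \<theta>" using e by simp
  hence "1 \<le> cos \<theta>" using e by simp
  thus False using cos_monotone_0_pi[of 0 \<theta>] \<theta> by simp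
qed

text \<open>The resolvent identity used three times about the point -1. After multiplication by z^2
  / (1 + z)^3 the first three terms are explicit rational functions and the last has lost its pole
  at -1.\<close>

lemma res_expand:
  assumes z: "z \<in> rho" "1 + z \<noteq> 0"
  shows "res z x = - R1 x - cscale J (1 + z) (R1 (R1 x)) - cscale J ((1 + z)\<^sup>2) (R1 (R1 (R1 x)))
     + cscale J ((1 + z) ^ 3) (res z (R1 (R1 (R1 x))))"
proof -
  have step: "res z y = - R1 y + cscale J (1 + z) (res z (R1 y))" for y
  proof -
    have "z + of_real 1 \<noteq> 0" using z(2) by (simp add: add.commute)
    from Rp_res[OF zero_less_one z(1) this, of y]
    have "cscale J (1 + z) (R1 (res z y)) = res z y + R1 y" using z(2) by (simp add: add.commute)
    moreover have "R1 (res z y) = res z (R1 y)"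
      using resolvent_commute[OF neg_rho[of 1] z(1), of y] by (simp add: Rp_def blinfun.minus_left blinfun.minus_right)
    ultimately show ?thesis by (simp add: algebra_simps)
  qed
  define w where "w = 1 + z"
  define a b c where "a = R1 x" and "b = R1 a" and "c = R1 b"
  have "res z x = - a + cscale J w (- b + cscale J w (- c + cscale J w (res z c)))"
    using step[of x] step[of a] step[of b] unfolding w_def a_def b_def c_def by simp
  thus ?thesis
    unfolding w_def[symmetric] a_def[symmetric] b_def[symmetric] c_def[symmetric]
    by (simp add: cscale_add_right cscale_diff_right cscale_minus_right power2_eq_square power3_eq_cube mult.assoc)
qed

text \<open>The contour integral of \<open>z\<^sup>2 (1 + z)\<^sup>-\<^sup>3 (z - A)\<^sup>-\<^sup>1\<close> is closed through the complement of the
  sector, where the only singularity is the pole at \<open>-1\<close>.\<close>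
lemma dual_calc_residue:
  assumes \<Phi>: "dual_unit \<Phi>"
  shows "\<Phi> (calc (\<lambda>z. z\<^sup>2 / (1 + z) ^ 3) x) = \<Phi> (R1 x) - 2 * \<Phi> (R1 (R1 x)) + \<Phi> (R1 (R1 (R1 x)))"
proof -
  define h :: "complex \<Rightarrow> complex" where "h z = z\<^sup>2 / (1 + z) ^ 3" for z
  have dh: "decays 1 (1 / q ^ 3) h" unfolding h_def by (rule decays_rational) auto
  have lin: "bounded_linear \<Phi>" and sc: "\<And>c x. \<Phi> (cscale J c x) = c * \<Phi> x" and \<Phi>le: "\<And>x. cmod (\<Phi> x) \<le> 2 * norm x"
    using \<Phi> unfolding dual_unit_def by auto
  interpret \<Phi>: bounded_linear \<Phi> by (rule lin)
  define c1 where "c1 = \<Phi> (R1 x)"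
  define c2 where "c2 = \<Phi> (R1 (R1 x))"
  define c3 where "c3 = \<Phi> (R1 (R1 (R1 x)))"
  define H where "H z = h z * \<Phi> (res z x)" for z
  \<comment> \<open>The square matters: |z| norm (res z) is only bounded, so z^2 is the power that
    makes this function continuous at the vertex 0.\<close>
  define h3 where "h3 z = z\<^sup>2 * \<Phi> (res z (R1 (R1 (R1 x))))" for z
  \<comment> \<open>The coefficient of 1 / (1 + z) when z^2 is expanded in powers of 1 + z. All
    other rational terms are collected in \<open>d\<close>, which has the primitive
    \<open>Dp\<close>.\<close>
  define \<kappa> where "\<kappa> = - c1 + 2 * c2 - c3"
  define d where "d z = - c1 * (1 / (1 + z) ^ 3 - 2 / (1 + z)\<^sup>2) - c2 * (1 + 1 / (1 + z)\<^sup>2) - c3 * ((1 + z) - 2)" for z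
  define Dp where "Dp z = - c1 * (2 * (1 / (1 + z)) - 1 / 2 * (1 / (1 + z)\<^sup>2)) - c2 * ((1 + z) - 1 / (1 + z))
      - c3 * (1 / 2 * (1 + z)\<^sup>2 - 2 * (1 + z))" for z
  define \<rho> where "\<rho> z = \<kappa> * (1 / (z - of_real (-1))) + d z" for z
  have H_eq: "H z = \<rho> z + h3 z" if z: "z \<in> rho \<or> z = 0" "1 + z \<noteq> 0" for z
  proof (cases "z = 0")
    case True
    thus ?thesis by (simp add: H_def h_def \<rho>_def h3_def \<kappa>_def d_def)
  next
    case False
    hence zr: "z \<in> rho" using z by blast
    define w where "w = 1 + z"
    have w: "w \<noteq> 0" and zw: "z = w - 1" using z by (auto simp: w_def)
    have "\<Phi> (res z x) = - c1 - w * c2 - w\<^sup>2 * c3 + w ^ 3 * \<Phi> (res z (R1 (R1 (R1 x))))"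
      unfolding res_expand[OF zr z(2), of x] \<Phi>.add \<Phi>.diff \<Phi>.neg sc c1_def c2_def c3_def w_def ..
    hence "H z = z\<^sup>2 / w ^ 3 * (- c1 - w * c2 - w\<^sup>2 * c3) + h3 z"
      using w by (simp add: H_def h_def h3_def w_def[symmetric] distrib_left)
    moreover have "z\<^sup>2 / w ^ 3 * (- c1 - w * c2 - w\<^sup>2 * c3) = \<rho> z"
    proof -
      have "z - of_real (-1) = w" by (simp add: w_def add.commute)
      thus ?thesis
        unfolding \<rho>_def d_def \<kappa>_def w_def[symmetric] unfolding zw using w
        by (simp add: field_simps power2_eq_square power3_eq_cube)
    qed
    ultimately show ?thesis by simp
  qed
  have cont_h3: "continuous_on (ext c) h3" and holo_h3: "h3 holomorphic_on interior (ext c)" if c: "c = 1 \<or> c = -1" for c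
  proof -
    have bl: "bounded_linear (\<lambda>B::'a \<Rightarrow>\<^sub>L 'a. \<Phi> (B (R1 (R1 (R1 x)))))"
      by (rule bounded_linear_compose[OF lin blinfun.bounded_linear_left])
    have c0: "continuous_on (ext c - {0}) h3"
      unfolding h3_def
      by (intro continuous_intros bounded_linear.continuous_on[OF bl] continuous_on_res) (use ext_in_rho[OF c] in auto)
    show "continuous_on (ext c) h3"
      unfolding continuous_on_def
    proof
      fix z assume z: "z \<in> ext c"
      show "(h3 \<longlongrightarrow> h3 z) (at z within ext c)"
      proof (cases "z = 0")
        case True
        have "((\<lambda>z. cmod z * (2 * M * norm (R1 (R1 (R1 x))))) \<longlongrightarrow> cmod 0 * (2 * M * norm (R1 (R1 (R1 x))))) (at 0 within ext c)"
          by (intro tendsto_intros)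
        hence "((\<lambda>z. cmod z * (2 * M * norm (R1 (R1 (R1 x))))) \<longlongrightarrow> 0) (at 0 within ext c)" by simp
        moreover have "\<forall>\<^sub>F z in at 0 within ext c. cmod (h3 z) \<le> cmod z * (2 * M * norm (R1 (R1 (R1 x))))"
          unfolding eventually_at_filter
        proof (intro always_eventually allI impI)
          fix z assume z: "z \<noteq> 0" "z \<in> ext c"
          let ?y = "R1 (R1 (R1 x))"
          have "cmod (\<Phi> (res z ?y)) \<le> 2 * (norm (res z) * norm ?y)"
            using order_trans[OF \<Phi>le mult_left_mono[OF norm_blinfun[of "res z" ?y], of 2]] by simp
          hence "cmod z * cmod (\<Phi> (res z ?y)) \<le> cmod z * (2 * (norm (res z) * norm ?y))" by (rule mult_left_mono) simp
          also have "\<dots> = 2 * (cmod z * norm (res z)) * norm ?y" by simp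
          also have "\<dots> \<le> 2 * M * norm ?y"
            using ext_bound[OF z(1) ext_Re[OF c z(2)]] by (intro mult_right_mono mult_left_mono) auto
          finally have "cmod z * (cmod z * cmod (\<Phi> (res z ?y))) \<le> cmod z * (2 * M * norm ?y)" by (rule mult_left_mono) simp
          thus "cmod (h3 z) \<le> cmod z * (2 * M * norm ?y)" by (simp add: h3_def norm_mult power2_eq_square mult.assoc)
        qed
        ultimately have "(h3 \<longlongrightarrow> 0) (at 0 within ext c)" by (rule Lim_null_comparison[rotated])
        thus ?thesis using True by (simp add: h3_def)
      next
        case False
        have "(h3 \<longlongrightarrow> h3 z) (at z within ext c - {0})" using c0 z False unfolding continuous_on_def by blast
        moreover have "at z within ext c - {0} = at z within ext c"
          by (rule at_within_nhd[of _ "- {0}"]) (use False in auto)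
        ultimately show ?thesis by simp
      qed
    qed
    show "h3 holomorphic_on interior (ext c)"
      unfolding holomorphic_on_def
    proof
      fix z assume z: "z \<in> interior (ext c)"
      have sub: "interior (ext c) \<subseteq> rho"
        using interior_subset interior_ext_nonzero[OF c] ext_in_rho[OF c] by blast
      have "((\<lambda>l. \<Phi> (blinfun_pow (res l) 1 (R1 (R1 (R1 x))))) has_field_derivative
         - (of_nat 1 * \<Phi> (blinfun_pow (res z) (Suc 1) (R1 (R1 (R1 x)))))) (at z within interior (ext c))"
        by (rule dual_res_pow_has_field_derivative[OF sub z \<Phi>])
      hence "(\<lambda>l. \<Phi> (res l (R1 (R1 (R1 x))))) field_differentiable at z within interior (ext c)"
        unfolding field_differentiable_def by auto
      thus "h3 field_differentiable at z within interior (ext c)"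
        unfolding h3_def by (intro derivative_intros) auto
    qed
  qed
  let ?W = "\<lambda>F u v. contour_integral (linepath u v) F"
  \<comment> \<open>Around the kite p, - L, cnj p, 0 only \<kappa> / (1 + z) contributes:
    \<open>d\<close> has a primitive, and \<open>h3\<close> integrates to 0 over each of the two
    triangles into which the negative axis cuts the kite.\<close>
  have main: "?W H 0 (cnj p) - ?W H 0 p = - (2 * of_real pi * \<i> * \<kappa>) + ?W H p (of_real (- L)) + ?W H (of_real (- L)) (cnj p)"
    if L: "L > 1" and p_def: "p = of_real L * cis \<theta>" for L p
  proof -
    let ?n = "of_real (- L) :: complex"
    have cp: "cnj p = of_real L * cis (- \<theta>)" by (simp add: p_def cis_cnj)
    have Imp: "Im p > 0" using L sin_gt_zero[OF \<theta>] by (simp add: p_def)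
    have pe: "p \<in> ext 1" "?n \<in> ext 1" "0 \<in> ext 1" "cnj p \<in> ext (-1)" "?n \<in> ext (-1)" "0 \<in> ext (-1)"
      using ext_rays[of 1 L] ext_rays[of "-1" L] ext_rays(2)[of 1 0] ext_rays(2)[of "-1" 0] L by (auto simp: p_def cis_cnj)
    have seg: "closed_segment u v \<subseteq> ext c" if "u \<in> ext c" "v \<in> ext c" for u v c
      using closed_segment_subset[OF that convex_ext] .
    have m1: "1 + z \<noteq> 0" if z: "z \<in> closed_segment u v" and uv: "(u = of_real y \<and> v = w) \<or> (u = w \<and> v = of_real y)"
        and y: "y = 0 \<or> y = - L" and w: "Im w \<noteq> 0" for z u v w y
    proof
      assume "1 + z = 0"
      hence z1: "z = -1" by (simp add: add_eq_0_iff)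
      have "z \<in> closed_segment (of_real y) w" using z uv by (auto simp: closed_segment_commute)
      then obtain s where s: "z = (1 - s) *\<^sub>R of_real y + s *\<^sub>R w" by (auto simp: in_segment)
      from arg_cong[OF s, of Im] have "s = 0" using w z1 by simp
      hence "of_real y = (-1 :: complex)" using s z1 by simp
      hence "y = -1" by (metis of_real_1 of_real_eq_iff of_real_minus)
      thus False using y L by auto
    qed
    have split: "?W H u v = ?W \<rho> u v + ?W h3 u v" and rev: "?W \<rho> u v = - ?W \<rho> v u" "?W h3 u v = - ?W h3 v u" "?W \<rho> u v = \<kappa> * ?W (\<lambda>z. 1 / (z - of_real (-1))) u v + (Dp v - Dp u)"
      if c: "c = 1 \<or> c = -1" and uv: "(u = of_real y \<and> v = w) \<or> (u = w \<and> v = of_real y)"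
        and y: "y = 0 \<or> y = - L" and w: "Im w \<noteq> 0" and e: "u \<in> ext c" "v \<in> ext c" for u v w y c
    proof -
      have n1: "1 + z \<noteq> 0" if "z \<in> closed_segment u v" for z by (rule m1[OF that uv y w])
      have n2: "z - of_real (-1) \<noteq> 0" if "z \<in> closed_segment u v" for z using n1[OF that] by (simp add: add.commute)
      have ch: "continuous_on (closed_segment u v) h3" by (rule continuous_on_subset[OF cont_h3[OF c] seg[OF e]])
      have c\<rho>: "continuous_on (closed_segment u v) \<rho>"
        unfolding \<rho>_def d_def using n1 n2 by (intro continuous_intros) auto
      have "?W H u v = ?W (\<lambda>z. \<rho> z + h3 z) u v"
      proof (rule contour_integral_eq)
        fix z assume "z \<in> path_image (linepath u v)"
        hence z: "z \<in> closed_segment u v" by simp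
        thus "H z = \<rho> z + h3 z" using seg[OF e] ext_in_rho[OF c] n1[OF z] by (intro H_eq) auto
      qed
      thus "?W H u v = ?W \<rho> u v + ?W h3 u v"
        using ch c\<rho> by (simp add: contour_integral_add contour_integrable_continuous_linepath)
      show "?W \<rho> u v = - ?W \<rho> v u" "?W h3 u v = - ?W h3 v u"
        by (rule contour_integral_reverse_linepath[OF c\<rho>], rule contour_integral_reverse_linepath[OF ch])
      have "(d has_contour_integral (Dp (pathfinish (linepath u v)) - Dp (pathstart (linepath u v)))) (linepath u v)"
      proof (rule contour_integral_primitive[where S = "closed_segment u v"])
        fix z assume z: "z \<in> closed_segment u v"
        note n = n1[OF z]
        have i0: "((\<lambda>z. 1 + z) has_field_derivative 1) (at z)" by (auto intro!: derivative_eq_intros)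
        have i1: "((\<lambda>z. 1 / (1 + z)) has_field_derivative - (1 / (1 + z)\<^sup>2)) (at z)"
          using n by (auto intro!: derivative_eq_intros simp: power2_eq_square)
        have i2: "((\<lambda>z. 1 / (1 + z)\<^sup>2) has_field_derivative - (2 / (1 + z) ^ 3)) (at z)"
        proof -
          have "((\<lambda>w. 1 / w\<^sup>2) has_field_derivative - (2 / w ^ 3)) (at w)" if "w \<noteq> 0" for w :: complex
            using that by (auto intro!: derivative_eq_intros simp: field_simps power2_eq_square power3_eq_cube)
          from DERIV_chain2[OF this[OF n] i0] show ?thesis by simp
        qed
        have i3: "((\<lambda>z. (1 + z)\<^sup>2) has_field_derivative 2 * (1 + z)) (at z)" by (auto intro!: derivative_eq_intros)
        have "(Dp has_field_derivative (- c1 * (2 * (- (1 / (1 + z)\<^sup>2)) - 1 / 2 * (- (2 / (1 + z) ^ 3)))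
            - c2 * (1 - - (1 / (1 + z)\<^sup>2)) - c3 * (1 / 2 * (2 * (1 + z)) - 2 * 1))) (at z)"
          unfolding Dp_def[abs_def] by (intro DERIV_diff DERIV_cmult i0 i1 i2 i3)
        moreover have "- c1 * (2 * (- (1 / (1 + z)\<^sup>2)) - 1 / 2 * (- (2 / (1 + z) ^ 3)))
            - c2 * (1 - - (1 / (1 + z)\<^sup>2)) - c3 * (1 / 2 * (2 * (1 + z)) - 2 * 1) = d z"
          unfolding d_def by simp
        ultimately have "(Dp has_field_derivative d z) (at z)" by simp
        thus "(Dp has_field_derivative d z) (at z within closed_segment u v)" by (rule has_field_derivative_at_within)
      qed auto
      moreover have ci: "(\<lambda>z. 1 / (z - of_real (-1))) contour_integrable_on linepath u v"
        using n2 by (intro contour_integrable_continuous_linepath continuous_intros) auto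
      ultimately have "(\<rho> has_contour_integral (\<kappa> * ?W (\<lambda>z. 1 / (z - of_real (-1))) u v + (Dp v - Dp u))) (linepath u v)"
        unfolding \<rho>_def[abs_def]
        by (intro has_contour_integral_add has_contour_integral_lmul has_contour_integral_integral ci) simp
      thus "?W \<rho> u v = \<kappa> * ?W (\<lambda>z. 1 / (z - of_real (-1))) u v + (Dp v - Dp u)" by (rule contour_integral_unique)
    qed
    have tri: "?W h3 0 u + ?W h3 u ?n + ?W h3 ?n 0 = 0" if c: "c = 1 \<or> c = -1" and u: "u \<in> ext c" "?n \<in> ext c" "0 \<in> ext c" for u c
    proof -
      have sub: "convex hull {0, u, ?n} \<subseteq> ext c" using u by (intro hull_minimal convex_ext) auto
      show ?thesis
        by (rule has_chain_integral_chain_integral3, rule Cauchy_theorem_triangle_interior)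
           (rule continuous_on_subset[OF cont_h3[OF c] sub], rule holomorphic_on_subset[OF holo_h3[OF c] interior_mono[OF sub]])
    qed
    let ?k = "\<lambda>z. 1 / (z - of_real (-1))"
    have kite: "?W ?k p ?n + ?W ?k ?n (cnj p) + ?W ?k (cnj p) (of_real 0) + ?W ?k (of_real 0) p = 2 * of_real pi * \<i>"
      by (rule kite_integral) (use L Imp in auto)
    have e1: "?W H 0 p = ?W \<rho> 0 p + ?W h3 0 p" by (rule split[of 1 0 0 p p]) (use Imp pe in auto)
    have e2: "?W H p ?n = ?W \<rho> p ?n + ?W h3 p ?n" by (rule split[of 1 _ "-L" _ p]) (use Imp pe in auto)
    have e3: "?W H 0 (cnj p) = ?W \<rho> 0 (cnj p) + ?W h3 0 (cnj p)" by (rule split[of "-1" 0 0 "cnj p" "cnj p"]) (use Imp pe in auto)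
    have e4: "?W H ?n (cnj p) = ?W \<rho> ?n (cnj p) + ?W h3 ?n (cnj p)" by (rule split[of "-1" _ "-L" _ "cnj p"]) (use Imp pe in auto)
    have r1: "?W \<rho> 0 p = \<kappa> * ?W ?k 0 p + (Dp p - Dp 0)" by (rule rev(3)[of 1 0 0 p p]) (use Imp pe in auto)
    have r2: "?W \<rho> p ?n = \<kappa> * ?W ?k p ?n + (Dp ?n - Dp p)" by (rule rev(3)[of 1 _ "-L" _ p]) (use Imp pe in auto)
    have r3: "?W \<rho> (cnj p) 0 = \<kappa> * ?W ?k (cnj p) 0 + (Dp 0 - Dp (cnj p))" by (rule rev(3)[of "-1" _ 0 _ "cnj p"]) (use Imp pe in auto)
    have r4: "?W \<rho> ?n (cnj p) = \<kappa> * ?W ?k ?n (cnj p) + (Dp (cnj p) - Dp ?n)" by (rule rev(3)[of "-1" _ "-L" _ "cnj p"]) (use Imp pe in auto)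
    have r3': "?W \<rho> 0 (cnj p) = - ?W \<rho> (cnj p) 0" by (rule rev(1)[of "-1" 0 0 "cnj p" "cnj p"]) (use Imp pe in auto)
    have r4': "?W h3 ?n (cnj p) = - ?W h3 (cnj p) ?n" by (rule rev(2)[of "-1" _ "-L" _ "cnj p"]) (use Imp pe in auto)
    have t1: "?W h3 0 p + ?W h3 p ?n + ?W h3 ?n 0 = 0" by (rule tri[of 1]) (use pe in auto)
    have t2: "?W h3 0 (cnj p) + ?W h3 (cnj p) ?n + ?W h3 ?n 0 = 0" by (rule tri[of "-1"]) (use pe in auto)
    have "?W \<rho> p ?n + ?W \<rho> ?n (cnj p) + ?W \<rho> (cnj p) 0 + ?W \<rho> 0 p
        = \<kappa> * (?W ?k p ?n + ?W ?k ?n (cnj p) + ?W ?k (cnj p) (of_real 0) + ?W ?k (of_real 0) p)"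
      unfolding r1 r2 r3 r4 by (simp add: algebra_simps)
    hence \<rho>: "?W \<rho> p ?n + ?W \<rho> ?n (cnj p) + ?W \<rho> (cnj p) 0 + ?W \<rho> 0 p = 2 * of_real pi * \<i> * \<kappa>"
      unfolding kite by (simp add: mult_ac)
    show ?thesis unfolding e1 e2 e3 e4 r3' r4' using \<rho> t1 t2 by algebra
  qed
  define f where "f c r = \<Phi> (branch h c r x)" for c r
  have f_eq: "f c r = cis (c * \<theta>) * H (of_real r * cis (c * \<theta>))" for c r
    by (simp add: f_def branch_def sc H_def mult_ac)
  have bl: "bounded_linear (\<lambda>B::'a \<Rightarrow>\<^sub>L 'a. \<Phi> (B x))"
    by (rule bounded_linear_compose[OF lin blinfun.bounded_linear_left])
  have si: "set_integrable lborel {0<..} (f c)" if c: "c = 1 \<or> c = -1" for c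
  proof (rule set_integrable_bump_bound[of 1])
    show "continuous_on {0<..} (f c)"
      unfolding f_def by (intro bounded_linear.continuous_on[OF bl] continuous_branch[OF dh c])
    show "cmod (f c r) \<le> (2 * (1 / q ^ 3 * M) * norm x) * (bump 1 r / r)" if r: "r > 0" for r
    proof -
      have "cmod (f c r) \<le> 2 * (norm (branch h c r) * norm x)"
        unfolding f_def using order_trans[OF \<Phi>le mult_left_mono[OF norm_blinfun[of "branch h c r" x], of 2]] by simp
      also have "\<dots> \<le> 2 * ((1 / q ^ 3 * M * (bump 1 r / r)) * norm x)"
        using branch_bound[OF dh c r] by (intro mult_left_mono mult_right_mono) auto
      finally show ?thesis by (simp add: mult_ac)
    qed
  qed simp
  have fi: "f c integrable_on {0<..}" "integral {0<..} (f c) = (LBINT r:{0<..}. f c r)" if "c = 1 \<or> c = -1" for c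
    using set_borel_integral_eq_integral[OF si[OF that]] by simp_all
  have "\<Phi> (integral {0<..} (integrand h) x) = integral {0<..} (\<lambda>r. \<Phi> (integrand h r x))"
    using integral_linear[OF integrand_integrable(1)[OF dh] bl] by (simp add: o_def)
  also have "\<dots> = integral {0<..} (\<lambda>r. f (-1) r - f 1 r)"
    by (simp add: integrand_def f_def blinfun.diff_left \<Phi>.diff)
  also have "\<dots> = (LBINT r:{0<..}. f (-1) r) - (LBINT r:{0<..}. f 1 r)"
    using fi[of 1] fi[of "-1"] by (simp add: Henstock_Kurzweil_Integration.integral_diff)
  finally have \<Phi>int: "\<Phi> (integral {0<..} (integrand h) x) = (LBINT r:{0<..}. f (-1) r) - (LBINT r:{0<..}. f 1 r)" .
  have W_f: "?W H 0 (of_real L * cis (c * \<theta>)) = integral {0..L} (f c)" if "L > 0" for L c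
    unfolding contour_integral_ray[OF that] f_eq ..
  \<comment> \<open>The constant of \<open>norm_add_wedge\<close> for the complementary sector of
    half-opening \<pi> - \<theta>. It keeps the outer chords at distance L q' from 0, so the
    integral over them is of order 1 / L.\<close>
  define q' where "q' = sqrt ((1 + cos (pi - \<theta>)) / 2)"
  have q': "q' > 0" using cos_monotone_0_pi[of 0 \<theta>] \<theta> by (simp add: q'_def cos_diff)
  let ?B = "\<lambda>L. 2 * M * norm x * L / (L * q' - 1) ^ 3 * (2 * L)"
  have outer: "cmod (?W H u v) \<le> ?B L"
    if L: "L * q' > 1" "L > 0" and c: "c = 1 \<or> c = -1"
      and uv: "(u = of_real L * cis (c * \<theta>) \<and> v = of_real (- L)) \<or> (u = of_real (- L) \<and> v = of_real L * cis (c * \<theta>))" for L c u v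
  proof -
    let ?p = "of_real L * cis (c * \<theta>)"
    have uve: "u \<in> ext c" "v \<in> ext c" using uv ext_rays[OF c, of L] L by auto
    have seg: "closed_segment u v \<subseteq> ext c" using closed_segment_subset[OF uve convex_ext] .
    have z_bounds: "cmod z \<le> L" "L * q' \<le> cmod z" if zs: "z \<in> closed_segment u v" for z
    proof -
      have "z \<in> closed_segment ?p (of_real (- L))" using zs uv by (auto simp: closed_segment_commute)
      then obtain s where s: "0 \<le> s" "s \<le> 1" "z = (1 - s) *\<^sub>R ?p + s *\<^sub>R of_real (- L)"
        unfolding in_segment by blast
      have "cmod z \<le> (1 - s) * L + s * L"
        unfolding s(3) using norm_triangle_ineq[of "(1 - s) *\<^sub>R ?p" "s *\<^sub>R of_real (- L)"] s L by (simp add: norm_mult)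
      thus "cmod z \<le> L" by (simp add: algebra_simps)
      define y where "y = of_real ((1 - s) * L) * cis (c * (pi - \<theta>))"
      have cy: "cmod y = (1 - s) * L" unfolding y_def norm_mult norm_cis norm_of_real using s L by simp
      have Ry: "Re y = (1 - s) * L * cos (pi - \<theta>)" using c by (auto simp: y_def)
      have "q' * ((1 - s) * L + s * L) \<le> cmod (y + of_real (s * L))"
        using norm_add_wedge[of y "cos (pi - \<theta>)" "s * L"] s L cy Ry unfolding q'_def by simp
      also have "y + of_real (s * L) = - cnj z"
        unfolding y_def s(3) using c by (auto simp: complex_eq_iff cos_diff sin_diff)
      finally show "L * q' \<le> cmod z" by (simp add: algebra_simps)
    qed
    have n1: "1 + z \<noteq> 0" if "z \<in> closed_segment u v" for z
    proof
      assume "1 + z = 0"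
      hence "cmod z = 1" by (simp add: add_eq_0_iff)
      thus False using z_bounds(2)[OF that] L by simp
    qed
    have n0: "z \<noteq> 0" if "z \<in> closed_segment u v" for z using z_bounds(2)[OF that] L by auto
    have contH: "continuous_on (closed_segment u v) H"
      unfolding H_def h_def using n1 n0 seg ext_in_rho[OF c]
      by (intro continuous_intros bounded_linear.continuous_on[OF bl] continuous_on_res) auto
    have "cmod (?W H u v) \<le> (2 * M * norm x * L / (L * q' - 1) ^ 3) * cmod (v - u)"
    proof (rule contour_integral_bound_linepath)
      show "H contour_integrable_on linepath u v" by (rule contour_integrable_continuous_linepath[OF contH])
      show "0 \<le> 2 * M * norm x * L / (L * q' - 1) ^ 3" using M L by simp
      fix z assume z: "z \<in> closed_segment u v"
      have e: "cmod z * norm (res z) \<le> M" using ext_bound[OF n0[OF z]] ext_Re[OF c] seg z by blast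
      have w: "L * q' - 1 \<le> cmod (1 + z)"
        using norm_triangle_ineq4[of "1 + z" 1] z_bounds(2)[OF z] by simp
      have "cmod (\<Phi> (res z x)) \<le> 2 * (norm (res z) * norm x)"
        using order_trans[OF \<Phi>le mult_left_mono[OF norm_blinfun[of "res z" x], of 2]] by simp
      hence "cmod (H z) \<le> (cmod z)\<^sup>2 / cmod (1 + z) ^ 3 * (2 * (norm (res z) * norm x))"
        unfolding H_def h_def norm_mult norm_divide norm_power by (rule mult_left_mono) simp
      also have "\<dots> = (2 * norm x * cmod z * (cmod z * norm (res z))) / cmod (1 + z) ^ 3"
        by (simp add: power2_eq_square mult_ac)
      also have "\<dots> \<le> (2 * norm x * L * M) / (L * q' - 1) ^ 3"
        using e w L z_bounds(1)[OF z] M by (intro frac_le mult_mono power_mono zero_less_power) auto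
      finally show "cmod (H z) \<le> 2 * M * norm x * L / (L * q' - 1) ^ 3" by (simp add: mult_ac)
    qed
    also have "\<dots> \<le> (2 * M * norm x * L / (L * q' - 1) ^ 3) * (2 * L)"
    proof (rule mult_left_mono)
      have "cmod u = L" "cmod v = L" using uv L by (auto simp: norm_mult)
      thus "cmod (v - u) \<le> 2 * L" using norm_triangle_ineq4[of v u] by simp
      show "0 \<le> 2 * M * norm x * L / (L * q' - 1) ^ 3" using M L by simp
    qed
    finally show ?thesis .
  qed
  have lim1: "((\<lambda>L. integral {0..L} (f (-1)) - integral {0..L} (f 1)) \<longlongrightarrow> \<Phi> (integral {0<..} (integrand h) x)) at_top"
    unfolding \<Phi>int by (intro tendsto_diff tendsto_integral_half_line si) auto
  have lim2: "((\<lambda>L. integral {0..L} (f (-1)) - integral {0..L} (f 1)) \<longlongrightarrow> - (2 * of_real pi * \<i> * \<kappa>)) at_top"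
  proof (rule LIM_zero_cancel, rule Lim_null_comparison)
    have "((\<lambda>L. (8 * M * norm x) * (L\<^sup>2 / (L * q' - 1) ^ 3)) \<longlongrightarrow> (8 * M * norm x) * 0) at_top"
      using q' by (intro tendsto_mult_left) real_asymp
    moreover have "(8 * M * norm x) * (L\<^sup>2 / (L * q' - 1) ^ 3) = 2 * ?B L" for L
      by (simp add: power2_eq_square mult_ac)
    ultimately show "((\<lambda>L. 2 * ?B L) \<longlongrightarrow> 0) at_top" by (simp only: mult_zero_right)
    show "\<forall>\<^sub>F L in at_top. cmod (integral {0..L} (f (-1)) - integral {0..L} (f 1) - - (2 * of_real pi * \<i> * \<kappa>)) \<le> 2 * ?B L"
      using eventually_gt_at_top[of 1] eventually_gt_at_top[of "1 / q'"]
    proof eventually_elim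
      fix L assume L: "1 < L" "1 / q' < L"
      have Lq: "L * q' > 1" using L q' by (simp add: field_simps)
      let ?p = "of_real L * cis \<theta>"
      have cp: "cnj ?p = of_real L * cis (-1 * \<theta>)" by (simp add: cis_cnj)
      have "integral {0..L} (f (-1)) - integral {0..L} (f 1) = ?W H 0 (cnj ?p) - ?W H 0 ?p"
        using W_f[of L "-1"] W_f[of L 1] L unfolding cp by simp
      hence "integral {0..L} (f (-1)) - integral {0..L} (f 1) - - (2 * of_real pi * \<i> * \<kappa>)
          = ?W H ?p (of_real (- L)) + ?W H (of_real (- L)) (cnj ?p)"
        using main[OF L(1) refl] by simp
      also have "cmod \<dots> \<le> ?B L + ?B L"
        by (rule order_trans[OF norm_triangle_ineq add_mono[OF outer[of L 1] outer[of L "-1"]]])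
           (use L Lq in \<open>auto simp: cis_cnj\<close>)
      also have "?B L + ?B L = 2 * ?B L" by (simp only: mult_2)
      finally show "cmod (integral {0..L} (f (-1)) - integral {0..L} (f 1) - - (2 * of_real pi * \<i> * \<kappa>)) \<le> 2 * ?B L" .
    qed
  qed
  have "\<Phi> (integral {0<..} (integrand h) x) = - (2 * of_real pi * \<i> * \<kappa>)"
    by (rule tendsto_unique[OF trivial_limit_at_top_linorder lim1 lim2])
  hence "\<Phi> (calc h x) = - \<kappa>"
    unfolding calc_def by (simp add: sc)
  thus ?thesis unfolding h_def[abs_def, symmetric] \<kappa>_def c1_def c2_def c3_def by simp
qed

end

section \<open>Decay of the symbol z^\<sigma> (1 + z)^(-\<sigma>) after subtracting z / (1 + z) or
  dividing by z^j\<close>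

lemma cmod_powr_of_real: "z \<noteq> 0 \<Longrightarrow> cmod (z powr of_real s) = cmod z powr s"
  by (simp add: powr_def)

text \<open>Off the real axis both logarithms have imaginary parts of the same sign, and on the
  positive reals both are real, so the difference stays in the principal strip. This identifies
  z^\<sigma> (1 + z)^(-\<sigma>) with a power of z / (1 + z).\<close>

lemma Ln_diff_quotient:
  fixes z :: complex
  assumes "z \<in> - \<real>\<^sub>\<le>\<^sub>0"
  shows "Ln z - Ln (1 + z) = Ln (z / (1 + z))"
proof -
  have z: "z \<noteq> 0" "1 + z \<in> - \<real>\<^sub>\<le>\<^sub>0" "1 + z \<noteq> 0" using assms one_add_slit one_add_slit_nonzero by auto
  have "- pi < Im (Ln z - Ln (1 + z)) \<and> Im (Ln z - Ln (1 + z)) \<le> pi"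
  proof (cases "Im z = 0")
    case True
    hence "Re z > 0" using assms by (auto simp: complex_nonpos_Reals_iff)
    hence "Im (Ln z) = 0" "Im (Ln (1 + z)) = 0" 
      using Im_Ln_eq_0[OF z(1)] Im_Ln_eq_0[OF z(3)] True by auto
    thus ?thesis by simp
  next
    case False
    show ?thesis
    proof (cases "Im z > 0")
      case True
      have "0 < Im (Ln z)" "Im (Ln z) < pi" "0 < Im (Ln (1 + z))" "Im (Ln (1 + z)) < pi"
        using Im_Ln_pos_lt[of z] Im_Ln_pos_lt[of "1 + z"] True z by (auto simp: Im_Ln_pos_lt_imp)
      thus ?thesis by simp
    next
      case False
      hence neg: "Im z < 0" using \<open>Im z \<noteq> 0\<close> by simp
      have c: "Ln (cnj z) = cnj (Ln z)" by (rule cnj_Ln[symmetric]) (use assms in auto)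
      have c': "Ln (cnj (1 + z)) = cnj (Ln (1 + z))" by (rule cnj_Ln[symmetric]) (use z in auto)
      have "0 < Im (Ln (cnj z))" "Im (Ln (cnj z)) < pi" "0 < Im (Ln (cnj (1 + z)))" "Im (Ln (cnj (1 + z))) < pi"
        using Im_Ln_pos_lt[of "cnj z"] Im_Ln_pos_lt[of "cnj (1 + z)"] neg z by (auto simp: complex_eq_iff)
      thus ?thesis unfolding c c' by simp
    qed
  qed
  moreover have "exp (Ln z - Ln (1 + z)) = z / (1 + z)" using z by (simp add: exp_diff)
  ultimately show ?thesis using Ln_unique by metis
qed

text \<open>Mean value inequality on a disc that avoids the slit; it is meant for y = z / (1 + z),
  which tends to 1 at infinity.\<close>

lemma powr_near_one:
  fixes \<sigma> :: real
  obtains L where "L \<ge> 0" "\<And>y::complex. cmod (y - 1) \<le> 1 / 2 \<Longrightarrow> cmod (y powr of_real \<sigma> - 1) \<le> L * cmod (y - 1)"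
proof -
  let ?S = "cball (1::complex) (1 / 2)"
  have Re_pos: "Re y > 0" if "y \<in> ?S" for y
    using that abs_Re_le_cmod[of "1 - y"] by (simp add: dist_norm)
  hence slit: "y \<notin> \<real>\<^sub>\<le>\<^sub>0" if "y \<in> ?S" for y
    using that by (force simp: complex_nonpos_Reals_iff)
  let ?D = "\<lambda>y::complex. of_real \<sigma> * y powr (of_real \<sigma> - 1)"
  have "continuous_on ?S ?D" by (intro continuous_intros) (auto dest: Re_pos simp del: mem_cball)
  hence "bounded (?D ` ?S)" by (intro compact_imp_bounded compact_continuous_image compact_cball)
  then obtain L where L: "\<And>y. y \<in> ?S \<Longrightarrow> cmod (?D y) \<le> L" unfolding bounded_iff by blast
  have "cmod (y powr of_real \<sigma> - 1) \<le> L * cmod (y - 1)" if "cmod (y - 1) \<le> 1 / 2" for y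
  proof -
    have "norm (y powr of_real \<sigma> - 1 powr of_real \<sigma>) \<le> L * norm (y - 1)"
    proof (rule field_differentiable_bound[of ?S "\<lambda>y. y powr of_real \<sigma>" ?D])
      show "((\<lambda>y. y powr of_real \<sigma>) has_field_derivative ?D y) (at y within ?S)" if "y \<in> ?S" for y
        by (rule has_field_derivative_at_within[OF has_field_derivative_powr[OF slit[OF that]]])
    qed (use L that in \<open>auto simp: dist_norm norm_minus_commute\<close>)
    thus ?thesis by simp
  qed
  moreover have "L \<ge> 0" using order_trans[OF norm_ge_zero L[of 1]] by simp
  ultimately show ?thesis by (intro that)
qed

context sectorial_op
begin

lemma A_Rp: "\<mu> > 0 \<Longrightarrow> Rp \<mu> x \<in> D" "\<mu> > 0 \<Longrightarrow> A (Rp \<mu> x) = x - \<mu> *\<^sub>R Rp \<mu> x"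
proof -
  assume \<mu>: "\<mu> > 0"
  note r = res_in_D[OF neg_rho[OF \<mu>], of x]
  show "Rp \<mu> x \<in> D" using r subspace_D by (simp add: Rp_def blinfun.minus_left subspace_neg)
  have "A (- res (of_real (- \<mu>)) x) = - A (res (of_real (- \<mu>)) x)"
    using A_linear[OF r r, of "-1" 0] by simp
  thus "A (Rp \<mu> x) = x - \<mu> *\<^sub>R Rp \<mu> x"
    using A_res[OF neg_rho[OF \<mu>], of x] by (simp add: Rp_def blinfun.minus_left cscale_minus_left)
qed

lemma Rp_unique:
  assumes \<mu>: "\<mu> > 0" and "y \<in> D" "A y + \<mu> *\<^sub>R y = x"
  shows "Rp \<mu> x = y"
proof -
  have "res (of_real (- \<mu>)) (cscale J (of_real (- \<mu>)) y - A y) = y"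
    by (rule res_left[OF neg_rho[OF \<mu>] assms(2)])
  moreover have "cscale J (of_real (- \<mu>)) y - A y = - x"
    unfolding cscale_of_real using assms(3) by (simp add: algebra_simps)
  ultimately show ?thesis by (simp add: Rp_def blinfun.minus_left blinfun.minus_right)
qed

lemma calc_residue: "calc (\<lambda>z. z\<^sup>2 / (1 + z) ^ 3) = R1 o\<^sub>L (P1 o\<^sub>L P1)"
proof (rule blinfun_eqI_dual)
  fix \<Phi> x assume \<Phi>: "dual_unit \<Phi>"
  then interpret \<Phi>: bounded_linear \<Phi> unfolding dual_unit_def by blast
  have "(R1 o\<^sub>L (P1 o\<^sub>L P1)) x = R1 x - R1 (R1 x) - (R1 (R1 x) - R1 (R1 (R1 x)))"
    by (simp add: blinfun.diff_left blinfun.diff_right)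
  thus "\<Phi> (calc (\<lambda>z. z\<^sup>2 / (1 + z) ^ 3) x) = \<Phi> ((R1 o\<^sub>L (P1 o\<^sub>L P1)) x)"
    unfolding dual_calc_residue[OF \<Phi>] by (simp add: \<Phi>.diff)
qed

lemma P1_calc:
  assumes k: "decays \<kappa> C k"
  shows "P1 o\<^sub>L calc k = calc (\<lambda>z. k z * z / (1 + z))"
proof -
  have "P1 o\<^sub>L calc k = calc k - (R1 o\<^sub>L calc k)" by (intro blinfun_eqI) (simp add: blinfun.diff_left)
  also have "\<dots> = calc (\<lambda>z. k z - k z / (z + of_real 1))"
    unfolding Rp_calc[OF k zero_less_one] by (rule calc_diff[OF k decays_div[OF k zero_less_one], symmetric])
  also have "\<dots> = calc (\<lambda>z. k z * z / (1 + z))"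
  proof (rule calc_cong)
    fix z assume "z \<in> wide" "z \<noteq> 0"
    hence "1 + z \<noteq> 0" using wide_slit one_add_slit_nonzero by blast
    thus "k z - k z / (z + of_real 1) = k z * z / (1 + z)" by (simp add: field_simps)
  qed
  finally show ?thesis .
qed

definition fr :: "real \<Rightarrow> complex \<Rightarrow> complex" where
  "fr \<sigma> z = z powr of_real \<sigma> * (1 + z) powr (- of_real \<sigma>)"

text \<open>\<open>fr \<sigma>\<close> tends to 1 at infinity, so its contour integral would not
  converge absolutely. For \<sigma> > 0 the function z / (1 + z) has the same limits 0 and 1 at the
  two ends, and the operator belonging to it is \<open>P1\<close>.\<close>

definition gf :: "real \<Rightarrow> complex \<Rightarrow> complex" where
  "gf \<sigma> z = fr \<sigma> z - z / (1 + z)"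

text \<open>For 1 \<le> j < \<sigma> the symbol z^(\<sigma> - j) (1 + z)^(-\<sigma>) decays at both
  ends by itself, so nothing is subtracted.\<close>

definition kf :: "real \<Rightarrow> nat \<Rightarrow> complex \<Rightarrow> complex" where
  "kf \<sigma> j z = fr \<sigma> z / z ^ j"

lemma fr_bound:
  assumes z: "z \<in> wide" "z \<noteq> 0" and \<sigma>: "\<sigma> \<ge> 0"
  shows "cmod (fr \<sigma> z) \<le> q powr (- \<sigma>) * (cmod z powr \<sigma> * (1 + cmod z) powr (- \<sigma>))"
proof -
  have n: "1 + z \<noteq> 0" using wide_slit[OF z] one_add_slit_nonzero by blast
  have "cmod ((1 + z) powr (- of_real \<sigma>)) = cmod (1 + z) powr (- \<sigma>)"
    using cmod_powr_of_real[OF n, of "- \<sigma>"] by simp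
  also have "\<dots> \<le> (q * (1 + cmod z)) powr (- \<sigma>)"
    using one_add_wide[OF z(1)] \<sigma> mult_pos_pos[OF q(1) add_pos_nonneg[OF zero_less_one norm_ge_zero[of z]]]
    by (intro powr_mono2') auto
  also have "\<dots> = q powr (- \<sigma>) * (1 + cmod z) powr (- \<sigma>)" using q by (simp add: powr_mult)
  finally have "cmod (z powr of_real \<sigma>) * cmod ((1 + z) powr (- of_real \<sigma>))
      \<le> cmod z powr \<sigma> * (q powr (- \<sigma>) * (1 + cmod z) powr (- \<sigma>))"
    using cmod_powr_of_real[OF z(2), of \<sigma>] by (intro mult_mono) auto
  thus ?thesis by (simp add: fr_def norm_mult mult_ac)
qed

lemma fr_holomorphic: "fr \<sigma> holomorphic_on - \<real>\<^sub>\<le>\<^sub>0"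
  unfolding fr_def using one_add_slit by (intro holomorphic_intros) auto

lemma kf_decays:
  assumes j: "1 \<le> j" "real j < \<sigma>"
  shows "decays (min (\<sigma> - real j) 1) (q powr (- \<sigma>)) (kf \<sigma> j)"
proof (rule decaysI)
  have k_le: "cmod (kf \<sigma> j z) \<le> q powr (- \<sigma>) * (cmod z powr (\<sigma> - real j) * (1 + cmod z) powr (- \<sigma>))"
    if z: "z \<in> wide" "z \<noteq> 0" for z
  proof -
    have "cmod (kf \<sigma> j z) = cmod (fr \<sigma> z) / cmod z powr real j"
      using z by (simp add: kf_def norm_divide norm_power powr_realpow)
    also have "\<dots> \<le> q powr (- \<sigma>) * (cmod z powr \<sigma> * (1 + cmod z) powr (- \<sigma>)) / cmod z powr real j"
      using fr_bound[OF z] j by (intro divide_right_mono) auto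
    finally show ?thesis by (simp add: powr_diff mult_ac)
  qed
  show "kf \<sigma> j holomorphic_on - \<real>\<^sub>\<le>\<^sub>0"
    unfolding kf_def by (intro holomorphic_intros fr_holomorphic) auto
  show "kf \<sigma> j 0 = 0" using j by (simp add: kf_def)
  show "cmod (kf \<sigma> j z) \<le> q powr (- \<sigma>) * cmod z powr min (\<sigma> - real j) 1"
    if z: "z \<in> wide" "z \<noteq> 0" "cmod z \<le> 1" for z
  proof -
    have "(1 + cmod z) powr (- \<sigma>) \<le> (1 + cmod z) powr 0" using j by (intro powr_mono) auto
    moreover have "1 + cmod z > 0" by (simp add: add_pos_nonneg)
    ultimately have "(1 + cmod z) powr (- \<sigma>) \<le> 1" by simp
    hence "cmod z powr (\<sigma> - real j) * (1 + cmod z) powr (- \<sigma>) \<le> cmod z powr (\<sigma> - real j) * 1"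
      by (rule mult_left_mono) simp
    also have "\<dots> \<le> cmod z powr min (\<sigma> - real j) 1" using z by (simp add: powr_mono')
    finally show ?thesis using k_le[OF z(1,2)] by (meson mult_left_mono order_trans powr_ge_zero)
  qed
  show "cmod (kf \<sigma> j z) \<le> q powr (- \<sigma>) * cmod z powr (- min (\<sigma> - real j) 1)"
    if z: "z \<in> wide" "cmod z \<ge> 1" for z
  proof -
    have z0: "z \<noteq> 0" using z by auto
    have "(1 + cmod z) powr (- \<sigma>) \<le> cmod z powr (- \<sigma>)" using z j by (intro powr_mono2') auto
    hence "cmod z powr (\<sigma> - real j) * (1 + cmod z) powr (- \<sigma>) \<le> cmod z powr (\<sigma> - real j) * cmod z powr (- \<sigma>)"
      by (rule mult_left_mono) simp
    also have "\<dots> = cmod z powr (- real j)" by (simp flip: powr_add)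
    also have "\<dots> \<le> cmod z powr (- min (\<sigma> - real j) 1)" using z j by (intro powr_mono) auto
    finally show ?thesis using k_le[OF z(1) z0] by (meson mult_left_mono order_trans powr_ge_zero)
  qed
qed (use j in auto)

text \<open>Near 0 both terms are small separately. Near infinity they cancel: with y = z / (1 + z)
  the symbol is y^\<sigma> - y = (y^\<sigma> - 1) - (y - 1), which is O(|y - 1|) = O(1 /
  |z|).\<close>

lemma gf_decays:
  assumes \<sigma>: "\<sigma> > 0"
  obtains C where "decays (min \<sigma> 1) C (gf \<sigma>)"
proof -
  obtain L where L: "L \<ge> 0" "\<And>y::complex. cmod (y - 1) \<le> 1 / 2 \<Longrightarrow> cmod (y powr of_real \<sigma> - 1) \<le> L * cmod (y - 1)"
    using powr_near_one[of \<sigma>] by blast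
  define C1 where "C1 = q powr (- \<sigma>) + 1 / q"
  \<comment> \<open>Covers the ranges |z| \<le> 1, 1 \<le> |z| \<le> 2 / q and |z| > 2 / q; beyond 2
    / q one has |y - 1| \<le> 1 / (q |z|) \<le> 1 / 2, as \<open>powr_near_one\<close>
    demands.\<close>
  define C where "C = C1 * (2 / q) + (L + 1) / q"
  have C1: "C1 \<ge> 0" using q by (simp add: C1_def)
  have qz: "1 \<le> 2 / q" using q by (simp add: field_simps)
  have C: "C \<ge> C1" "C \<ge> C1 * (2 / q)" "C \<ge> (L + 1) / q"
    using mult_left_mono[OF qz C1] L q C1 by (auto simp: C_def add_increasing2 add_increasing)
  have frac: "cmod (z / (1 + z)) \<le> cmod z / q" "cmod (z / (1 + z)) \<le> 1 / q" if z: "z \<in> wide" for z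
  proof -
    have "q * 1 \<le> q * (1 + cmod z)" "q * cmod z \<le> q * (1 + cmod z)" using q by (auto intro!: mult_left_mono)
    hence a: "q \<le> cmod (1 + z)" "q * cmod z \<le> cmod (1 + z)" using one_add_wide[OF z] by auto
    show "cmod (z / (1 + z)) \<le> cmod z / q" unfolding norm_divide using a q by (intro frac_le) auto
    show "cmod (z / (1 + z)) \<le> 1 / q" 
    proof -
      have "cmod z \<le> cmod (1 + z) / q" using a(2) q by (simp add: pos_le_divide_eq mult.commute)
      hence "cmod z / cmod (1 + z) \<le> cmod (1 + z) / q / cmod (1 + z)" by (rule divide_right_mono) simp
      also have "\<dots> = 1 / q" using a q by auto
      finally show ?thesis by (simp add: norm_divide)
    qed
  qed
  have "decays (min \<sigma> 1) C (gf \<sigma>)"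
  proof (rule decaysI)
    show "gf \<sigma> holomorphic_on - \<real>\<^sub>\<le>\<^sub>0"
      unfolding gf_def using one_add_slit_nonzero by (intro holomorphic_intros fr_holomorphic) auto
    show "gf \<sigma> 0 = 0" using \<sigma> by (simp add: gf_def fr_def)
    show "C \<ge> 0" using C C1 by linarith
    have crude: "cmod (gf \<sigma> z) \<le> C1" if z: "z \<in> wide" "z \<noteq> 0" for z
    proof -
      have "cmod z powr \<sigma> * (1 + cmod z) powr (- \<sigma>) \<le> (1 + cmod z) powr \<sigma> * (1 + cmod z) powr (- \<sigma>)"
        using \<sigma> by (intro mult_right_mono powr_mono2) auto
      also have "\<dots> = 1" using add_pos_nonneg[of 1 "cmod z"] by (simp flip: powr_add)
      finally have "cmod (fr \<sigma> z) \<le> q powr (- \<sigma>)"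
        using fr_bound[OF z less_imp_le[OF \<sigma>]] mult_left_mono[of _ 1 "q powr (- \<sigma>)"] by (fastforce intro: order_trans)
      thus ?thesis unfolding gf_def C1_def
        by (intro order_trans[OF norm_triangle_ineq4] add_mono frac(2) z)
    qed
    show "cmod (gf \<sigma> z) \<le> C * cmod z powr min \<sigma> 1" if z: "z \<in> wide" "z \<noteq> 0" "cmod z \<le> 1" for z
    proof -
      have "(1 + cmod z) powr (- \<sigma>) \<le> (1 + cmod z) powr 0" using \<sigma> by (intro powr_mono) auto
      moreover have "1 + cmod z > 0" by (simp add: add_pos_nonneg)
      ultimately have "(1 + cmod z) powr (- \<sigma>) \<le> 1" by simp
      hence "cmod z powr \<sigma> * (1 + cmod z) powr (- \<sigma>) \<le> cmod z powr \<sigma> * 1" by (rule mult_left_mono) simp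
      also have "\<dots> \<le> cmod z powr min \<sigma> 1" using z by (simp add: powr_mono')
      finally have "q powr (- \<sigma>) * (cmod z powr \<sigma> * (1 + cmod z) powr (- \<sigma>)) \<le> q powr (- \<sigma>) * cmod z powr min \<sigma> 1"
        by (rule mult_left_mono) simp
      hence 1: "cmod (fr \<sigma> z) \<le> q powr (- \<sigma>) * cmod z powr min \<sigma> 1"
        using fr_bound[OF z(1,2) less_imp_le[OF \<sigma>]] by linarith
      have "cmod z powr 1 \<le> cmod z powr min \<sigma> 1" using z by (intro powr_mono') auto
      hence "cmod z / q \<le> 1 / q * cmod z powr min \<sigma> 1" using z q by (simp add: divide_right_mono)
      hence "cmod (gf \<sigma> z) \<le> C1 * cmod z powr min \<sigma> 1"
        using 1 frac(1)[OF z(1)] norm_triangle_ineq4[of "fr \<sigma> z" "z / (1 + z)"]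
        unfolding gf_def C1_def distrib_right by linarith
      also have "\<dots> \<le> C * cmod z powr min \<sigma> 1" using C by (intro mult_right_mono) auto
      finally show ?thesis .
    qed
    show "cmod (gf \<sigma> z) \<le> C * cmod z powr (- min \<sigma> 1)" if z: "z \<in> wide" "cmod z \<ge> 1" for z
    proof -
      have z0: "z \<noteq> 0" using z by auto
      have slit: "z \<in> - \<real>\<^sub>\<le>\<^sub>0" using wide_slit[OF z(1) z0] by simp
      have n: "1 + z \<noteq> 0" by (rule one_add_slit_nonzero[OF slit])
      have "cmod (gf \<sigma> z) \<le> C * (1 / cmod z)"
      proof (cases "cmod z \<le> 2 / q")
        case True
        have "cmod (gf \<sigma> z) \<le> C1 * 1" using crude[OF z(1) z0] by simp
        also have "\<dots> \<le> C1 * (2 / q * (1 / cmod z))"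
        proof (rule mult_left_mono[OF _ C1])
          have "0 < cmod z" using z by linarith
          thus "1 \<le> 2 / q * (1 / cmod z)" using True by (simp only: times_divide_eq_right mult_1_right pos_le_divide_eq mult_1)
        qed
        also have "\<dots> = C1 * (2 / q) * (1 / cmod z)" by simp
        also have "\<dots> \<le> C * (1 / cmod z)" using C by (intro mult_right_mono) auto
        finally show ?thesis .
      next
        case False
        define y where "y = z / (1 + z)"
        have y1: "y - 1 = - 1 / (1 + z)" using n by (simp add: y_def field_simps)
        have "q * cmod z \<le> q * (1 + cmod z)" using q by (intro mult_left_mono) auto
        hence a: "q * cmod z \<le> cmod (1 + z)" using one_add_wide[OF z(1)] by linarith
        have pos: "q * cmod z > 0" using q z by (intro mult_pos_pos) auto
        have y_le: "cmod (y - 1) \<le> 1 / (q * cmod z)"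
          unfolding y1 norm_divide using a pos by (simp add: frac_le)
        also have "\<dots> \<le> 1 / 2" using False q pos by (simp add: field_simps)
        finally have yh: "cmod (y - 1) \<le> 1 / 2" .
        have "fr \<sigma> z = exp (of_real \<sigma> * (Ln z - Ln (1 + z)))"
          using z0 n by (simp add: fr_def powr_def algebra_simps flip: exp_add)
        also have "\<dots> = y powr of_real \<sigma>"
          unfolding Ln_diff_quotient[OF slit] using z0 n by (simp add: y_def powr_def)
        finally have "gf \<sigma> z = (y powr of_real \<sigma> - 1) - (y - 1)" by (simp add: gf_def y_def)
        hence "cmod (gf \<sigma> z) \<le> L * cmod (y - 1) + cmod (y - 1)"
          using L(2)[OF yh] norm_triangle_ineq4[of "y powr of_real \<sigma> - 1" "y - 1"] by simp
        also have "\<dots> = (L + 1) * cmod (y - 1)" by (simp add: algebra_simps)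
        also have "\<dots> \<le> (L + 1) * (1 / (q * cmod z))" using y_le L by (intro mult_left_mono) auto
        also have "\<dots> = (L + 1) / q * (1 / cmod z)" by simp
        also have "\<dots> \<le> C * (1 / cmod z)" using C by (intro mult_right_mono) auto
        finally show ?thesis .
      qed
      also have "1 / cmod z = cmod z powr (- 1)" using z by (simp add: powr_minus_divide)
      also have "C * cmod z powr (- 1) \<le> C * cmod z powr (- min \<sigma> 1)"
        using z C C1 by (intro mult_left_mono powr_mono) auto
      finally show ?thesis .
    qed
  qed (use \<sigma> in auto)
  thus ?thesis by (rule that)
qed

text \<open>\<open>Cop \<sigma> j\<close> is \<open>A powr (\<sigma> - j) * (1 + A) powr (- \<sigma>)\<close>.\<close>
definition Cop :: "real \<Rightarrow> nat \<Rightarrow> ('a \<Rightarrow>\<^sub>L 'a)" where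
  "Cop \<sigma> j = (if j = 0 then calc (gf \<sigma>) + P1 else calc (kf \<sigma> j))"

text \<open>|z + \<mu>| dominates the weighted geometric mean |z|^\<tau>' \<mu>^(1 - \<tau>'). This
  exchanges an order \<tau>' of decay for the factor \<mu>^(\<tau>' - 1), which is better for small
  \<mu> than the \<mu>^(-1) of \<open>decays_div\<close>.\<close>

lemma decays_gain:
  assumes k: "decays \<tau> C k" and \<tau>': "0 < \<tau>'" "\<tau>' < \<tau>" "\<tau>' \<le> 1" and \<mu>: "\<mu> > 0"
  shows "decays (\<tau> - \<tau>') (C / q * \<mu> powr (\<tau>' - 1)) (\<lambda>z. k z / (z + of_real \<mu>))"
  unfolding decays_def
proof (intro conjI ballI)
  show "(\<lambda>z. k z / (z + of_real \<mu>)) holomorphic_on - \<real>\<^sub>\<le>\<^sub>0"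
    using decays_div[OF k \<mu>] by (simp add: decays_def)
  fix z assume z: "z \<in> wide"
  show "cmod (k z / (z + of_real \<mu>)) \<le> C / q * \<mu> powr (\<tau>' - 1) * bump (\<tau> - \<tau>') (cmod z)"
  proof (cases "z = 0")
    case True
    thus ?thesis using decays_zero[OF k] decays_C[OF k] q bump_nonneg by simp
  next
    case False
    define r where "r = cmod z"
    have r: "r > 0" using False by (simp add: r_def)
    have "r powr \<tau>' * \<mu> powr (1 - \<tau>') \<le> (r + \<mu>) powr \<tau>' * (r + \<mu>) powr (1 - \<tau>')"
      using r \<mu> \<tau>' by (intro mult_mono powr_mono2) auto
    also have "\<dots> = r + \<mu>" using r \<mu> by (simp flip: powr_add)
    finally have "q * (r powr \<tau>' * \<mu> powr (1 - \<tau>')) \<le> q * (r + \<mu>)" using q by (intro mult_left_mono) auto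
    also have "\<dots> \<le> cmod (z + of_real \<mu>)" using norm_add_wide[OF z, of \<mu>] \<mu> by (simp add: r_def)
    finally have d: "q * (r powr \<tau>' * \<mu> powr (1 - \<tau>')) \<le> cmod (z + of_real \<mu>)" .
    have b: "bump \<tau> r * r powr (- \<tau>') \<le> bump (\<tau> - \<tau>') r"
    proof -
      have "bump \<tau> r * r powr (- \<tau>') \<le> r powr \<tau> * r powr (- \<tau>')"
        by (intro mult_right_mono) (auto simp: bump_def)
      also have "\<dots> = r powr (\<tau> - \<tau>')" by (simp flip: powr_add)
      finally have 1: "bump \<tau> r * r powr (- \<tau>') \<le> r powr (\<tau> - \<tau>')" .
      have "bump \<tau> r * r powr (- \<tau>') \<le> r powr (- (\<tau> - \<tau>'))"
      proof (cases "r \<le> 1")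
        case True
        have "r powr (\<tau> - \<tau>') \<le> r powr (- (\<tau> - \<tau>'))" using r True \<tau>' by (intro powr_mono') auto
        thus ?thesis using 1 by linarith
      next
        case False
        have "bump \<tau> r * r powr (- \<tau>') \<le> r powr (- \<tau>) * r powr (- \<tau>')"
          by (intro mult_right_mono) (auto simp: bump_def)
        also have "\<dots> = r powr (- \<tau> - \<tau>')" by (simp flip: powr_add)
        also have "\<dots> \<le> r powr (- (\<tau> - \<tau>'))" using False \<tau>' by (intro powr_mono) auto
        finally show ?thesis .
      qed
      thus ?thesis using 1 by (simp add: bump_def)
    qed
    have "cmod (k z) \<le> C * bump \<tau> r" using k z unfolding decays_def r_def by blast
    hence "cmod (k z / (z + of_real \<mu>)) \<le> C * bump \<tau> r / (q * (r powr \<tau>' * \<mu> powr (1 - \<tau>')))"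
      unfolding norm_divide using d q r \<mu> decays_C[OF k] bump_nonneg by (intro frac_le) auto
    also have "\<dots> = C / q * \<mu> powr (\<tau>' - 1) * (bump \<tau> r * r powr (- \<tau>'))"
      using r \<mu> q by (simp add: powr_diff powr_minus field_simps)
    also have "\<dots> \<le> C / q * \<mu> powr (\<tau>' - 1) * bump (\<tau> - \<tau>') r"
      using b decays_C[OF k] q by (intro mult_left_mono) auto
    finally show ?thesis by (simp add: r_def)
  qed
qed (use \<tau>' in auto)

text \<open>The symbol has order \<sigma> - j at 0, and \<open>decays_gain\<close> converts a part
  \<tau>' of it into a power of \<mu>. The inequality for \<tau>' is strict because a positive order
  must be left for convergence. The additional \<open>P1\<close> for j = 0 is harmless, since (\<mu>
  + A)^(-1) A (1 + A)^(-1) stays bounded for \<mu> \<le> 1.\<close>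

lemma Rp_Cop_bound:
  assumes \<sigma>: "\<sigma> > 0" and J: "real j < \<sigma>" "\<sigma> \<le> real j + 1" and \<tau>': "0 < \<tau>'" "\<tau>' < \<sigma> - real j"
  obtains K where "K \<ge> 0" "\<And>\<mu>. 0 < \<mu> \<Longrightarrow> \<mu> \<le> 1 \<Longrightarrow> norm (Rp \<mu> o\<^sub>L Cop \<sigma> j) \<le> K * \<mu> powr (\<tau>' - 1)"
proof -
  define \<tau> where "\<tau> = \<sigma> - real j"
  have key: "norm (Rp \<mu> o\<^sub>L calc k) \<le> (C / q * M * bump_integral (\<tau> - \<tau>') / pi) * \<mu> powr (\<tau>' - 1)"
    if k: "decays \<tau> C k" and \<mu>: "\<mu> > 0" for C k \<mu>
    unfolding Rp_calc[OF k \<mu>]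
    using integrand_integrable(2)[OF decays_gain[OF k \<tau>'(1) _ _ \<mu>]] \<tau>' J by (simp add: \<tau>_def mult_ac)
  have bi: "bump_integral (\<tau> - \<tau>') \<ge> 0"
    unfolding bump_integral_def
    by (rule Henstock_Kurzweil_Integration.integral_nonneg[OF bump_integrable]) (use \<tau>' in \<open>auto simp: \<tau>_def bump_nonneg\<close>)
  show ?thesis
  proof (cases "j = 0")
    case False
    have "min (\<sigma> - real j) 1 = \<tau>" using J by (simp add: \<tau>_def)
    with kf_decays[of j \<sigma>] False J have "decays \<tau> (q powr (- \<sigma>)) (kf \<sigma> j)" by simp
    from key[OF this] show ?thesis
      using False bi M q by (intro that[of "q powr (- \<sigma>) / q * M * bump_integral (\<tau> - \<tau>') / pi"]) (auto simp: Cop_def)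
  next
    case True
    obtain C where "decays (min \<sigma> 1) C (gf \<sigma>)" using gf_decays[OF \<sigma>] by blast
    moreover have "min \<sigma> 1 = \<tau>" using J True by (simp add: \<tau>_def)
    ultimately have g: "decays \<tau> C (gf \<sigma>)" by simp
    let ?K = "C / q * M * bump_integral (\<tau> - \<tau>') / pi"
    show ?thesis
    proof (rule that)
      show "0 \<le> ?K + (1 + M) * norm R1" using bi M q decays_C[OF g] by simp
      fix \<mu> :: real assume \<mu>: "0 < \<mu>" "\<mu> \<le> 1"
      have "Rp \<mu> (P1 x) = R1 x - \<mu> *\<^sub>R Rp \<mu> (R1 x)" for x
      proof (rule Rp_unique[OF \<mu>(1)])
        let ?y = "R1 x - \<mu> *\<^sub>R Rp \<mu> (R1 x)"
        have m: "\<mu> *\<^sub>R Rp \<mu> (R1 x) \<in> D" using A_Rp(1)[OF \<mu>(1)] subspace_D by (simp add: subspace_scale)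
        show "?y \<in> D" using m A_Rp(1)[of 1] subspace_D by (simp add: subspace_diff)
        have "A (\<mu> *\<^sub>R Rp \<mu> (R1 x)) = \<mu> *\<^sub>R A (Rp \<mu> (R1 x))"
          using A_linear[OF A_Rp(1)[OF \<mu>(1)] A_Rp(1)[OF \<mu>(1)], of \<mu> "R1 x" 0] by simp
        hence "A ?y = A (R1 x) - \<mu> *\<^sub>R A (Rp \<mu> (R1 x))" using A_diff[OF A_Rp(1)[of 1] m] by simp
        thus "A ?y + \<mu> *\<^sub>R ?y = P1 x"
          using A_Rp(2)[of 1 x] A_Rp(2)[OF \<mu>(1), of "R1 x"] by (simp add: blinfun.diff_left algebra_simps)
      qed
      hence RP: "Rp \<mu> o\<^sub>L P1 = R1 - \<mu> *\<^sub>R (Rp \<mu> o\<^sub>L R1)"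
        by (intro blinfun_eqI) (simp add: blinfun.diff_left blinfun.scaleR_left)
      have "norm (Rp \<mu> o\<^sub>L P1) \<le> norm R1 + norm (\<mu> *\<^sub>R (Rp \<mu> o\<^sub>L R1))"
        unfolding RP by (rule norm_triangle_ineq4)
      also have "norm (\<mu> *\<^sub>R (Rp \<mu> o\<^sub>L R1)) \<le> \<mu> * (norm (Rp \<mu>) * norm R1)"
        using \<mu> norm_blinfun_compose[of "Rp \<mu>" R1] by simp
      also have "\<mu> * (norm (Rp \<mu>) * norm R1) \<le> M * norm R1"
      proof -
        have "\<mu> * norm (Rp \<mu>) \<le> M" using norm_Rp[OF \<mu>(1)] \<mu> by (simp add: pos_le_divide_eq mult.commute)
        from mult_right_mono[OF this norm_ge_zero[of R1]] show ?thesis by (simp only: mult.assoc)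
      qed
      finally have p: "norm (Rp \<mu> o\<^sub>L P1) \<le> (1 + M) * norm R1" by (simp add: algebra_simps)
      have one: "1 \<le> \<mu> powr (\<tau>' - 1)"
        using powr_mono'[of "\<tau>' - 1" 0 \<mu>] \<mu> \<tau>' J True by simp
      have "(1 + M) * norm R1 * 1 \<le> (1 + M) * norm R1 * \<mu> powr (\<tau>' - 1)"
        using one M by (intro mult_left_mono) auto
      moreover have "Rp \<mu> o\<^sub>L Cop \<sigma> j = (Rp \<mu> o\<^sub>L calc (gf \<sigma>)) + (Rp \<mu> o\<^sub>L P1)"
        unfolding Cop_def using True by (intro blinfun_eqI) (simp add: blinfun.add_left blinfun.add_right)
      ultimately show "norm (Rp \<mu> o\<^sub>L Cop \<sigma> j) \<le> (?K + (1 + M) * norm R1) * \<mu> powr (\<tau>' - 1)"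
        using key[OF g \<mu>(1)] p norm_triangle_ineq[of "Rp \<mu> o\<^sub>L calc (gf \<sigma>)" "Rp \<mu> o\<^sub>L P1"]
        by (simp add: distrib_right)
    qed
  qed
qed

end

locale injective_sectorial_op = sectorial_op +
  assumes inj: "inj_on A D"
begin

text \<open>A vector killed by A (1 + A)^(-1) is fixed by (1 + A)^(-1), hence lies in the domain and
  in the kernel of A.\<close>

lemma P1_inj: "P1 x = P1 y \<Longrightarrow> x = y"
proof -
  assume "P1 x = P1 y"
  hence e: "(x - y) = R1 (x - y)" by (simp add: blinfun.diff_left blinfun.diff_right algebra_simps)
  have "A (R1 (x - y)) = (x - y) - R1 (x - y)" using A_Rp(2)[of 1 "x - y"] by simp
  also have "\<dots> = A 0" using e A_linear[OF subspace_0[OF subspace_D] subspace_0[OF subspace_D], of 0 0] by simp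
  finally have "R1 (x - y) = 0"
    using inj_onD[OF inj _ A_Rp(1)[of 1 "x - y"] subspace_0[OF subspace_D]] by simp
  thus ?thesis using e by simp
qed

text \<open>Multiplied by \<open>P1\<close>, the claim is the residue computation
  \<open>calc_residue\<close>; injectivity of \<open>P1\<close> cancels the factor.\<close>

lemma calc_quotient: "calc (\<lambda>z. z / (1 + z)\<^sup>2) = R1 o\<^sub>L P1"
proof -
  have k: "decays 1 (1 / q\<^sup>2) (\<lambda>z. z / (1 + z)\<^sup>2)" using decays_rational[of 1 2] by simp
  have "P1 o\<^sub>L calc (\<lambda>z. z / (1 + z)\<^sup>2) = calc (\<lambda>z. z\<^sup>2 / (1 + z) ^ 3)"
    unfolding P1_calc[OF k] by (rule calc_cong) (simp add: power2_eq_square power3_eq_cube)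
  hence eq: "P1 o\<^sub>L calc (\<lambda>z. z / (1 + z)\<^sup>2) = R1 o\<^sub>L (P1 o\<^sub>L P1)" unfolding calc_residue .
  have e: "P1 (calc (\<lambda>z. z / (1 + z)\<^sup>2) x) = R1 (P1 (P1 x))" for x
    using arg_cong[OF eq, of "\<lambda>B. blinfun_apply B x"] by (simp only: blinfun_apply_blinfun_compose)
  have "R1 (P1 (P1 x)) = P1 (R1 (P1 x))" for x by (simp add: blinfun.diff_left blinfun.diff_right)
  hence "P1 (calc (\<lambda>z. z / (1 + z)\<^sup>2) x) = P1 (R1 (P1 x))" for x unfolding e .
  hence "calc (\<lambda>z. z / (1 + z)\<^sup>2) x = R1 (P1 x)" for x by (rule P1_inj)
  thus ?thesis by (intro blinfun_eqI) simp
qed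

text \<open>The relation A Cop (j + 1) = Cop j multiplied by (1 + A)^(-1), so that only bounded
  operators occur and the calculus can compare symbols. For j = 0 the subtracted z / (1 + z) has to
  be matched with the explicit \<open>P1\<close>, which requires
  \<open>calc_quotient\<close>.\<close>

lemma Cop_step:
  assumes j: "real (Suc j) < \<sigma>"
  shows "R1 o\<^sub>L Cop \<sigma> j = P1 o\<^sub>L Cop \<sigma> (Suc j)"
proof -
  note ks = kf_decays[of "Suc j" \<sigma>, OF _ j]
  have P: "P1 o\<^sub>L Cop \<sigma> (Suc j) = calc (\<lambda>z. kf \<sigma> (Suc j) z * z / (1 + z))"
    unfolding Cop_def using P1_calc[OF ks] by simp
  show ?thesis
  proof (cases "j = 0")
    case False
    have "R1 o\<^sub>L Cop \<sigma> j = calc (\<lambda>z. kf \<sigma> j z / (z + of_real 1))"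
      unfolding Cop_def using Rp_calc[OF kf_decays[of j \<sigma>], of 1] False j by simp
    also have "\<dots> = calc (\<lambda>z. kf \<sigma> (Suc j) z * z / (1 + z))"
      by (rule calc_cong) (simp add: kf_def add.commute)
    finally show ?thesis unfolding P .
  next
    case True
    have \<sigma>: "\<sigma> > 0" using j by simp
    obtain C where g: "decays (min \<sigma> 1) C (gf \<sigma>)" using gf_decays[OF \<sigma>] by blast
    have k2: "decays 1 (1 / q\<^sup>2) (\<lambda>z. z / (1 + z)\<^sup>2)" using decays_rational[of 1 2] by simp
    have g1: "decays (min \<sigma> 1) (C / (q * 1)) (\<lambda>z. gf \<sigma> z / (z + of_real 1))" by (rule decays_div[OF g]) simp
    have s1: "min \<sigma> 1 = 1" using j by simp
    have k2': "decays 1 (1 / q\<^sup>2) (\<lambda>z. - (z / (1 + z)\<^sup>2))"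
      using k2 unfolding decays_def by (auto intro: holomorphic_on_minus)
    have neg: "calc (\<lambda>z. - (z / (1 + z)\<^sup>2)) = - calc (\<lambda>z. z / (1 + z)\<^sup>2)"
    proof -
      have z: "decays 1 0 (\<lambda>z. 0)" unfolding decays_def by auto
      have z0: "calc (\<lambda>z. 0) = 0" using calc_diff[OF k2 k2] by simp
      show ?thesis using calc_diff[OF z k2] z0 by simp
    qed
    have "R1 o\<^sub>L Cop \<sigma> j = (R1 o\<^sub>L calc (gf \<sigma>)) + (R1 o\<^sub>L P1)"
      unfolding Cop_def using True by (intro blinfun_eqI) (simp add: blinfun.add_left blinfun.add_right)
    also have "\<dots> = calc (\<lambda>z. gf \<sigma> z / (z + of_real 1)) - calc (\<lambda>z. - (z / (1 + z)\<^sup>2))"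
      unfolding Rp_calc[OF g zero_less_one] neg calc_quotient by simp
    also have "\<dots> = calc (\<lambda>z. gf \<sigma> z / (z + of_real 1) - (- (z / (1 + z)\<^sup>2)))"
      by (rule calc_diff[OF g1 k2', symmetric])
    also have "\<dots> = calc (\<lambda>z. kf \<sigma> (Suc j) z * z / (1 + z))"
    proof (rule calc_cong)
      fix z assume z: "z \<in> wide" "z \<noteq> 0"
      hence n: "1 + z \<noteq> 0" using wide_slit one_add_slit_nonzero by blast
      have "gf \<sigma> z / (z + of_real 1) - (- (z / (1 + z)\<^sup>2)) = (gf \<sigma> z + z / (1 + z)) / (1 + z)"
        using n by (simp add: add.commute add_divide_distrib power2_eq_square)
      thus "gf \<sigma> z / (z + of_real 1) - (- (z / (1 + z)\<^sup>2)) = kf \<sigma> (Suc j) z * z / (1 + z)"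
        using True z by (simp add: gf_def kf_def)
    qed
    finally show ?thesis unfolding P .
  qed
qed

lemma A_Cop:
  assumes j: "real (Suc j) < \<sigma>"
  shows "Cop \<sigma> (Suc j) x \<in> D" "A (Cop \<sigma> (Suc j) x) = Cop \<sigma> j x"
proof -
  have "(R1 o\<^sub>L Cop \<sigma> j) x = (P1 o\<^sub>L Cop \<sigma> (Suc j)) x" unfolding Cop_step[OF j] ..
  hence e: "Cop \<sigma> (Suc j) x = R1 (Cop \<sigma> j x + Cop \<sigma> (Suc j) x)"
    by (simp add: blinfun.diff_left blinfun.add_right algebra_simps)
  show "Cop \<sigma> (Suc j) x \<in> D" by (subst e) (rule A_Rp(1), simp)
  have "A (Cop \<sigma> (Suc j) x) = Cop \<sigma> j x + Cop \<sigma> (Suc j) x - R1 (Cop \<sigma> j x + Cop \<sigma> (Suc j) x)"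
    using A_Rp(2)[of 1 "Cop \<sigma> j x + Cop \<sigma> (Suc j) x"] e by simp
  thus "A (Cop \<sigma> (Suc j) x) = Cop \<sigma> j x" using e by simp
qed

end

section \<open>Laplace transform of the semigroup, and decay of orbits from resolvent bounds\<close>

section \<open>Decay of semigroup orbits\<close>

context complex_banach
begin

lemma dual_unit_lin: "dual_unit \<Phi> \<Longrightarrow> bounded_linear \<Phi>"
  and dual_unit_cscale: "dual_unit \<Phi> \<Longrightarrow> \<Phi> (cscale J c x) = c * \<Phi> x"
  and dual_unit_bound: "dual_unit \<Phi> \<Longrightarrow> cmod (\<Phi> x) \<le> 2 * norm x"
  unfolding dual_unit_def by auto

lemma dual_unit_apply_bound:
  fixes B :: "'a \<Rightarrow>\<^sub>L 'a"
  shows "dual_unit \<Phi> \<Longrightarrow> cmod (\<Phi> (B x)) \<le> 2 * (norm B * norm x)"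
  using order_trans[OF dual_unit_bound mult_left_mono[OF norm_blinfun, of 2]] by simp

text \<open>Weakly entire, with one operator-valued derivative for all functionals and vectors and a
  common bound on the unit disc. This is the uniform form of what \<open>tauberian\<close> asks of
  the scalar functions \<open>p\<close> and \<open>p1\<close>.\<close>

definition entire_op :: "(complex \<Rightarrow> ('a \<Rightarrow>\<^sub>L 'a)) \<Rightarrow> bool" where
  "entire_op P \<longleftrightarrow> (\<exists>P' K. \<forall>\<Phi> x z. dual_unit \<Phi> \<longrightarrow>
     ((\<lambda>z. \<Phi> (blinfun_apply (P z) x)) has_field_derivative \<Phi> (blinfun_apply (P' z) x)) (at z) \<and> (\<lambda>z. \<Phi> (blinfun_apply (P' z) x)) holomorphic_on UNIV \<and>
     (cmod z \<le> 1 \<longrightarrow> norm (P z) \<le> K \<and> norm (P' z) \<le> K))"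

lemma entire_op_const: "entire_op (\<lambda>_. B)"
  unfolding entire_op_def
proof (intro exI[of _ "\<lambda>_. 0"] exI[of _ "norm B"] allI impI conjI)
  fix \<Phi> :: "'a \<Rightarrow> complex" and x :: 'a and z :: complex
  assume "dual_unit \<Phi>"
  then interpret bounded_linear \<Phi> by (rule dual_unit_lin)
  show "((\<lambda>z. \<Phi> (B x)) has_field_derivative \<Phi> (blinfun_apply 0 x)) (at z)" by (simp add: zero)
  show "(\<lambda>z. \<Phi> (blinfun_apply 0 x)) holomorphic_on UNIV" by (rule holomorphic_on_const)
qed auto

lemma dual_unit_exists: "\<exists>\<Phi>. dual_unit \<Phi>"
  using norming_functional by blast

text \<open>Closure under exactly the combination that arises when one A is moved through the
  resolvents in \<open>RLp_Cop_step\<close>.\<close>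

lemma entire_op_step:
  assumes P: "entire_op P" and Q: "entire_op Q"
  shows "entire_op (\<lambda>z. P z - cscaleL J z (Q z))"
proof -
  obtain P' :: "complex \<Rightarrow> ('a \<Rightarrow>\<^sub>L 'a)" and K where PK: "\<And>\<Phi> x z. dual_unit \<Phi> \<Longrightarrow>
     ((\<lambda>z. \<Phi> (blinfun_apply (P z) x)) has_field_derivative \<Phi> (blinfun_apply (P' z) x)) (at z) \<and> (\<lambda>z. \<Phi> (blinfun_apply (P' z) x)) holomorphic_on UNIV \<and>
     (cmod z \<le> 1 \<longrightarrow> norm (P z) \<le> K \<and> norm (P' z) \<le> K)"
    using P unfolding entire_op_def by blast
  obtain Q' :: "complex \<Rightarrow> ('a \<Rightarrow>\<^sub>L 'a)" and L where QL: "\<And>\<Phi> x z. dual_unit \<Phi> \<Longrightarrow>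
     ((\<lambda>z. \<Phi> (blinfun_apply (Q z) x)) has_field_derivative \<Phi> (blinfun_apply (Q' z) x)) (at z) \<and> (\<lambda>z. \<Phi> (blinfun_apply (Q' z) x)) holomorphic_on UNIV \<and>
     (cmod z \<le> 1 \<longrightarrow> norm (Q z) \<le> L \<and> norm (Q' z) \<le> L)"
    using Q unfolding entire_op_def by blast
  obtain \<Phi>0 :: "'a \<Rightarrow> complex" where \<Phi>0: "dual_unit \<Phi>0" using dual_unit_exists by blast
  have nP: "norm (P z) \<le> K" "norm (P' z) \<le> K" and nQ: "norm (Q z) \<le> L" "norm (Q' z) \<le> L" if "cmod z \<le> 1" for z
    using PK[OF \<Phi>0, of _ z] QL[OF \<Phi>0, of _ z] that by auto
  have small: "norm (cscaleL J z B) \<le> L" if "cmod z \<le> 1" "norm B \<le> L" for z B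
  proof -
    have "cmod z * norm B \<le> 1 * L" using that by (intro mult_mono) auto
    thus ?thesis by simp
  qed
  show ?thesis
    unfolding entire_op_def
  proof (intro exI[of _ "\<lambda>z. P' z - (Q z + cscaleL J z (Q' z))"] exI[of _ "K + L + L"] allI impI conjI)
    fix \<Phi> :: "'a \<Rightarrow> complex" and x :: 'a and z :: complex
    assume \<Phi>: "dual_unit \<Phi>"
    then interpret bounded_linear \<Phi> by (rule dual_unit_lin)
    have e: "\<Phi> ((P z - cscaleL J z (Q z)) x) = \<Phi> (P z x) - z * \<Phi> (Q z x)" for z
      by (simp add: blinfun.diff_left diff dual_unit_cscale[OF \<Phi>])
    have e': "\<Phi> ((P' z - (Q z + cscaleL J z (Q' z))) x) = \<Phi> (P' z x) - (\<Phi> (Q z x) + z * \<Phi> (Q' z x))" for z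
      by (simp add: blinfun.diff_left blinfun.add_left diff add dual_unit_cscale[OF \<Phi>])
    note dP = PK[OF \<Phi>, THEN conjunct1] and dQ = QL[OF \<Phi>, THEN conjunct1]
    have "((\<lambda>z. \<Phi> (P z x) - z * \<Phi> (Q z x)) has_field_derivative \<Phi> (P' z x) - (1 * \<Phi> (Q z x) + \<Phi> (Q' z x) * z)) (at z)"
      by (intro DERIV_diff DERIV_mult dP dQ DERIV_ident)
    thus "((\<lambda>z. \<Phi> ((P z - cscaleL J z (Q z)) x)) has_field_derivative \<Phi> ((P' z - (Q z + cscaleL J z (Q' z))) x)) (at z)"
      unfolding e e' by (simp add: mult.commute)
    have "(\<lambda>z. \<Phi> (Q z x)) holomorphic_on UNIV"
      unfolding holomorphic_on_def field_differentiable_def using dQ by auto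
    thus "(\<lambda>z. \<Phi> ((P' z - (Q z + cscaleL J z (Q' z))) x)) holomorphic_on UNIV"
      unfolding e' using PK[OF \<Phi>, THEN conjunct2, THEN conjunct1] QL[OF \<Phi>, THEN conjunct2, THEN conjunct1]
      by (intro holomorphic_intros) auto
    assume z: "cmod z \<le> 1"
    show "norm (P z - cscaleL J z (Q z)) \<le> K + L + L"
      using norm_triangle_ineq4[of "P z" "cscaleL J z (Q z)"] nP[OF z] small[OF z nQ(1)[OF z]] order_trans[OF norm_ge_zero nQ(1)[OF z]]
      by linarith
    show "norm (P' z - (Q z + cscaleL J z (Q' z))) \<le> K + L + L"
      using norm_triangle_ineq4[of "P' z" "Q z + cscaleL J z (Q' z)"] norm_triangle_ineq[of "Q z" "cscaleL J z (Q' z)"]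
        nP[OF z] nQ[OF z] small[OF z nQ(2)[OF z]] by linarith
  qed
qed

end

context complex_closed_op
begin

text \<open>The k-th power of (z + A)^(-1) = - res (- z). For k \<ge> 1 it is, up to sign and a
  factorial, the (k-1)-st derivative of the Laplace transform of the semigroup.\<close>

definition RLp :: "complex \<Rightarrow> nat \<Rightarrow> ('a \<Rightarrow>\<^sub>L 'a)" where
  "RLp z k = (-1) ^ k *\<^sub>R blinfun_pow (res (- z)) k"

lemma RLp_Suc: "RLp z (Suc k) x = - res (- z) (RLp z k x)"
  by (simp add: RLp_def blinfun.scaleR_left blinfun.minus_left blinfun.scaleR_right)

lemma RLp_zero [simp]: "RLp z 0 x = x"
  by (simp add: RLp_def)

lemma norm_RLp_le: "norm (RLp z k) \<le> norm (res (- z)) ^ k"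
  unfolding RLp_def norm_scaleR by (simp add: power_abs norm_blinfun_pow_le)

lemma RLp_Suc_right: "- z \<in> rho \<Longrightarrow> RLp z (Suc k) x = RLp z k (- res (- z) x)"
proof (induction k arbitrary: x)
  case 0
  show ?case using RLp_Suc[of z 0 x] by simp
next
  case (Suc k)
  have "RLp z (Suc (Suc k)) x = - res (- z) (RLp z k (- res (- z) x))"
    using RLp_Suc[of z "Suc k" x] Suc by simp
  thus ?case using RLp_Suc[of z k "- res (- z) x"] by simp
qed

lemma dual_RLp_derivative:
  assumes \<Phi>: "dual_unit \<Phi>" and S: "\<And>z. z \<in> S \<Longrightarrow> - z \<in> rho" and z: "z \<in> S"
  shows "((\<lambda>z. \<Phi> (RLp z k x)) has_field_derivative - (of_nat k * \<Phi> (RLp z (Suc k) x))) (at z within S)"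
proof -
  interpret bounded_linear \<Phi> by (rule dual_unit_lin[OF \<Phi>])
  have "((\<lambda>l. \<Phi> (blinfun_pow (res l) k x)) has_field_derivative
     - (of_nat k * \<Phi> (blinfun_pow (res (- z)) (Suc k) x))) (at (- z) within uminus ` S)"
    by (rule dual_res_pow_has_field_derivative[OF _ _ \<Phi>]) (use S z in auto)
  moreover have "(uminus has_field_derivative (-1)) (at z within S)"
    by (auto intro!: derivative_eq_intros)
  ultimately have "((\<lambda>l. \<Phi> (blinfun_pow (res l) k x)) \<circ> uminus has_field_derivative
      - (of_nat k * \<Phi> (blinfun_pow (res (- z)) (Suc k) x)) * (-1)) (at z within S)"
    by (rule DERIV_image_chain)
  from DERIV_cmult[OF this, of "(-1) ^ k"]
  have "((\<lambda>z. (-1) ^ k * \<Phi> (blinfun_pow (res (- z)) k x)) has_field_derivative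
      (-1) ^ k * (of_nat k * \<Phi> (blinfun_pow (res (- z)) (Suc k) x))) (at z within S)"
    by (simp add: o_def)
  moreover have "\<Phi> (RLp w j y) = (-1) ^ j * \<Phi> (blinfun_pow (res (- w)) j y)" for w j y
    unfolding RLp_def blinfun.scaleR_left scaleR by (simp add: scaleR_conv_of_real)
  ultimately show ?thesis by (simp add: mult_ac del: blinfun_pow.simps)
qed

text \<open>The generator only records the right derivative at 0. Its image under \<open>T t\<close>
  is the right derivative at t; for the left one T t = T (t - k) T k is used, where the bound on T
  over {0..t} and strong continuity control the limit.\<close>

lemma semigroup_orbit_derivative:
  assumes gen: "generates J D (\<lambda>x. - A x) T" and bound: "\<And>t. t \<ge> 0 \<Longrightarrow> norm (T t) \<le> N * exp (\<omega> * t)" and \<omega>: "\<omega> \<ge> 0"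
    and x: "x \<in> D" and t: "t > 0" and \<Phi>: "dual_unit \<Phi>"
  shows "((\<lambda>t. \<Phi> (T t x)) has_vector_derivative - \<Phi> (T t (A x))) (at t)"
proof -
  interpret bounded_linear \<Phi> by (rule dual_unit_lin[OF \<Phi>])
  have c0: "c0_semigroup J T" using gen unfolding generates_def by blast
  have Tadd: "T (s + t) y = T s (T t y)" if "s \<ge> 0" "t \<ge> 0" for s t y
    using c0 that unfolding c0_semigroup_def by (metis blinfun_apply_blinfun_compose)
  have sc: "continuous_on {0..} (\<lambda>t. T t y)" for y using c0 unfolding c0_semigroup_def by blast
  define e where "e = - A x"
  define d where "d h = (1 / h) *\<^sub>R (T h x - x)" for h
  have d: "(d \<longlongrightarrow> e) (at_right 0)" using gen x unfolding generates_def d_def e_def by blast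
  have Th: "T h x = x + h *\<^sub>R d h" if "h > 0" for h using that by (simp add: d_def)
  have N: "N \<ge> 0" using order_trans[OF norm_ge_zero bound[of 0]] by simp
  have norm_T: "norm (T s y) \<le> N * exp (\<omega> * t) * norm y" if "0 \<le> s" "s \<le> t" for s y
  proof -
    have "norm (T s y) \<le> norm (T s) * norm y" by (rule norm_blinfun)
    also have "\<dots> \<le> N * exp (\<omega> * t) * norm y"
      using bound[OF that(1)] that N \<omega> by (intro mult_right_mono order_trans[OF bound[OF that(1)] mult_left_mono]) (auto intro: mult_left_mono)
    finally show ?thesis .
  qed
  let ?q = "\<lambda>h. cmod (\<Phi> (T (t + h) x) - \<Phi> (T t x) - h *\<^sub>R \<Phi> (T t e)) / norm h"
  have right: "(?q \<longlongrightarrow> 0) (at_right 0)"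
  proof (rule Lim_null_comparison)
    have "((\<lambda>h. 2 * (N * exp (\<omega> * t) * norm (d h - e))) \<longlongrightarrow> 2 * (N * exp (\<omega> * t) * norm (e - e))) (at_right 0)"
      by (intro tendsto_intros d)
    thus "((\<lambda>h. 2 * (N * exp (\<omega> * t) * norm (d h - e))) \<longlongrightarrow> 0) (at_right 0)" by simp
    show "\<forall>\<^sub>F h in at_right 0. norm (?q h) \<le> 2 * (N * exp (\<omega> * t) * norm (d h - e))"
      using eventually_at_right_less[of 0]
    proof eventually_elim
      fix h :: real assume h: "0 < h"
      have "\<Phi> (T (t + h) x) - \<Phi> (T t x) - h *\<^sub>R \<Phi> (T t e) = h *\<^sub>R \<Phi> (T t (d h - e))"
      proof -
        have "T (t + h) x = T t x + h *\<^sub>R T t (d h)"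
          using Tadd[of t h x] Th[OF h] h t by (simp add: blinfun.add_right blinfun.scaleR_right)
        thus ?thesis by (simp add: blinfun.diff_right add diff scaleR scaleR_diff_right)
      qed
      hence "?q h = cmod (\<Phi> (T t (d h - e)))" using h by simp
      also have "\<dots> \<le> 2 * norm (T t (d h - e))" by (rule dual_unit_bound[OF \<Phi>])
      also have "\<dots> \<le> 2 * (N * exp (\<omega> * t) * norm (d h - e))" using norm_T[of t "d h - e"] t by simp
      finally show "norm (?q h) \<le> 2 * (N * exp (\<omega> * t) * norm (d h - e))" by simp
    qed
  qed
  have "((\<lambda>k. ?q (- k)) \<longlongrightarrow> 0) (at_right 0)"
  proof (rule Lim_null_comparison)
    let ?b = "\<lambda>k. 2 * norm (T t e - T (t - k) e) + 2 * (N * exp (\<omega> * t) * norm (e - d k))"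
    have "((\<lambda>k. T (t - k) e) \<longlongrightarrow> T (t - 0) e) (at_right 0)"
    proof -
      have "((\<lambda>s. T s e) \<longlongrightarrow> T t e) (at t within {0..})" using sc[of e] t unfolding continuous_on_def by auto
      moreover have "filterlim (\<lambda>k. t - k) (at t within {0..}) (at_right 0)"
        unfolding filterlim_at
      proof
        show "\<forall>\<^sub>F k in at_right 0. t - k \<in> {0..} \<and> t - k \<noteq> t"
          using eventually_at_right_real[OF t] by eventually_elim auto
        show "((\<lambda>k. t - k) \<longlongrightarrow> t) (at_right 0)" by (auto intro!: tendsto_eq_intros)
      qed
      ultimately show ?thesis using filterlim_compose by fastforce
    qed
    from tendsto_mult[OF tendsto_const tendsto_norm[OF tendsto_diff[OF tendsto_const this]]]
    have "(?b \<longlongrightarrow> 2 * norm (T t e - T (t - 0) e) + 2 * (N * exp (\<omega> * t) * norm (e - e))) (at_right 0)"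
      by (rule tendsto_add) (intro tendsto_mult tendsto_const tendsto_norm tendsto_diff d)
    thus "(?b \<longlongrightarrow> 0) (at_right 0)" by simp
    show "\<forall>\<^sub>F k in at_right 0. norm (?q (- k)) \<le> ?b k"
      using eventually_at_right_real[OF t]
    proof eventually_elim
      fix k assume k: "k \<in> {0<..<t}"
      have "T t x = T (t - k) (T k x)" using Tadd[of "t - k" k x] k by simp
      hence "\<Phi> (T (t + - k) x) - \<Phi> (T t x) - (- k) *\<^sub>R \<Phi> (T t e) = k *\<^sub>R \<Phi> ((T t e - T (t - k) e) + T (t - k) (e - d k))"
      proof -
        have "T t x = T (t - k) x + k *\<^sub>R T (t - k) (d k)"
          using \<open>T t x = _\<close> Th[of k] k by (simp add: blinfun.add_right blinfun.scaleR_right)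
        thus ?thesis by (simp add: blinfun.diff_right add diff scaleR scaleR_diff_right scaleR_add_right)
      qed
      hence "?q (- k) = cmod (\<Phi> ((T t e - T (t - k) e) + T (t - k) (e - d k)))" using k by simp
      also have "\<dots> \<le> 2 * norm ((T t e - T (t - k) e) + T (t - k) (e - d k))" by (rule dual_unit_bound[OF \<Phi>])
      also have "\<dots> \<le> 2 * (norm (T t e - T (t - k) e) + norm (T (t - k) (e - d k)))" by (intro mult_left_mono norm_triangle_ineq) simp
      also have "\<dots> \<le> ?b k" using norm_T[of "t - k" "e - d k"] k by simp
      finally show "norm (?q (- k)) \<le> ?b k" by simp
    qed
  qed
  hence left: "(?q \<longlongrightarrow> 0) (at_left 0)" by (subst filterlim_at_left_to_right) simp
  have "(?q \<longlongrightarrow> 0) (at 0)" by (rule filterlim_split_at[OF left right])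
  hence "((\<lambda>t. \<Phi> (T t x)) has_derivative (\<lambda>h. h *\<^sub>R \<Phi> (T t e))) (at t)"
    unfolding has_derivative_at by (auto intro: bounded_linear_scaleR_left)
  moreover have "\<Phi> (T t e) = - \<Phi> (T t (A x))" by (simp add: e_def blinfun.minus_right neg)
  ultimately show ?thesis unfolding has_vector_derivative_def by simp
qed

text \<open>For x = (z + A)^(-1) y one has A x = y - z x, so - exp (- z t) \<Phi> (T t x) is a
  primitive of exp (- z t) \<Phi> (T t y), and it vanishes at infinity.\<close>

lemma laplace_semigroup:
  assumes gen: "generates J D (\<lambda>x. - A x) T" and bound: "\<And>t. t \<ge> 0 \<Longrightarrow> norm (T t) \<le> N * exp (\<omega> * t)" and \<omega>: "\<omega> \<ge> 0"
    and \<Phi>: "dual_unit \<Phi>" and z: "Re z > \<omega>" "- z \<in> rho"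
  shows "\<Phi> (- res (- z) y) = laplace (\<lambda>t. \<Phi> (T t y)) z"
proof -
  interpret bounded_linear \<Phi> by (rule dual_unit_lin[OF \<Phi>])
  have c0: "c0_semigroup J T" using gen unfolding generates_def by blast
  have T0: "T 0 x = x" for x using c0 unfolding c0_semigroup_def by simp
  have comm: "T t (cscale J c x) = cscale J c (T t x)" if "t \<ge> 0" for t c x
  proof (rule commuting_cscale)
    have "J o\<^sub>L T t = T t o\<^sub>L J" using c0 that unfolding c0_semigroup_def by blast
    thus "commuting (T t)" unfolding commuting_def by (metis blinfun_apply_blinfun_compose)
  qed
  have cont: "continuous_on {0..} (\<lambda>t. \<Phi> (T t x))" for x
    using c0 unfolding c0_semigroup_def by (intro continuous_on_compose2[OF linear_continuous_on[OF bounded_linear_axioms, of UNIV]]) auto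
  have le: "cmod (\<Phi> (T t x)) \<le> (2 * N * norm x) * exp (\<omega> * t)" if "t \<ge> 0" for t x
  proof -
    have "cmod (\<Phi> (T t x)) \<le> 2 * (norm (T t) * norm x)" by (rule dual_unit_apply_bound[OF \<Phi>])
    also have "\<dots> \<le> 2 * ((N * exp (\<omega> * t)) * norm x)" using bound[OF that] by (intro mult_left_mono mult_right_mono) auto
    finally show ?thesis by (simp add: mult_ac)
  qed
  define x where "x = - res (- z) y"
  have xD: "x \<in> D" and Ax: "A x = y - cscale J z x"
  proof -
    note r = res_in_D[OF z(2), of y]
    show "x \<in> D" using r subspace_D by (simp add: x_def subspace_neg)
    have "A (- res (- z) y) = - A (res (- z) y)" using A_linear[OF r r, of "-1" 0] by simp
    thus "A x = y - cscale J z x"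
      using A_res[OF z(2), of y] by (simp add: x_def cscale_minus_left cscale_minus_right)
  qed
  have "set_integrable lborel {0<..} (\<lambda>t. exp (- (z * of_real t)) * \<Phi> (T t y))"
    by (rule laplace_integrable[OF continuous_on_subset[OF cont] le z(1)]) auto
  from tendsto_integral_half_line[OF this]
  have lim1: "((\<lambda>L. integral {0..L} (\<lambda>t. exp (- (z * of_real t)) * \<Phi> (T t y))) \<longlongrightarrow> laplace (\<lambda>t. \<Phi> (T t y)) z) at_top"
    unfolding laplace_def .
  have int: "integral {0..L} (\<lambda>t. exp (- (z * of_real t)) * \<Phi> (T t y)) = \<Phi> x - exp (- (z * of_real L)) * \<Phi> (T L x)" if L: "L \<ge> 0" for L
  proof -
    have "((\<lambda>t. exp (- (z * of_real t)) * \<Phi> (T t y)) has_integral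
        (- (exp (- (z * of_real L)) * \<Phi> (T L x)) - - (exp (- (z * of_real 0)) * \<Phi> (T 0 x)))) {0..L}"
    proof (rule fundamental_theorem_of_calculus_interior[OF L])
      show "continuous_on {0..L} (\<lambda>t. - (exp (- (z * of_real t)) * \<Phi> (T t x)))"
        by (intro continuous_intros continuous_on_subset[OF cont]) auto
      fix t assume t: "t \<in> {0<..<L}"
      have ex: "((\<lambda>t. exp (- (z * of_real t))) has_vector_derivative - z * exp (- (z * of_real t))) (at t)"
      proof -
        have "((\<lambda>w. exp (- (z * w))) has_field_derivative - z * exp (- (z * of_real t))) (at (of_real t))"
          by (auto intro!: derivative_eq_intros)
        thus ?thesis by (rule has_vector_derivative_real_field)
      qed
      have or: "((\<lambda>t. \<Phi> (T t x)) has_vector_derivative - \<Phi> (T t (A x))) (at t)"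
        by (rule semigroup_orbit_derivative[OF gen bound \<omega> xD _ \<Phi>]) (use t in auto)
      have eq: "\<Phi> (T t (A x)) = \<Phi> (T t y) - z * \<Phi> (T t x)"
        unfolding Ax using t by (simp add: blinfun.diff_right comm diff dual_unit_cscale[OF \<Phi>])
      thus "((\<lambda>t. - (exp (- (z * of_real t)) * \<Phi> (T t x))) has_vector_derivative exp (- (z * of_real t)) * \<Phi> (T t y)) (at t)"
        using has_vector_derivative_minus[OF has_vector_derivative_mult[OF ex or]] unfolding eq by (simp add: algebra_simps)
    qed
    thus ?thesis using T0 by (simp add: integral_unique)
  qed
  have lim2: "((\<lambda>L. \<Phi> x - exp (- (z * of_real L)) * \<Phi> (T L x)) \<longlongrightarrow> \<Phi> x - 0) at_top"
  proof (rule tendsto_diff[OF tendsto_const Lim_null_comparison])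
    show "((\<lambda>L. 2 * N * norm x * exp (- ((Re z - \<omega>) * L))) \<longlongrightarrow> 0) at_top"
    proof -
      have "((\<lambda>L. exp (- ((Re z - \<omega>) * L))) \<longlongrightarrow> 0) at_top" using z(1) by real_asymp
      thus ?thesis by (rule tendsto_mult_right_zero)
    qed
    show "\<forall>\<^sub>F L in at_top. cmod (exp (- (z * of_real L)) * \<Phi> (T L x)) \<le> 2 * N * norm x * exp (- ((Re z - \<omega>) * L))"
      using eventually_gt_at_top[of 0]
    proof eventually_elim
      fix L :: real assume L: "0 < L"
      have "cmod (exp (- (z * of_real L)) * \<Phi> (T L x)) \<le> (2 * N * norm x) * exp (- (Re z - \<omega>) * L)"
        by (rule laplace_integrand_bound[where f = "\<lambda>t. \<Phi> (T t x)"]) (use L le in auto)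
      thus "cmod (exp (- (z * of_real L)) * \<Phi> (T L x)) \<le> 2 * N * norm x * exp (- ((Re z - \<omega>) * L))"
        by (simp only: minus_mult_left)
    qed
  qed
  have ev: "\<forall>\<^sub>F L in at_top. \<Phi> x - exp (- (z * of_real L)) * \<Phi> (T L x) = integral {0..L} (\<lambda>t. exp (- (z * of_real t)) * \<Phi> (T t y))"
    using eventually_ge_at_top[of 0] by eventually_elim (simp add: int)
  show ?thesis
    using tendsto_unique[OF trivial_limit_at_top_linorder lim1 Lim_transform_eventually[OF lim2 ev]] by (simp add: x_def)
qed

text \<open>Half of the angle yields a closed sector, without its vertex, inside the given one;
  capping the angle at \<pi> / 2 first keeps cos \<theta> positive.\<close>

lemma small_sector:
  assumes "0 < \<theta>0" "\<theta>0 \<le> pi"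
  obtains \<theta> where "0 < \<theta>" "\<theta> < pi / 2" "{z. cmod z * cos \<theta> \<le> Re z} - {0} \<subseteq> sector \<theta>0"
proof (rule that)
  define \<theta> where "\<theta> = min \<theta>0 (pi / 2) / 2"
  show \<theta>: "0 < \<theta>" "\<theta> < pi / 2" using assms pi_gt_zero by (auto simp: \<theta>_def)
  show "{z. cmod z * cos \<theta> \<le> Re z} - {0} \<subseteq> sector \<theta>0"
  proof
    fix z assume z: "z \<in> {z. cmod z * cos \<theta> \<le> Re z} - {0}"
    have "cmod z * cos \<theta> \<le> cmod z * cos (Arg z)"
      using z cos_Arg[of z] by (simp add: field_simps)
    hence "cos \<theta> \<le> cos \<bar>Arg z\<bar>" using z by simp
    hence "\<bar>Arg z\<bar> \<le> \<theta>"
      using cos_mono_le_eq[of \<theta> "\<bar>Arg z\<bar>"] \<theta> Arg_bounded[of z] by auto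
    thus "z \<in> sector \<theta>0" using \<theta> z assms by (auto simp: sector_def \<theta>_def)
  qed
qed

lemma holo_op_dual:
  assumes "holo_op J F U" and \<Phi>: "dual_unit \<Phi>"
  shows "z \<in> U \<Longrightarrow> \<exists>f'. ((\<lambda>z. \<Phi> (F z x)) has_field_derivative f') (at z)"
proof -
  interpret bounded_linear \<Phi> by (rule dual_unit_lin[OF \<Phi>])
  assume "z \<in> U"
  then obtain F' where F': "((\<lambda>h. cscaleL J (1 / h) (F (z + h) - F z)) \<longlongrightarrow> F') (at 0)"
    using assms unfolding holo_op_def by blast
  have "((\<lambda>h. \<Phi> (blinfun_apply (cscaleL J (1 / h) (F (z + h) - F z)) x)) \<longlongrightarrow> \<Phi> (F' x)) (at 0)"
    by (intro tendsto blinfun.tendsto F' tendsto_const)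
  moreover have "\<Phi> (blinfun_apply (cscaleL J (1 / h) (F (z + h) - F z)) x) = (\<Phi> (F (z + h) x) - \<Phi> (F z x)) / h" for h
    by (simp add: blinfun.diff_left diff dual_unit_cscale[OF \<Phi>])
  ultimately show ?thesis unfolding DERIV_def by auto
qed

text \<open>The factorials in r k = k! \<Phi> ((z + A)^(-(k + 1)) B x) make each function minus the
  derivative of its predecessor, starting from the Laplace transform of the orbit; so the resolvent
  power exceeds the order of differentiation by one. The bounds hold in operator norm, hence the
  constant is common to all functionals and a norming one recovers the norm.\<close>

lemma semigroup_decay:
  fixes B :: "'a \<Rightarrow>\<^sub>L 'a"
  assumes gen: "generates J D (\<lambda>x. - A x) T" and aa: "asymptotically_analytic J T"
    and rho: "\<And>z. z \<in> rhp \<Longrightarrow> - z \<in> rho" and \<alpha>: "\<alpha> \<ge> 1" and \<gamma>: "0 < \<gamma>" "\<gamma> < 1"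
    and P: "entire_op P" and C: "C \<ge> 0"
    and bound1: "\<And>z. z \<in> rhp \<Longrightarrow> norm (RLp z (n + 2) o\<^sub>L B) \<le> C * (cmod z powr (- 1 - \<alpha> * \<gamma>) + 1)"
    and bound2: "\<And>z. z \<in> rhp \<Longrightarrow> cmod z \<le> 1 \<Longrightarrow> norm ((RLp z (n + 1) o\<^sub>L B) - P z) \<le> C * cmod z powr (\<alpha> * (1 - \<gamma>) - 1)"
  shows "\<exists>C'\<ge>0. \<forall>t\<ge>1. \<forall>x. norm (T t (B x)) \<le> C' * t powr (\<gamma> - real (Suc n)) * norm x"
proof -
  obtain w S K where w: "w < 0" and S: "analytic_class J S"
    and K: "\<And>t. t > 0 \<Longrightarrow> exp (- w * t) * norm (T t - S t) \<le> K"
    using aa unfolding asymptotically_analytic_def by blast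
  obtain \<theta>0 F M1 w1 where \<theta>0: "0 < \<theta>0" "\<theta>0 \<le> pi" and FS: "\<And>t. t > 0 \<Longrightarrow> F (complex_of_real t) = S t"
    and holo: "holo_op J F (sector \<theta>0)" and FM: "\<And>z. z \<in> sector \<theta>0 \<Longrightarrow> norm (F z) \<le> M1 * exp (w1 * cmod z)"
    using S unfolding analytic_class_def by blast
  obtain \<theta> where \<theta>: "0 < \<theta>" "\<theta> < pi / 2" and sub: "{z. cmod z * cos \<theta> \<le> Re z} - {0} \<subseteq> sector \<theta>0"
    using small_sector[OF \<theta>0] by blast
  define \<epsilon> where "\<epsilon> = - w"
  define \<omega> where "\<omega> = max w1 0"
  have \<epsilon>: "\<epsilon> > 0" and \<omega>: "\<omega> \<ge> 0" using w by (auto simp: \<epsilon>_def \<omega>_def)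
  have TS: "norm (T t - S t) \<le> K * exp (- \<epsilon> * t)" if "t > 0" for t
  proof -
    have "norm (T t - S t) = exp (- \<epsilon> * t) * (exp (- w * t) * norm (T t - S t))"
      by (simp add: \<epsilon>_def mult.assoc[symmetric] exp_add[symmetric])
    also have "\<dots> \<le> exp (- \<epsilon> * t) * K" by (intro mult_left_mono K that) simp
    finally show ?thesis by (simp add: mult.commute)
  qed
  have K0: "K \<ge> 0" using K[of 1] by (meson order_trans mult_nonneg_nonneg exp_ge_zero norm_ge_zero zero_less_one)
  define M where "M = max M1 0"
  have M0: "M \<ge> 0" by (simp add: M_def)
  have FM': "norm (F z) \<le> M * exp (\<omega> * cmod z)" if "z \<in> sector \<theta>0" for z
  proof -
    have "M1 * exp (w1 * cmod z) \<le> M * exp (\<omega> * cmod z)"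
      unfolding M_def \<omega>_def by (intro mult_mono) (auto intro: mult_right_mono)
    thus ?thesis using FM[OF that] by linarith
  qed
  have real_in: "complex_of_real t \<in> sector \<theta>0" if "t > 0" for t
    using that \<theta>0 by (simp add: sector_def)
  have c0: "c0_semigroup J T" using gen unfolding generates_def by blast
  define N where "N = M + K + 1"
  have TN: "norm (T t) \<le> N * exp (\<omega> * t)" if t: "t \<ge> 0" for t
  proof (cases "t = 0")
    case True
    have "norm (id_blinfun :: 'a \<Rightarrow>\<^sub>L 'a) \<le> 1" by (rule norm_blinfun_id_le)
    thus ?thesis using c0 True M0 K0 by (simp add: c0_semigroup_def N_def)
  next
    case False
    hence t: "t > 0" using t by simp
    have "norm (T t) \<le> norm (T t - S t) + norm (S t)" using norm_triangle_ineq[of "T t - S t" "S t"] by simp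
    also have "\<dots> \<le> K * 1 + M * exp (\<omega> * t)"
    proof (rule add_mono)
      have "K * exp (- \<epsilon> * t) \<le> K * 1" using K0 \<epsilon> t by (intro mult_left_mono) auto
      thus "norm (T t - S t) \<le> K * 1" using TS[OF t] by linarith
      show "norm (S t) \<le> M * exp (\<omega> * t)" using FM'[OF real_in[OF t]] FS[OF t] t by simp
    qed
    also have "\<dots> \<le> N * exp (\<omega> * t)"
    proof -
      have "K * 1 \<le> (K + 1) * exp (\<omega> * t)" using K0 \<omega> t by (intro mult_mono) auto
      thus ?thesis by (simp add: N_def algebra_simps)
    qed
    finally show ?thesis .
  qed
  obtain \<Phi>0 :: "'a \<Rightarrow> complex" where \<Phi>0: "dual_unit \<Phi>0" using dual_unit_exists by blast
  obtain P' :: "complex \<Rightarrow> ('a \<Rightarrow>\<^sub>L 'a)" and L where PL: "\<And>\<Phi> x z. dual_unit \<Phi> \<Longrightarrow>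
     ((\<lambda>z. \<Phi> (blinfun_apply (P z) x)) has_field_derivative \<Phi> (blinfun_apply (P' z) x)) (at z) \<and> (\<lambda>z. \<Phi> (blinfun_apply (P' z) x)) holomorphic_on UNIV \<and>
     (cmod z \<le> 1 \<longrightarrow> norm (P z) \<le> L \<and> norm (P' z) \<le> L)"
    using P unfolding entire_op_def by blast
  have L0: "L \<ge> 0" using PL[OF \<Phi>0, of _ 0, THEN conjunct2, THEN conjunct2] order_trans[OF norm_ge_zero, of "P 0" L] by simp
  \<comment> \<open>2 bounds the functionals, (n + 1)! is the largest factorial that occurs, and C +
    L covers the resolvent bounds as well as the entire part.\<close>
  define c where "c = 2 * fact (Suc n) * (C + L)"
  have c0': "c \<ge> 0" using C L0 by (simp add: c_def)
  define C' where "C' = tauberian_const \<theta> (2 * M * norm B) \<omega> (2 * K * norm B) \<epsilon> \<alpha> \<gamma> c n"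
  have unit: "cmod (\<Phi> (T t (B x))) \<le> C' * t powr (\<gamma> - real (Suc n))"
    if \<Phi>: "dual_unit \<Phi>" and x: "norm x \<le> 1" and t: "t \<ge> 1" for \<Phi> x t
  proof -
    interpret bounded_linear \<Phi> by (rule dual_unit_lin[OF \<Phi>])
    have nB: "norm (B x) \<le> norm B"
      using norm_blinfun[of B x] mult_left_mono[OF x, of "norm B"] by simp
    have op: "cmod (\<Phi> (blinfun_apply Q y)) \<le> 2 * (b * d)" if "norm Q \<le> b" "norm y \<le> d" for Q :: "'a \<Rightarrow>\<^sub>L 'a" and y b d
    proof -
      have "norm Q * norm y \<le> b * d" using that order_trans[OF norm_ge_zero that(1)] by (intro mult_mono) auto
      thus ?thesis using dual_unit_apply_bound[OF \<Phi>, of Q y] by linarith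
    qed
    define r where "r k z = fact k * \<Phi> (RLp z (Suc k) (B x))" for k z
    define p where "p z = fact n * \<Phi> (blinfun_apply (P z) x)" for z
    show ?thesis
      unfolding C'_def
    proof (rule tauberian[where s = "\<lambda>z. \<Phi> (F z (B x))" and r = r and p = p and ?p1.0 = "\<lambda>z. fact n * \<Phi> (blinfun_apply (P' z) x)"])
      show "(\<lambda>z. \<Phi> (F z (B x))) holomorphic_on {z. cmod z * cos \<theta> \<le> Re z} - {0}"
        unfolding holomorphic_on_def field_differentiable_def
        using holo_op_dual[OF holo \<Phi>] sub has_field_derivative_at_within by (meson subsetD)
      show "cmod (\<Phi> (F z (B x))) \<le> 2 * M * norm B * exp (\<omega> * cmod z)" if "z \<in> {z. cmod z * cos \<theta> \<le> Re z} - {0}" for z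
        using op[OF FM' nB] sub that by (simp add: mult_ac subset_iff)
      have "continuous_on {0..} (\<lambda>t. \<Phi> (T t (B x)))"
        using c0 unfolding c0_semigroup_def by (intro continuous_on_compose2[OF linear_continuous_on[OF bounded_linear_axioms, of UNIV]]) auto
      thus "continuous_on {0<..} (\<lambda>t. \<Phi> (T t (B x)))" by (rule continuous_on_subset) auto
      show "cmod (\<Phi> (T t (B x)) - \<Phi> (F (of_real t) (B x))) \<le> 2 * K * norm B * exp (- \<epsilon> * t)" if "t > 0" for t
      proof -
        have "\<Phi> (T t (B x)) - \<Phi> (F (of_real t) (B x)) = \<Phi> ((T t - S t) (B x))"
          using FS[OF that] by (simp add: blinfun.diff_left diff)
        thus ?thesis using op[OF TS[OF that] nB] by (simp add: mult_ac)
      qed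
      show "(r k has_field_derivative - r (Suc k) z) (at z within rhp)" if "z \<in> rhp" for k z
        unfolding r_def using DERIV_cmult[OF dual_RLp_derivative[OF \<Phi> rho that, of "Suc k" "B x"], of "fact k"]
        by (simp add: mult_ac)
      show "r 0 z = laplace (\<lambda>t. \<Phi> (T t (B x))) z" if "Re z > \<omega>" for z
      proof -
        have "- z \<in> rho" using rho[of z] that \<omega> by (cases "z = 0") auto
        from laplace_semigroup[OF gen TN \<omega> \<Phi> that this, of "B x"]
        show ?thesis using RLp_Suc[of z 0 "B x"] by (simp add: r_def del: RLp_Suc)
      qed
      show "(p has_field_derivative fact n * \<Phi> (blinfun_apply (P' z) x)) (at z)" for z
        unfolding p_def by (intro DERIV_cmult) (use PL[OF \<Phi>] in blast)
      show "(\<lambda>z. fact n * \<Phi> (blinfun_apply (P' z) x)) holomorphic_on UNIV"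
        by (intro holomorphic_intros) (use PL[OF \<Phi>] in blast)
      have f: "fact n * (2 * (b * 1)) \<le> c * d" if "0 \<le> d" "0 \<le> b'" "b' \<le> C + L" "b = b' * d" for b d b'
      proof -
        have "fact n * (2 * (b * 1)) = 2 * fact n * b' * d" using that by simp
        also have "\<dots> \<le> 2 * fact (Suc n) * (C + L) * d"
          using that by (intro mult_right_mono mult_mono fact_mono) auto
        finally show ?thesis by (simp add: c_def)
      qed
      show "cmod (fact n * \<Phi> (blinfun_apply (P' z) x)) \<le> c" if "cmod z \<le> 1" for z
      proof -
        have "norm (P' z) \<le> L" using PL[OF \<Phi>, of _ z] that by blast
        hence "fact n * cmod (\<Phi> (blinfun_apply (P' z) x)) \<le> fact n * (2 * (L * 1))"
          by (intro mult_left_mono op x) auto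
        also have "\<dots> \<le> c * 1" using L0 C by (intro f) auto
        finally show ?thesis by (simp add: norm_mult)
      qed
      show "cmod (r (Suc n) z) \<le> c * (cmod z powr (- 1 - \<alpha> * \<gamma>) + 1)" if z: "z \<in> rhp" for z
      proof -
        have "cmod (r (Suc n) z) = fact (Suc n) * cmod (\<Phi> (blinfun_apply (RLp z (n + 2) o\<^sub>L B) x))"
          by (simp add: r_def norm_mult del: fact_Suc)
        also have "\<dots> \<le> fact (Suc n) * (2 * (C * (cmod z powr (- 1 - \<alpha> * \<gamma>) + 1) * 1))"
          by (intro mult_left_mono op bound1 z x) simp
        also have "\<dots> = (2 * fact (Suc n) * C) * (cmod z powr (- 1 - \<alpha> * \<gamma>) + 1)" by simp
        also have "\<dots> \<le> c * (cmod z powr (- 1 - \<alpha> * \<gamma>) + 1)"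
          unfolding c_def using L0 by (intro mult_right_mono mult_left_mono) auto
        finally show ?thesis .
      qed
      show "cmod (r n z - p z) \<le> c * cmod z powr (\<alpha> * (1 - \<gamma>) - 1)" if z: "z \<in> rhp" "cmod z \<le> 1" for z
      proof -
        have "r n z - p z = fact n * \<Phi> (blinfun_apply ((RLp z (n + 1) o\<^sub>L B) - P z) x)"
          by (simp add: r_def p_def blinfun.diff_left diff right_diff_distrib)
        hence "cmod (r n z - p z) \<le> fact n * (2 * (C * cmod z powr (\<alpha> * (1 - \<gamma>) - 1) * 1))"
          using op[OF bound2[OF z] x] by (simp add: norm_mult)
        thus ?thesis using f[of "cmod z powr (\<alpha> * (1 - \<gamma>) - 1)" C] C L0 by simp
      qed
    qed (use \<theta> \<omega> M0 \<epsilon> K0 \<alpha> \<gamma> c0' t in auto)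
  qed
  have C'0: "C' \<ge> 0" using unit[OF \<Phi>0, of 0 1] by (simp add: order_trans[OF norm_ge_zero])
  have "norm (T t (B x)) \<le> C' * t powr (\<gamma> - real (Suc n)) * norm x" if t: "t \<ge> 1" for t x
  proof (cases "x = 0")
    case False
    define y where "y = (1 / norm x) *\<^sub>R x"
    have y: "norm y \<le> 1" and xy: "x = norm x *\<^sub>R y" using False by (auto simp: y_def)
    obtain \<Phi> where "dual_unit \<Phi>" "norm (T t (B y)) \<le> cmod (\<Phi> (T t (B y)))" using norming_functional by blast
    hence "norm (T t (B y)) \<le> C' * t powr (\<gamma> - real (Suc n))" using unit[OF _ y t] by fastforce
    hence "norm x * norm (T t (B y)) \<le> norm x * (C' * t powr (\<gamma> - real (Suc n)))" by (rule mult_left_mono) simp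
    moreover have "norm (T t (B x)) = norm x * norm (T t (B y))"
      by (subst xy) (simp add: blinfun.scaleR_right)
    ultimately show ?thesis by (simp add: mult_ac)
  qed simp
  thus ?thesis using C'0 by blast
qed

end

section \<open>Size of resolvent powers near 0, with and without the regularising fractional
  power\<close>

context complex_closed_op
begin

text \<open>Since |1 + z| \<le> 2 max(1, |z|), the weight |z|^(-\<alpha>) |1 + z|^\<alpha> is of
  size |z|^(-\<alpha>) near 0 and bounded far out; the sum covers both ranges.\<close>

lemma resolvent_growth_bound:
  assumes g: "resolvent_growth J D A T \<alpha> 0" and \<alpha>: "\<alpha> \<ge> 0"
  obtains G where "G \<ge> 0" "\<And>z. z \<in> rhp \<Longrightarrow> - z \<in> rho"
    "\<And>z. z \<in> rhp \<Longrightarrow> norm (res (- z)) \<le> G * (cmod z powr (- \<alpha>) + 1)"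
proof -
  obtain M where M: "\<And>l. Re l \<ge> 0 \<Longrightarrow> l \<noteq> 0 \<Longrightarrow>
      norm (cscaleL J (l powr (of_real \<alpha>) * (1 + l) powr (of_real (- \<alpha> - 0))) (- res (- l))) \<le> M"
    using g unfolding resolvent_growth_def by blast
  have rho: "- z \<in> rho" if "z \<in> rhp" for z
    using g that unfolding resolvent_growth_def rho_def by simp
  have M0: "M \<ge> 0" using order_trans[OF norm_ge_zero M[of 1]] by simp
  have "norm (res (- z)) \<le> (M * 2 powr \<alpha>) * (cmod z powr (- \<alpha>) + 1)" if z: "z \<in> rhp" for z
  proof -
    have pos: "cmod z > 0" using z by auto
    have nz: "1 + z \<noteq> 0" using z by (auto simp: complex_eq_iff)
    have "cmod z powr \<alpha> * cmod (1 + z) powr (- \<alpha>) * norm (res (- z)) \<le> M"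
      using M[of z] z nz cmod_powr_of_real[of z \<alpha>] cmod_powr_of_real[OF nz, of "- \<alpha>"] by (simp add: norm_mult)
    hence "norm (res (- z)) \<le> M * (cmod z powr (- \<alpha>) * cmod (1 + z) powr \<alpha>)"
      using pos nz by (simp add: powr_minus field_simps)
    also have "cmod (1 + z) powr \<alpha> \<le> (2 * max 1 (cmod z)) powr \<alpha>"
      using \<alpha> norm_triangle_ineq[of 1 z] by (intro powr_mono2) auto
    also have "\<dots> = 2 powr \<alpha> * max 1 (cmod z) powr \<alpha>" by (simp add: powr_mult)
    also have "cmod z powr (- \<alpha>) * (2 powr \<alpha> * max 1 (cmod z) powr \<alpha>) \<le> 2 powr \<alpha> * (cmod z powr (- \<alpha>) + 1)"
      using pos by (cases "cmod z \<le> 1") (auto simp: powr_minus field_simps)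
    finally show ?thesis using M0 by (simp add: mult_left_mono mult.assoc)
  qed
  thus thesis using that[of "M * 2 powr \<alpha>"] M0 rho by simp
qed

text \<open>For \<alpha> < 1 the product of \<mu> and the norm of (\<mu> + A)^(-1) is O(\<mu>^(1 -
  \<alpha>)) and becomes small, so a single point \<mu> controls a whole half-disc around 0 by
  \<open>norm_res_near\<close>.\<close>

lemma rhp_resolvent_bounded:
  assumes \<alpha>: "\<alpha> < 1" and G: "G \<ge> 0" and rho: "\<And>z. z \<in> rhp \<Longrightarrow> - z \<in> rho"
    and bound: "\<And>z. z \<in> rhp \<Longrightarrow> norm (res (- z)) \<le> G * (cmod z powr (- \<alpha>) + 1)" and \<alpha>0: "\<alpha> \<ge> 0"
  obtains H where "H \<ge> 0" "\<And>z. z \<in> rhp \<Longrightarrow> norm (res (- z)) \<le> H"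
proof -
  \<comment> \<open>Chosen for 4 G \<mu>^(1 - \<alpha>) \<le> 1 / 2: points of modulus at most \<mu>
    are within 2 \<mu> of \<mu>, and the resolvent belonging to \<mu> \<le> 1 has norm at most 2 G
    \<mu>^(-\<alpha>).\<close>
  define \<mu> where "\<mu> = min 1 ((1 / (8 * (G + 1))) powr (1 / (1 - \<alpha>)))"
  have \<mu>: "0 < \<mu>" "\<mu> \<le> 1" using G by (auto simp: \<mu>_def)
  have "\<mu> powr (1 - \<alpha>) \<le> ((1 / (8 * (G + 1))) powr (1 / (1 - \<alpha>))) powr (1 - \<alpha>)"
    using \<alpha> \<mu> by (intro powr_mono2) (auto simp: \<mu>_def)
  also have "\<dots> = 1 / (8 * (G + 1))" using \<alpha> G by (simp add: powr_powr)
  finally have "4 * G * \<mu> powr (1 - \<alpha>) \<le> 4 * G * (1 / (8 * (G + 1)))" using G by (intro mult_left_mono) auto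
  also have "\<dots> \<le> 1 / 2" using G by (simp add: field_simps)
  finally have small: "4 * G * \<mu> powr (1 - \<alpha>) \<le> 1 / 2" .
  have m: "complex_of_real \<mu> \<in> rhp" using \<mu> by simp
  have near: "norm (res (- z)) \<le> 2 * norm (res (- of_real \<mu>))" if z: "z \<in> rhp" "cmod z \<le> \<mu>" for z
  proof (rule norm_res_near[OF rho[OF z(1)] rho[OF m]])
    have "cmod (- z - - of_real \<mu>) \<le> 2 * \<mu>" using norm_triangle_ineq4[of "of_real \<mu>" z] z \<mu> by simp
    moreover have "norm (res (- of_real \<mu>)) \<le> G * (\<mu> powr (- \<alpha>) + \<mu> powr (- \<alpha>))"
      using bound[OF m] G \<mu> \<alpha>0 powr_mono2'[of "- \<alpha>" \<mu> 1] by (intro order_trans[OF bound[OF m]] mult_left_mono) auto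
    ultimately have "cmod (- z - - of_real \<mu>) * norm (res (- of_real \<mu>)) \<le> (2 * \<mu>) * (G * (\<mu> powr (- \<alpha>) + \<mu> powr (- \<alpha>)))"
      using \<mu> by (intro mult_mono) auto
    also have "\<dots> = 4 * G * \<mu> powr (1 - \<alpha>)" using \<mu> by (simp add: powr_diff powr_minus field_simps)
    finally show "cmod (- z - - of_real \<mu>) * norm (res (- of_real \<mu>)) \<le> 1 / 2" using small by simp
  qed
  have far: "norm (res (- z)) \<le> G * (\<mu> powr (- \<alpha>) + 1)" if z: "z \<in> rhp" "\<mu> \<le> cmod z" for z
    using G \<mu> \<alpha>0 z powr_mono2'[of "- \<alpha>" \<mu> "cmod z"] by (intro order_trans[OF bound[OF z(1)]] mult_left_mono) auto
  show thesis
  proof (rule that)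
    show "0 \<le> max (2 * norm (res (- of_real \<mu>))) (G * (\<mu> powr (- \<alpha>) + 1))" by (simp add: le_max_iff_disj)
    show "norm (res (- z)) \<le> max (2 * norm (res (- of_real \<mu>))) (G * (\<mu> powr (- \<alpha>) + 1))" if "z \<in> rhp" for z
      using near[OF that] far[OF that] by (cases "cmod z \<le> \<mu>") (auto simp: le_max_iff_disj)
  qed
qed

lemma norm_RLp_compose_le:
  assumes "norm (res (- z)) \<le> H"
  shows "norm (RLp z k o\<^sub>L B) \<le> H ^ k * norm B"
  by (intro order_trans[OF norm_blinfun_compose] mult_right_mono order_trans[OF norm_RLp_le] power_mono assms) auto

lemma RLp_cscale: "- z \<in> rho \<Longrightarrow> RLp z k (cscale J c x) = cscale J c (RLp z k x)"
  by (induction k arbitrary: x) (simp_all add: RLp_Suc res_cscale cscale_minus_right)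

text \<open>\<open>semigroup_decay\<close> is used with \<alpha> = 1 and entire part 0. Its
  exponents are then -1 - \<gamma> and - \<gamma>; the first bound contains a constant and the
  second exponent is negative, so bounded resolvent powers qualify. Since n is free, every
  polynomial rate is reached.\<close>

lemma semigroup_decay_bounded_resolvent:
  fixes B :: "'a \<Rightarrow>\<^sub>L 'a"
  assumes gen: "generates J D (\<lambda>x. - A x) T" and aa: "asymptotically_analytic J T"
    and rho: "\<And>z. z \<in> rhp \<Longrightarrow> - z \<in> rho" and H: "H \<ge> 0" "\<And>z. z \<in> rhp \<Longrightarrow> norm (res (- z)) \<le> H"
    and \<gamma>: "0 < \<gamma>" "\<gamma> < 1"
  shows "\<exists>C'\<ge>0. \<forall>t\<ge>1. \<forall>x. norm (T t (B x)) \<le> C' * t powr (\<gamma> - real (Suc n)) * norm x"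
proof (rule semigroup_decay[OF gen aa rho _ \<gamma> entire_op_const[of 0]])
  define C where "C = max (H ^ (n + 2)) (H ^ (n + 1)) * norm B"
  have C: "C \<ge> 0" "H ^ (n + 2) * norm B \<le> C" "H ^ (n + 1) * norm B \<le> C"
    using H by (auto simp: C_def le_max_iff_disj mult_right_mono)
  show "C \<ge> 0" by fact
  show "norm (RLp z (n + 2) o\<^sub>L B) \<le> C * (cmod z powr (- 1 - 1 * \<gamma>) + 1)" if z: "z \<in> rhp" for z
  proof -
    have "norm (RLp z (n + 2) o\<^sub>L B) \<le> C * 1" using norm_RLp_compose_le[OF H(2)[OF z], of "n + 2" B] C by linarith
    also have "\<dots> \<le> C * (cmod z powr (- 1 - 1 * \<gamma>) + 1)" using C by (intro mult_left_mono) auto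
    finally show ?thesis .
  qed
  show "norm ((RLp z (n + 1) o\<^sub>L B) - 0) \<le> C * cmod z powr (1 * (1 - \<gamma>) - 1)" if z: "z \<in> rhp" "cmod z \<le> 1" for z
  proof -
    have "norm (RLp z (n + 1) o\<^sub>L B) \<le> C * 1" using norm_RLp_compose_le[OF H(2)[OF z(1)], of "n + 1" B] C by linarith
    also have "\<dots> \<le> C * cmod z powr (1 * (1 - \<gamma>) - 1)"
      using C \<gamma> z powr_mono2'[of "1 * (1 - \<gamma>) - 1" "cmod z" 1] by (intro mult_left_mono) auto
    finally show ?thesis by simp
  qed
qed auto

end

context sectorial_op
begin

text \<open>One resolvent is compared with the one at \<mu> = |z| on the positive axis, where
  \<open>Rp_Cop_bound\<close> gives \<mu>^(\<tau> - 1). Passing from \<mu> to z costs a factor of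
  order \<mu>^(1 - \<alpha>), and each further resolvent costs |z|^(-\<alpha>).\<close>

lemma norm_RLp_Cop_top:
  assumes \<alpha>: "\<alpha> \<ge> 1" and G: "G \<ge> 0" and rho: "\<And>z. z \<in> rhp \<Longrightarrow> - z \<in> rho"
    and bound: "\<And>z. z \<in> rhp \<Longrightarrow> norm (res (- z)) \<le> G * (cmod z powr (- \<alpha>) + 1)"
    and \<sigma>: "\<sigma> > 0" and m: "real m < \<sigma>" "\<sigma> \<le> real m + 1" and \<tau>: "0 < \<tau>" "\<tau> < \<sigma> - real m"
  obtains K where "K \<ge> 0" "\<And>z. z \<in> rhp \<Longrightarrow> cmod z \<le> 1 \<Longrightarrow>
    norm (RLp z (Suc i) o\<^sub>L Cop \<sigma> m) \<le> K * cmod z powr (\<tau> - real (Suc i) * \<alpha>)"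
proof -
  obtain K where K: "K \<ge> 0" "\<And>\<mu>. 0 < \<mu> \<Longrightarrow> \<mu> \<le> 1 \<Longrightarrow> norm (Rp \<mu> o\<^sub>L Cop \<sigma> m) \<le> K * \<mu> powr (\<tau> - 1)"
    using Rp_Cop_bound[OF \<sigma> m \<tau>] by blast
  have small: "norm (res (- z)) \<le> 2 * G * cmod z powr (- \<alpha>)" if z: "z \<in> rhp" "cmod z \<le> 1" for z
  proof -
    have "1 \<le> cmod z powr (- \<alpha>)" using \<alpha> z powr_mono2'[of "- \<alpha>" "cmod z" 1] by auto
    hence "G * (cmod z powr (- \<alpha>) + 1) \<le> G * (2 * cmod z powr (- \<alpha>))" using G by (intro mult_left_mono) auto
    thus ?thesis using bound[OF z(1)] by simp
  qed
  have "norm (RLp z (Suc i) o\<^sub>L Cop \<sigma> m) \<le> ((2 * G) ^ i * (K * (1 + 4 * G))) * cmod z powr (\<tau> - real (Suc i) * \<alpha>)"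
    if z: "z \<in> rhp" "cmod z \<le> 1" for z
  proof (induction i)
    case 0
    define \<mu> where "\<mu> = cmod z"
    have \<mu>: "0 < \<mu>" "\<mu> \<le> 1" using z by (auto simp: \<mu>_def)
    have eq: "RLp z (Suc 0) x = Rp \<mu> x - cscale J (of_real \<mu> - z) (res (- z) (Rp \<mu> x))" for x
    proof -
      have "res (- z) x - res (- of_real \<mu>) x = cscale J (z - of_real \<mu>) (res (- z) (res (- of_real \<mu>) x))"
        using resolvent_identity[OF rho[OF z(1)] neg_rho[OF \<mu>(1)], of x] by simp
      thus ?thesis
        by (simp add: RLp_Suc Rp_def blinfun.minus_left blinfun.minus_right cscale_minus_right cscale_diff_left algebra_simps)
    qed
    have "norm (RLp z (Suc 0) (Cop \<sigma> m x)) \<le> ((1 + 4 * G * \<mu> powr (1 - \<alpha>)) * (K * \<mu> powr (\<tau> - 1))) * norm x" for x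
    proof -
      let ?y = "Rp \<mu> (Cop \<sigma> m x)"
      have y: "norm ?y \<le> (K * \<mu> powr (\<tau> - 1)) * norm x"
        using norm_blinfun[of "Rp \<mu> o\<^sub>L Cop \<sigma> m" x] mult_right_mono[OF K(2)[OF \<mu>], of "norm x"] by simp
      have "norm (res (- z) ?y) \<le> norm (res (- z)) * norm ?y" by (rule norm_blinfun)
      also have "\<dots> \<le> (2 * G * \<mu> powr (- \<alpha>)) * norm ?y"
        using small[OF z] by (intro mult_right_mono) (auto simp: \<mu>_def)
      finally have "cmod (of_real \<mu> - z) * norm (res (- z) ?y) \<le> (2 * \<mu>) * ((2 * G * \<mu> powr (- \<alpha>)) * norm ?y)"
        using norm_triangle_ineq4[of "of_real \<mu>" z] \<mu> by (intro mult_mono) (auto simp: \<mu>_def)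
      moreover have "(2 * \<mu>) * ((2 * G * \<mu> powr (- \<alpha>)) * norm ?y) = (4 * G * \<mu> powr (1 - \<alpha>)) * norm ?y"
        using \<mu> by (simp add: powr_diff powr_minus field_simps)
      ultimately have "norm (RLp z (Suc 0) (Cop \<sigma> m x)) \<le> norm ?y + (4 * G * \<mu> powr (1 - \<alpha>)) * norm ?y"
        unfolding eq using norm_triangle_ineq4[of ?y "cscale J (of_real \<mu> - z) (res (- z) ?y)"] by simp
      also have "\<dots> = (1 + 4 * G * \<mu> powr (1 - \<alpha>)) * norm ?y" by (simp add: algebra_simps)
      also have "\<dots> \<le> (1 + 4 * G * \<mu> powr (1 - \<alpha>)) * ((K * \<mu> powr (\<tau> - 1)) * norm x)"
        using G by (intro mult_left_mono y) auto
      finally show ?thesis by (simp add: mult.assoc)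
    qed
    hence "norm (RLp z (Suc 0) o\<^sub>L Cop \<sigma> m) \<le> (1 + 4 * G * \<mu> powr (1 - \<alpha>)) * (K * \<mu> powr (\<tau> - 1))"
      using G K by (intro norm_blinfun_bound) auto
    also have "\<dots> \<le> ((1 + 4 * G) * \<mu> powr (1 - \<alpha>)) * (K * \<mu> powr (\<tau> - 1))"
    proof (intro mult_right_mono)
      have "1 \<le> \<mu> powr (1 - \<alpha>)" using \<alpha> \<mu> powr_mono2'[of "1 - \<alpha>" \<mu> 1] by auto
      thus "1 + 4 * G * \<mu> powr (1 - \<alpha>) \<le> (1 + 4 * G) * \<mu> powr (1 - \<alpha>)" by (simp add: algebra_simps)
    qed (use K in auto)
    also have "\<dots> = K * (1 + 4 * G) * (\<mu> powr (1 - \<alpha>) * \<mu> powr (\<tau> - 1))" by (simp add: mult_ac)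
    also have "\<mu> powr (1 - \<alpha>) * \<mu> powr (\<tau> - 1) = \<mu> powr (\<tau> - \<alpha>)"
      by (simp add: powr_add[symmetric])
    finally show ?case by (simp add: \<mu>_def)
  next
    case (Suc i)
    have "RLp z (Suc (Suc i)) o\<^sub>L Cop \<sigma> m = - (res (- z) o\<^sub>L (RLp z (Suc i) o\<^sub>L Cop \<sigma> m))"
      by (rule blinfun_eqI) (simp add: RLp_Suc[of z "Suc i"] blinfun.minus_left)
    hence "norm (RLp z (Suc (Suc i)) o\<^sub>L Cop \<sigma> m) \<le> norm (res (- z)) * norm (RLp z (Suc i) o\<^sub>L Cop \<sigma> m)"
      using norm_blinfun_compose by simp
    also have "\<dots> \<le> (2 * G * cmod z powr (- \<alpha>)) * (((2 * G) ^ i * (K * (1 + 4 * G))) * cmod z powr (\<tau> - real (Suc i) * \<alpha>))"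
      by (intro mult_mono small z Suc) (use G in auto)
    also have "\<dots> = ((2 * G) ^ Suc i * (K * (1 + 4 * G))) * (cmod z powr (- \<alpha>) * cmod z powr (\<tau> - real (Suc i) * \<alpha>))"
      by (simp add: mult_ac)
    also have "cmod z powr (- \<alpha>) * cmod z powr (\<tau> - real (Suc i) * \<alpha>) = cmod z powr (\<tau> - real (Suc (Suc i)) * \<alpha>)"
      by (simp add: powr_add[symmetric] algebra_simps)
    finally show ?case .
  qed
  thus thesis using that[of "(2 * G) ^ i * (K * (1 + 4 * G))"] G K(1) by simp
qed

end

context injective_sectorial_op
begin

text \<open>This is (z + A)^(-1) A = 1 - z (z + A)^(-1), applied to \<open>Cop \<sigma> i\<close> =
  A \<open>Cop \<sigma> (Suc i)\<close>.\<close>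

lemma RLp_Cop_step:
  assumes z: "- z \<in> rho" and i: "real (Suc i) < \<sigma>"
  shows "RLp z (Suc k) (Cop \<sigma> i x) = RLp z k (Cop \<sigma> (Suc i) x) - cscale J z (RLp z (Suc k) (Cop \<sigma> (Suc i) x))"
proof -
  let ?y = "Cop \<sigma> (Suc i) x"
  have "res (- z) (cscale J (- z) ?y - Cop \<sigma> i x) = ?y" using res_left[OF z A_Cop(1)[OF i]] A_Cop(2)[OF i] by simp
  hence "- res (- z) (Cop \<sigma> i x) = ?y - cscale J z (- res (- z) ?y)"
    using z by (simp add: blinfun.diff_right res_cscale blinfun.minus_right cscale_minus_left cscale_minus_right algebra_simps)
  thus ?thesis
    unfolding RLp_Suc_right[OF z] by (simp add: blinfun.diff_right RLp_cscale[OF z])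
qed

text \<open>Induction on the number j of factors A moved, starting at the top index m. Of the two
  terms in \<open>RLp_Cop_step\<close> the second gains a factor |z|, and the first has one
  resolvent less and gains |z|^\<alpha>, which is no worse because \<alpha> \<ge> 1 and |z| \<le> 1.
  Where the resolvents run out, k = 0, a constant operator is left; these constants build up the
  entire part.\<close>

lemma RLp_Cop_bound:
  assumes \<alpha>: "\<alpha> \<ge> 1" and G: "G \<ge> 0" and rho: "\<And>z. z \<in> rhp \<Longrightarrow> - z \<in> rho"
    and bound: "\<And>z. z \<in> rhp \<Longrightarrow> norm (res (- z)) \<le> G * (cmod z powr (- \<alpha>) + 1)"
    and \<sigma>: "\<sigma> > 0" and m: "real m < \<sigma>" "\<sigma> \<le> real m + 1" and \<tau>: "0 < \<tau>" "\<tau> < \<sigma> - real m"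
  shows "j \<le> m \<Longrightarrow> \<exists>P K. entire_op P \<and> 0 \<le> K \<and> (\<forall>z\<in>rhp. cmod z \<le> 1 \<longrightarrow>
    norm ((RLp z k o\<^sub>L Cop \<sigma> (m - j)) - P z) \<le> K * cmod z powr (\<tau> + real j - real k * \<alpha>))"
proof (induction j arbitrary: k)
  case 0
  show ?case
  proof (cases k)
    case 0
    have "RLp z 0 o\<^sub>L Cop \<sigma> m = Cop \<sigma> m" for z by (rule blinfun_eqI) simp
    thus ?thesis using 0 entire_op_const[of "Cop \<sigma> m"] by (intro exI[of _ "\<lambda>_. Cop \<sigma> m"] exI[of _ 0]) simp
  next
    case (Suc i)
    obtain K where "K \<ge> 0" "\<And>z. z \<in> rhp \<Longrightarrow> cmod z \<le> 1 \<Longrightarrow>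
      norm (RLp z (Suc i) o\<^sub>L Cop \<sigma> m) \<le> K * cmod z powr (\<tau> - real (Suc i) * \<alpha>)"
      using norm_RLp_Cop_top[OF \<alpha> G rho bound \<sigma> m \<tau>] by blast
    thus ?thesis using Suc entire_op_const[of 0] by (intro exI[of _ "\<lambda>_. 0"] exI[of _ K]) simp
  qed
next
  case (Suc j)
  show ?case
  proof (cases k)
    case 0
    have "RLp z 0 o\<^sub>L Cop \<sigma> (m - Suc j) = Cop \<sigma> (m - Suc j)" for z by (rule blinfun_eqI) simp
    thus ?thesis using 0 entire_op_const[of "Cop \<sigma> (m - Suc j)"]
      by (intro exI[of _ "\<lambda>_. Cop \<sigma> (m - Suc j)"] exI[of _ 0]) simp
  next
    case k: (Suc k')
    define i where "i = m - Suc j"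
    have i: "Suc i = m - j" "real (Suc i) < \<sigma>" using Suc.prems m by (auto simp: i_def)
    obtain P K where P: "entire_op P" and K: "0 \<le> K" and PK: "\<And>z. z \<in> rhp \<Longrightarrow> cmod z \<le> 1 \<Longrightarrow>
      norm ((RLp z k' o\<^sub>L Cop \<sigma> (Suc i)) - P z) \<le> K * cmod z powr (\<tau> + real j - real k' * \<alpha>)"
      using Suc.IH[of k'] Suc.prems unfolding i by auto
    obtain Q L where Q: "entire_op Q" and L: "0 \<le> L" and QL: "\<And>z. z \<in> rhp \<Longrightarrow> cmod z \<le> 1 \<Longrightarrow>
      norm ((RLp z k o\<^sub>L Cop \<sigma> (Suc i)) - Q z) \<le> L * cmod z powr (\<tau> + real j - real k * \<alpha>)"
      using Suc.IH[of k] Suc.prems unfolding i by auto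
    have "norm ((RLp z k o\<^sub>L Cop \<sigma> i) - (P z - cscaleL J z (Q z))) \<le> (K + L) * cmod z powr (\<tau> + real (Suc j) - real k * \<alpha>)"
      if z: "z \<in> rhp" "cmod z \<le> 1" for z
    proof -
      have "(RLp z k o\<^sub>L Cop \<sigma> i) - (P z - cscaleL J z (Q z)) =
          ((RLp z k' o\<^sub>L Cop \<sigma> (Suc i)) - P z) - cscaleL J z ((RLp z k o\<^sub>L Cop \<sigma> (Suc i)) - Q z)"
        unfolding k by (rule blinfun_eqI)
          (simp add: RLp_Cop_step[OF rho[OF z(1)] i(2)] blinfun.diff_left cscale_diff_right)
      also have "norm \<dots> \<le> norm ((RLp z k' o\<^sub>L Cop \<sigma> (Suc i)) - P z) + cmod z * norm ((RLp z k o\<^sub>L Cop \<sigma> (Suc i)) - Q z)"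
        by (rule order_trans[OF norm_triangle_ineq4]) simp
      also have "\<dots> \<le> K * cmod z powr (\<tau> + real j - real k' * \<alpha>) + cmod z * (L * cmod z powr (\<tau> + real j - real k * \<alpha>))"
        by (intro add_mono mult_left_mono PK QL z) simp
      also have "\<dots> \<le> K * cmod z powr (\<tau> + real (Suc j) - real k * \<alpha>) + L * cmod z powr (\<tau> + real (Suc j) - real k * \<alpha>)"
      proof (intro add_mono mult_left_mono K)
        show "cmod z powr (\<tau> + real j - real k' * \<alpha>) \<le> cmod z powr (\<tau> + real (Suc j) - real k * \<alpha>)"
          using z \<alpha> by (intro powr_mono') (auto simp: k algebra_simps)
        have e: "\<tau> + real (Suc j) - real k * \<alpha> = 1 + (\<tau> + real j - real k * \<alpha>)" by simp
        have "cmod z * cmod z powr (\<tau> + real j - real k * \<alpha>) = cmod z powr (\<tau> + real (Suc j) - real k * \<alpha>)"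
          unfolding e using z by (subst powr_add) auto
        thus "cmod z * (L * cmod z powr (\<tau> + real j - real k * \<alpha>)) \<le> L * cmod z powr (\<tau> + real (Suc j) - real k * \<alpha>)"
          by (simp only: mult.left_commute order_refl)
      qed
      finally show ?thesis by (simp add: distrib_right)
    qed
    thus ?thesis using entire_op_step[OF P Q] K L unfolding i_def
      by (intro exI[of _ "\<lambda>z. P z - cscaleL J z (Q z)"] exI[of _ "K + L"]) simp
  qed
qed

text \<open>Only |z| \<le> 1 depends on the regularisation by \<open>Cop \<sigma> 0\<close>; the
  hypothesis on \<sigma> is the strict form of the exponent condition there.\<close>

lemma semigroup_decay_fractional:
  assumes gen: "generates J D (\<lambda>x. - A x) T" and aa: "asymptotically_analytic J T"
    and \<alpha>: "\<alpha> \<ge> 1" and G: "G \<ge> 0" and rho: "\<And>z. z \<in> rhp \<Longrightarrow> - z \<in> rho"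
    and bound: "\<And>z. z \<in> rhp \<Longrightarrow> norm (res (- z)) \<le> G * (cmod z powr (- \<alpha>) + 1)"
    and \<sigma>: "\<sigma> > 0" and \<gamma>: "0 < \<gamma>" "\<gamma> < 1" and lt: "\<alpha> * (real n + 2 - \<gamma>) < \<sigma> + 1"
  shows "\<exists>C\<ge>0. \<forall>t\<ge>1. \<forall>x. norm (T t (Cop \<sigma> 0 x)) \<le> C * t powr (\<gamma> - real (Suc n)) * norm x"
proof -
  \<comment> \<open>The largest integer strictly below \<sigma>. Then 0 < \<sigma> - m \<le> 1, the
    range in which the decay order of the symbol at 0 is \<sigma> - m and is not cut off at
    1.\<close>
  define m where "m = nat (\<lceil>\<sigma>\<rceil> - 1)"
  have m: "real m < \<sigma>" "\<sigma> \<le> real m + 1" using \<sigma> unfolding m_def by linarith+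
  \<comment> \<open>The strict inequality for \<sigma> leaves room for \<tau>. The result \<tau> + m
    + 1 \<ge> \<alpha> (n + 2 - \<gamma>) yields both exponents required below, for the powers n + 1
    and n + 2.\<close>
  obtain \<tau> where \<tau>': "max 0 (\<alpha> * (real n + 2 - \<gamma>) - 1 - real m) < \<tau>" "\<tau> < \<sigma> - real m"
    using dense[of "max 0 (\<alpha> * (real n + 2 - \<gamma>) - 1 - real m)" "\<sigma> - real m"] lt m by auto
  hence \<tau>: "0 < \<tau>" and \<tau>m: "\<alpha> * (real n + 2 - \<gamma>) - 1 \<le> \<tau> + real m" by auto
  note main = RLp_Cop_bound[OF \<alpha> G rho bound \<sigma> m \<tau> \<tau>'(2) order_refl]
  obtain P K where P: "entire_op P" and K: "0 \<le> K" and PK: "\<And>z. z \<in> rhp \<Longrightarrow> cmod z \<le> 1 \<Longrightarrow>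
      norm ((RLp z (n + 1) o\<^sub>L Cop \<sigma> 0) - P z) \<le> K * cmod z powr (\<tau> + real m - real (n + 1) * \<alpha>)"
    using main[of "n + 1"] by auto
  obtain Q L where Q: "entire_op Q" and L: "0 \<le> L" and QL: "\<And>z. z \<in> rhp \<Longrightarrow> cmod z \<le> 1 \<Longrightarrow>
      norm ((RLp z (n + 2) o\<^sub>L Cop \<sigma> 0) - Q z) \<le> L * cmod z powr (\<tau> + real m - real (n + 2) * \<alpha>)"
    using main[of "n + 2"] by auto
  obtain N where N: "\<And>z. cmod z \<le> 1 \<Longrightarrow> norm (Q z) \<le> N"
    using Q dual_unit_exists unfolding entire_op_def by blast
  have N0: "0 \<le> N" using order_trans[OF norm_ge_zero N[of 0]] by simp
  define C where "C = K + L + N + (2 * G) ^ (n + 2) * norm (Cop \<sigma> 0)"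
  have C: "K \<le> C" "L \<le> C" "N \<le> C" "(2 * G) ^ (n + 2) * norm (Cop \<sigma> 0) \<le> C" "0 \<le> C"
    using K L N0 G by (auto simp: C_def)
  show ?thesis
  proof (rule semigroup_decay[OF gen aa rho \<alpha> \<gamma> P C(5)])
    show "norm (RLp z (n + 2) o\<^sub>L Cop \<sigma> 0) \<le> C * (cmod z powr (- 1 - \<alpha> * \<gamma>) + 1)" if z: "z \<in> rhp" for z
    proof (cases "cmod z \<le> 1")
      case True
      have "norm (RLp z (n + 2) o\<^sub>L Cop \<sigma> 0) \<le> norm ((RLp z (n + 2) o\<^sub>L Cop \<sigma> 0) - Q z) + norm (Q z)"
        using norm_triangle_ineq[of "(RLp z (n + 2) o\<^sub>L Cop \<sigma> 0) - Q z" "Q z"] by simp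
      also have "\<dots> \<le> L * cmod z powr (\<tau> + real m - real (n + 2) * \<alpha>) + N" by (intro add_mono QL N z True)
      also have "\<dots> \<le> C * cmod z powr (- 1 - \<alpha> * \<gamma>) + C * 1"
        using True z \<tau>m C L by (intro add_mono mult_mono powr_mono') (auto simp: algebra_simps)
      finally show ?thesis by (simp add: distrib_left)
    next
      case False
      \<comment> \<open>Away from 0 the resolvent is bounded by 2 G, and the summand 1 in the
        required bound takes care of this range.\<close>
      have "cmod z powr (- \<alpha>) \<le> 1" using False \<alpha> powr_mono2'[of "- \<alpha>" 1 "cmod z"] by auto
      hence "G * (cmod z powr (- \<alpha>) + 1) \<le> G * 2" using G by (intro mult_left_mono) auto
      hence "norm (res (- z)) \<le> 2 * G" using bound[OF z] by linarith
      from norm_RLp_compose_le[OF this, of "n + 2" "Cop \<sigma> 0"]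
      have "norm (RLp z (n + 2) o\<^sub>L Cop \<sigma> 0) \<le> C * 1" using C by linarith
      also have "\<dots> \<le> C * (cmod z powr (- 1 - \<alpha> * \<gamma>) + 1)" using C by (intro mult_left_mono) auto
      finally show ?thesis .
    qed
    show "norm ((RLp z (n + 1) o\<^sub>L Cop \<sigma> 0) - P z) \<le> C * cmod z powr (\<alpha> * (1 - \<gamma>) - 1)" if z: "z \<in> rhp" "cmod z \<le> 1" for z
      using z \<tau>m C K by (intro order_trans[OF PK[OF z]] mult_mono powr_mono') (auto simp: algebra_simps)
  qed
qed

end

section \<open>From the definition of sectoriality to the contour integrals, and the decay
  rate\<close>

lemma closure_sector_subset:
  assumes "0 \<le> \<phi>" "\<phi> \<le> pi"
  shows "closure (sector \<phi>) \<subseteq> {z. cmod z * cos \<phi> \<le> Re z}"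
proof (rule closure_minimal)
  show "closed {z. cmod z * cos \<phi> \<le> Re z}" by (intro closed_Collect_le continuous_intros)
  show "sector \<phi> \<subseteq> {z. cmod z * cos \<phi> \<le> Re z}"
  proof
    fix z assume z: "z \<in> sector \<phi>"
    show "z \<in> {z. cmod z * cos \<phi> \<le> Re z}"
    proof (cases "\<phi> = 0")
      case True
      thus ?thesis using z by (auto simp: sector_def)
    next
      case False
      hence z0: "z \<noteq> 0" and a: "\<bar>Arg z\<bar> < \<phi>" using z by (auto simp: sector_def)
      have "cos \<phi> \<le> cos \<bar>Arg z\<bar>" using a assms by (intro cos_monotone_0_pi_le) auto
      hence "cos \<phi> \<le> Re z / cmod z" using cos_Arg[of z] z0 by simp
      thus ?thesis using z0 by (simp add: field_simps)
    qed
  qed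
qed

lemma (in complex_closed_op) sectorial_angle_sectorial_op:
  assumes s: "sectorial_angle J D A \<phi>" and \<theta>: "\<phi> < \<theta>" "\<theta> < pi"
  obtains M where "sectorial_op J D A \<theta> M"
proof -
  \<comment> \<open>An intermediate angle: the definition bounds the resolvent only outside the
    closure of a sector, so the rays of angle \<theta> themselves are reached by using a smaller
    sector.\<close>
  define \<psi> where "\<psi> = (\<phi> + \<theta>) / 2"
  have \<phi>: "0 \<le> \<phi>" "\<phi> < pi" using s by (auto simp: sectorial_angle_def)
  have \<psi>: "\<phi> < \<psi>" "\<psi> < \<theta>" using \<theta> by (auto simp: \<psi>_def)
  obtain M where M: "\<And>l. l \<notin> closure (sector \<psi>) \<Longrightarrow> norm (cscaleL J l (res l)) \<le> M"
    using s \<psi> \<theta> unfolding sectorial_angle_def by (metis less_trans)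
  have out: "z \<notin> closure (sector \<chi>')" if z: "z \<noteq> 0" "Re z \<le> cmod z * cos \<theta>" and \<chi>: "0 \<le> \<chi>'" "\<chi>' < \<theta>" for z \<chi>'
  proof
    assume "z \<in> closure (sector \<chi>')"
    hence "cmod z * cos \<chi>' \<le> Re z" using closure_sector_subset[of \<chi>'] \<chi> \<theta> by auto
    hence "cmod z * cos \<chi>' \<le> cmod z * cos \<theta>" using z by linarith
    moreover have "cos \<theta> < cos \<chi>'" using \<chi> \<theta> by (intro cos_monotone_0_pi) auto
    ultimately show False using z by simp
  qed
  have "sectorial_op J D A \<theta> M"
  proof unfold_locales
    show "0 < \<theta>" "\<theta> < pi" using \<theta> \<phi> by auto
    show "z \<in> rho" if "z \<noteq> 0" "Re z \<le> cmod z * cos \<theta>" for z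
      using out[OF that \<phi>(1)] \<theta> s unfolding rho_def sectorial_angle_def by auto
    show "cmod z * norm (res z) \<le> M" if "z \<noteq> 0" "Re z \<le> cmod z * cos \<theta>" for z
      using M[OF out[OF that _ \<psi>(2)]] \<phi> \<psi> by simp
  qed
  thus thesis by (rule that)
qed

text \<open>The angle is the very one selected inside \<open>frac_reg\<close>, so independence of
  the contour angle need not be discussed and the identity is a matter of unfolding.\<close>

lemma frac_reg_Cop:
  assumes J: "complex_structure J" and s: "sectorial J D A" and \<sigma>: "\<sigma> \<noteq> 0"
  obtains \<theta> M where "sectorial_op J D A \<theta> M" "frac_reg J D A \<sigma> = sectorial_op.Cop J D A \<theta> \<sigma> 0"
proof -
  interpret complex_closed_op J D A
    using J s by unfold_locales (auto simp: sectorial_def)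
  let ?Q = "\<lambda>\<theta>. 0 < \<theta> \<and> \<theta> < pi \<and> (\<exists>\<phi><\<theta>. sectorial_angle J D A \<phi>)"
  define \<theta> where "\<theta> = (SOME \<theta>. ?Q \<theta>)"
  obtain \<phi> where \<phi>: "sectorial_angle J D A \<phi>" using s unfolding sectorial_def by blast
  hence "?Q ((\<phi> + pi) / 2)" by (auto simp: sectorial_angle_def intro!: exI[of _ \<phi>])
  hence "?Q \<theta>" unfolding \<theta>_def by (rule someI)
  then obtain \<phi>' where "\<phi>' < \<theta>" "\<theta> < pi" "sectorial_angle J D A \<phi>'" by blast
  then obtain M where M: "sectorial_op J D A \<theta> M" using sectorial_angle_sectorial_op by blast
  interpret S: sectorial_op J D A \<theta> M by (rule M)
  have "frac_reg J D A \<sigma> = S.Cop \<sigma> 0"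
    unfolding frac_reg_def \<theta>_def[symmetric] Let_def S.Cop_def S.calc_def S.integrand_def S.branch_def S.gf_def S.fr_def S.Rp_def
    using \<sigma> by simp
  thus thesis using that M by blast
qed

text \<open>Vectors of X^\<sigma> are parametrised as x = A^\<sigma> (1 + A)^(-\<sigma>) z, so z is
  (1 + A)^\<sigma> A^(-\<sigma>) x and the last factor of the estimate is the norm of x in
  X^\<sigma>. The disjunct \<alpha> = 0 renders the convention 1 / 0 = infinity.\<close>

theorem theorem4p16:
  fixes J :: "'a::banach \<Rightarrow>\<^sub>L 'a" and D :: "'a set" and A :: "'a \<Rightarrow> 'a"
    and T :: "real \<Rightarrow> ('a \<Rightarrow>\<^sub>L 'a)" and \<alpha> \<sigma> \<rho> :: real
  assumes "complex_structure J"
    and "\<alpha> \<ge> 0"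
    and "sectorial J D A" and "inj_on A D"
    and "resolvent_growth J D A T \<alpha> 0"
    and "asymptotically_analytic J T"
    and "\<sigma> \<ge> 0" and "\<sigma> > \<alpha> - 1"
    and "\<rho> \<ge> 0" and "\<alpha> = 0 \<or> \<rho> < (\<sigma> + 1) / \<alpha> - 1"
  shows "\<exists>C\<ge>0. \<forall>t\<ge>1. \<forall>z.
           norm (T t (frac_reg J D A \<sigma> z))
             \<le> C * t powr (- \<rho>) * (norm (frac_reg J D A \<sigma> z) + norm z)"
proof -
  interpret complex_closed_op J D A
    using assms by unfold_locales (auto simp: sectorial_def)
  let ?B = "frac_reg J D A \<sigma>"
  have gen: "generates J D (\<lambda>x. - A x) T" using assms(5) unfolding resolvent_growth_def by blast
  obtain G where G: "G \<ge> 0" and rho: "\<And>z. z \<in> rhp \<Longrightarrow> - z \<in> rho"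
    and bound: "\<And>z. z \<in> rhp \<Longrightarrow> norm (res (- z)) \<le> G * (cmod z powr (- \<alpha>) + 1)"
    using resolvent_growth_bound[OF assms(5,2)] by blast
  \<comment> \<open>Upper limit for the auxiliary rate \<rho>' > \<rho>: below the next integer, so
    that \<gamma> = n + 1 - \<rho>' lies strictly between 0 and 1, and for \<alpha> \<ge> 1 also
    below the critical rate. For \<alpha> < 1 the resolvent is bounded and every rate is
    admissible.\<close>
  define b where "b = (if \<alpha> < 1 then real_of_int (\<lfloor>\<rho>\<rfloor> + 1) else min (real_of_int (\<lfloor>\<rho>\<rfloor> + 1)) ((\<sigma> + 1) / \<alpha> - 1))"
  have "\<rho> < b" using assms(10) unfolding b_def by auto
  then obtain \<rho>' where \<rho>': "\<rho> < \<rho>'" "\<rho>' < b" using dense by blast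
  define n where "n = nat \<lfloor>\<rho>\<rfloor>"
  define \<gamma> where "\<gamma> = real (Suc n) - \<rho>'"
  have "b \<le> real_of_int (\<lfloor>\<rho>\<rfloor> + 1)" by (simp add: b_def)
  hence \<gamma>: "0 < \<gamma>" "\<gamma> < 1" using \<rho>' assms(9) unfolding \<gamma>_def n_def by linarith+
  have "\<exists>C\<ge>0. \<forall>t\<ge>1. \<forall>x. norm (T t (?B x)) \<le> C * t powr (\<gamma> - real (Suc n)) * norm x"
  proof (cases "\<alpha> < 1")
    case True
    obtain H where H: "H \<ge> 0" "\<And>z. z \<in> rhp \<Longrightarrow> norm (res (- z)) \<le> H"
      using rhp_resolvent_bounded[OF True G rho bound assms(2)] by blast
    show ?thesis by (rule semigroup_decay_bounded_resolvent[OF gen assms(6) rho H \<gamma>])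
  next
    case False
    hence \<alpha>: "\<alpha> \<ge> 1" and \<sigma>: "\<sigma> > 0" using assms(8) by auto
    obtain \<theta> M where S: "sectorial_op J D A \<theta> M" and eq: "?B = sectorial_op.Cop J D A \<theta> \<sigma> 0"
      using frac_reg_Cop[OF assms(1,3), of \<sigma>] \<sigma> by auto
    interpret S: injective_sectorial_op J D A \<theta> M
      using S assms(4) by (intro injective_sectorial_op.intro injective_sectorial_op_axioms.intro)
    have "\<rho>' < (\<sigma> + 1) / \<alpha> - 1" using \<rho>'(2) False by (simp add: b_def)
    hence lt: "\<alpha> * (real n + 2 - \<gamma>) < \<sigma> + 1" using \<alpha> by (simp add: \<gamma>_def field_simps)
    show ?thesis
      unfolding eq by (rule S.semigroup_decay_fractional[OF gen assms(6) \<alpha> G rho bound \<sigma> \<gamma> lt])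
  qed
  then obtain C where C: "C \<ge> 0" "\<And>t x. t \<ge> 1 \<Longrightarrow> norm (T t (?B x)) \<le> C * t powr (\<gamma> - real (Suc n)) * norm x"
    by blast
  have "norm (T t (?B z)) \<le> C * t powr (- \<rho>) * (norm (?B z) + norm z)" if t: "t \<ge> 1" for t z
  proof -
    have "t powr (\<gamma> - real (Suc n)) \<le> t powr (- \<rho>)" using t \<rho>' by (intro powr_mono) (auto simp: \<gamma>_def)
    hence "C * t powr (\<gamma> - real (Suc n)) * norm z \<le> C * t powr (- \<rho>) * (norm (?B z) + norm z)"
      using C(1) by (intro mult_mono mult_left_mono) auto
    thus ?thesis using C(2)[OF t, of z] by linarith
  qed
  thus ?thesis using C(1) by blast
qed

end
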